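(* Let $X$ be a noetherian $\Lambda[\Delta]$-module with parameters $\rho,\mu,\lambda$. Then there exists a unique virtual $\ell$-adic character $\nu$ of $\Delta$ such that, for every $\ell$-adic irreducible character $\varphi$ of $\Delta$ and every sufficiently large integer $n$, the order $\ell^{x_n^\varphi}$ of the $\varphi$-component $e_\varphi(X/\nabla_nX)$ of the quotient $X/\nabla_nX$ (equivalently, the index $(X_\varphi:\nabla_nX_\varphi)$) is given by $$x_n^\varphi=\langle\rho,\varphi\rangle(n+1)\ell^n+\langle\mu,\varphi\rangle\ell^n+\langle\lambda,\varphi\rangle n+\langle\nu,\varphi\rangle .$$
   Context: $\ell$ is a prime, $\Delta$ a finite abelian group of order $d$ prime to $\ell$. For an $\ell$-adic irreducible character $\varphi$ of $\Delta$, $e_\varphi=\frac1d\sum_{\tau\in\Delta}\varphi(\tau^{-1})\tau$ is the corresponding primitive idempotent of $\mathbb{Z}_\ell[\Delta]$ and $\mathbb{Z}_\varphi=\mathbb{Z}_\ell[\Delta]e_\varphi$ (an unramified extension of $\mathbb{Z}_\ell$ of rank $\deg\varphi$). $\Gamma=\gamma^{\mathbb{Z}_\ell}\cong\mathbb{Z}_\ell$, $\Lambda=\mathbb{Z}_\ell[[\gamma-1]]$, $\Lambda_\varphi=\Lambda[\Delta]e_\varphi\cong\mathbb{Z}_\varphi[[\gamma-1]]$, and for a $\Lambda[\Delta]$-module $X$, $X_\varphi=e_\varphi X$. $\omega_n=\gamma^{\ell^n}-1$ and $\nabla_n=\ell^{n+1}\Lambda+\omega_n\Lambda$. For a noetherian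 $\Lambda[\Delta]$-module $X$, each $X_\varphi$ is pseudo-isomorphic (i.e. maps by a $\Lambda[\Delta]$-morphism with finite kernel and cokernel) to a unique elementary module $\Lambda_\varphi^{\rho_\varphi}\oplus\bigoplus_{i}\Lambda_\varphi/f_{\varphi,i}\Lambda_\varphi\oplus\bigoplus_j\Lambda_\varphi/\ell^{m_{\varphi,j}}\Lambda_\varphi$ with $f_{\varphi,i}$ distinguished polynomials in $\mathbb{Z}_\varphi[\gamma-1]$ and $m_{\varphi,j}\ge1$. The parameters of $X$ are the characters $\rho=\sum_\varphi\rho_\varphi\varphi$, $\mu=\sum_\varphi(\sum_j m_{\varphi,j})\varphi$, $\lambda=\sum_\varphi(\sum_i\deg f_{\varphi,i})\varphi$. $\langle\chi,\psi\rangle=\frac1d\sum_{\sigma\in\Delta}\chi(\sigma)\psi(\sigma^{-1})$ is the usual scalar product of characters. *)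

theory Defs
  imports "HOL-Algebra.Algebra" "HOL-Library.FuncSet"
begin

definition Zl :: "nat \<Rightarrow> (nat \<Rightarrow> int) ring" where
  "Zl l = \<lparr> carrier = {a. \<forall>k. 0 \<le> a k \<and> a k < int l ^ k \<and> a (Suc k) mod int l ^ k = a k},
            monoid.mult = (\<lambda>a b. \<lambda>k. (a k * b k) mod int l ^ k),
            monoid.one = (\<lambda>k. 1 mod int l ^ k),
            ring.zero = (\<lambda>k. 0),
            ring.add = (\<lambda>a b. \<lambda>k. (a k + b k) mod int l ^ k) \<rparr>"

text \<open>Lambda = Z_l[[T]], T = gamma - 1; an element is its coefficient sequence.\<close>

definition PS :: "nat \<Rightarrow> (nat \<Rightarrow> nat \<Rightarrow> int) ring" where
  "PS l = \<lparr> carrier = {f. \<forall>i. f i \<in> carrier (Zl l)},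
            monoid.mult = (\<lambda>f g. \<lambda>i. finsum (Zl l) (\<lambda>j. f j \<otimes>\<^bsub>Zl l\<^esub> g (i - j)) {..i}),
            monoid.one = (\<lambda>i. if i = 0 then \<one>\<^bsub>Zl l\<^esub> else \<zero>\<^bsub>Zl l\<^esub>),
            ring.zero = (\<lambda>i. \<zero>\<^bsub>Zl l\<^esub>),
            ring.add = (\<lambda>f g. \<lambda>i. f i \<oplus>\<^bsub>Zl l\<^esub> g i) \<rparr>"

type_synonym 'g LD = "'g \<Rightarrow> nat \<Rightarrow> nat \<Rightarrow> int"

definition GR :: "nat \<Rightarrow> 'g monoid \<Rightarrow> 'g LD ring" where
  "GR l G = \<lparr> carrier = carrier G \<rightarrow>\<^sub>E carrier (PS l),
     monoid.mult = (\<lambda>x y. \<lambda>g\<in>carrier G.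
               finsum (PS l) (\<lambda>h. x h \<otimes>\<^bsub>PS l\<^esub> y (inv\<^bsub>G\<^esub> h \<otimes>\<^bsub>G\<^esub> g)) (carrier G)),
     monoid.one = (\<lambda>g\<in>carrier G. if g = \<one>\<^bsub>G\<^esub> then \<one>\<^bsub>PS l\<^esub> else \<zero>\<^bsub>PS l\<^esub>),
     ring.zero = (\<lambda>g\<in>carrier G. \<zero>\<^bsub>PS l\<^esub>),
     ring.add = (\<lambda>x y. \<lambda>g\<in>carrier G. x g \<oplus>\<^bsub>PS l\<^esub> y g) \<rparr>"

definition embZl :: "nat \<Rightarrow> 'g monoid \<Rightarrow> (nat \<Rightarrow> int) \<Rightarrow> 'g LD" where
  "embZl l G c = (\<lambda>g\<in>carrier G. if g = \<one>\<^bsub>G\<^esub>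
       then (\<lambda>i. if i = 0 then c else \<zero>\<^bsub>Zl l\<^esub>) else \<zero>\<^bsub>PS l\<^esub>)"

definition intLD :: "nat \<Rightarrow> 'g monoid \<Rightarrow> int \<Rightarrow> 'g LD" where
  "intLD l G c = embZl l G (\<lambda>k. c mod int l ^ k)"

definition gammaLD :: "nat \<Rightarrow> 'g monoid \<Rightarrow> 'g LD" where
  "gammaLD l G = (\<lambda>g\<in>carrier G. if g = \<one>\<^bsub>G\<^esub>
       then (\<lambda>i. if i \<le> 1 then \<one>\<^bsub>Zl l\<^esub> else \<zero>\<^bsub>Zl l\<^esub>) else \<zero>\<^bsub>PS l\<^esub>)"

definition omegaLD :: "nat \<Rightarrow> 'g monoid \<Rightarrow> nat \<Rightarrow> 'g LD" where
  "omegaLD l G n = (gammaLD l G [^]\<^bsub>GR l G\<^esub> (l ^ n)) \<ominus>\<^bsub>GR l G\<^esub> \<one>\<^bsub>GR l G\<^esub>"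

definition ZlD :: "nat \<Rightarrow> 'g monoid \<Rightarrow> 'g LD set" where
  "ZlD l G = {x \<in> carrier (GR l G). \<forall>g\<in>carrier G. \<forall>i>0. x g i = \<zero>\<^bsub>Zl l\<^esub>}"

definition idem :: "nat \<Rightarrow> 'g monoid \<Rightarrow> 'g LD \<Rightarrow> bool" where
  "idem l G e \<longleftrightarrow> e \<in> ZlD l G \<and> e \<otimes>\<^bsub>GR l G\<^esub> e = e"

text \<open>l-adic irreducible characters phi of Delta are identified with the primitive
  idempotents e_phi of Z_l[Delta].\<close>

definition prim_idem :: "nat \<Rightarrow> 'g monoid \<Rightarrow> 'g LD \<Rightarrow> bool" where
  "prim_idem l G e \<longleftrightarrow> idem l G e \<and> e \<noteq> \<zero>\<^bsub>GR l G\<^esub> \<and>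
     (\<forall>a b. idem l G a \<longrightarrow> idem l G b \<longrightarrow> a \<otimes>\<^bsub>GR l G\<^esub> b = \<zero>\<^bsub>GR l G\<^esub> \<longrightarrow>
        a \<oplus>\<^bsub>GR l G\<^esub> b = e \<longrightarrow> a = \<zero>\<^bsub>GR l G\<^esub> \<or> b = \<zero>\<^bsub>GR l G\<^esub>)"

definition Zphi :: "nat \<Rightarrow> 'g monoid \<Rightarrow> 'g LD \<Rightarrow> 'g LD set" where
  "Zphi l G e = {a \<otimes>\<^bsub>GR l G\<^esub> e | a. a \<in> ZlD l G}"

definition has_Zl_rank :: "nat \<Rightarrow> 'g monoid \<Rightarrow> 'g LD \<Rightarrow> nat \<Rightarrow> bool" where
  "has_Zl_rank l G e n \<longleftrightarrow> (\<exists>b. (\<forall>i<n. b i \<in> Zphi l G e) \<and>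
     (\<forall>y\<in>Zphi l G e. \<exists>!c. c \<in> {..<n} \<rightarrow>\<^sub>E carrier (Zl l) \<and>
        y = finsum (GR l G) (\<lambda>i. embZl l G (c i) \<otimes>\<^bsub>GR l G\<^esub> b i) {..<n}))"

definition chardeg :: "nat \<Rightarrow> 'g monoid \<Rightarrow> 'g LD \<Rightarrow> nat" where
  "chardeg l G e = (THE n. has_Zl_rank l G e n)"

text \<open>A (virtual) character is represented by its coefficients on the irreducible
  l-adic characters; then <chi, phi> = chi_phi * <phi, phi> = chi_phi * deg phi.\<close>

definition charpair :: "nat \<Rightarrow> 'g monoid \<Rightarrow> ('g LD \<Rightarrow> int) \<Rightarrow> 'g LD \<Rightarrow> int" where
  "charpair l G \<chi> e = \<chi> e * int (chardeg l G e)"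

definition gen_submod :: "('r, 'z) ring_scheme \<Rightarrow> ('r, 'm) module \<Rightarrow> 'm set \<Rightarrow> 'm set" where
  "gen_submod R M S = {finsum M (\<lambda>s. c s \<odot>\<^bsub>M\<^esub> s) T | T c.
      finite T \<and> T \<subseteq> S \<and> c \<in> T \<rightarrow> carrier R}"

definition noetherian_module :: "('r, 'z) ring_scheme \<Rightarrow> ('r, 'm) module \<Rightarrow> bool" where
  "noetherian_module R M \<longleftrightarrow> module R M \<and>
     (\<forall>N. submodule N R M \<longrightarrow> (\<exists>S. finite S \<and> S \<subseteq> N \<and> N = gen_submod R M S))"

definition mod_hom :: "('r, 'z) ring_scheme \<Rightarrow> ('r, 'a) module \<Rightarrow> ('r, 'b) module \<Rightarrow> ('a \<Rightarrow> 'b) set" where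
  "mod_hom R A B = {f. f \<in> carrier A \<rightarrow> carrier B \<and>
     (\<forall>x\<in>carrier A. \<forall>y\<in>carrier A. f (x \<oplus>\<^bsub>A\<^esub> y) = f x \<oplus>\<^bsub>B\<^esub> f y) \<and>
     (\<forall>a\<in>carrier R. \<forall>x\<in>carrier A. f (a \<odot>\<^bsub>A\<^esub> x) = a \<odot>\<^bsub>B\<^esub> f x)}"

definition pseudo_iso :: "('r, 'z) ring_scheme \<Rightarrow> ('r, 'a) module \<Rightarrow> ('r, 'b) module \<Rightarrow> bool" where
  "pseudo_iso R A B \<longleftrightarrow> (\<exists>f \<in> mod_hom R A B.
     finite {x \<in> carrier A. f x = \<zero>\<^bsub>B\<^esub>} \<and> finite (A_RCOSETS B (f ` carrier A)))"

definition quot_module :: "('r, 'm) module \<Rightarrow> 'm set \<Rightarrow> ('r, 'm set) module" where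
  "quot_module M N = \<lparr> carrier = A_RCOSETS M N, monoid.mult = undefined, monoid.one = undefined,
      ring.zero = N, ring.add = (\<lambda>A B. A <+>\<^bsub>M\<^esub> B),
      module.smult = (\<lambda>a A. \<Union>{N +>\<^bsub>M\<^esub> (a \<odot>\<^bsub>M\<^esub> x) | x. x \<in> A}) \<rparr>"

definition free_mod :: "('r, 'z) ring_scheme \<Rightarrow> nat \<Rightarrow> ('r, nat \<Rightarrow> 'r) module" where
  "free_mod R k = \<lparr> carrier = {..<k} \<rightarrow>\<^sub>E carrier R, monoid.mult = undefined, monoid.one = undefined,
      ring.zero = (\<lambda>i\<in>{..<k}. \<zero>\<^bsub>R\<^esub>),
      ring.add = (\<lambda>v w. \<lambda>i\<in>{..<k}. v i \<oplus>\<^bsub>R\<^esub> w i),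
      module.smult = (\<lambda>a v. \<lambda>i\<in>{..<k}. a \<otimes>\<^bsub>R\<^esub> v i) \<rparr>"

definition unitvec :: "('r, 'z) ring_scheme \<Rightarrow> nat \<Rightarrow> nat \<Rightarrow> (nat \<Rightarrow> 'r)" where
  "unitvec R k i = (\<lambda>j\<in>{..<k}. if j = i then \<one>\<^bsub>R\<^esub> else \<zero>\<^bsub>R\<^esub>)"

text \<open>Distinguished polynomial of degree dg in Z_phi[gamma - 1], viewed inside Lambda_phi.
  coefT f k is the coefficient of T^k (an element of Z_l[Delta]).\<close>

definition coefT :: "nat \<Rightarrow> 'g monoid \<Rightarrow> 'g LD \<Rightarrow> nat \<Rightarrow> 'g LD" where
  "coefT l G f k = (\<lambda>g\<in>carrier G. (\<lambda>i. if i = 0 then f g k else \<zero>\<^bsub>Zl l\<^esub>))"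

definition distinguished :: "nat \<Rightarrow> 'g monoid \<Rightarrow> 'g LD \<Rightarrow> 'g LD \<Rightarrow> nat \<Rightarrow> bool" where
  "distinguished l G e f dg \<longleftrightarrow> f \<in> carrier (GR l G) \<and>
     coefT l G f dg = e \<and>
     (\<forall>k>dg. coefT l G f k = \<zero>\<^bsub>GR l G\<^esub>) \<and>
     (\<forall>k<dg. coefT l G f k \<in> {intLD l G (int l) \<otimes>\<^bsub>GR l G\<^esub> a | a. a \<in> Zphi l G e})"

text \<open>The elementary module
  Lambda_phi^r + (+)_i Lambda_phi/(f_i) + (+)_j Lambda_phi/(l^(m_j)),
  realised as the quotient of Lambda[Delta]^k by the submodule generated by
  (1 - e_phi) on each coordinate, f_i on the f-coordinates and l^(m_j) on the m-coordinates.\<close>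

definition elem_rels :: "nat \<Rightarrow> 'g monoid \<Rightarrow> 'g LD \<Rightarrow> nat \<Rightarrow> 'g LD list \<Rightarrow> nat list
    \<Rightarrow> (nat \<Rightarrow> 'g LD) set" where
  "elem_rels l G e r fs ms =
     {(\<one>\<^bsub>GR l G\<^esub> \<ominus>\<^bsub>GR l G\<^esub> e) \<odot>\<^bsub>free_mod (GR l G) (r + length fs + length ms)\<^esub>
        unitvec (GR l G) (r + length fs + length ms) i | i. i < r + length fs + length ms}
     \<union> {(fs ! i) \<odot>\<^bsub>free_mod (GR l G) (r + length fs + length ms)\<^esub>
        unitvec (GR l G) (r + length fs + length ms) (r + i) | i. i < length fs}
     \<union> {intLD l G (int l ^ (ms ! j)) \<odot>\<^bsub>free_mod (GR l G) (r + length fs + length ms)\<^esub>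
        unitvec (GR l G) (r + length fs + length ms) (r + length fs + j) | j. j < length ms}"

definition elem_module :: "nat \<Rightarrow> 'g monoid \<Rightarrow> 'g LD \<Rightarrow> nat \<Rightarrow> 'g LD list \<Rightarrow> nat list
    \<Rightarrow> ('g LD, (nat \<Rightarrow> 'g LD) set) module" where
  "elem_module l G e r fs ms =
     quot_module (free_mod (GR l G) (r + length fs + length ms))
       (gen_submod (GR l G) (free_mod (GR l G) (r + length fs + length ms)) (elem_rels l G e r fs ms))"

definition comp_module :: "('r, 'm) module \<Rightarrow> 'r \<Rightarrow> ('r, 'm) module" where
  "comp_module M e = partial_object.carrier_update (\<lambda>_. (\<lambda>x. e \<odot>\<^bsub>M\<^esub> x) ` carrier M) M"

definition nabla_sub :: "nat \<Rightarrow> 'g monoid \<Rightarrow> nat \<Rightarrow> ('g LD, 'm) module \<Rightarrow> 'm set" where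
  "nabla_sub l G n Y = {intLD l G (int l ^ (n + 1)) \<odot>\<^bsub>Y\<^esub> x \<oplus>\<^bsub>Y\<^esub> omegaLD l G n \<odot>\<^bsub>Y\<^esub> y
      | x y. x \<in> carrier Y \<and> y \<in> carrier Y}"

definition has_parameters :: "nat \<Rightarrow> 'g monoid \<Rightarrow> ('g LD, 'm) module
    \<Rightarrow> ('g LD \<Rightarrow> int) \<Rightarrow> ('g LD \<Rightarrow> int) \<Rightarrow> ('g LD \<Rightarrow> int) \<Rightarrow> bool" where
  "has_parameters l G M \<rho> \<mu> lam \<longleftrightarrow> (\<forall>e. prim_idem l G e \<longrightarrow>
     (\<exists>r fds ms. (\<forall>(f, dg)\<in>set fds. distinguished l G e f dg) \<and> (\<forall>m\<in>set ms. m \<ge> 1) \<and>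
        pseudo_iso (GR l G) (comp_module M e) (elem_module l G e r (map fst fds) ms) \<and>
        \<rho> e = int r \<and> \<mu> e = int (sum_list ms) \<and> lam e = int (sum_list (map snd fds))))"

end

theory Submission
  imports Defs "HOL-Computational_Algebra.Formal_Power_Series" "HOL-Number_Theory.Residues"
begin

text \<open>
  Put \<open>T = \<gamma> - 1\<close>, \<open>\<omega>\<^sub>n = w n\<close> and let \<open>q\<close> be the order of the residue field of \<open>\<Lambda>\<^sub>\<phi>\<close>.  A pseudo-isomorphism
  from \<open>X\<^sub>\<phi>\<close> to \<open>F / N\<close> with \<open>F\<close> free changes the index of \<open>\<nabla>\<^sub>n\<close> by a factor that is constant for
  large \<open>n\<close>.  The part coming from the finite kernel \<open>K\<close> is the index of \<open>K \<inter> \<nabla>\<^sub>n X\<^sub>\<phi>\<close>, a decreasing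
  sequence of finite sets.  For the part coming from the finite cokernel \<open>F / Y\<close>, the subgroups
  \<open>{(x, y). l ^ (n + 1) x + \<omega>\<^sub>n y \<in> \<nabla>\<^sub>n Y + N}\<close> of \<open>F \<times> F\<close> contain \<open>Y \<times> Y\<close> and eventually increase, hence
  stabilise.

  For the cyclic summands, if \<open>f \<equiv> T ^ N\<close> modulo \<open>l\<close> then \<open>\<Lambda>\<^sub>\<phi> / f\<close> is \<open>l\<close>-torsion free and
  \<open>\<Lambda>\<^sub>\<phi> / (f, l ^ k)\<close> has order \<open>q ^ (N k)\<close>; by Frobenius this applies to \<open>f = \<omega>\<^sub>n\<close> with \<open>N = l ^ n\<close>, which
  settles the free and the torsion summands.  Modulo a distinguished \<open>f\<close>, \<open>\<omega>\<^bsub>n + 1\<^esub> / \<omega>\<^sub>n\<close> is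
  eventually \<open>l\<close> times a unit, so that \<open>\<nabla>\<^bsub>n + 1\<^esub> = l \<nabla>\<^sub>n\<close> and the index grows by \<open>q ^ deg f\<close> at each step.

  Finally \<open>q = l ^ deg \<phi>\<close>, and every finite index of submodules of \<open>X\<^sub>\<phi>\<close> is a power of \<open>q\<close>, so the constant
  is \<open>q ^ \<nu>\<close> with an integer \<open>\<nu>\<close>.
\<close>

section \<open>Indices of subgroups\<close>

text \<open>On the cokernel side \<open>nabla_n Y + N\<close> and \<open>nabla_n F + N\<close> both
  shrink with n and no monotonicity of their quotient is visible; hence the comparison of
  coefficient pairs (x, y). Passing from n to n + 1 multiplies a relation by \<open>L\<close> and
  leaves the error \<open>(w (n + 1) - L w n) y\<close>. As
  \<open>w (n + 1) = w n (L + w n t)\<close>, this is \<open>w n ^ 2 t y\<close>, and for each kind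
  of cyclic summand it can be rewritten, for large n, with coefficients in
  \<open>(L ^ s, T ^ s)\<close>, which send F into Y.

  The ring is never cut down to one component: the ideals whose indices are computed live in
  \<open>Lambda[Delta]\<close> and have \<open>1 - e\<close> among their generators, so one free
  module serves all summands. The module theory uses no topology; completeness is felt there only
  through the invertibility of \<open>1 + c\<close> for c in \<open>(L, T)\<close>. Quotient modules
  are avoided too: a map into \<open>F / N\<close> is replaced by representatives in F, linear
  modulo N.\<close>

lemma bij_betw_images:
  assumes "\<And>x y. x \<in> S \<Longrightarrow> y \<in> S \<Longrightarrow> f x = f y \<longleftrightarrow> g x = g y"
  shows "bij_betw (\<lambda>u. g (SOME x. x \<in> S \<and> f x = u)) (f ` S) (g ` S)"
proof -
  have *: "g (SOME z. z \<in> S \<and> f z = f x) = g x" if "x \<in> S" for x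
  proof -
    have "(SOME z. z \<in> S \<and> f z = f x) \<in> S \<and> f (SOME z. z \<in> S \<and> f z = f x) = f x"
      by (rule someI[of _ x]) (use that in auto)
    then show ?thesis using assms that by blast
  qed
  show ?thesis
    unfolding bij_betw_def inj_on_def image_image using * assms by (auto simp: image_iff)
qed

text \<open>Indices are compared by this principle throughout: two labellings of the same set S with
  equal fibres have equally many labels, so no isomorphism of quotients has to be
  constructed.\<close>

lemma card_images_eq:
  assumes "\<And>x y. x \<in> S \<Longrightarrow> y \<in> S \<Longrightarrow> f x = f y \<longleftrightarrow> g x = g y"
  shows "card (f ` S) = card (g ` S)"
  using bij_betw_same_card[OF bij_betw_images[OF assms]] .

lemma finite_images_iff:
  assumes "\<And>x y. x \<in> S \<Longrightarrow> y \<in> S \<Longrightarrow> f x = f y \<longleftrightarrow> g x = g y"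
  shows "finite (f ` S) \<longleftrightarrow> finite (g ` S)"
  using bij_betw_finite[OF bij_betw_images[OF assms]] .

lemma finite_image_coarser:
  assumes "finite (f ` S)" "\<And>x y. x \<in> S \<Longrightarrow> y \<in> S \<Longrightarrow> f x = f y \<Longrightarrow> g x = g y"
  shows "finite (g ` S)"
proof -
  have "g ` S \<subseteq> (\<lambda>u. g (SOME x. x \<in> S \<and> f x = u)) ` f ` S"
  proof
    fix v assume "v \<in> g ` S"
    then obtain x where x: "x \<in> S" "v = g x" by auto
    have "(SOME z. z \<in> S \<and> f z = f x) \<in> S \<and> f (SOME z. z \<in> S \<and> f z = f x) = f x"
      by (rule someI[of _ x]) (use x in auto)
    then have "g (SOME z. z \<in> S \<and> f z = f x) = v" using assms(2) x by metis
    then show "v \<in> (\<lambda>u. g (SOME x. x \<in> S \<and> f x = u)) ` f ` S" using imageI[OF imageI[OF x(1), of f], of "\<lambda>u. g (SOME x. x \<in> S \<and> f x = u)"] by simp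
  qed
  then show ?thesis using assms(1) finite_subset by blast
qed

definition cosets :: "('a, 'b) ring_scheme \<Rightarrow> 'a set \<Rightarrow> 'a set \<Rightarrow> 'a set set" where
  "cosets M A B = (\<lambda>b. A +>\<^bsub>M\<^esub> b) ` B"

text \<open>An infinite index has the value 0. The product formulas in \<open>index_tower\<close>
  and \<open>index_lin_step\<close> survive this convention, so finiteness is carried along in
  separate statements.\<close>

definition index :: "('a, 'b) ring_scheme \<Rightarrow> 'a set \<Rightarrow> 'a set \<Rightarrow> nat" where
  "index M A B = card (cosets M A B)"

abbreviation subgp :: "'a set \<Rightarrow> ('a, 'b) ring_scheme \<Rightarrow> bool" where
  "subgp A M \<equiv> subgroup A (add_monoid M)"

lemma A_RCOSETS_eq_cosets: "A_RCOSETS M A = cosets M A (carrier M)"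
  by (auto simp: A_RCOSETS_def RCOSETS_def cosets_def a_r_coset_def)

context abelian_group begin

lemma subgpD:
  assumes "subgp A G"
  shows "A \<subseteq> carrier G" "\<zero> \<in> A" "\<And>x y. x \<in> A \<Longrightarrow> y \<in> A \<Longrightarrow> x \<oplus> y \<in> A"
    "\<And>x. x \<in> A \<Longrightarrow> \<ominus> x \<in> A" "\<And>x y. x \<in> A \<Longrightarrow> y \<in> A \<Longrightarrow> x \<ominus> y \<in> A"
proof -
  interpret A: subgroup A "add_monoid G" by fact
  show 1: "A \<subseteq> carrier G" using A.subset by simp
  show "\<zero> \<in> A" using A.one_closed by simp
  show 2: "\<And>x y. x \<in> A \<Longrightarrow> y \<in> A \<Longrightarrow> x \<oplus> y \<in> A" using A.m_closed by simp
  show 3: "\<And>x. x \<in> A \<Longrightarrow> \<ominus> x \<in> A" using A.m_inv_closed by (simp add: a_inv_def)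
  show "\<And>x y. x \<in> A \<Longrightarrow> y \<in> A \<Longrightarrow> x \<ominus> y \<in> A" using 2 3 by (simp add: a_minus_def)
qed

lemma subgpI:
  assumes "A \<subseteq> carrier G" "\<zero> \<in> A" "\<And>x y. x \<in> A \<Longrightarrow> y \<in> A \<Longrightarrow> x \<oplus> y \<in> A"
    "\<And>x. x \<in> A \<Longrightarrow> \<ominus> x \<in> A"
  shows "subgp A G"
  using assms by (intro subgroup.intro) (auto simp: a_inv_def)

lemma subgp_carrier: "subgp (carrier G) G"
  by (rule subgpI) auto

lemma coset_eq_iff:
  assumes "subgp A G" "x \<in> carrier G" "y \<in> carrier G"
  shows "A +> x = A +> y \<longleftrightarrow> x \<ominus> y \<in> A"
proof
  note A = subgpD[OF assms(1)]
  assume eq: "A +> x = A +> y"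
  have "x \<in> A +> x" using A(2) assms by (auto simp: a_r_coset_def' intro!: bexI[of _ \<zero>])
  then obtain a where "a \<in> A" "x = a \<oplus> y" using eq by (auto simp: a_r_coset_def')
  moreover then have "a \<in> carrier G" using A by auto
  ultimately show "x \<ominus> y \<in> A" using assms by (simp add: a_minus_def a_assoc r_neg)
next
  note A = subgpD[OF assms(1)]
  assume d: "x \<ominus> y \<in> A"
  have aux: "\<exists>b\<in>A. a \<oplus> u = b \<oplus> v" if "a \<in> A" "u \<ominus> v \<in> A" "u \<in> carrier G" "v \<in> carrier G" for a u v
  proof
    show "a \<oplus> (u \<ominus> v) \<in> A" using that A by auto
    have "a \<in> carrier G" using that A by auto
    then show "a \<oplus> u = a \<oplus> (u \<ominus> v) \<oplus> v" using that by (simp add: a_minus_def a_assoc l_neg)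
  qed
  have d': "y \<ominus> x \<in> A" using A(4)[OF d] assms by (simp add: a_minus_def minus_add a_comm)
  show "A +> x = A +> y"
    using aux[OF _ d] aux[OF _ d'] assms by (fastforce simp: a_r_coset_def')
qed

lemma minus_minus_cancel:
  "\<And>a b c. a \<in> carrier G \<Longrightarrow> b \<in> carrier G \<Longrightarrow> c \<in> carrier G \<Longrightarrow> (a \<ominus> c) \<ominus> (b \<ominus> c) = a \<ominus> b"
  "\<And>a b c. a \<in> carrier G \<Longrightarrow> b \<in> carrier G \<Longrightarrow> c \<in> carrier G \<Longrightarrow> (a \<ominus> b) \<oplus> (b \<ominus> c) = a \<ominus> c"
  "\<And>a b c. a \<in> carrier G \<Longrightarrow> b \<in> carrier G \<Longrightarrow> c \<in> carrier G \<Longrightarrow> (a \<oplus> c) \<ominus> (b \<oplus> c) = a \<ominus> b"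
  "\<And>a b. a \<in> carrier G \<Longrightarrow> b \<in> carrier G \<Longrightarrow> (a \<ominus> b) \<oplus> b = a"
  "\<And>a b. a \<in> carrier G \<Longrightarrow> b \<in> carrier G \<Longrightarrow> (a \<oplus> b) \<ominus> b = a"
  "\<And>a b. a \<in> carrier G \<Longrightarrow> b \<in> carrier G \<Longrightarrow> a \<ominus> (a \<ominus> b) = b"
  "\<And>a b. a \<in> carrier G \<Longrightarrow> b \<in> carrier G \<Longrightarrow> \<ominus> (a \<ominus> b) = b \<ominus> a"
proof -
  have [simp]: "x \<oplus> (\<ominus> x \<oplus> y) = y" "\<ominus> x \<oplus> (x \<oplus> y) = y" "x \<oplus> (y \<oplus> \<ominus> x) = y" "\<ominus> x \<oplus> (y \<oplus> x) = y"
    if "x \<in> carrier G" "y \<in> carrier G" for x y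
    using that by (simp_all add: a_assoc[symmetric] r_neg l_neg a_comm[of y])
  show "\<And>a b c. a \<in> carrier G \<Longrightarrow> b \<in> carrier G \<Longrightarrow> c \<in> carrier G \<Longrightarrow> (a \<ominus> c) \<ominus> (b \<ominus> c) = a \<ominus> b"
  "\<And>a b c. a \<in> carrier G \<Longrightarrow> b \<in> carrier G \<Longrightarrow> c \<in> carrier G \<Longrightarrow> (a \<ominus> b) \<oplus> (b \<ominus> c) = a \<ominus> c"
  "\<And>a b c. a \<in> carrier G \<Longrightarrow> b \<in> carrier G \<Longrightarrow> c \<in> carrier G \<Longrightarrow> (a \<oplus> c) \<ominus> (b \<oplus> c) = a \<ominus> b"
  "\<And>a b. a \<in> carrier G \<Longrightarrow> b \<in> carrier G \<Longrightarrow> (a \<ominus> b) \<oplus> b = a"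
  "\<And>a b. a \<in> carrier G \<Longrightarrow> b \<in> carrier G \<Longrightarrow> (a \<oplus> b) \<ominus> b = a"
  "\<And>a b. a \<in> carrier G \<Longrightarrow> b \<in> carrier G \<Longrightarrow> a \<ominus> (a \<ominus> b) = b"
  "\<And>a b. a \<in> carrier G \<Longrightarrow> b \<in> carrier G \<Longrightarrow> \<ominus> (a \<ominus> b) = b \<ominus> a"
    by (simp_all add: a_minus_def minus_add a_ac l_neg r_neg)
qed

text \<open>With a representative r c of every B-coset in C, the pair (B + c, A + (c - r c))
  separates exactly the A-cosets in C, and every pair of a B-coset in C and an A-coset in B
  occurs.\<close>

lemma index_tower:
  assumes A: "subgp A G" and B: "subgp B G" and C: "subgp C G" and "A \<subseteq> B" "B \<subseteq> C"
  shows "index G A C = index G B C * index G A B"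
    and "finite (cosets G A C) \<longleftrightarrow> finite (cosets G B C) \<and> finite (cosets G A B)"
proof -
  note AD = subgpD[OF A] and BD = subgpD[OF B] and CD = subgpD[OF C]
  define r where "r c = (SOME x. x \<in> C \<and> B +> x = B +> c)" for c
  have r: "r c \<in> C \<and> B +> r c = B +> c" if "c \<in> C" for c
    unfolding r_def by (rule someI[of _ c]) (use that in auto)
  have cr: "c \<in> carrier G" if "c \<in> C" for c using that CD by auto
  have rB: "c \<ominus> r c \<in> B" if "c \<in> C" for c
    using r[OF that] coset_eq_iff[OF B] that cr by metis
  define F where "F c = (B +> c, A +> (c \<ominus> r c))" for c
  have F: "A +> c = A +> c' \<longleftrightarrow> F c = F c'" if "c \<in> C" "c' \<in> C" for c c'
  proof -
    have [simp]: "c \<in> carrier G" "c' \<in> carrier G" "r c \<in> carrier G" "r c' \<in> carrier G"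
      using that cr r by auto
    show ?thesis
    proof (cases "B +> c = B +> c'")
      case True
      then have [simp]: "r c = r c'" by (simp add: r_def)
      show ?thesis using True by (simp add: F_def coset_eq_iff[OF A] minus_minus_cancel)
    next
      case False
      then have "c \<ominus> c' \<notin> A" using \<open>A \<subseteq> B\<close> coset_eq_iff[OF B] by auto
      then show ?thesis using False by (simp add: F_def coset_eq_iff[OF A])
    qed
  qed
  have img: "F ` C = cosets G B C \<times> cosets G A B"
  proof (intro equalityI subsetI)
    fix z assume "z \<in> F ` C" then show "z \<in> cosets G B C \<times> cosets G A B"
      using rB by (auto simp: F_def cosets_def)
  next
    fix z assume "z \<in> cosets G B C \<times> cosets G A B"
    then obtain c b where z: "c \<in> C" "b \<in> B" "z = (B +> c, A +> b)" by (auto simp: cosets_def)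
    have [simp]: "c \<in> carrier G" "b \<in> carrier G" "r c \<in> carrier G" using z cr r BD by auto
    define c'' where "c'' = b \<oplus> r c"
    have c'': "c'' \<in> C" using z r CD \<open>B \<subseteq> C\<close> by (auto simp: c''_def)
    have "c'' \<ominus> r c = b" by (simp add: c''_def minus_minus_cancel)
    then have "B +> c'' = B +> r c" using coset_eq_iff[OF B] c'' cr z by auto
    then have B'': "B +> c'' = B +> c" using r z by auto
    then have "r c'' = r c" by (simp add: r_def)
    then have "F c'' = z" using B'' z by (simp add: F_def c''_def minus_minus_cancel)
    then show "z \<in> F ` C" using c'' by auto
  qed
  have ne: "cosets G B C \<noteq> {}" "cosets G A B \<noteq> {}" using BD CD by (auto simp: cosets_def)
  show "index G A C = index G B C * index G A B"
    using card_images_eq[of C "\<lambda>c. A +> c" F] F img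
    by (simp add: index_def card_cartesian_product cosets_def)
  show "finite (cosets G A C) \<longleftrightarrow> finite (cosets G B C) \<and> finite (cosets G A B)"
    using finite_images_iff[of C "\<lambda>c. A +> c" F] F img ne
    by (auto simp: cosets_def finite_cartesian_product_iff)
qed

lemma finite_cosets_mono:
  assumes "subgp A G" "subgp B G" "C \<subseteq> D" "A \<subseteq> B" "D \<subseteq> carrier G" "finite (cosets G A D)"
  shows "finite (cosets G B C)"
proof -
  have "finite (cosets G B D)"
    unfolding cosets_def
    by (rule finite_image_coarser[of "\<lambda>b. A +> b"])
      (use assms in \<open>auto simp: cosets_def coset_eq_iff subset_iff\<close>)
  moreover have "cosets G B C \<subseteq> cosets G B D" using assms by (auto simp: cosets_def)
  ultimately show ?thesis using finite_subset by blast
qed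

lemma index_pos: 
  assumes "finite (cosets G A B)" "B \<noteq> {}" shows "index G A B > 0"
  using assms by (auto simp: index_def cosets_def card_gt_0_iff)

end

section \<open>Finitely generated ideals and the Frobenius map\<close>

text \<open>Generators form a list because indices are computed by prepending one element at a time,
  as in \<open>index_lin_step\<close>, and because membership then unfolds to explicit
  coefficients.\<close>

fun lin :: "('a, 'b) ring_scheme \<Rightarrow> 'a list \<Rightarrow> 'a set" where
  "lin R [] = {\<zero>\<^bsub>R\<^esub>}"
| "lin R (a # as) = {a \<otimes>\<^bsub>R\<^esub> x \<oplus>\<^bsub>R\<^esub> y | x y. x \<in> carrier R \<and> y \<in> lin R as}"

lemma (in ring) minus_eqI: "a \<ominus> b = \<zero> \<Longrightarrow> a \<in> carrier R \<Longrightarrow> b \<in> carrier R \<Longrightarrow> a = b"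
  by simp

context cring begin

lemma lin_ConsI: "x \<in> carrier R \<Longrightarrow> y \<in> lin R as \<Longrightarrow> z = a \<otimes> x \<oplus> y \<Longrightarrow> z \<in> lin R (a # as)"
  by auto

lemma lin_carrier: "set as \<subseteq> carrier R \<Longrightarrow> lin R as \<subseteq> carrier R"
  by (induction as) auto

lemma lin_ideal:
  assumes "set as \<subseteq> carrier R" shows "ideal (lin R as) R"
proof -
  have add: "\<lbrakk>x \<in> lin R as; y \<in> lin R as\<rbrakk> \<Longrightarrow> x \<oplus> y \<in> lin R as" for x y
    using assms
  proof (induction as arbitrary: x y)
    case (Cons a as)
    then obtain u v u' v' where *: "x = a \<otimes> u \<oplus> v" "y = a \<otimes> u' \<oplus> v'" "u \<in> carrier R" "u' \<in> carrier R"
      "v \<in> lin R as" "v' \<in> lin R as" by auto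
    then have "v \<in> carrier R" "v' \<in> carrier R" "a \<in> carrier R" using Cons lin_carrier by auto
    then have "x \<oplus> y = a \<otimes> (u \<oplus> u') \<oplus> (v \<oplus> v')" using * by - (hypsubst, algebra)
    moreover have "v \<oplus> v' \<in> lin R as" using Cons * by auto
    ultimately show ?case using * by auto
  qed auto
  have mult: "x \<in> lin R as \<Longrightarrow> c \<in> carrier R \<Longrightarrow> c \<otimes> x \<in> lin R as" for x c
    using assms
  proof (induction as arbitrary: x)
    case (Cons a as)
    then obtain u v where *: "x = a \<otimes> u \<oplus> v" "u \<in> carrier R" "v \<in> lin R as" by auto
    then have "v \<in> carrier R" "a \<in> carrier R" using Cons lin_carrier by auto
    then have "c \<otimes> x = a \<otimes> (c \<otimes> u) \<oplus> c \<otimes> v" using * Cons.prems(2) by - (hypsubst, algebra)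
    moreover have "c \<otimes> v \<in> lin R as" using Cons * by auto
    ultimately show ?case using * Cons.prems(2) by auto
  qed auto
  have zero: "\<zero> \<in> lin R as" using assms
  proof (induction as)
    case (Cons a as)
    then show ?case by (intro lin_ConsI[of \<zero> \<zero>]) auto
  qed auto
  have inv: "\<ominus> x \<in> lin R as" if "x \<in> lin R as" for x
  proof -
    have "x \<in> carrier R" using that lin_carrier[OF assms] by auto
    then show ?thesis using mult[OF that, of "\<ominus> \<one>"] by (simp add: l_minus)
  qed
  have sub: "subgroup (lin R as) (add_monoid R)"
    by (rule subgpI) (use add inv zero lin_carrier[OF assms] in auto)
  show ?thesis
    by (rule idealI) (use sub mult m_comm lin_carrier[OF assms] ring_axioms in \<open>auto simp: subset_iff\<close>)
qed

lemma idealD: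
  assumes "ideal J R"
  shows "subgp J R" "J \<subseteq> carrier R" "\<zero> \<in> J" "\<And>x y. x \<in> J \<Longrightarrow> y \<in> J \<Longrightarrow> x \<oplus> y \<in> J"
    "\<And>x. x \<in> J \<Longrightarrow> \<ominus> x \<in> J" "\<And>x y. x \<in> J \<Longrightarrow> y \<in> J \<Longrightarrow> x \<ominus> y \<in> J"
    "\<And>x a. x \<in> J \<Longrightarrow> a \<in> carrier R \<Longrightarrow> a \<otimes> x \<in> J" "\<And>x a. x \<in> J \<Longrightarrow> a \<in> carrier R \<Longrightarrow> x \<otimes> a \<in> J"
proof -
  interpret ideal J R by fact
  show 1: "subgp J R" by (rule a_subgroup)
  show "J \<subseteq> carrier R" "\<zero> \<in> J" "\<And>x y. x \<in> J \<Longrightarrow> y \<in> J \<Longrightarrow> x \<oplus> y \<in> J"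
    "\<And>x. x \<in> J \<Longrightarrow> \<ominus> x \<in> J" "\<And>x y. x \<in> J \<Longrightarrow> y \<in> J \<Longrightarrow> x \<ominus> y \<in> J" using subgpD[OF 1] by auto
  show "\<And>x a. x \<in> J \<Longrightarrow> a \<in> carrier R \<Longrightarrow> a \<otimes> x \<in> J" "\<And>x a. x \<in> J \<Longrightarrow> a \<in> carrier R \<Longrightarrow> x \<otimes> a \<in> J"
    using I_l_closed I_r_closed by auto
qed

lemma lin_least:
  assumes "ideal J R" "set as \<subseteq> J" shows "lin R as \<subseteq> J"
  using assms(2) idealD[OF assms(1)] by (induction as) auto

lemma lin_gen:
  assumes "set as \<subseteq> carrier R" "a \<in> set as" shows "a \<in> lin R as"
  using assms
proof (induction as)
  case (Cons b as)
  have I: "ideal (lin R as) R" using lin_ideal Cons by auto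
  show ?case
  proof (cases "a = b")
    case True
    show ?thesis using True idealD(3)[OF I] Cons.prems by (intro lin_ConsI[of \<one> \<zero>]) auto
  next
    case False
    then have "a \<in> lin R as" using Cons by auto
    then show ?thesis using Cons.prems by (intro lin_ConsI[of \<zero> a]) auto
  qed
qed auto

lemma lin_subset:
  assumes "set as \<subseteq> carrier R" "set bs \<subseteq> lin R as" shows "lin R bs \<subseteq> lin R as"
  using lin_least[OF lin_ideal] assms by auto

lemma lin1: "a \<in> carrier R \<Longrightarrow> x \<in> lin R [a] \<longleftrightarrow> (\<exists>u\<in>carrier R. x = a \<otimes> u)"
  by auto (metis m_closed r_zero)

lemma lin2: "a \<in> carrier R \<Longrightarrow> b \<in> carrier R \<Longrightarrow>
    x \<in> lin R [a, b] \<longleftrightarrow> (\<exists>u\<in>carrier R. \<exists>v\<in>carrier R. x = a \<otimes> u \<oplus> b \<otimes> v)"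
  by (simp add: lin1 lin.simps(2)[of R a] del: lin.simps) blast

lemma lin3: "a \<in> carrier R \<Longrightarrow> b \<in> carrier R \<Longrightarrow> c \<in> carrier R \<Longrightarrow>
    x \<in> lin R [a, b, c] \<longleftrightarrow>
      (\<exists>u\<in>carrier R. \<exists>v\<in>carrier R. \<exists>w\<in>carrier R. x = a \<otimes> u \<oplus> (b \<otimes> v \<oplus> c \<otimes> w))"
  by (simp add: lin2 lin.simps(2)[of R a] del: lin.simps) blast

declare lin.simps [simp del]

text \<open>Multiplication by \<open>c\<close> identifies \<open>R / (I : c)\<close> with \<open>(I + c R) / I\<close>.\<close>

lemma index_lin_step:
  assumes as: "set as \<subseteq> carrier R" and c: "c \<in> carrier R"
    and K: "\<And>x. x \<in> carrier R \<Longrightarrow> c \<otimes> x \<in> lin R as \<longleftrightarrow> x \<in> K" and Ks: "ideal K R"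
  shows "index R (lin R as) (carrier R) = index R (lin R (c # as)) (carrier R) * index R K (carrier R)"
    and "finite (cosets R (lin R as) (carrier R)) \<longleftrightarrow>
      finite (cosets R (lin R (c # as)) (carrier R)) \<and> finite (cosets R K (carrier R))"
proof -
  let ?A = "lin R as" and ?B = "lin R (c # as)"
  note A = idealD[OF lin_ideal[OF as]]
  have cas: "set (c # as) \<subseteq> carrier R" using as c by simp
  note B = idealD[OF lin_ideal[OF cas]]
  have AB: "?A \<subseteq> ?B" by (rule lin_least[OF lin_ideal[OF cas]]) (use lin_gen[OF cas] in auto)
  have co: "cosets R ?A ?B = (\<lambda>x. ?A +> c \<otimes> x) ` carrier R"
  proof (intro equalityI subsetI)
    fix u assume "u \<in> cosets R ?A ?B"
    then obtain x y where *: "x \<in> carrier R" "y \<in> ?A" "u = ?A +> (c \<otimes> x \<oplus> y)"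
      by (auto simp: cosets_def lin.simps(2)[of R c])
    then have "y \<in> carrier R" using A by auto
    then have "(c \<otimes> x \<oplus> y) \<ominus> c \<otimes> x = y" using * c by algebra
    then have "u = ?A +> c \<otimes> x" using coset_eq_iff[OF A(1)] * c \<open>y \<in> carrier R\<close> by auto
    then show "u \<in> (\<lambda>x. ?A +> c \<otimes> x) ` carrier R" using * by auto
  next
    fix u assume "u \<in> (\<lambda>x. ?A +> c \<otimes> x) ` carrier R"
    then obtain x where x: "x \<in> carrier R" "u = ?A +> c \<otimes> x" by auto
    then have "c \<otimes> x \<in> ?B" using B(8)[OF lin_gen[OF cas, of c]] by auto
    then show "u \<in> cosets R ?A ?B" using x by (auto simp: cosets_def)
  qed
  have key: "?A +> c \<otimes> x = ?A +> c \<otimes> y \<longleftrightarrow> K +> x = K +> y" if "x \<in> carrier R" "y \<in> carrier R" for x y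
  proof -
    have "c \<otimes> x \<ominus> c \<otimes> y = c \<otimes> (x \<ominus> y)" using that c by algebra
    then show ?thesis using that c K[of "x \<ominus> y"]
      by (simp add: coset_eq_iff[OF A(1)] coset_eq_iff[OF idealD(1)[OF Ks]])
  qed
  have i: "index R ?A ?B = index R K (carrier R)" "finite (cosets R ?A ?B) = finite (cosets R K (carrier R))"
    using card_images_eq[of "carrier R" "\<lambda>x. ?A +> c \<otimes> x" "\<lambda>x. K +> x"]
      finite_images_iff[of "carrier R" "\<lambda>x. ?A +> c \<otimes> x" "\<lambda>x. K +> x"] key
    by (simp_all add: index_def co) (simp_all add: cosets_def)
  show "index R ?A (carrier R) = index R ?B (carrier R) * index R K (carrier R)"
    using index_tower(1)[OF A(1) B(1) subgp_carrier AB B(2)] i by simp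
  show "finite (cosets R ?A (carrier R)) \<longleftrightarrow> finite (cosets R ?B (carrier R)) \<and> finite (cosets R K (carrier R))"
    using index_tower(2)[OF A(1) B(1) subgp_carrier AB B(2)] i by simp
qed

section \<open>Powers, binomial expansion and Frobenius modulo p\<close>

abbreviation nn :: "nat \<Rightarrow> 'a" where "nn k \<equiv> [k] \<cdot> \<one>"

lemma nn_Suc: "nn (Suc k) = nn k \<oplus> \<one>" 
  by simp

lemma nn_add: "nn (a + b) = nn a \<oplus> nn b"
  by (simp add: add.nat_pow_mult)

lemma nn_mult: "nn (a * b) = nn a \<otimes> nn b"
proof (induction a)
  case (Suc a)
  have "nn (Suc a * b) = nn b \<oplus> nn a \<otimes> nn b" by (simp add: nn_add Suc)
  also have "\<dots> = nn (Suc a) \<otimes> nn b" by (simp add: l_distr a_comm)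
  finally show ?case .
qed simp

text \<open>Here s is the sum of all x^i y^(n-i), and the second equation evaluates it modulo x - y,
  where its n + 1 terms all become y^n. With y = 1 and exponent p this produces the factor
  \<open>L\<close> in \<open>w_Suc\<close>; in \<open>pow_prime_lift\<close> it produces the
  additional factor p.\<close>

lemma pow_diff:
  assumes "x \<in> carrier R" "y \<in> carrier R"
  shows "\<exists>s\<in>carrier R. \<exists>t\<in>carrier R. x [^] Suc n \<ominus> y [^] Suc n = (x \<ominus> y) \<otimes> s
    \<and> s = nn (Suc n) \<otimes> y [^] n \<oplus> (x \<ominus> y) \<otimes> t"
proof (induction n)
  case 0
  show ?case using assms by (intro bexI[of _ \<one>] bexI[of _ \<zero>]) auto
next
  case (Suc n)
  then obtain s t where st: "s \<in> carrier R" "t \<in> carrier R" "x [^] Suc n \<ominus> y [^] Suc n = (x \<ominus> y) \<otimes> s"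
    "s = nn (Suc n) \<otimes> y [^] n \<oplus> (x \<ominus> y) \<otimes> t" by blast
  obtain U Y N Z where d: "U = x [^] Suc n" "Y = y [^] Suc n" "N = nn (Suc n)" "Z = y [^] n" by blast
  have c: "U \<in> carrier R" "Y \<in> carrier R" "N \<in> carrier R" "Z \<in> carrier R"
    unfolding d using assms by (simp_all del: nat_pow_Suc)
  have Y: "Y = Z \<otimes> y" by (simp add: d)
  have U: "U = Y \<oplus> (x \<ominus> y) \<otimes> s"
  proof -
    have "Y \<oplus> (U \<ominus> Y) = U" using c by algebra
    then show ?thesis using st(3) by (simp only: d)
  qed
  have s: "s = N \<otimes> Z \<oplus> (x \<ominus> y) \<otimes> t" using st by (simp only: d)
  have 1: "U \<otimes> x \<ominus> Y \<otimes> y = (x \<ominus> y) \<otimes> (U \<oplus> y \<otimes> s)"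
    using c assms st(1,2) unfolding U by algebra
  have 2: "U \<oplus> y \<otimes> s = (N \<oplus> \<one>) \<otimes> Y \<oplus> (x \<ominus> y) \<otimes> (s \<oplus> y \<otimes> t)"
  proof -
    have "U \<oplus> y \<otimes> s = U \<oplus> y \<otimes> (N \<otimes> Z \<oplus> (x \<ominus> y) \<otimes> t)" using s by simp
    also have "\<dots> = (N \<oplus> \<one>) \<otimes> Y \<oplus> (x \<ominus> y) \<otimes> (s \<oplus> y \<otimes> t)"
      using c assms st(1,2) unfolding U Y by algebra
    finally show ?thesis .
  qed
  show ?case
  proof (intro bexI conjI)
    show "x [^] Suc (Suc n) \<ominus> y [^] Suc (Suc n) = (x \<ominus> y) \<otimes> (U \<oplus> y \<otimes> s)"
      using 1 by (simp only: d nat_pow_Suc[of _ "Suc n"])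
    show "U \<oplus> y \<otimes> s = nn (Suc (Suc n)) \<otimes> y [^] Suc n \<oplus> (x \<ominus> y) \<otimes> (s \<oplus> y \<otimes> t)"
      using 2 by (simp only: d nn_Suc[of "Suc n"])
  qed (use c st assms in auto)
qed

text \<open>\<open>B n m\<close> is the sum of the first m terms of the binomial expansion. Giving
  it by its recursion in m lets \<open>frobenius_add\<close> inspect partial sums. Pascal's rule
  already holds for partial sums, which is \<open>step\<close>; the theorem is the case of the full
  sum.\<close>

lemma binomial_rec:
  assumes x: "x \<in> carrier R" and y: "y \<in> carrier R"
    and B: "\<And>n. B n 0 = \<zero>" "\<And>n m. B n (Suc m) = B n m \<oplus> nn (n choose m) \<otimes> (x [^] m \<otimes> y [^] (n - m))"
  shows "(x \<oplus> y) [^] n = B n (Suc n)"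
proof -
  have Bc: "B n m \<in> carrier R" for n m by (induction m) (use x y B in auto)
  have step: "B (Suc n) (Suc m) = y \<otimes> B n (Suc m) \<oplus> x \<otimes> B n m" if "m \<le> n" for n m
    using that
  proof (induction m)
    case 0
    then show ?case using x y by (simp add: B m_comm)
  next
    case (Suc m)
    obtain b0 b1 c0 c1 xm yr where d: "b0 = B n m" "b1 = B n (Suc m)" "c0 = nn (n choose m)" "c1 = nn (n choose Suc m)"
      "xm = x [^] m" "yr = y [^] (n - Suc m)" by blast
    have c: "b0 \<in> carrier R" "b1 \<in> carrier R" "c0 \<in> carrier R" "c1 \<in> carrier R" "xm \<in> carrier R" "yr \<in> carrier R"
      unfolding d using Bc x y by auto
    have nm: "n - m = Suc (n - Suc m)" using Suc by auto
    have "B (Suc n) (Suc (Suc m)) = (y \<otimes> b1 \<oplus> x \<otimes> b0) \<oplus> (c0 \<oplus> c1) \<otimes> ((xm \<otimes> x) \<otimes> (yr \<otimes> y))"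
      using Suc by (simp add: B(2)[of "Suc n" "Suc m"] nn_add nm d)
    also have "\<dots> = y \<otimes> (b1 \<oplus> c1 \<otimes> ((xm \<otimes> x) \<otimes> yr)) \<oplus> x \<otimes> (b0 \<oplus> c0 \<otimes> (xm \<otimes> (yr \<otimes> y)))"
      using c x y by algebra
    also have "b1 \<oplus> c1 \<otimes> ((xm \<otimes> x) \<otimes> yr) = B n (Suc (Suc m))" by (simp add: B(2)[of n "Suc m"] d)
    also have "b0 \<oplus> c0 \<otimes> (xm \<otimes> (yr \<otimes> y)) = B n (Suc m)" by (simp add: B(2)[of n m] d nm)
    finally show ?case .
  qed
  show ?thesis
  proof (induction n)
    case 0
    show ?case by (simp add: B)
  next
    case (Suc n)
    obtain b0 xm where d: "b0 = B n n" "xm = x [^] n" by blast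
    have c: "b0 \<in> carrier R" "xm \<in> carrier R" unfolding d using Bc x by auto
    have e: "B n (Suc n) = b0 \<oplus> xm" using c y by (simp add: B(2) d)
    have "B (Suc n) (Suc (Suc n)) = B (Suc n) (Suc n) \<oplus> xm \<otimes> x" 
      using c x y by (simp add: B(2)[of "Suc n" "Suc n"] d)
    also have "B (Suc n) (Suc n) = y \<otimes> (b0 \<oplus> xm) \<oplus> x \<otimes> b0" using step[of n n] e d by simp
    also have "(y \<otimes> (b0 \<oplus> xm) \<oplus> x \<otimes> b0) \<oplus> xm \<otimes> x = (b0 \<oplus> xm) \<otimes> (x \<oplus> y)"
      using c x y by algebra
    finally show ?case using Suc e by simp
  qed
qed

lemma frobenius_add:
  assumes p: "Factorial_Ring.prime p" and x: "x \<in> carrier R" and y: "y \<in> carrier R"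
  shows "(x \<oplus> y) [^] p \<ominus> (x [^] p \<oplus> y [^] p) \<in> lin R [nn p]"
proof -
  define B where "B = (\<lambda>n. rec_nat \<zero> (\<lambda>m b. b \<oplus> nn (n choose m) \<otimes> (x [^] m \<otimes> y [^] (n - m))))"
  have B: "B n 0 = \<zero>" "B n (Suc m) = B n m \<oplus> nn (n choose m) \<otimes> (x [^] m \<otimes> y [^] (n - m))" for n m
    by (simp_all add: B_def)
  have Bc: "B n m \<in> carrier R" for n m by (induction m) (use x y B in auto)
  have I: "ideal (lin R [nn p]) R" by (rule lin_ideal) simp
  \<comment> \<open>Strictly between the first and the last term all binomial coefficients are
    divisible by p, so every partial sum that stops before the last term is congruent to its first
    term y^p.\<close>
  have m: "B p (Suc m) \<ominus> y [^] p \<in> lin R [nn p]" if "m < p" for m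
    using that
  proof (induction m)
    case 0
    then show ?case using x y idealD[OF I] by (simp add: B a_minus_def r_neg del: lin.simps)
  next
    case (Suc m)
    have "p dvd (p choose Suc m)" using Suc p by (intro dvd_choose_prime) auto
    then obtain k where k: "p choose Suc m = p * k" by (auto simp: dvd_def)
    obtain b Y z where d: "b = B p (Suc m)" "Y = y [^] p" "z = x [^] Suc m \<otimes> y [^] (p - Suc m)" by blast
    have c: "b \<in> carrier R" "Y \<in> carrier R" "z \<in> carrier R"
      unfolding d using x y Bc by (simp_all del: nat_pow_Suc)
    obtain P K where d2: "P = nn p" "K = nn k" by blast
    have c2: "P \<in> carrier R" "K \<in> carrier R" unfolding d2 by simp_all
    have "B p (Suc (Suc m)) \<ominus> Y = (b \<oplus> (P \<otimes> K) \<otimes> z) \<ominus> Y"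
      by (simp only: B(2)[of p "Suc m"] d k d2 nn_mult)
    also have "\<dots> = (b \<ominus> Y) \<oplus> P \<otimes> (K \<otimes> z)" using c c2 by algebra
    finally have "B p (Suc (Suc m)) \<ominus> Y = (b \<ominus> Y) \<oplus> P \<otimes> (K \<otimes> z)" .
    moreover have "P \<otimes> (K \<otimes> z) \<in> lin R [P]" using c2 c lin1 by auto
    moreover have "b \<ominus> Y \<in> lin R [P]" using Suc unfolding d d2 by auto
    ultimately show ?case using idealD(4)[OF I] by (simp only: d d2)
  qed
  have "p > 0" using p prime_gt_0_nat by blast
  then have bp: "B p p \<ominus> y [^] p \<in> lin R [nn p]" using m[of "p - 1"] by simp
  obtain b U Y where d: "b = B p p" "Y = y [^] p" "U = x [^] p" by blast
  have c: "b \<in> carrier R" "Y \<in> carrier R" "U \<in> carrier R" unfolding d using x y Bc by simp_all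
  have "(x \<oplus> y) [^] p = b \<oplus> U" using binomial_rec[OF x y B] c x y by (simp add: B(2) d)
  moreover have "(b \<oplus> U) \<ominus> (U \<oplus> Y) = b \<ominus> Y" using c by algebra
  ultimately show ?thesis using bp by (simp only: d)
qed

lemma pow_cong:
  assumes J: "ideal J R" and "x \<in> carrier R" "y \<in> carrier R" "x \<ominus> y \<in> J"
  shows "x [^] (n::nat) \<ominus> y [^] n \<in> J"
proof (cases n)
  case 0
  then show ?thesis using idealD[OF J] by (simp add: a_minus_def r_neg)
next
  case (Suc m)
  then show ?thesis using pow_diff[OF assms(2,3), of m] idealD(8)[OF J assms(4)] by metis
qed

text \<open>By \<open>pow_diff\<close> the quotient of x^p - y^p by x - y is p y^(p-1) plus a
  multiple of x - y. For j \<ge> 1 both summands are divisible by p, which gains one power of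
  p.\<close>

lemma pow_prime_lift:
  assumes "x \<in> carrier R" "y \<in> carrier R" "x \<ominus> y \<in> lin R [nn p [^] j]" "j \<ge> (1::nat)" "p > 0"
  shows "x [^] p \<ominus> y [^] p \<in> lin R [nn p [^] Suc j]"
proof -
  obtain m where m: "p = Suc m" using \<open>p > 0\<close> by (cases p) auto
  obtain s t where st: "s \<in> carrier R" "t \<in> carrier R" "x [^] p \<ominus> y [^] p = (x \<ominus> y) \<otimes> s"
    "s = nn p \<otimes> y [^] m \<oplus> (x \<ominus> y) \<otimes> t" using pow_diff[OF assms(1,2), of m] m by metis
  obtain z where z: "z \<in> carrier R" "x \<ominus> y = nn p [^] j \<otimes> z" using assms(3) lin1[of "nn p [^] j"] by auto
  obtain i where i: "j = Suc i" using assms(4) by (cases j) auto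
  obtain P Q Y where d: "P = nn p" "Q = P [^] i" "Y = y [^] m" by blast
  have c: "P \<in> carrier R" "Q \<in> carrier R" "Y \<in> carrier R" unfolding d using assms by simp_all
  have xy: "x \<ominus> y = Q \<otimes> P \<otimes> z" using z by (simp add: i d)
  have "x [^] p \<ominus> y [^] p = Q \<otimes> P \<otimes> z \<otimes> (P \<otimes> Y \<oplus> Q \<otimes> P \<otimes> z \<otimes> t)" using st xy d by simp
  also have "\<dots> = Q \<otimes> P \<otimes> P \<otimes> (z \<otimes> (Y \<oplus> Q \<otimes> z \<otimes> t))"
    using c st(1,2) z(1) by algebra
  also have "\<dots> = nn p [^] Suc j \<otimes> (z \<otimes> (Y \<oplus> Q \<otimes> z \<otimes> t))" by (simp add: i d)
  finally show ?thesis using lin1[of "nn p [^] Suc j"] c st z by auto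
qed

end

section \<open>Indices of ideals in Iwasawa algebras\<close>

context cring begin

lemma lin1I: "x = a \<otimes> u \<Longrightarrow> a \<in> carrier R \<Longrightarrow> u \<in> carrier R \<Longrightarrow> x \<in> lin R [a]"
  by (subst lin1, assumption, intro bexI, assumption+)

lemma lin2I: "x = a \<otimes> u \<oplus> b \<otimes> v \<Longrightarrow> a \<in> carrier R \<Longrightarrow> b \<in> carrier R \<Longrightarrow>
    u \<in> carrier R \<Longrightarrow> v \<in> carrier R \<Longrightarrow> x \<in> lin R [a, b]"
  by (subst lin2, assumption+, intro bexI, assumption+)

lemma lin3I: "x = a \<otimes> u \<oplus> (b \<otimes> v \<oplus> c \<otimes> w) \<Longrightarrow> a \<in> carrier R \<Longrightarrow> b \<in> carrier R \<Longrightarrow>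
    c \<in> carrier R \<Longrightarrow> u \<in> carrier R \<Longrightarrow> v \<in> carrier R \<Longrightarrow> w \<in> carrier R \<Longrightarrow> x \<in> lin R [a, b, c]"
  by (subst lin3, assumption+, intro bexI, assumption+)

lemma lin_mem:
  assumes "set as \<subseteq> carrier R" "a \<in> set as" "x \<in> carrier R"
  shows "a \<otimes> x \<in> lin R as"
  using idealD(8)[OF lin_ideal[OF assms(1)] lin_gen[OF assms(1,2)] assms(3)] .

lemma lin_mono_set:
  assumes "set bs \<subseteq> carrier R" "set as \<subseteq> set bs"
  shows "lin R as \<subseteq> lin R bs"
  using lin_subset[OF assms(1)] lin_gen[OF assms(1)] assms by blast

lemma lin_eqI:
  assumes "set as \<subseteq> carrier R" "set bs \<subseteq> carrier R"
    "\<And>a. a \<in> set as \<Longrightarrow> a \<in> lin R bs" "\<And>a. a \<in> set bs \<Longrightarrow> a \<in> lin R as"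
  shows "lin R as = lin R bs"
  using lin_subset[OF assms(1)] lin_subset[OF assms(2)] assms(3,4) by blast

lemma lin_one:
  assumes "set as \<subseteq> carrier R" "\<one> \<in> lin R as" shows "lin R as = carrier R"
proof
  show "carrier R \<subseteq> lin R as"
  proof
    fix x assume "x \<in> carrier R"
    then show "x \<in> lin R as" using idealD(8)[OF lin_ideal[OF assms(1)] assms(2), of x] by simp
  qed
qed (rule lin_carrier[OF assms(1)])

lemma index_self: "index R (carrier R) (carrier R) = 1" "finite (cosets R (carrier R) (carrier R))"
proof -
  have "cosets R (carrier R) (carrier R) = {carrier R +> \<zero>}"
  proof -
    have "carrier R +> x = carrier R +> \<zero>" if "x \<in> carrier R" for x
      using coset_eq_iff[OF subgp_carrier that zero_closed] that by simp
    then show ?thesis unfolding cosets_def using zero_closed by blast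
  qed
  then show "index R (carrier R) (carrier R) = 1" "finite (cosets R (carrier R) (carrier R))"
    by (simp_all add: index_def)
qed

lemma ideal_cong:
  assumes "ideal J R" "x \<ominus> y \<in> J" "x \<in> carrier R" "y \<in> carrier R"
  shows "x \<in> J \<longleftrightarrow> y \<in> J"
proof -
  note J = idealD[OF assms(1)]
  have "x = (x \<ominus> y) \<oplus> y" "y = x \<ominus> (x \<ominus> y)"
    using assms(3,4) by (simp_all add: minus_minus_cancel)
  then show ?thesis using J(4)[OF assms(2)] J(6)[of x "x \<ominus> y"] assms(2) by metis
qed

end

text \<open>The properties of \<open>\<Lambda>[\<Delta>]\<close> that the argument uses; \<open>e\<close> is a primitive idempotent, and
  \<open>R / (L, T, 1 - e)\<close> is the residue field of \<open>\<Lambda>\<^sub>\<phi>\<close>.\<close>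

locale iwasawa = cring R for R (structure) +
  fixes p q :: nat and L T e
  assumes prime_p: "Factorial_Ring.prime p"
    and L_eq: "L = [p] \<cdot> \<one>"
    and T_carrier [simp]: "T \<in> carrier R" and e_carrier [simp]: "e \<in> carrier R"
    and e_idem: "e \<otimes> e = e"
    and reg_L: "x \<in> carrier R \<Longrightarrow> L \<otimes> x = \<zero> \<Longrightarrow> x = \<zero>"
    and reg_T: "x \<in> carrier R \<Longrightarrow> T \<otimes> x \<in> lin R [L] \<Longrightarrow> x \<in> lin R [L]"
    and jacobson: "c \<in> lin R [L, T] \<Longrightarrow> \<exists>d\<in>carrier R. (\<one> \<oplus> c) \<otimes> d = \<one>"
    and residue_card: "index R (lin R [L, T, \<one> \<ominus> e]) (carrier R) = q"
    and residue_finite: "finite (cosets R (lin R [L, T, \<one> \<ominus> e]) (carrier R))"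
    and residue_field: "x \<in> carrier R \<Longrightarrow> x \<notin> lin R [L, T, \<one> \<ominus> e] \<Longrightarrow>
      \<exists>y\<in>carrier R. x \<otimes> y \<ominus> \<one> \<in> lin R [L, T, \<one> \<ominus> e]"
begin

lemma L_carrier [simp]: "L \<in> carrier R" by (simp add: L_eq)

lemma L_cancel:
  assumes "x \<in> carrier R" "y \<in> carrier R" "L \<otimes> x = L \<otimes> y" shows "x = y"
proof -
  have "L \<otimes> (x \<ominus> y) = L \<otimes> x \<ominus> L \<otimes> y" using assms(1,2) L_carrier by algebra
  then have "L \<otimes> (x \<ominus> y) = \<zero>" using assms by simp
  then show ?thesis using reg_L[of "x \<ominus> y"] assms by simp
qed

lemma reg_T_pow:
  assumes "x \<in> carrier R" "T [^] (n::nat) \<otimes> x \<in> lin R [L]" shows "x \<in> lin R [L]"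
  using assms(2)
proof (induction n)
  case 0 then show ?case using assms by simp
next
  case (Suc n)
  have "T [^] Suc n \<otimes> x = T \<otimes> (T [^] n \<otimes> x)" using assms(1) by (simp add: m_ac)
  then show ?case using Suc reg_T[of "T [^] n \<otimes> x"] assms(1) by simp
qed

text \<open>Multiplication by e removes the generator 1 - e and leaves L e x = g e b. Modulo L this
  says T^N e b = 0, so e b = L z by regularity of T; cancelling L gives e x = g z.\<close>

lemma distinguished_torsion_free:
  assumes g: "g \<in> carrier R" "g \<ominus> T [^] (N::nat) \<in> lin R [L, \<one> \<ominus> e]"
    and x: "x \<in> carrier R" "L \<otimes> x \<in> lin R [g, \<one> \<ominus> e]"
  shows "x \<in> lin R [g, \<one> \<ominus> e]"
proof -
  obtain b c where bc: "b \<in> carrier R" "c \<in> carrier R" "L \<otimes> x = g \<otimes> b \<oplus> (\<one> \<ominus> e) \<otimes> c"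
    using x(2) g lin2[of g "\<one> \<ominus> e"] by auto
  obtain t where t: "t = T [^] N" by blast
  have tR: "t \<in> carrier R" by (simp add: t)
  obtain h k where hk: "h \<in> carrier R" "k \<in> carrier R" "g \<ominus> t = L \<otimes> h \<oplus> (\<one> \<ominus> e) \<otimes> k"
    using g lin2[of L "\<one> \<ominus> e"] t by auto
  have [simp]: "e \<otimes> (\<one> \<ominus> e) = \<zero>" using e_idem by (simp add: a_minus_def r_distr r_minus r_neg)
  have e1: "e \<otimes> ((\<one> \<ominus> e) \<otimes> z) = \<zero>" if "z \<in> carrier R" for z
    using that by (simp add: m_assoc[symmetric])
  have ee: "e \<otimes> (e \<otimes> z) = e \<otimes> z" if "z \<in> carrier R" for z
    using that e_idem by (simp add: m_assoc[symmetric])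
  have 1: "L \<otimes> (e \<otimes> x) = g \<otimes> (e \<otimes> b)"
  proof -
    have "L \<otimes> (e \<otimes> x) = e \<otimes> (L \<otimes> x)" using x(1) by (simp add: m_ac)
    also have "\<dots> = g \<otimes> (e \<otimes> b)" using bc g by (simp add: r_distr e1 m_ac)
    finally show ?thesis .
  qed
  have 2: "g = t \<oplus> (L \<otimes> h \<oplus> (\<one> \<ominus> e) \<otimes> k)"
  proof -
    have "g = t \<oplus> (g \<ominus> t)" using g tR by algebra
    then show ?thesis using hk by simp
  qed
  have 3: "g \<otimes> (e \<otimes> b) = t \<otimes> (e \<otimes> b) \<oplus> L \<otimes> (h \<otimes> (e \<otimes> b))"
  proof -
    obtain u where u: "u = e \<otimes> b" by blast
    have uR: "u \<in> carrier R" "e \<otimes> u = u" using bc u ee by auto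
    have "(\<one> \<ominus> e) \<otimes> u = u \<ominus> e \<otimes> u" using uR(1) e_carrier by algebra
    then have "(\<one> \<ominus> e) \<otimes> u = \<zero>" using uR by simp
    moreover have "g \<otimes> u = t \<otimes> u \<oplus> L \<otimes> (h \<otimes> u) \<oplus> k \<otimes> ((\<one> \<ominus> e) \<otimes> u)"
      unfolding 2 using uR(1) hk(1,2) tR e_carrier L_carrier by algebra
    ultimately show ?thesis using uR hk tR by (simp add: u)
  qed
  have "t \<otimes> (e \<otimes> b) = L \<otimes> (e \<otimes> x \<ominus> h \<otimes> (e \<otimes> b))"
  proof -
    obtain u v where u: "u = e \<otimes> b" "v = e \<otimes> x" by blast
    have uR: "u \<in> carrier R" "v \<in> carrier R" using bc x u by auto
    have "t \<otimes> u = (t \<otimes> u \<oplus> L \<otimes> (h \<otimes> u)) \<ominus> L \<otimes> (h \<otimes> u)"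
      using uR hk(1) tR L_carrier by algebra
    also have "\<dots> = L \<otimes> v \<ominus> L \<otimes> (h \<otimes> u)" using 1 3 u by simp
    also have "\<dots> = L \<otimes> (v \<ominus> h \<otimes> u)"
      using uR hk(1) L_carrier by algebra
    finally show ?thesis by (simp add: u)
  qed
  then have "T [^] N \<otimes> (e \<otimes> b) \<in> lin R [L]"
    unfolding t by (rule lin1I) (use bc x hk in simp_all)
  then have "e \<otimes> b \<in> lin R [L]" by (rule reg_T_pow[rotated]) (use bc in simp)
  then obtain z where z: "z \<in> carrier R" "e \<otimes> b = L \<otimes> z" using lin1[of L] by auto
  have "L \<otimes> (e \<otimes> x) = L \<otimes> (g \<otimes> z)" using 1 z g by (simp add: m_ac)
  then have "e \<otimes> x = g \<otimes> z" using L_cancel x z g by simp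
  then have "x = g \<otimes> z \<oplus> (\<one> \<ominus> e) \<otimes> x"
    using x(1) by (metis (no_types, lifting) e_carrier l_distr l_one minus_closed minus_minus_cancel(4) a_comm one_closed)
  then show ?thesis by (rule lin2I) (use z x g in simp_all)
qed

text \<open>The substance is that L can be cancelled modulo (g, 1 - e), by
  \<open>distinguished_torsion_free\<close>. The result is the colon ideal that
  \<open>index_lin_step\<close> asks for with c = L.\<close>

lemma L_pow_colon:
  assumes g: "g \<in> carrier R" "g \<ominus> T [^] (N::nat) \<in> lin R [L, \<one> \<ominus> e]" and x: "x \<in> carrier R"
  shows "L \<otimes> x \<in> lin R [L [^] Suc k, g, \<one> \<ominus> e] \<longleftrightarrow> x \<in> lin R [L [^] k, g, \<one> \<ominus> e]"
proof -
  obtain K where K: "K = L [^] k" by blast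
  have KR: "K \<in> carrier R" by (simp add: K)
  have LK: "L [^] Suc k = K \<otimes> L" by (simp add: K)
  have E: "\<one> \<ominus> e \<in> carrier R" by simp
  show ?thesis
  proof
    assume "L \<otimes> x \<in> lin R [L [^] Suc k, g, \<one> \<ominus> e]"
    then obtain a b c where *: "a \<in> carrier R" "b \<in> carrier R" "c \<in> carrier R"
      "L \<otimes> x = (K \<otimes> L) \<otimes> a \<oplus> (g \<otimes> b \<oplus> (\<one> \<ominus> e) \<otimes> c)"
      using lin3[of "K \<otimes> L" g "\<one> \<ominus> e"] g KR LK by auto
    have "L \<otimes> (x \<ominus> K \<otimes> a) = L \<otimes> x \<ominus> (K \<otimes> L) \<otimes> a"
      using x KR *(1) L_carrier by algebra
    also have "\<dots> = g \<otimes> b \<oplus> (\<one> \<ominus> e) \<otimes> c"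
      unfolding *(4) using x KR *(1-3) L_carrier g(1) e_carrier by algebra
    finally have "L \<otimes> (x \<ominus> K \<otimes> a) \<in> lin R [g, \<one> \<ominus> e]" using lin2[of g "\<one> \<ominus> e"] *(2,3) g(1) E by blast
    then have "x \<ominus> K \<otimes> a \<in> lin R [g, \<one> \<ominus> e]"
      using distinguished_torsion_free[OF g, of "x \<ominus> K \<otimes> a"] x KR *(1) by simp
    then obtain b c where **: "b \<in> carrier R" "c \<in> carrier R" "x \<ominus> K \<otimes> a = g \<otimes> b \<oplus> (\<one> \<ominus> e) \<otimes> c"
      using lin2[of g "\<one> \<ominus> e"] g by auto
    have "x = K \<otimes> a \<oplus> (x \<ominus> K \<otimes> a)" using x KR * by algebra
    then have "x = K \<otimes> a \<oplus> (g \<otimes> b \<oplus> (\<one> \<ominus> e) \<otimes> c)" by (simp only: **(3))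
    then show "x \<in> lin R [L [^] k, g, \<one> \<ominus> e]"
      unfolding K[symmetric] by (rule lin3I) (use KR g *(1) **(1,2) in simp_all)
  next
    assume "x \<in> lin R [L [^] k, g, \<one> \<ominus> e]"
    then obtain a b c where *: "a \<in> carrier R" "b \<in> carrier R" "c \<in> carrier R"
      "x = K \<otimes> a \<oplus> (g \<otimes> b \<oplus> (\<one> \<ominus> e) \<otimes> c)"
      using lin3[of K g "\<one> \<ominus> e"] g KR K by auto
    have "L \<otimes> x = (K \<otimes> L) \<otimes> a \<oplus> (g \<otimes> (L \<otimes> b) \<oplus> (\<one> \<ominus> e) \<otimes> (L \<otimes> c))"
      unfolding *(4) using KR *(1-3) L_carrier g(1) e_carrier by algebra
    then show "L \<otimes> x \<in> lin R [L [^] Suc k, g, \<one> \<ominus> e]"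
      unfolding LK by (rule lin3I) (use g KR *(1-3) in simp_all)
  qed
qed

text \<open>Induction on N through \<open>index_lin_step\<close> with c = T. Adding T to the
  generators gives the residue field, of q elements, and the colon ideal by T is the ideal for N
  because T is regular modulo L.\<close>

lemma index_L_T_pow:
  "index R (lin R [L, T [^] (N::nat), \<one> \<ominus> e]) (carrier R) = q ^ N
   \<and> finite (cosets R (lin R [L, T [^] N, \<one> \<ominus> e]) (carrier R))"
proof (induction N)
  case 0
  have "lin R [L, T [^] (0::nat), \<one> \<ominus> e] = carrier R"
    using lin_gen[of "[L, \<one>, \<one> \<ominus> e]" \<one>] by (intro lin_one) simp_all
  then show ?case using index_self by simp
next
  case (Suc N)
  let ?as = "[L, T [^] Suc N, \<one> \<ominus> e]" and ?bs = "[L, T [^] N, \<one> \<ominus> e]"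
  have as: "set ?as \<subseteq> carrier R" and bs: "set ?bs \<subseteq> carrier R" and cs: "set [L, T, \<one> \<ominus> e] \<subseteq> carrier R" by auto
  obtain t where t: "t = T [^] N" by blast
  have tR: "t \<in> carrier R" by (simp add: t)
  have tS: "T [^] Suc N = t \<otimes> T" by (simp add: t)
  have 1: "lin R (T # ?as) = lin R [L, T, \<one> \<ominus> e]"
  proof (rule lin_eqI)
    have "T [^] Suc N \<in> lin R [L, T, \<one> \<ominus> e]"
      using lin_mem[OF cs, of T t] tR tS m_comm[of t T] by simp
    then show "\<And>a. a \<in> set (T # ?as) \<Longrightarrow> a \<in> lin R [L, T, \<one> \<ominus> e]"
      using lin_gen[OF cs] by auto
    have "set (T # ?as) \<subseteq> carrier R" by simp
    then show "\<And>a. a \<in> set [L, T, \<one> \<ominus> e] \<Longrightarrow> a \<in> lin R (T # ?as)" 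
      using lin_gen[of "T # ?as"] by auto
  qed auto
  have 2: "T \<otimes> x \<in> lin R ?as \<longleftrightarrow> x \<in> lin R ?bs" if x: "x \<in> carrier R" for x
  proof
    assume "T \<otimes> x \<in> lin R ?as"
    then obtain a b c where *: "a \<in> carrier R" "b \<in> carrier R" "c \<in> carrier R"
      "T \<otimes> x = L \<otimes> a \<oplus> (t \<otimes> T \<otimes> b \<oplus> (\<one> \<ominus> e) \<otimes> c)"
      using lin3[of L "t \<otimes> T" "\<one> \<ominus> e"] tR tS by auto
    \<comment> \<open>The factor e annihilates the term (1 - e) c of the representation of T x, and
      subtracting t b removes the middle term; what is left is a multiple of L.\<close>
    have "T \<otimes> (e \<otimes> (x \<ominus> t \<otimes> b)) = e \<otimes> (T \<otimes> x) \<ominus> e \<otimes> (t \<otimes> T \<otimes> b)"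
      using x tR *(1,2) T_carrier e_carrier by algebra
    also have "\<dots> = L \<otimes> (e \<otimes> a) \<oplus> (e \<ominus> e \<otimes> e) \<otimes> c"
      unfolding *(4) using x tR *(1-3) T_carrier e_carrier L_carrier by algebra
    also have "\<dots> = L \<otimes> (e \<otimes> a)" using * by (simp add: e_idem a_minus_def r_neg)
    finally have "T \<otimes> (e \<otimes> (x \<ominus> t \<otimes> b)) \<in> lin R [L]" by (rule lin1I) (use *(1) in simp_all)
    then have "e \<otimes> (x \<ominus> t \<otimes> b) \<in> lin R [L]" by (rule reg_T[rotated]) (use x tR *(2) in simp)
    then obtain z where z: "z \<in> carrier R" "e \<otimes> (x \<ominus> t \<otimes> b) = L \<otimes> z" using lin1[of L] by auto
    have "x = e \<otimes> (x \<ominus> t \<otimes> b) \<oplus> (t \<otimes> b \<oplus> (\<one> \<ominus> e) \<otimes> (x \<ominus> t \<otimes> b))"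
      using x tR *(1-3) e_carrier by algebra
    then have "x = L \<otimes> z \<oplus> (t \<otimes> b \<oplus> (\<one> \<ominus> e) \<otimes> (x \<ominus> t \<otimes> b))" by (simp only: z(2))
    then show "x \<in> lin R ?bs"
      unfolding t[symmetric] by (rule lin3I) (use z x tR *(1-3) in simp_all)
  next
    assume "x \<in> lin R ?bs"
    then obtain a b c where *: "a \<in> carrier R" "b \<in> carrier R" "c \<in> carrier R"
      "x = L \<otimes> a \<oplus> (t \<otimes> b \<oplus> (\<one> \<ominus> e) \<otimes> c)"
      using lin3[of L "t" "\<one> \<ominus> e"] tR t by auto
    have "T \<otimes> x = L \<otimes> (T \<otimes> a) \<oplus> (t \<otimes> T \<otimes> b \<oplus> (\<one> \<ominus> e) \<otimes> (T \<otimes> c))"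
      unfolding *(4) using tR *(1-3) e_carrier T_carrier L_carrier by algebra
    then show "T \<otimes> x \<in> lin R ?as"
      unfolding tS by (rule lin3I) (use tR *(1-3) in simp_all)
  qed
  show ?case
    using index_lin_step[OF as T_carrier 2 lin_ideal[OF bs]] Suc residue_card residue_finite
    unfolding 1 by auto
qed

lemma lin_L_distinguished:
  assumes g: "g \<in> carrier R" "g \<ominus> T [^] (N::nat) \<in> lin R [L, \<one> \<ominus> e]"
  shows "lin R [L, g, \<one> \<ominus> e] = lin R [L, T [^] N, \<one> \<ominus> e]"
proof -
  have s: "set [L, g, \<one> \<ominus> e] \<subseteq> carrier R" "set [L, T [^] N, \<one> \<ominus> e] \<subseteq> carrier R" using g by auto
  have "T [^] N \<in> lin R [L, g, \<one> \<ominus> e]"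
    using ideal_cong[OF lin_ideal[OF s(1)], of g "T [^] N"] lin_mono_set[OF s(1), of "[L, \<one> \<ominus> e]"]
      g lin_gen[OF s(1), of g] by auto
  moreover have "g \<in> lin R [L, T [^] N, \<one> \<ominus> e]"
    using ideal_cong[OF lin_ideal[OF s(2)], of g "T [^] N"] lin_mono_set[OF s(2), of "[L, \<one> \<ominus> e]"]
      g lin_gen[OF s(2), of "T [^] N"] by auto
  ultimately show ?thesis using s lin_gen[OF s(1)] lin_gen[OF s(2)] by (intro lin_eqI) auto
qed

text \<open>Induction on k through \<open>index_lin_step\<close> with c = L: every step contributes
  the index of (L, g, 1 - e) = (L, T^N, 1 - e), which is q^N.\<close>

lemma index_L_pow_distinguished:
  assumes g: "g \<in> carrier R" "g \<ominus> T [^] (N::nat) \<in> lin R [L, \<one> \<ominus> e]"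
  shows "index R (lin R [L [^] (k::nat), g, \<one> \<ominus> e]) (carrier R) = q ^ (N * k)
   \<and> finite (cosets R (lin R [L [^] k, g, \<one> \<ominus> e]) (carrier R))"
proof (induction k)
  case 0
  have "lin R [L [^] (0::nat), g, \<one> \<ominus> e] = carrier R"
    using g lin_gen[of "[\<one>, g, \<one> \<ominus> e]" \<one>] by (intro lin_one) simp_all
  then show ?case using index_self by simp
next
  case (Suc k)
  let ?as = "[L [^] Suc k, g, \<one> \<ominus> e]" and ?bs = "[L [^] k, g, \<one> \<ominus> e]"
  have as: "set ?as \<subseteq> carrier R" and bs: "set ?bs \<subseteq> carrier R" and cs: "set [L, g, \<one> \<ominus> e] \<subseteq> carrier R"
    using g by auto
  have 1: "lin R (L # ?as) = lin R [L, g, \<one> \<ominus> e]"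
  proof (rule lin_eqI)
    have "L [^] Suc k \<in> lin R [L, g, \<one> \<ominus> e]"
      using lin_mem[OF cs, of L "L [^] k"] m_comm[of "L [^] k" L] by simp
    then show "\<And>a. a \<in> set (L # ?as) \<Longrightarrow> a \<in> lin R [L, g, \<one> \<ominus> e]"
      using lin_gen[OF cs] by auto
    have "set (L # ?as) \<subseteq> carrier R" using as by simp
    then show "\<And>a. a \<in> set [L, g, \<one> \<ominus> e] \<Longrightarrow> a \<in> lin R (L # ?as)"
      using lin_gen[of "L # ?as"] by auto
  qed (use g in auto)
  show ?case
    using index_lin_step[OF as L_carrier L_pow_colon[OF g] lin_ideal[OF bs]] Suc
      index_L_T_pow[of N] lin_L_distinguished[OF g]
    unfolding 1 by (auto simp: power_add)
qed

end

section \<open>Powers of the ideal (L, T) and the elements \<open>w n\<close>\<close>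

context cring begin

lemma frobenius_add_pow:
  assumes p: "Factorial_Ring.prime p" and x: "x \<in> carrier R" and y: "y \<in> carrier R"
  shows "(x \<oplus> y) [^] (p ^ n) \<ominus> (x [^] (p ^ n) \<oplus> y [^] (p ^ n)) \<in> lin R [nn p]"
proof (induction n)
  have I: "ideal (lin R [nn p]) R" by (rule lin_ideal) simp
  {
    case 0
    then show ?case using idealD(3)[OF I] x y by (simp add: a_minus_def r_neg)
  next
    case (Suc n)
    obtain z u v where d: "z = (x \<oplus> y) [^] (p ^ n)" "u = x [^] (p ^ n)" "v = y [^] (p ^ n)" by blast
    have c: "z \<in> carrier R" "u \<in> carrier R" "v \<in> carrier R" using x y by (simp_all add: d)
    have 1: "z [^] p \<ominus> (u \<oplus> v) [^] p \<in> lin R [nn p]"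
      by (rule pow_cong[OF I]) (use c Suc d in simp_all)
    have 2: "(u \<oplus> v) [^] p \<ominus> (u [^] p \<oplus> v [^] p) \<in> lin R [nn p]"
      by (rule frobenius_add[OF p c(2,3)])
    have "z [^] p \<ominus> (u [^] p \<oplus> v [^] p) \<in> lin R [nn p]"
      using idealD(4)[OF I 1 2] c by (simp add: minus_minus_cancel)
    then show ?case using x y by (simp add: d nat_pow_pow mult.commute)
  }
qed

context
  fixes L T assumes L_carrier [simp]: "L \<in> carrier R" and T_carrier [simp]: "T \<in> carrier R"
begin

text \<open>Write c = L u + T v. The product L u x is controlled by the first membership of x and
  the product T v x by the second.\<close>

lemma lin_m_step:
  assumes c: "c \<in> lin R [L, T]" and x: "x \<in> lin R [L [^] a, T [^] Suc b]" "x \<in> lin R [L [^] Suc a, T [^] b]"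
  shows "c \<otimes> x \<in> lin R [L [^] Suc a, T [^] Suc (b::nat)]"
proof -
  obtain A B where d: "A = L [^] a" "B = T [^] b" by blast
  have AB: "A \<in> carrier R" "B \<in> carrier R" by (simp_all add: d)
  obtain u v where u: "u \<in> carrier R" "v \<in> carrier R" "c = L \<otimes> u \<oplus> T \<otimes> v" using c lin2 by auto
  obtain r s where r: "r \<in> carrier R" "s \<in> carrier R" "x = A \<otimes> r \<oplus> (B \<otimes> T) \<otimes> s"
    using x(1) lin2[of A "B \<otimes> T"] d AB by auto
  obtain r' s' where r': "r' \<in> carrier R" "s' \<in> carrier R" "x = (A \<otimes> L) \<otimes> r' \<oplus> B \<otimes> s'"
    using x(2) lin2[of "A \<otimes> L" "B"] d AB by auto
  have "c \<otimes> x = (L \<otimes> u) \<otimes> x \<oplus> (T \<otimes> v) \<otimes> x"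
    unfolding u(3) using u r AB by (intro l_distr) simp_all
  also have "(L \<otimes> u) \<otimes> x \<oplus> (T \<otimes> v) \<otimes> x = 
     (L \<otimes> u) \<otimes> (A \<otimes> r \<oplus> (B \<otimes> T) \<otimes> s) \<oplus> (T \<otimes> v) \<otimes> ((A \<otimes> L) \<otimes> r' \<oplus> B \<otimes> s')"
    using r(3) r'(3) by simp
  also have "\<dots> = (A \<otimes> L) \<otimes> (u \<otimes> r \<oplus> T \<otimes> v \<otimes> r') \<oplus> (B \<otimes> T) \<otimes> (L \<otimes> u \<otimes> s \<oplus> v \<otimes> s')"
    using u(1,2) r(1,2) r'(1,2) AB T_carrier L_carrier by algebra
  finally show ?thesis unfolding nat_pow_Suc d[symmetric]
    by (rule lin2I) (use u(1,2) r(1,2) r'(1,2) AB in simp_all)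
qed

lemma lin_pow_one: "lin R [L [^] (0::nat), x] = carrier R" "lin R [x, T [^] (0::nat)] = carrier R" if "x \<in> carrier R"
  using that lin_gen[of "[\<one>, x]" \<one>] lin_gen[of "[x, \<one>]" \<one>] by (auto intro!: lin_one)

text \<open>Such an x n lies in the power (L, T)^(n+1), and a monomial L^i T^j with i + j = n + 1
  has i \<ge> a or j \<ge> b as soon as a + b \<le> n + 2. Induction on n, for all a and b at once,
  reaches this without forming powers of ideals.\<close>

lemma prod_in_lin_pow:
  assumes "\<And>n. x n \<in> carrier R" "x 0 \<in> lin R [L, T]" "\<And>n. \<exists>c\<in>lin R [L, T]. x (Suc n) = c \<otimes> x n"
    and "a + b \<le> n + 2"
  shows "x n \<in> lin R [L [^] a, T [^] (b::nat)]"
  using assms(4)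
proof (induction n arbitrary: a b)
  case 0
  consider "a = 0" | "b = 0" | "a = 1" "b = 1" using 0 by linarith
  then show ?case
  proof cases
    case 3
    then show ?thesis using assms(2) by simp
  qed (use assms(1) lin_pow_one in \<open>auto simp del: nat_pow_0\<close>)
next
  case (Suc n)
  show ?case
  proof (cases "a = 0 \<or> b = 0")
    case True
    then show ?thesis using assms(1) lin_pow_one by (auto simp del: nat_pow_0)
  next
    case False
    then obtain a' b' where ab: "a = Suc a'" "b = Suc b'" by (meson not0_implies_Suc)
    obtain c where c: "c \<in> lin R [L, T]" "x (Suc n) = c \<otimes> x n" using assms(3) by blast
    show ?thesis unfolding ab c(2)
      by (rule lin_m_step[OF c(1)]; rule Suc.IH) (use Suc.prems ab in simp_all)
  qed
qed

end

end

context iwasawa begin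

definition w :: "nat \<Rightarrow> 'a" where "w n = (\<one> \<oplus> T) [^] (p ^ n) \<ominus> \<one>"

lemma w_carrier [simp]: "w n \<in> carrier R" by (simp add: w_def)

lemma p_pos: "p > 0" using prime_p prime_gt_0_nat by blast

lemma w_0: "w 0 = T"
proof -
  have "(\<one> \<oplus> T) \<ominus> \<one> = T" using T_carrier by algebra
  then show ?thesis by (simp add: w_def)
qed

text \<open>Since \<open>w (Suc n)\<close> is (1 + w n)^p - 1, \<open>pow_diff\<close> at y = 1
  splits off the factor w n and leaves p modulo w n.\<close>

lemma w_Suc: "\<exists>t\<in>carrier R. w (Suc n) = w n \<otimes> (L \<oplus> w n \<otimes> t)"
proof -
  obtain m where m: "p = Suc m" using p_pos by (cases p) auto
  have "w (Suc n) = ((\<one> \<oplus> T) [^] (p ^ n)) [^] p \<ominus> \<one> [^] p"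
    by (simp add: w_def nat_pow_pow mult.commute)
  then show ?thesis
    using pow_diff[of "(\<one> \<oplus> T) [^] (p ^ n)" \<one> m]
    unfolding m[symmetric] w_def[symmetric] by (auto simp: L_eq w_def[symmetric] simp del: nat_pow_Suc)
qed

lemma w_mod_L: "w n \<ominus> T [^] (p ^ n) \<in> lin R [L]"
proof -
  have "(\<one> \<oplus> T) [^] (p ^ n) \<ominus> (\<one> \<oplus> T [^] (p ^ n)) \<in> lin R [L]"
    using frobenius_add_pow[OF prime_p one_closed T_carrier, of n] by (simp add: L_eq)
  moreover obtain x y where "x = (\<one> \<oplus> T) [^] (p ^ n)" "y = T [^] (p ^ n)" by blast
  moreover then have c: "x \<in> carrier R" "y \<in> carrier R" by simp_all
  moreover have "x \<ominus> \<one> \<ominus> y = x \<ominus> (\<one> \<oplus> y)" using c by algebra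
  ultimately show ?thesis by (simp add: w_def)
qed

text \<open>The quotient L + w n t of consecutive terms lies in (L, T), so
  \<open>prod_in_lin_pow\<close> applies: the elements w n tend to 0 in the (L, T)-adic
  sense.\<close>

lemma w_in_lin_pow: "a + b \<le> n + 2 \<Longrightarrow> w n \<in> lin R [L [^] a, T [^] (b::nat)]"
proof (rule prod_in_lin_pow[OF L_carrier T_carrier])
  have cs: "set [L, T] \<subseteq> carrier R" by simp
  note m = idealD[OF lin_ideal[OF cs]]
  show "w 0 \<in> lin R [L, T]" using w_0 lin_gen[OF cs, of T] by simp
  have wm: "w n \<in> lin R [L, T]" for n
  proof (induction n)
    case 0 then show ?case using \<open>w 0 \<in> lin R [L, T]\<close> .
  next
    case (Suc n)
    obtain t where "t \<in> carrier R" "w (Suc n) = w n \<otimes> (L \<oplus> w n \<otimes> t)" using w_Suc by blast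
    then show ?case using m(8)[OF Suc, of "L \<oplus> w n \<otimes> t"] by simp
  qed
  fix n
  obtain t where t: "t \<in> carrier R" "w (Suc n) = w n \<otimes> (L \<oplus> w n \<otimes> t)" using w_Suc by blast
  have "L \<oplus> w n \<otimes> t \<in> lin R [L, T]" using m(4)[OF lin_gen[OF cs, of L] m(8)[OF wm t(1)]] by simp
  then show "\<exists>c\<in>lin R [L, T]. w (Suc n) = c \<otimes> w n" using t m_comm[of "w n" "L \<oplus> w n \<otimes> t"] by auto
qed simp_all

text \<open>Modulo L the element w n is a power of T and hence regular. So a factor L splits off x
  and can be cancelled on both sides, which lowers k by one.\<close>

lemma w_colon_L_pow:
  assumes x: "x \<in> carrier R" "w n \<otimes> x \<in> lin R [L [^] (k::nat)]"
  shows "x \<in> lin R [L [^] k]"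
  using x
proof (induction k arbitrary: x)
  case 0
  then show ?case using lin_one[of "[\<one>]"] lin_gen[of "[\<one>]" \<one>] by simp
next
  case (Suc k)
  obtain W t K where d: "W = w n" "t = T [^] (p ^ n)" "K = L [^] k" by blast
  have c: "W \<in> carrier R" "t \<in> carrier R" "K \<in> carrier R" by (simp_all add: d)
  obtain h where h: "h \<in> carrier R" "W \<ominus> t = L \<otimes> h" using w_mod_L[of n] lin1 d by auto
  obtain a where a: "a \<in> carrier R" "W \<otimes> x = (K \<otimes> L) \<otimes> a" using Suc.prems(2) lin1[of "K \<otimes> L"] d c by auto
  have "t \<otimes> x = W \<otimes> x \<ominus> (W \<ominus> t) \<otimes> x" using c Suc.prems(1) by algebra
  also have "\<dots> = L \<otimes> (K \<otimes> a \<ominus> h \<otimes> x)"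
    unfolding a(2) h(2) using c a(1) h(1) Suc.prems(1) L_carrier by algebra
  finally have "t \<otimes> x \<in> lin R [L]" by (rule lin1I) (use c a h Suc.prems(1) in simp_all)
  then have "x \<in> lin R [L]" using reg_T_pow Suc.prems(1) d by simp
  then obtain y where y: "y \<in> carrier R" "x = L \<otimes> y" using lin1 by auto
  have "L \<otimes> (W \<otimes> y) = L \<otimes> (K \<otimes> a)"
    using a y c by (simp add: m_ac)
  then have "W \<otimes> y = K \<otimes> a" using L_cancel c y a by simp
  then have "W \<otimes> y \<in> lin R [K]" by (rule lin1I) (use c a in simp_all)
  then have "y \<in> lin R [K]" using Suc.IH[OF y(1)] d by simp
  then obtain z where z: "z \<in> carrier R" "y = K \<otimes> z" using lin1 c by auto
  have "x = (K \<otimes> L) \<otimes> z" using y z c by (simp add: m_ac)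
  then show ?case unfolding nat_pow_Suc d(3)[symmetric] by (rule lin1I) (use c z in simp_all)
qed

lemma index_free:
  "index R (lin R [L [^] (k::nat), w n, \<one> \<ominus> e]) (carrier R) = q ^ (p ^ n * k)
   \<and> finite (cosets R (lin R [L [^] k, w n, \<one> \<ominus> e]) (carrier R))"
proof (rule index_L_pow_distinguished)
  show "w n \<ominus> T [^] (p ^ n) \<in> lin R [L, \<one> \<ominus> e]"
    using lin_mono_set[of "[L, \<one> \<ominus> e]" "[L]"] w_mod_L by auto
qed simp

text \<open>Modulo a distinguished \<open>f\<close>, the quotient \<open>w (Suc n) / w n\<close> eventually becomes \<open>L\<close> times a
  unit close to 1.\<close>

lemma w_Suc_mod_distinguished:
  assumes f: "f \<in> carrier R" "f \<ominus> T [^] (N::nat) \<in> lin R [L, \<one> \<ominus> e]"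
  shows "\<exists>n0. \<forall>n\<ge>n0. \<exists>k\<in>carrier R. \<exists>v\<in>carrier R.
     w (Suc n) \<ominus> w n \<otimes> L \<otimes> (\<one> \<oplus> L [^] Suc s \<otimes> k) \<in> lin R [f, \<one> \<ominus> e]
     \<and> (\<one> \<oplus> L [^] Suc s \<otimes> k) \<otimes> v = \<one>"
proof -
  have cs: "set [L, f, \<one> \<ominus> e] \<subseteq> carrier R" "set [f, \<one> \<ominus> e] \<subseteq> carrier R" using f by auto
  have cj: "set [L [^] j, f, \<one> \<ominus> e] \<subseteq> carrier R" for j :: nat using f by auto
  have E: "\<one> \<ominus> e \<in> carrier R" by simp
  have T1: "T [^] N \<in> lin R [L, f, \<one> \<ominus> e]"
    using ideal_cong[OF lin_ideal[OF cs(1)], of f "T [^] N"] lin_mono_set[OF cs(1), of "[L, \<one> \<ominus> e]"]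
      f lin_gen[OF cs(1), of f] by auto
  then obtain a b c where abc: "a \<in> carrier R" "b \<in> carrier R" "c \<in> carrier R"
    "T [^] N = L \<otimes> a \<oplus> (f \<otimes> b \<oplus> (\<one> \<ominus> e) \<otimes> c)" using lin3 f by auto
  \<comment> \<open>Modulo f and 1 - e the power T^N is a multiple of L, because f is congruent to
    T^N modulo L. Its j-th power is therefore a multiple of L^j.\<close>
  have Tj: "T [^] (N * j) \<in> lin R [L [^] j, f, \<one> \<ominus> e]" for j
  proof (induction j)
    case 0
    then show ?case using f lin_gen[of "[\<one>, f, \<one> \<ominus> e]" \<one>] by simp
  next
    case (Suc j)
    obtain K where K: "K = L [^] j" by blast
    have KR: "K \<in> carrier R" by (simp add: K)
    obtain a' b' c' where *: "a' \<in> carrier R" "b' \<in> carrier R" "c' \<in> carrier R"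
      "T [^] (N * j) = K \<otimes> a' \<oplus> (f \<otimes> b' \<oplus> (\<one> \<ominus> e) \<otimes> c')" using lin3 f Suc K KR by auto
    have cK: "set [K \<otimes> L, f, \<one> \<ominus> e] \<subseteq> carrier R" using KR f by simp
    note JD = idealD[OF lin_ideal[OF cK]]
    have fg: "f \<otimes> x \<oplus> (\<one> \<ominus> e) \<otimes> y \<in> lin R [K \<otimes> L, f, \<one> \<ominus> e]"
      if "x \<in> carrier R" "y \<in> carrier R" for x y
      by (rule JD(4); rule lin_mem[OF cK]) (use that in simp_all)
    obtain i0 i1 where i: "i0 = f \<otimes> b \<oplus> (\<one> \<ominus> e) \<otimes> c" "i1 = f \<otimes> b' \<oplus> (\<one> \<ominus> e) \<otimes> c'" by blast
    have iJ: "i0 \<in> lin R [K \<otimes> L, f, \<one> \<ominus> e]" "i1 \<in> lin R [K \<otimes> L, f, \<one> \<ominus> e]"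
      unfolding i using fg abc * by simp_all
    have iR: "i0 \<in> carrier R" "i1 \<in> carrier R" using iJ JD(2) by auto
    have "T [^] (N * Suc j) = T [^] N \<otimes> T [^] (N * j)" by (simp add: nat_pow_mult)
    also have "\<dots> = (L \<otimes> a \<oplus> i0) \<otimes> (K \<otimes> a' \<oplus> i1)" by (simp only: *(4) abc(4) i)
    also have "\<dots> = (K \<otimes> L) \<otimes> (a \<otimes> a') \<oplus> ((L \<otimes> a) \<otimes> i1 \<oplus> i0 \<otimes> (K \<otimes> a' \<oplus> i1))"
      using *(1) abc(1) iR KR L_carrier by algebra
    also have "\<dots> \<in> lin R [K \<otimes> L, f, \<one> \<ominus> e]"
      by (intro JD(4) JD(7)[OF iJ(2)] JD(8)[OF iJ(1)] lin_mem[OF cK]) (use *(1) abc(1) iR KR in simp_all)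
    finally show ?case unfolding nat_pow_Suc K[symmetric] .
  qed
  \<comment> \<open>For such n, \<open>w_in_lin_pow\<close> puts w n into (L^(s+2), T^(N (s+2))), so
    modulo f it has the form L^(s+2) h. In w (Suc n) = w n (L + w n t) one of these powers of L
    becomes the displayed factor, and the other s + 1 remain inside the unit.\<close>
  have main: "\<exists>k\<in>carrier R. \<exists>v\<in>carrier R.
     w (Suc n) \<ominus> w n \<otimes> L \<otimes> (\<one> \<oplus> L [^] Suc s \<otimes> k) \<in> lin R [f, \<one> \<ominus> e]
     \<and> (\<one> \<oplus> L [^] Suc s \<otimes> k) \<otimes> v = \<one>" if "n \<ge> (s + 2) + N * (s + 2)" for n
  proof -
    have "lin R [L [^] (s + 2), T [^] (N * (s + 2))] \<subseteq> lin R [L [^] (s + 2), f, \<one> \<ominus> e]"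
      by (rule lin_subset[OF cj]) (use Tj[of "s + 2"] lin_gen[OF cj, of "L [^] (s + 2)" "s + 2"] in auto)
    then have wn: "w n \<in> lin R [L [^] (s + 2), f, \<one> \<ominus> e]"
      using w_in_lin_pow[of "s + 2" "N * (s + 2)" n] that by auto
    obtain S W where S: "S = L [^] Suc s" "W = w n" by blast
    have SR: "S \<in> carrier R" "W \<in> carrier R" by (simp_all add: S del: nat_pow_Suc)
    have S2: "L [^] (s + 2) = S \<otimes> L" by (simp add: S)
    obtain h b c where h: "h \<in> carrier R" "b \<in> carrier R" "c \<in> carrier R"
      "W = (S \<otimes> L) \<otimes> h \<oplus> (f \<otimes> b \<oplus> (\<one> \<ominus> e) \<otimes> c)"
      using wn lin3[of "S \<otimes> L" f "\<one> \<ominus> e"] SR f S2 S by auto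
    obtain t where t: "t \<in> carrier R" "w (Suc n) = W \<otimes> (L \<oplus> W \<otimes> t)" using w_Suc[of n] S by blast
    have kR: "h \<otimes> t \<in> carrier R" using h t by simp
    have "S \<otimes> (h \<otimes> t) = L \<otimes> (L [^] s \<otimes> (h \<otimes> t)) \<oplus> T \<otimes> \<zero>" using kR by (simp add: S m_ac)
    then have "S \<otimes> (h \<otimes> t) \<in> lin R [L, T]" by (rule lin2I) (use kR in simp_all)
    then obtain v where v: "v \<in> carrier R" "(\<one> \<oplus> S \<otimes> (h \<otimes> t)) \<otimes> v = \<one>" using jacobson by blast
    have "w (Suc n) \<ominus> W \<otimes> L \<otimes> (\<one> \<oplus> S \<otimes> (h \<otimes> t)) = W \<otimes> t \<otimes> (W \<ominus> (S \<otimes> L) \<otimes> h)"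
      unfolding t(2) using SR h(1) t(1) L_carrier by algebra
    also have "W \<ominus> (S \<otimes> L) \<otimes> h = f \<otimes> b \<oplus> (\<one> \<ominus> e) \<otimes> c"
      unfolding h(4) using SR(1) h(1-3) f(1) e_carrier L_carrier by algebra
    also have "W \<otimes> t \<otimes> (f \<otimes> b \<oplus> (\<one> \<ominus> e) \<otimes> c) = f \<otimes> (W \<otimes> t \<otimes> b) \<oplus> (\<one> \<ominus> e) \<otimes> (W \<otimes> t \<otimes> c)"
      using SR(2) t(1) h(2,3) f(1) e_carrier by algebra
    finally have "w (Suc n) \<ominus> W \<otimes> L \<otimes> (\<one> \<oplus> S \<otimes> (h \<otimes> t)) \<in> lin R [f, \<one> \<ominus> e]"
      by (rule lin2I) (use SR t h f in simp_all)
    then show ?thesis using v kR unfolding S by blast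
  qed
  then show ?thesis by blast
qed

text \<open>Modulo f the element w (Suc n) is L w n times a unit. With torsion freeness this yields
  (J (Suc n) : L) = J n for the ideals \<open>?J\<close>, while adding L to J (Suc n) gives (L, f, 1
  - e), of index q^N.\<close>

lemma index_distinguished:
  assumes f: "f \<in> carrier R" "f \<ominus> T [^] (N::nat) \<in> lin R [L, \<one> \<ominus> e]"
  shows "\<exists>n0. index R (lin R [L [^] Suc n0, w n0, f, \<one> \<ominus> e]) (carrier R) > 0 \<and>
    (\<forall>n. finite (cosets R (lin R [L [^] Suc n, w n, f, \<one> \<ominus> e]) (carrier R))) \<and>
    (\<forall>n\<ge>n0. index R (lin R [L [^] Suc n, w n, f, \<one> \<ominus> e]) (carrier R) =
       index R (lin R [L [^] Suc n0, w n0, f, \<one> \<ominus> e]) (carrier R) * q ^ (N * (n - n0)))"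
proof -
  obtain n0 where n0: "\<And>n. n \<ge> n0 \<Longrightarrow> \<exists>k\<in>carrier R. \<exists>v\<in>carrier R.
     w (Suc n) \<ominus> w n \<otimes> L \<otimes> (\<one> \<oplus> L [^] Suc 0 \<otimes> k) \<in> lin R [f, \<one> \<ominus> e]
     \<and> (\<one> \<oplus> L [^] Suc 0 \<otimes> k) \<otimes> v = \<one>" using w_Suc_mod_distinguished[OF f, of 0] by blast
  let ?J = "\<lambda>n. lin R [L [^] Suc n, w n, f, \<one> \<ominus> e]"
  have Js: "set [L [^] Suc n, w n, f, \<one> \<ominus> e] \<subseteq> carrier R" for n using f by auto
  have J3: "set [L [^] Suc n, f, \<one> \<ominus> e] \<subseteq> carrier R" for n using f by auto
  have fin: "finite (cosets R (?J n) (carrier R))" for n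
  proof (rule finite_cosets_mono)
    show "finite (cosets R (lin R [L [^] Suc n, f, \<one> \<ominus> e]) (carrier R))"
      using index_L_pow_distinguished[OF f] by blast
    show "lin R [L [^] Suc n, f, \<one> \<ominus> e] \<subseteq> ?J n" by (rule lin_mono_set[OF Js]) auto
    show "subgp (lin R [L [^] Suc n, f, \<one> \<ominus> e]) R" using idealD(1)[OF lin_ideal[OF J3]] .
    show "subgp (?J n) R" using idealD(1)[OF lin_ideal[OF Js]] .
  qed auto
  have rec: "index R (?J (Suc n)) (carrier R) = q ^ N * index R (?J n) (carrier R)" if n: "n \<ge> n0" for n
  proof -
    obtain k v where kv: "k \<in> carrier R" "v \<in> carrier R"
      "w (Suc n) \<ominus> w n \<otimes> L \<otimes> (\<one> \<oplus> L \<otimes> k) \<in> lin R [f, \<one> \<ominus> e]"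
      "(\<one> \<oplus> L \<otimes> k) \<otimes> v = \<one>" using n0[OF n] by auto
    obtain W W' K where d: "W = w n" "W' = w (Suc n)" "K = L [^] Suc n" by blast
    have c: "W \<in> carrier R" "W' \<in> carrier R" "K \<in> carrier R" by (simp_all add: d del: nat_pow_Suc)
    have LS: "L [^] Suc (Suc n) = K \<otimes> L" by (simp add: d)
    obtain i where i: "i = W' \<ominus> W \<otimes> L \<otimes> (\<one> \<oplus> L \<otimes> k)" by blast
    have iI: "i \<in> lin R [f, \<one> \<ominus> e]" using kv d i by simp
    have iR: "i \<in> carrier R" using i kv c by simp
    have W'_eq: "W' = W \<otimes> L \<otimes> (\<one> \<oplus> L \<otimes> k) \<oplus> i"
      unfolding i using kv(1) c L_carrier by algebra
    have cs: "set [L, f, \<one> \<ominus> e] \<subseteq> carrier R" and cs4: "set [L, L [^] Suc (Suc n), w (Suc n), f, \<one> \<ominus> e] \<subseteq> carrier R"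
      and cs2: "set [f, \<one> \<ominus> e] \<subseteq> carrier R" using f by auto
    note I = idealD[OF lin_ideal[OF cs2]]
    have 1: "lin R [L, L [^] Suc (Suc n), w (Suc n), f, \<one> \<ominus> e] = lin R [L, f, \<one> \<ominus> e]"
    proof (rule lin_eqI[OF cs4 cs])
      have "K \<otimes> L \<in> lin R [L, f, \<one> \<ominus> e]" using lin_mem[OF cs, of L K] c m_comm[of K L] by simp
      moreover have "W' \<in> lin R [L, f, \<one> \<ominus> e]"
      proof -
        have "W' = L \<otimes> (W \<otimes> (\<one> \<oplus> L \<otimes> k)) \<oplus> i"
          unfolding W'_eq using kv(1) c iR L_carrier by algebra
        moreover have "i \<in> lin R [L, f, \<one> \<ominus> e]" using lin_mono_set[OF cs, of "[f, \<one> \<ominus> e]"] iI by auto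
        ultimately show ?thesis
          using idealD(4)[OF lin_ideal[OF cs] lin_mem[OF cs, of L "W \<otimes> (\<one> \<oplus> L \<otimes> k)"], of i] c kv by simp
      qed
      ultimately show "\<And>a. a \<in> set [L, L [^] Suc (Suc n), w (Suc n), f, \<one> \<ominus> e] \<Longrightarrow> a \<in> lin R [L, f, \<one> \<ominus> e]"
        using lin_gen[OF cs] LS d by auto
      show "\<And>a. a \<in> set [L, f, \<one> \<ominus> e] \<Longrightarrow> a \<in> lin R [L, L [^] Suc (Suc n), w (Suc n), f, \<one> \<ominus> e]"
        using lin_gen[OF cs4] by auto
    qed
    have 2: "L \<otimes> x \<in> ?J (Suc n) \<longleftrightarrow> x \<in> ?J n" if x: "x \<in> carrier R" for x
    proof
      assume "L \<otimes> x \<in> ?J (Suc n)"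
      then obtain a b j where ab: "a \<in> carrier R" "b \<in> carrier R" "j \<in> lin R [f, \<one> \<ominus> e]"
        "L \<otimes> x = (K \<otimes> L) \<otimes> a \<oplus> (W' \<otimes> b \<oplus> j)"
        unfolding LS d(2)[symmetric] by (auto simp: lin.simps(2)[of R "K \<otimes> L"] lin.simps(2)[of R W'])
      have jR: "j \<in> carrier R" using ab I by auto
      \<comment> \<open>The subtracted element is the candidate for the part of x in (L^(n+1), w n):
        multiplied by L it reproduces the given representation of L x up to i b + j, and L is then
        cancelled modulo (f, 1 - e).\<close>
      have "L \<otimes> (x \<ominus> (K \<otimes> a \<oplus> W \<otimes> (\<one> \<oplus> L \<otimes> k) \<otimes> b)) = 
          L \<otimes> x \<ominus> ((K \<otimes> L) \<otimes> a \<oplus> (W' \<otimes> b \<oplus> j)) \<oplus> (i \<otimes> b \<oplus> j)"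
        unfolding W'_eq using x ab(1,2) kv(1) c iR jR L_carrier by algebra
      also have "\<dots> = i \<otimes> b \<oplus> j" unfolding ab(4)[symmetric]
        using x ab(1,2) iR jR by (simp add: a_minus_def r_neg)
      also have "\<dots> \<in> lin R [f, \<one> \<ominus> e]" using I(4)[OF I(8)[OF iI ab(2)] ab(3)] .
      finally have *: "x \<ominus> (K \<otimes> a \<oplus> W \<otimes> (\<one> \<oplus> L \<otimes> k) \<otimes> b) \<in> lin R [f, \<one> \<ominus> e]" (is "?z \<in> _")
        by (rule distinguished_torsion_free[OF f, rotated]) (use x ab(1,2) c kv in simp)
      have "x = K \<otimes> a \<oplus> (W \<otimes> ((\<one> \<oplus> L \<otimes> k) \<otimes> b) \<oplus> ?z)"
        using x ab(1,2) c kv(1) L_carrier by algebra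
      then show "x \<in> ?J n" unfolding d[symmetric]
        by (rule lin_ConsI[rotated 2]) (use * ab c kv in \<open>auto intro!: lin_ConsI[of "(\<one> \<oplus> L \<otimes> k) \<otimes> b" ?z]\<close>)
    next
      assume "x \<in> ?J n"
      then obtain a b j where ab: "a \<in> carrier R" "b \<in> carrier R" "j \<in> lin R [f, \<one> \<ominus> e]"
        "x = K \<otimes> a \<oplus> (W \<otimes> b \<oplus> j)"
        unfolding d[symmetric] by (auto simp: lin.simps(2)[of R "K"] lin.simps(2)[of R W])
      have jR: "j \<in> carrier R" using ab I by auto
      \<comment> \<open>\<open>o'\<close> names a product that equals 1. Read as 1 it may be
        inserted as a factor; read as the product it turns L w n into w (Suc n) times v, up to the
        error i.\<close>
      obtain o' where o': "o' = (\<one> \<oplus> L \<otimes> k) \<otimes> v" by blast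
      have "L \<otimes> x = (K \<otimes> L) \<otimes> a \<oplus> (W \<otimes> L \<otimes> o' \<otimes> b \<oplus> L \<otimes> j)"
        unfolding o' kv(4) ab(4) using ab(1,2) c jR L_carrier by algebra
      also have "\<dots> = (K \<otimes> L) \<otimes> a \<oplus> (W' \<otimes> (v \<otimes> b) \<oplus> (L \<otimes> j \<ominus> i \<otimes> (v \<otimes> b)))"
        unfolding o' W'_eq using ab(1,2) kv(1,2) c iR jR L_carrier by algebra
      finally have eq: "L \<otimes> x = (K \<otimes> L) \<otimes> a \<oplus> (W' \<otimes> (v \<otimes> b) \<oplus> (L \<otimes> j \<ominus> i \<otimes> (v \<otimes> b)))" .
      have "L \<otimes> j \<ominus> i \<otimes> (v \<otimes> b) \<in> lin R [f, \<one> \<ominus> e]"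
        using I(6)[OF I(7)[OF ab(3) L_carrier] I(8)[OF iI, of "v \<otimes> b"]] kv ab by simp
      then show "L \<otimes> x \<in> ?J (Suc n)" unfolding LS d(2)[symmetric] using eq ab kv
        by (intro lin_ConsI[OF _ lin_ConsI[OF _ _ refl] eq]) simp_all
    qed
    show ?thesis
      using index_lin_step(1)[OF Js L_carrier 2 lin_ideal[OF Js]] index_L_T_pow[of N] lin_L_distinguished[OF f] 1 by simp
  qed
  have "index R (?J n) (carrier R) = index R (?J n0) (carrier R) * q ^ (N * (n - n0))" if "n \<ge> n0" for n
    using that
  proof (induction n rule: dec_induct)
    case (step n)
    have "Suc n - n0 = Suc (n - n0)" using step by simp
    then show ?case using step.IH rec[OF step.hyps(1)] by (simp only: power_add mult_Suc_right mult.assoc mult.commute[of "q ^ N"])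
  qed simp
  moreover have "index R (?J n0) (carrier R) > 0" using index_pos[OF fin] zero_closed by blast
  ultimately show ?thesis using fin by blast
qed

end

section \<open>Modules over Iwasawa algebras\<close>

definition msum :: "('r, 'm, 'x) module_scheme \<Rightarrow> 'm set \<Rightarrow> 'm set \<Rightarrow> 'm set" where
  "msum M A B = {a \<oplus>\<^bsub>M\<^esub> b | a b. a \<in> A \<and> b \<in> B}"

definition mscale :: "('r, 'm, 'x) module_scheme \<Rightarrow> 'r \<Rightarrow> 'm set \<Rightarrow> 'm set" where
  "mscale M c A = (\<lambda>a. c \<odot>\<^bsub>M\<^esub> a) ` A"

definition mcyc :: "('r, 'm, 'x) module_scheme \<Rightarrow> ('r, 'z) ring_scheme \<Rightarrow> 'm \<Rightarrow> 'm set" where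
  "mcyc M R x = (\<lambda>r. r \<odot>\<^bsub>M\<^esub> x) ` carrier R"

context module begin

lemma submoduleD:
  assumes "submodule A R M"
  shows "subgp A M" "A \<subseteq> carrier M" "\<zero>\<^bsub>M\<^esub> \<in> A" "\<And>x y. x \<in> A \<Longrightarrow> y \<in> A \<Longrightarrow> x \<oplus>\<^bsub>M\<^esub> y \<in> A"
    "\<And>x. x \<in> A \<Longrightarrow> \<ominus>\<^bsub>M\<^esub> x \<in> A" "\<And>x y. x \<in> A \<Longrightarrow> y \<in> A \<Longrightarrow> x \<ominus>\<^bsub>M\<^esub> y \<in> A"
    "\<And>x a. x \<in> A \<Longrightarrow> a \<in> carrier R \<Longrightarrow> a \<odot>\<^bsub>M\<^esub> x \<in> A"
proof -
  show 1: "subgp A M" using assms by (rule submodule.axioms)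
  show "A \<subseteq> carrier M" "\<zero>\<^bsub>M\<^esub> \<in> A" "\<And>x y. x \<in> A \<Longrightarrow> y \<in> A \<Longrightarrow> x \<oplus>\<^bsub>M\<^esub> y \<in> A"
    "\<And>x. x \<in> A \<Longrightarrow> \<ominus>\<^bsub>M\<^esub> x \<in> A" "\<And>x y. x \<in> A \<Longrightarrow> y \<in> A \<Longrightarrow> x \<ominus>\<^bsub>M\<^esub> y \<in> A"
    using M.subgpD[OF 1] by auto
  show "\<And>x a. x \<in> A \<Longrightarrow> a \<in> carrier R \<Longrightarrow> a \<odot>\<^bsub>M\<^esub> x \<in> A"
    by (rule submodule.smult_closed[OF assms])
qed

lemma smult_minus_r: "a \<in> carrier R \<Longrightarrow> x \<in> carrier M \<Longrightarrow> y \<in> carrier M \<Longrightarrow>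
    a \<odot>\<^bsub>M\<^esub> (x \<ominus>\<^bsub>M\<^esub> y) = a \<odot>\<^bsub>M\<^esub> x \<ominus>\<^bsub>M\<^esub> a \<odot>\<^bsub>M\<^esub> y"
  by (simp add: a_minus_def[of M] smult_r_distr smult_r_minus)

lemma smult_minus_l: "a \<in> carrier R \<Longrightarrow> b \<in> carrier R \<Longrightarrow> x \<in> carrier M \<Longrightarrow>
    (a \<ominus> b) \<odot>\<^bsub>M\<^esub> x = a \<odot>\<^bsub>M\<^esub> x \<ominus>\<^bsub>M\<^esub> b \<odot>\<^bsub>M\<^esub> x"
  by (simp add: a_minus_def smult_l_distr smult_l_minus)

lemma submodule_carrier: "submodule (carrier M) R M"
  by (rule submoduleI) auto

lemma submodule_mscale:
  assumes "submodule A R M" "c \<in> carrier R" shows "submodule (mscale M c A) R M"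
proof -
  note A = submoduleD[OF assms(1)]
  have Ac: "\<And>x. x \<in> A \<Longrightarrow> x \<in> carrier M" using A by auto
  show ?thesis
  proof (rule submoduleI)
    show "mscale M c A \<subseteq> carrier M" using Ac assms by (auto simp: mscale_def)
    show "\<zero>\<^bsub>M\<^esub> \<in> mscale M c A" unfolding mscale_def
      by (rule image_eqI[of _ _ "\<zero>\<^bsub>M\<^esub>"]) (use A assms in auto)
    fix a assume "a \<in> mscale M c A"
    then obtain x where x: "x \<in> A" "a = c \<odot>\<^bsub>M\<^esub> x" by (auto simp: mscale_def)
    show "\<ominus>\<^bsub>M\<^esub> a \<in> mscale M c A" unfolding mscale_def
      by (rule image_eqI[of _ _ "\<ominus>\<^bsub>M\<^esub> x"]) (use x A Ac assms in \<open>auto simp: smult_r_minus\<close>)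
    show "r \<odot>\<^bsub>M\<^esub> a \<in> mscale M c A" if "r \<in> carrier R" for r unfolding mscale_def
      by (rule image_eqI[of _ _ "r \<odot>\<^bsub>M\<^esub> x"])
        (use x A Ac assms that in \<open>auto simp: smult_assoc1[symmetric] R.m_comm\<close>)
    fix b assume "b \<in> mscale M c A"
    then obtain y where y: "y \<in> A" "b = c \<odot>\<^bsub>M\<^esub> y" by (auto simp: mscale_def)
    show "a \<oplus>\<^bsub>M\<^esub> b \<in> mscale M c A" unfolding mscale_def
      by (rule image_eqI[of _ _ "x \<oplus>\<^bsub>M\<^esub> y"]) (use x y A Ac assms in \<open>auto simp: smult_r_distr\<close>)
  qed
qed

lemma submodule_mcyc:
  assumes "x \<in> carrier M" shows "submodule (mcyc M R x) R M"
proof (rule submoduleI)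
  show "mcyc M R x \<subseteq> carrier M" using assms by (auto simp: mcyc_def)
  show "\<zero>\<^bsub>M\<^esub> \<in> mcyc M R x" unfolding mcyc_def
    by (rule image_eqI[of _ _ "\<zero>"]) (use assms in auto)
  fix a assume "a \<in> mcyc M R x"
  then obtain r where r: "r \<in> carrier R" "a = r \<odot>\<^bsub>M\<^esub> x" by (auto simp: mcyc_def)
  show "\<ominus>\<^bsub>M\<^esub> a \<in> mcyc M R x" unfolding mcyc_def
    by (rule image_eqI[of _ _ "\<ominus> r"]) (use r assms in \<open>auto simp: smult_l_minus\<close>)
  show "s \<odot>\<^bsub>M\<^esub> a \<in> mcyc M R x" if "s \<in> carrier R" for s unfolding mcyc_def
    by (rule image_eqI[of _ _ "s \<otimes> r"]) (use r assms that in \<open>auto simp: smult_assoc1\<close>)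
  fix b assume "b \<in> mcyc M R x"
  then obtain s where s: "s \<in> carrier R" "b = s \<odot>\<^bsub>M\<^esub> x" by (auto simp: mcyc_def)
  show "a \<oplus>\<^bsub>M\<^esub> b \<in> mcyc M R x" unfolding mcyc_def
    by (rule image_eqI[of _ _ "r \<oplus> s"]) (use r s assms in \<open>auto simp: smult_l_distr\<close>)
qed

lemma submodule_msum:
  assumes "submodule A R M" "submodule B R M" shows "submodule (msum M A B) R M"
proof -
  note A = submoduleD[OF assms(1)] and B = submoduleD[OF assms(2)]
  have c: "\<And>x. x \<in> A \<Longrightarrow> x \<in> carrier M" "\<And>x. x \<in> B \<Longrightarrow> x \<in> carrier M" using A B by auto
  have I: "z \<in> msum M A B" if "z = a \<oplus>\<^bsub>M\<^esub> b" "a \<in> A" "b \<in> B" for z a b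
    using that by (auto simp: msum_def)
  show ?thesis
  proof (rule submoduleI)
    show "msum M A B \<subseteq> carrier M" using c by (auto simp: msum_def)
    show "\<zero>\<^bsub>M\<^esub> \<in> msum M A B" by (rule I[of _ "\<zero>\<^bsub>M\<^esub>" "\<zero>\<^bsub>M\<^esub>"]) (use A B in auto)
    fix u assume "u \<in> msum M A B"
    then obtain a b where u: "a \<in> A" "b \<in> B" "u = a \<oplus>\<^bsub>M\<^esub> b" by (auto simp: msum_def)
    show "\<ominus>\<^bsub>M\<^esub> u \<in> msum M A B" 
      by (rule I[of _ "\<ominus>\<^bsub>M\<^esub> a" "\<ominus>\<^bsub>M\<^esub> b"]) (use u A B c in \<open>simp_all add: M.minus_add\<close>)
    show "r \<odot>\<^bsub>M\<^esub> u \<in> msum M A B" if "r \<in> carrier R" for r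
      by (rule I[of _ "r \<odot>\<^bsub>M\<^esub> a" "r \<odot>\<^bsub>M\<^esub> b"]) (use u A B c that in \<open>simp_all add: smult_r_distr\<close>)
    fix v assume "v \<in> msum M A B"
    then obtain a' b' where v: "a' \<in> A" "b' \<in> B" "v = a' \<oplus>\<^bsub>M\<^esub> b'" by (auto simp: msum_def)
    show "u \<oplus>\<^bsub>M\<^esub> v \<in> msum M A B"
      by (rule I[of _ "a \<oplus>\<^bsub>M\<^esub> a'" "b \<oplus>\<^bsub>M\<^esub> b'"]) (use u v A B c in \<open>simp_all add: M.a_ac\<close>)
  qed
qed

lemma msum_upper:
  assumes "submodule A R M" "submodule B R M" shows "A \<subseteq> msum M A B" "B \<subseteq> msum M A B"
proof -
  note A = submoduleD[OF assms(1)] and B = submoduleD[OF assms(2)]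
  show "A \<subseteq> msum M A B"
  proof
    fix a assume "a \<in> A"
    moreover then have "a = a \<oplus>\<^bsub>M\<^esub> \<zero>\<^bsub>M\<^esub>" using A by auto
    ultimately show "a \<in> msum M A B" unfolding msum_def using B(3) by blast
  qed
  show "B \<subseteq> msum M A B"
  proof
    fix a assume "a \<in> B"
    moreover then have "a = \<zero>\<^bsub>M\<^esub> \<oplus>\<^bsub>M\<^esub> a" using B by auto
    ultimately show "a \<in> msum M A B" unfolding msum_def using A(3) by blast
  qed
qed

lemma msum_least:
  assumes "submodule C R M" "A \<subseteq> C" "B \<subseteq> C" shows "msum M A B \<subseteq> C"
  using assms submoduleD(4)[OF assms(1)] by (auto simp: msum_def)

lemma mscale_subset: "submodule A R M \<Longrightarrow> c \<in> carrier R \<Longrightarrow> mscale M c A \<subseteq> A"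
  using submoduleD(7) by (auto simp: mscale_def)

end

section \<open>Finite subquotients of modules\<close>

locale iwasawa_module = R?: iwasawa R p q L T e + module R M
  for R :: "('a, 'b) ring_scheme" (structure) and p q L T e and M :: "('a, 'm) module"
begin

text \<open>In the finite quotient B / A two elements c^a v and c^(a+k) v with k > 0 coincide. As 1
  - c^k is a unit by \<open>jacobson\<close>, already c^a v lies in A. Since a is at most the index,
  the index itself is an exponent that serves all v.\<close>

lemma nilpotent_on_finite:
  assumes A: "submodule A R M" and B: "submodule B R M" and c: "c \<in> lin R [L, T]"
    and fin: "finite (cosets M A B)"
  shows "\<exists>s::nat. \<forall>v\<in>B. (c [^] s) \<odot>\<^bsub>M\<^esub> v \<in> A"
proof (intro exI ballI)
  note AD = submoduleD[OF A] and BD = submoduleD[OF B]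
  have cs: "set [L, T] \<subseteq> carrier R" by simp
  note m = idealD[OF lin_ideal[OF cs]]
  have cR: "c \<in> carrier R" using c m by auto
  let ?s = "card (cosets M A B)"
  fix v assume v: "v \<in> B"
  then have vM: "v \<in> carrier M" using BD by auto
  let ?f = "\<lambda>j::nat. A +>\<^bsub>M\<^esub> ((c [^] j) \<odot>\<^bsub>M\<^esub> v)"
  have "?f ` {..?s} \<subseteq> cosets M A B" using v BD cR by (auto simp: cosets_def)
  then have "card (?f ` {..?s}) \<le> ?s" using fin card_mono by blast
  then have "\<not> inj_on ?f {..?s}" using card_image[of ?f "{..?s}"] by auto
  then obtain i j where ij: "i \<le> ?s" "j \<le> ?s" "i \<noteq> j" "?f i = ?f j" by (auto simp: inj_on_def)
  define a where "a = min i j"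
  define k where "k = max i j - a"
  have ak: "?f a = ?f (a + k)" "a \<le> ?s" "k > 0" using ij by (auto simp: a_def k_def min_def max_def)
  obtain x y where d: "x = c [^] a" "y = c [^] k" by blast
  have xy: "x \<in> carrier R" "y \<in> carrier R" using d cR by auto
  obtain k' where k': "k = Suc k'" using ak(3) by (cases k) auto
  have yc: "y \<in> lin R [L, T]" unfolding d k' using m(7)[OF c, of "c [^] k'"] cR by simp
  obtain u where u: "u \<in> carrier R" "(\<one> \<oplus> \<ominus> y) \<otimes> u = \<one>" using jacobson[OF m(5)[OF yc]] by blast
  have "x \<odot>\<^bsub>M\<^esub> v \<ominus>\<^bsub>M\<^esub> (x \<otimes> y) \<odot>\<^bsub>M\<^esub> v \<in> A"
    using ak(1) M.coset_eq_iff[OF AD(1)] xy vM d cR by (simp add: nat_pow_mult)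
  then have "(x \<ominus> x \<otimes> y) \<odot>\<^bsub>M\<^esub> v \<in> A" using smult_minus_l[of x "x \<otimes> y" v] xy vM by simp
  then have "u \<odot>\<^bsub>M\<^esub> ((x \<ominus> x \<otimes> y) \<odot>\<^bsub>M\<^esub> v) \<in> A" using AD(7) u by blast
  then have "(u \<otimes> (x \<ominus> x \<otimes> y)) \<odot>\<^bsub>M\<^esub> v \<in> A" using smult_assoc1 u xy vM by simp
  moreover have "u \<otimes> (x \<ominus> x \<otimes> y) = x \<otimes> ((\<one> \<oplus> \<ominus> y) \<otimes> u)"
    using u(1) xy by algebra
  ultimately have "x \<odot>\<^bsub>M\<^esub> v \<in> A" using u xy by simp
  then have "(c [^] (?s - a)) \<odot>\<^bsub>M\<^esub> (x \<odot>\<^bsub>M\<^esub> v) \<in> A" using AD(7) cR by blast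
  then have "((c [^] (?s - a)) \<otimes> x) \<odot>\<^bsub>M\<^esub> v \<in> A" using smult_assoc1 cR xy vM by simp
  then show "(c [^] ?s) \<odot>\<^bsub>M\<^esub> v \<in> A" using ak(2) d cR by (simp add: nat_pow_mult)
qed

text \<open>By nilpotence some power of c sends x into A; the last power that does not is the
  required r.\<close>

lemma socle_step:
  assumes A: "submodule A R M" and B: "submodule B R M" and c: "c \<in> lin R [L, T]"
    and fin: "finite (cosets M A B)" and x: "x \<in> B" "x \<notin> A"
  shows "\<exists>r\<in>carrier R. r \<odot>\<^bsub>M\<^esub> x \<notin> A \<and> c \<odot>\<^bsub>M\<^esub> (r \<odot>\<^bsub>M\<^esub> x) \<in> A"
proof -
  note AD = submoduleD[OF A] and BD = submoduleD[OF B]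
  have cs: "set [L, T] \<subseteq> carrier R" by simp
  have cR: "c \<in> carrier R" using c lin_carrier[OF cs] by auto
  have xM: "x \<in> carrier M" using x BD by auto
  obtain s :: nat where "(c [^] s) \<odot>\<^bsub>M\<^esub> x \<in> A" using nilpotent_on_finite[OF A B c fin] x by blast
  then obtain s :: nat where s: "(c [^] s) \<odot>\<^bsub>M\<^esub> x \<in> A" "\<And>j. j < s \<Longrightarrow> (c [^] j) \<odot>\<^bsub>M\<^esub> x \<notin> A"
    using exists_least_iff[of "\<lambda>s::nat. (c [^] s) \<odot>\<^bsub>M\<^esub> x \<in> A"] by auto
  have "s \<noteq> 0" using s(1) x xM by (cases s) auto
  then obtain s' where s': "s = Suc s'" by (cases s) auto
  show ?thesis
  proof (intro bexI conjI)
    show "(c [^] s') \<odot>\<^bsub>M\<^esub> x \<notin> A" using s(2) s' by simp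
    have "c \<odot>\<^bsub>M\<^esub> ((c [^] s') \<odot>\<^bsub>M\<^esub> x) = (c [^] s) \<odot>\<^bsub>M\<^esub> x"
      using cR xM by (simp add: s' smult_assoc1[symmetric] R.m_comm)
    then show "c \<odot>\<^bsub>M\<^esub> ((c [^] s') \<odot>\<^bsub>M\<^esub> x) \<in> A" using s(1) by simp
  qed (use cR in simp)
qed

text \<open>Two applications of \<open>socle_step\<close>, for L and then for T, give x in B outside
  A with L x and T x in A. As e acts as the identity on B, the annihilator of x modulo A is the
  maximal ideal (L, T, 1 - e). So (A + R x) / A is a copy of the residue field, and the induction
  continues with A + R x.\<close>

lemma index_submodule_power:
  assumes "submodule A R M" "submodule B R M" "A \<subseteq> B" "finite (cosets M A B)"
    and "\<And>b. b \<in> B \<Longrightarrow> e \<odot>\<^bsub>M\<^esub> b = b"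
  shows "\<exists>k. index M A B = q ^ k"
  using assms(1,3,4)
proof (induction "index M A B" arbitrary: A rule: less_induct)
  case (less A)
  note A = less.prems(1) and AB = less.prems(2) and fin = less.prems(3)
  note B = assms(2)
  note AD = submoduleD[OF A] and BD = submoduleD[OF B]
  have cs: "set [L, T] \<subseteq> carrier R" and cs3: "set [L, T, \<one> \<ominus> e] \<subseteq> carrier R" by simp_all
  show ?case
  proof (cases "A = B")
    case True
    have "A +>\<^bsub>M\<^esub> x = A +>\<^bsub>M\<^esub> \<zero>\<^bsub>M\<^esub>" if "x \<in> B" for x
      using M.coset_eq_iff[OF AD(1), of x "\<zero>\<^bsub>M\<^esub>"] AD(6)[of x "\<zero>\<^bsub>M\<^esub>"] that True AD(2,3) by auto
    then have "cosets M A B = {A +>\<^bsub>M\<^esub> \<zero>\<^bsub>M\<^esub>}" unfolding cosets_def using BD(3) by blast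
    then have "index M A B = q ^ 0" by (simp add: index_def)
    then show ?thesis by blast
  next
    case False
    then obtain x0 where x0: "x0 \<in> B" "x0 \<notin> A" using AB by blast
    have x0M: "x0 \<in> carrier M" using x0 BD by auto
    obtain r where r: "r \<in> carrier R" "r \<odot>\<^bsub>M\<^esub> x0 \<notin> A" "L \<odot>\<^bsub>M\<^esub> (r \<odot>\<^bsub>M\<^esub> x0) \<in> A"
      using socle_step[OF A B lin_gen[OF cs, of L] fin x0] by auto
    let ?x1 = "r \<odot>\<^bsub>M\<^esub> x0"
    obtain s where s: "s \<in> carrier R" "s \<odot>\<^bsub>M\<^esub> ?x1 \<notin> A" "T \<odot>\<^bsub>M\<^esub> (s \<odot>\<^bsub>M\<^esub> ?x1) \<in> A"
      using socle_step[OF A B lin_gen[OF cs, of T] fin BD(7)[OF x0(1) r(1)] r(2)] by auto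
    define x where "x = s \<odot>\<^bsub>M\<^esub> ?x1"
    have xB: "x \<in> B" using x0 r s BD(7) by (simp add: x_def)
    then have xM: "x \<in> carrier M" using BD by auto
    have xA: "x \<notin> A" "T \<odot>\<^bsub>M\<^esub> x \<in> A" using s by (simp_all add: x_def)
    have "L \<odot>\<^bsub>M\<^esub> x = s \<odot>\<^bsub>M\<^esub> (L \<odot>\<^bsub>M\<^esub> ?x1)"
      using r s x0M by (simp add: x_def smult_assoc1[symmetric] R.m_comm R.m_lcomm R.m_assoc)
    then have LA: "L \<odot>\<^bsub>M\<^esub> x \<in> A" using AD(7)[OF r(3) s(1)] by simp
    define K where "K = {t \<in> carrier R. t \<odot>\<^bsub>M\<^esub> x \<in> A}"
    have K_ideal: "ideal K R"
    proof (rule idealI)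
      show "ring R" by (rule R.ring_axioms)
      show "subgp K R" using AD xM
        by (intro R.subgpI) (auto simp: K_def smult_l_distr smult_l_minus)
      show "\<And>a y. a \<in> K \<Longrightarrow> y \<in> carrier R \<Longrightarrow> y \<otimes> a \<in> K" using AD xM by (auto simp: K_def smult_assoc1)
      then show "\<And>a y. a \<in> K \<Longrightarrow> y \<in> carrier R \<Longrightarrow> a \<otimes> y \<in> K" using R.m_comm by (auto simp: K_def)
    qed
    note KD = idealD[OF K_ideal]
    have ex: "(\<one> \<ominus> e) \<odot>\<^bsub>M\<^esub> x = \<zero>\<^bsub>M\<^esub>"
      using smult_minus_l[of \<one> e x] assms(5)[OF xB] xM by (simp add: M.r_neg a_minus_def[of M])
    have "lin R [L, T, \<one> \<ominus> e] \<subseteq> K"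
      by (rule lin_least[OF K_ideal]) (use LA xA ex AD in \<open>auto simp: K_def\<close>)
    moreover have one: "\<one> \<notin> K" using xA xM by (simp add: K_def)
    \<comment> \<open>An element of K outside the maximal ideal is invertible modulo it, which would
      put 1 into K.\<close>
    moreover have "t \<in> lin R [L, T, \<one> \<ominus> e]" if "t \<in> K" for t
    proof (rule ccontr)
      assume "t \<notin> lin R [L, T, \<one> \<ominus> e]"
      moreover have tR: "t \<in> carrier R" using that by (simp add: K_def)
      ultimately obtain y where y: "y \<in> carrier R" "t \<otimes> y \<ominus> \<one> \<in> lin R [L, T, \<one> \<ominus> e]"
        using residue_field by blast
      then have "t \<otimes> y \<ominus> \<one> \<in> K" using \<open>lin R [L, T, \<one> \<ominus> e] \<subseteq> K\<close> by blast
      then have "t \<otimes> y \<ominus> (t \<otimes> y \<ominus> \<one>) \<in> K" using KD(6)[OF KD(8)[OF that y(1)]] by blast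
      then show False using one y tR by (simp add: R.minus_minus_cancel)
    qed
    ultimately have K: "K = lin R [L, T, \<one> \<ominus> e]" by blast
    have q: "index R K (carrier R) = q" "finite (cosets R K (carrier R))" using residue_card residue_finite K by simp_all
    have "K +> \<zero> \<noteq> K +> \<one>" using R.coset_eq_iff[OF KD(1), of \<one> \<zero>] one by (auto simp: a_minus_def)
    moreover have "{K +> \<zero>, K +> \<one>} \<subseteq> cosets R K (carrier R)" by (auto simp: cosets_def)
    ultimately have q1: "q > 1" using q card_mono[of "cosets R K (carrier R)" "{K +> \<zero>, K +> \<one>}"]
      by (simp add: index_def)
    define A' where "A' = msum M (mcyc M R x) A"
    have A': "submodule A' R M" unfolding A'_def by (rule submodule_msum[OF submodule_mcyc[OF xM] A])
    note A'D = submoduleD[OF A']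
    have AA': "A \<subseteq> A'" unfolding A'_def by (rule msum_upper(2)[OF submodule_mcyc[OF xM] A])
    have A'B: "A' \<subseteq> B" unfolding A'_def
      by (rule msum_least[OF B _ AB]) (use BD(7)[OF xB] in \<open>auto simp: mcyc_def\<close>)
    have "cosets M A A' = (\<lambda>t. A +>\<^bsub>M\<^esub> (t \<odot>\<^bsub>M\<^esub> x)) ` carrier R"
    proof (intro equalityI subsetI)
      fix u assume "u \<in> cosets M A A'"
      then obtain t a where ta: "t \<in> carrier R" "a \<in> A" "u = A +>\<^bsub>M\<^esub> (t \<odot>\<^bsub>M\<^esub> x \<oplus>\<^bsub>M\<^esub> a)"
        by (auto simp: cosets_def A'_def msum_def mcyc_def)
      then have "a \<in> carrier M" using AD by auto
      then have "u = A +>\<^bsub>M\<^esub> (t \<odot>\<^bsub>M\<^esub> x)"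
        using M.coset_eq_iff[OF AD(1), of "t \<odot>\<^bsub>M\<^esub> x \<oplus>\<^bsub>M\<^esub> a" "t \<odot>\<^bsub>M\<^esub> x"] ta xM
        by (simp add: M.minus_minus_cancel M.a_comm[of _ a])
      then show "u \<in> (\<lambda>t. A +>\<^bsub>M\<^esub> (t \<odot>\<^bsub>M\<^esub> x)) ` carrier R" using ta by blast
    next
      fix u assume "u \<in> (\<lambda>t. A +>\<^bsub>M\<^esub> (t \<odot>\<^bsub>M\<^esub> x)) ` carrier R"
      then show "u \<in> cosets M A A'"
        using msum_upper(1)[OF submodule_mcyc[OF xM] A] by (auto simp: cosets_def A'_def mcyc_def)
    qed
    moreover have "A +>\<^bsub>M\<^esub> (t \<odot>\<^bsub>M\<^esub> x) = A +>\<^bsub>M\<^esub> (t' \<odot>\<^bsub>M\<^esub> x) \<longleftrightarrow> K +> t = K +> t'"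
      if "t \<in> carrier R" "t' \<in> carrier R" for t t'
      using that xM by (simp add: M.coset_eq_iff[OF AD(1)] R.coset_eq_iff[OF KD(1)] smult_minus_l[symmetric]) (simp add: K_def)
    ultimately have i1: "index M A A' = q"
      using card_images_eq[of "carrier R" "\<lambda>t. A +>\<^bsub>M\<^esub> (t \<odot>\<^bsub>M\<^esub> x)" "\<lambda>t. K +> t"] q by (simp add: index_def cosets_def)
    have tow: "index M A B = index M A' B * q" "finite (cosets M A' B)"
      using M.index_tower[OF AD(1) A'D(1) BD(1) AA' A'B] i1 fin by simp_all
    have "index M A' B > 0" using M.index_pos[OF tow(2)] BD(3) by blast
    then have "index M A' B < index M A B" using tow q1 by simp
    then obtain k where "index M A' B = q ^ k" using less.hyps A' A'B tow(2) by blast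
    then have "index M A B = q ^ Suc k" using tow by simp
    then show ?thesis by blast
  qed
qed

end

context iwasawa begin

text \<open>Condition on the ideal \<open>I\<close> generated by \<open>as\<close> under which a relation
  \<open>L ^ (n + 1) x + w n y \<in> I\<close> forces \<open>L ^ (n + 2) x + w (n + 1) y \<in> \<nabla>\<^bsub>n + 1\<^esub> V + I\<close> for
  \<open>V = (L ^ s, T ^ s)\<close>; note that the latter element is \<open>(w (n + 1) - L w n) y\<close> modulo \<open>I\<close>.\<close>

definition asymptotically_stable :: "'a list \<Rightarrow> bool" where
  "asymptotically_stable as \<longleftrightarrow> (\<forall>s::nat. \<exists>n0. \<forall>n\<ge>n0. \<forall>y\<in>carrier R. w n \<otimes> y \<in> lin R (L [^] Suc n # as) \<longrightarrow>
     (\<exists>a\<in>lin R [L [^] s, T [^] s]. \<exists>b\<in>lin R [L [^] s, T [^] s].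
       (w (Suc n) \<ominus> L \<otimes> w n) \<otimes> y \<ominus> (L [^] Suc (Suc n) \<otimes> a \<oplus> w (Suc n) \<otimes> b) \<in> lin R as))"

text \<open>If w n y lies in (L^(n+1), 1 - e), then e y = L^(n+1) z by \<open>w_colon_L_pow\<close>.
  The coefficients a = - w n z and b = L^(n+1) z make the difference a multiple of 1 - e, and both
  lie in (L^s, T^s) once n \<ge> 2 s.\<close>

lemma asymptotically_stable_free: "asymptotically_stable [\<one> \<ominus> e]"
  unfolding asymptotically_stable_def
proof (intro allI exI ballI impI)
  fix s n :: nat and y assume n: "n \<ge> 2 * s" and y: "y \<in> carrier R" and wy: "w n \<otimes> y \<in> lin R (L [^] Suc n # [\<one> \<ominus> e])"
  have V: "ideal (lin R [L [^] s, T [^] s]) R" by (rule lin_ideal) simp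
  have Vs: "set [L [^] s, T [^] s] \<subseteq> carrier R" by simp
  obtain W W' K where d: "W = w n" "W' = w (Suc n)" "K = L [^] Suc n" by blast
  have c: "W \<in> carrier R" "W' \<in> carrier R" "K \<in> carrier R" by (simp_all add: d del: nat_pow_Suc)
  obtain u v where uv: "u \<in> carrier R" "v \<in> carrier R" "W \<otimes> y = K \<otimes> u \<oplus> (\<one> \<ominus> e) \<otimes> v"
    using wy lin2[of K "\<one> \<ominus> e"] c d by auto
  have "W \<otimes> (e \<otimes> y) = e \<otimes> (W \<otimes> y)" using c y by (simp add: m_ac)
  also have "\<dots> = K \<otimes> (e \<otimes> u) \<oplus> (e \<ominus> e \<otimes> e) \<otimes> v"
    unfolding uv(3) using uv(1,2) c e_carrier by algebra
  also have "\<dots> = K \<otimes> (e \<otimes> u)" using uv c by (simp add: e_idem a_minus_def r_neg)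
  finally have "W \<otimes> (e \<otimes> y) \<in> lin R [K]" by (rule lin1I) (use c uv in simp_all)
  then have "e \<otimes> y \<in> lin R [K]" unfolding d by (rule w_colon_L_pow[rotated]) (use y in simp)
  then obtain z where z: "z \<in> carrier R" "e \<otimes> y = K \<otimes> z" using lin1 c by auto
  have Ks: "K = L [^] s \<otimes> L [^] (Suc n - s)" using n by (simp add: d nat_pow_mult del: nat_pow_Suc)
  have Kz: "K \<otimes> z \<in> lin R [L [^] s, T [^] s]"
  proof -
    have "K \<otimes> z = L [^] s \<otimes> (L [^] (Suc n - s) \<otimes> z)" unfolding Ks using z by (simp add: m_assoc del: nat_pow_Suc)
    then show ?thesis using lin_mem[OF Vs, of "L [^] s" "L [^] (Suc n - s) \<otimes> z"] z by simp
  qed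
  have "W \<in> lin R [L [^] s, T [^] s]" unfolding d by (rule w_in_lin_pow) (use n in simp)
  then have Wz: "\<ominus> (W \<otimes> z) \<in> lin R [L [^] s, T [^] s]" using idealD(5)[OF V idealD(8)[OF V _ z(1)]] by blast
  have LK: "L [^] Suc (Suc n) = K \<otimes> L" by (simp add: d)
  have "(W' \<ominus> L \<otimes> W) \<otimes> y \<ominus> (K \<otimes> L \<otimes> \<ominus> (W \<otimes> z) \<oplus> W' \<otimes> (K \<otimes> z)) =
    (\<one> \<ominus> e) \<otimes> ((W' \<ominus> L \<otimes> W) \<otimes> y) \<oplus> (W' \<ominus> L \<otimes> W) \<otimes> (e \<otimes> y \<ominus> K \<otimes> z)"
    using c y z(1) L_carrier e_carrier by algebra
  also have "\<dots> = (\<one> \<ominus> e) \<otimes> ((W' \<ominus> L \<otimes> W) \<otimes> y)"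
    unfolding z(2) using c y z(1) by (simp add: a_minus_def[of R "K \<otimes> z"] r_neg)
  finally have "(W' \<ominus> L \<otimes> W) \<otimes> y \<ominus> (K \<otimes> L \<otimes> \<ominus> (W \<otimes> z) \<oplus> W' \<otimes> (K \<otimes> z)) \<in> lin R [\<one> \<ominus> e]"
    by (rule lin1I) (use c y in simp_all)
  then show "\<exists>a\<in>lin R [L [^] s, T [^] s]. \<exists>b\<in>lin R [L [^] s, T [^] s].
      (w (Suc n) \<ominus> L \<otimes> w n) \<otimes> y \<ominus> (L [^] Suc (Suc n) \<otimes> a \<oplus> w (Suc n) \<otimes> b) \<in> lin R [\<one> \<ominus> e]"
    using Wz Kz unfolding LK d(1,2)[symmetric] by blast
qed

text \<open>For n \<ge> m the generator L^(n+1) already lies in the ideal, hence so does w n y. By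
  \<open>w_Suc\<close> the factor w (Suc n) - L w n is a multiple of w n, so a = b = 0
  works.\<close>

lemma asymptotically_stable_torsion: "asymptotically_stable [L [^] (m::nat), \<one> \<ominus> e]"
  unfolding asymptotically_stable_def
proof (intro allI exI ballI impI)
  fix s n :: nat and y assume n: "n \<ge> m" and y: "y \<in> carrier R" and wy: "w n \<otimes> y \<in> lin R (L [^] Suc n # [L [^] m, \<one> \<ominus> e])"
  have Vs: "set [L [^] s, T [^] s] \<subseteq> carrier R" and ms: "set [L [^] m, \<one> \<ominus> e] \<subseteq> carrier R" by simp_all
  note V = idealD[OF lin_ideal[OF Vs]] and I = idealD[OF lin_ideal[OF ms]]
  obtain W where d: "W = w n" by blast
  have c: "W \<in> carrier R" by (simp add: d)
  have "lin R (L [^] Suc n # [L [^] m, \<one> \<ominus> e]) \<subseteq> lin R [L [^] m, \<one> \<ominus> e]"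
  proof (rule lin_subset[OF ms])
    have "L [^] Suc n = L [^] m \<otimes> L [^] (Suc n - m)" using n by (simp add: nat_pow_mult del: nat_pow_Suc)
    then have "L [^] Suc n \<in> lin R [L [^] m, \<one> \<ominus> e]" using lin_mem[OF ms, of "L [^] m" "L [^] (Suc n - m)"] by simp
    then show "set (L [^] Suc n # [L [^] m, \<one> \<ominus> e]) \<subseteq> lin R [L [^] m, \<one> \<ominus> e]" using lin_gen[OF ms] by simp
  qed
  then have wy: "W \<otimes> y \<in> lin R [L [^] m, \<one> \<ominus> e]" using wy d by blast
  obtain t where t: "t \<in> carrier R" "w (Suc n) = W \<otimes> (L \<oplus> W \<otimes> t)" using w_Suc d by blast
  have "(w (Suc n) \<ominus> L \<otimes> W) \<otimes> y = (W \<otimes> t) \<otimes> (W \<otimes> y)"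
    unfolding t(2) using c t(1) y L_carrier by algebra
  also have "\<dots> \<in> lin R [L [^] m, \<one> \<ominus> e]" by (rule I(7)[OF wy]) (use c t in simp)
  finally have "(w (Suc n) \<ominus> L \<otimes> W) \<otimes> y \<ominus> (L [^] Suc (Suc n) \<otimes> \<zero> \<oplus> w (Suc n) \<otimes> \<zero>) \<in> lin R [L [^] m, \<one> \<ominus> e]"
    using c y by (simp add: a_minus_def)
  then show "\<exists>a\<in>lin R [L [^] s, T [^] s]. \<exists>b\<in>lin R [L [^] s, T [^] s].
      (w (Suc n) \<ominus> L \<otimes> w n) \<otimes> y \<ominus> (L [^] Suc (Suc n) \<otimes> a \<oplus> w (Suc n) \<otimes> b) \<in> lin R [L [^] m, \<one> \<ominus> e]"
    using V(3) unfolding d by blast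
qed

text \<open>Modulo f, w (Suc n) = L w n u with a unit u = 1 + L^(s+1) k of inverse v. Hence w (Suc
  n) - L w n = w (Suc n) (1 - v), and 1 - v = (u - 1) v = L^(s+1) k v. So a = 0 and b = L^(s+1) k v
  y work for every y.\<close>

lemma asymptotically_stable_distinguished:
  assumes f: "f \<in> carrier R" "f \<ominus> T [^] (N::nat) \<in> lin R [L, \<one> \<ominus> e]"
  shows "asymptotically_stable [f, \<one> \<ominus> e]"
  unfolding asymptotically_stable_def
proof
  fix s :: nat
  have Vs: "set [L [^] s, T [^] s] \<subseteq> carrier R" and fs: "set [f, \<one> \<ominus> e] \<subseteq> carrier R" using f by simp_all
  note V = idealD[OF lin_ideal[OF Vs]] and I = idealD[OF lin_ideal[OF fs]]
  obtain n0 where n0: "\<And>n. n \<ge> n0 \<Longrightarrow> \<exists>k\<in>carrier R. \<exists>v\<in>carrier R.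
     w (Suc n) \<ominus> w n \<otimes> L \<otimes> (\<one> \<oplus> L [^] Suc s \<otimes> k) \<in> lin R [f, \<one> \<ominus> e]
     \<and> (\<one> \<oplus> L [^] Suc s \<otimes> k) \<otimes> v = \<one>" using w_Suc_mod_distinguished[OF f, of s] by blast
  show "\<exists>n0. \<forall>n\<ge>n0. \<forall>y\<in>carrier R. w n \<otimes> y \<in> lin R (L [^] Suc n # [f, \<one> \<ominus> e]) \<longrightarrow>
     (\<exists>a\<in>lin R [L [^] s, T [^] s]. \<exists>b\<in>lin R [L [^] s, T [^] s].
       (w (Suc n) \<ominus> L \<otimes> w n) \<otimes> y \<ominus> (L [^] Suc (Suc n) \<otimes> a \<oplus> w (Suc n) \<otimes> b) \<in> lin R [f, \<one> \<ominus> e])"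
  proof (intro exI[of _ n0] allI ballI impI)
    fix n y assume n: "n \<ge> n0" and y: "y \<in> carrier R"
    obtain W W' S where d: "W = w n" "W' = w (Suc n)" "S = L [^] s" by blast
    have c: "W \<in> carrier R" "W' \<in> carrier R" "S \<in> carrier R" by (simp_all add: d)
    obtain k v where kv: "k \<in> carrier R" "v \<in> carrier R" "W' \<ominus> W \<otimes> L \<otimes> (\<one> \<oplus> S \<otimes> L \<otimes> k) \<in> lin R [f, \<one> \<ominus> e]"
      "(\<one> \<oplus> S \<otimes> L \<otimes> k) \<otimes> v = \<one>" using n0[OF n] d by auto
    define i where "i = W' \<ominus> W \<otimes> L \<otimes> (\<one> \<oplus> S \<otimes> L \<otimes> k)"
    obtain o' where o': "o' = (\<one> \<oplus> S \<otimes> L \<otimes> k) \<otimes> v" by blast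
    have o1: "o' = \<one>" using o' kv by simp
    have b: "S \<otimes> (L \<otimes> k \<otimes> v \<otimes> y) \<in> lin R [L [^] s, T [^] s]"
      using lin_mem[OF Vs, of S "L \<otimes> k \<otimes> v \<otimes> y"] kv y d by simp
    have "(W' \<ominus> L \<otimes> W) \<otimes> y \<ominus> W' \<otimes> (S \<otimes> (L \<otimes> k \<otimes> v \<otimes> y))
      = (W' \<ominus> L \<otimes> W \<otimes> o') \<otimes> y \<ominus> W' \<otimes> (S \<otimes> (L \<otimes> k \<otimes> v \<otimes> y))" using o1 c by simp
    also have "\<dots> = (W' \<ominus> W \<otimes> L \<otimes> (\<one> \<oplus> S \<otimes> L \<otimes> k)) \<otimes> (v \<otimes> y) \<oplus> W' \<otimes> (\<one> \<ominus> o') \<otimes> y"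
      unfolding o' using c y kv(1,2) L_carrier by algebra
    also have "\<dots> = i \<otimes> (v \<otimes> y)" using o1 c y kv(1,2) by (simp add: i_def a_minus_def[of R \<one>] r_neg)
    also have "\<dots> \<in> lin R [f, \<one> \<ominus> e]" by (rule I(8)) (use kv y i_def in simp_all)
    finally have "(W' \<ominus> L \<otimes> W) \<otimes> y \<ominus> (L [^] Suc (Suc n) \<otimes> \<zero> \<oplus> W' \<otimes> (S \<otimes> (L \<otimes> k \<otimes> v \<otimes> y))) \<in> lin R [f, \<one> \<ominus> e]"
      using c y kv by simp
    then show "\<exists>a\<in>lin R [L [^] s, T [^] s]. \<exists>b\<in>lin R [L [^] s, T [^] s].
       (w (Suc n) \<ominus> L \<otimes> w n) \<otimes> y \<ominus> (L [^] Suc (Suc n) \<otimes> a \<oplus> w (Suc n) \<otimes> b) \<in> lin R [f, \<one> \<ominus> e]"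
      using V(3) b unfolding d by blast
  qed
qed

end

section \<open>Free modules, coordinatewise submodules and stabilisation of sequences of
  sets\<close>

lemma (in cring) free_mod_module: "module R (free_mod R k)"
proof (rule moduleI)
  show "cring R" by (rule is_cring)
  show "abelian_group (free_mod R k)"
  proof (rule abelian_groupI)
    fix x assume x: "x \<in> carrier (free_mod R k)"
    then have "(\<lambda>i\<in>{..<k}. \<ominus> x i) \<in> carrier (free_mod R k)" "(\<lambda>i\<in>{..<k}. \<ominus> x i) \<oplus>\<^bsub>free_mod R k\<^esub> x = \<zero>\<^bsub>free_mod R k\<^esub>"
      by (auto simp: free_mod_def PiE_iff l_neg intro!: restrict_ext)
    then show "\<exists>y\<in>carrier (free_mod R k). y \<oplus>\<^bsub>free_mod R k\<^esub> x = \<zero>\<^bsub>free_mod R k\<^esub>" by blast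
  qed (auto simp: free_mod_def PiE_iff a_ac l_zero extensional_def fun_eq_iff)
qed (auto simp: free_mod_def PiE_iff l_distr r_distr m_assoc extensional_def fun_eq_iff)

context cring begin

lemma free_mod_simps:
  "v \<in> carrier (free_mod R k) \<Longrightarrow> i < k \<Longrightarrow> v i \<in> carrier R"
  "i < k \<Longrightarrow> (v \<oplus>\<^bsub>free_mod R k\<^esub> u) i = v i \<oplus> u i"
  "i < k \<Longrightarrow> (a \<odot>\<^bsub>free_mod R k\<^esub> v) i = a \<otimes> v i"
  "i < k \<Longrightarrow> \<zero>\<^bsub>free_mod R k\<^esub> i = \<zero>"
  by (auto simp: free_mod_def PiE_iff)

lemma free_mod_minus:
  assumes "v \<in> carrier (free_mod R k)" "u \<in> carrier (free_mod R k)" "i < k"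
  shows "(\<ominus>\<^bsub>free_mod R k\<^esub> v) i = \<ominus> v i" "(u \<ominus>\<^bsub>free_mod R k\<^esub> v) i = u i \<ominus> v i"
proof -
  interpret F: module R "free_mod R k" by (rule free_mod_module)
  have "(\<ominus>\<^bsub>free_mod R k\<^esub> v \<oplus>\<^bsub>free_mod R k\<^esub> v) i = \<zero>" using F.M.l_neg[OF assms(1)] assms free_mod_simps(4) by metis
  then have "(\<ominus>\<^bsub>free_mod R k\<^esub> v) i \<oplus> v i = \<zero>" using free_mod_simps(2)[OF assms(3)] by simp
  then show "(\<ominus>\<^bsub>free_mod R k\<^esub> v) i = \<ominus> v i"
    using minus_equality free_mod_simps(1)[OF F.M.a_inv_closed[OF assms(1)] assms(3)] free_mod_simps(1)[OF assms(1,3)] by metis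
  then show "(u \<ominus>\<^bsub>free_mod R k\<^esub> v) i = u i \<ominus> v i"
    by (simp add: a_minus_def[of "free_mod R k"] free_mod_simps(2)[OF assms(3)] a_minus_def)
qed

lemma free_mod_I: "(\<And>i. i < k \<Longrightarrow> v i \<in> carrier R) \<Longrightarrow> (\<lambda>i\<in>{..<k}. v i) \<in> carrier (free_mod R k)"
  by (auto simp: free_mod_def)

lemma free_mod_eqI:
  "u \<in> carrier (free_mod R k) \<Longrightarrow> v \<in> carrier (free_mod R k) \<Longrightarrow> (\<And>i. i < k \<Longrightarrow> u i = v i) \<Longrightarrow> u = v"
  by (auto simp: free_mod_def intro: PiE_ext)

definition boxmod :: "nat \<Rightarrow> (nat \<Rightarrow> 'a set) \<Rightarrow> (nat \<Rightarrow> 'a) set" where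
  "boxmod k J = {v \<in> carrier (free_mod R k). \<forall>i<k. v i \<in> J i}"

lemma submodule_boxmod:
  assumes "\<And>i. i < k \<Longrightarrow> ideal (J i) R"
  shows "submodule (boxmod k J) R (free_mod R k)"
proof -
  interpret F: module R "free_mod R k" by (rule free_mod_module)
  note J = idealD[OF assms]
  show ?thesis
    by (rule F.submoduleI)
      (auto simp: boxmod_def free_mod_simps free_mod_minus J(3,4,5,7))
qed

text \<open>A coset of the product submodule is the same as a family of cosets, one for each
  coordinate.\<close>

lemma index_boxmod:
  assumes "\<And>i. i < k \<Longrightarrow> ideal (J i) R"
  shows "index (free_mod R k) (boxmod k J) (carrier (free_mod R k)) = (\<Prod>i<k. index R (J i) (carrier R))"
    and "(\<And>i. i < k \<Longrightarrow> finite (cosets R (J i) (carrier R))) \<Longrightarrow>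
      finite (cosets (free_mod R k) (boxmod k J) (carrier (free_mod R k)))"
proof -
  interpret F: module R "free_mod R k" by (rule free_mod_module)
  let ?F = "free_mod R k" and ?B = "boxmod k J"
  let ?f = "\<lambda>v. \<lambda>i\<in>{..<k}. J i +> v i"
  have eq: "?B +>\<^bsub>?F\<^esub> u = ?B +>\<^bsub>?F\<^esub> v \<longleftrightarrow> ?f u = ?f v" if "u \<in> carrier ?F" "v \<in> carrier ?F" for u v
  proof -
    have "?B +>\<^bsub>?F\<^esub> u = ?B +>\<^bsub>?F\<^esub> v \<longleftrightarrow> (\<forall>i<k. u i \<ominus> v i \<in> J i)"
      using F.M.coset_eq_iff[OF submodule.axioms(1)[OF submodule_boxmod[OF assms]] that] that
      by (auto simp: boxmod_def free_mod_minus)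
    also have "\<dots> \<longleftrightarrow> (\<forall>i<k. J i +> u i = J i +> v i)"
      using coset_eq_iff[OF idealD(1)[OF assms]] free_mod_simps(1)[OF that(1)] free_mod_simps(1)[OF that(2)] by auto
    also have "\<dots> \<longleftrightarrow> ?f u = ?f v" by (auto simp: fun_eq_iff restrict_def)
    finally show ?thesis .
  qed
  have img: "?f ` carrier ?F = Pi\<^sub>E {..<k} (\<lambda>i. cosets R (J i) (carrier R))"
  proof (intro equalityI subsetI)
    fix h assume "h \<in> ?f ` carrier ?F"
    then show "h \<in> Pi\<^sub>E {..<k} (\<lambda>i. cosets R (J i) (carrier R))"
      by (auto simp: cosets_def free_mod_simps)
  next
    fix h assume h: "h \<in> Pi\<^sub>E {..<k} (\<lambda>i. cosets R (J i) (carrier R))"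
    then have "\<forall>i\<in>{..<k}. \<exists>x. x \<in> carrier R \<and> h i = J i +> x" by (auto simp: cosets_def PiE_iff)
    then obtain x where x: "\<forall>i\<in>{..<k}. x i \<in> carrier R \<and> h i = J i +> x i" using bchoice by metis
    have "h = ?f (\<lambda>i\<in>{..<k}. x i)" using h x by (auto simp: fun_eq_iff PiE_iff extensional_def)
    then show "h \<in> ?f ` carrier ?F" using free_mod_I[of k x] x by blast
  qed
  show "index ?F ?B (carrier ?F) = (\<Prod>i<k. index R (J i) (carrier R))"
    using card_images_eq[of "carrier ?F" "\<lambda>v. ?B +>\<^bsub>?F\<^esub> v" ?f] eq img
    by (simp add: index_def cosets_def[of ?F] card_PiE)
  show "finite (cosets ?F ?B (carrier ?F))" if "\<And>i. i < k \<Longrightarrow> finite (cosets R (J i) (carrier R))"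
    using finite_images_iff[of "carrier ?F" "\<lambda>v. ?B +>\<^bsub>?F\<^esub> v" ?f] eq img that
    by (auto simp: cosets_def[of ?F] intro!: finite_PiE)
qed

end

text \<open>From a member of least cardinality on, the sequence cannot shrink any further.\<close>

lemma decseq_finite_stable:
  fixes S :: "nat \<Rightarrow> 'a set"
  assumes "\<And>n. S (Suc n) \<subseteq> S n" "finite (S 0)"
  shows "\<exists>n0. \<forall>n\<ge>n0. S n = S n0"
proof -
  have dec: "S n \<subseteq> S m" if "m \<le> n" for m n using that assms(1) lift_Suc_antimono_le[of S] by blast
  then have fin: "finite (S n)" for n using assms(2) finite_subset[of "S n" "S 0"] by blast
  define c where "c = (LEAST c. \<exists>n. card (S n) = c)"
  have "\<exists>n. card (S n) = c" unfolding c_def by (rule LeastI_ex) blast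
  then obtain n0 where n0: "card (S n0) = c" by blast
  have "S n = S n0" if "n \<ge> n0" for n
  proof (rule card_subset_eq[OF fin dec[OF that]])
    have "c \<le> card (S n)" unfolding c_def by (rule Least_le) blast
    then show "card (S n) = card (S n0)" using card_mono[OF fin dec[OF that]] n0 by simp
  qed
  then show ?thesis by blast
qed

text \<open>Complements in U reduce this to the decreasing case. Monotonicity is demanded only from
  m on, because the subgroups to which this is applied increase only for large n.\<close>

lemma incseq_finite_stable:
  fixes S :: "nat \<Rightarrow> 'a set"
  assumes "\<And>n. n \<ge> m \<Longrightarrow> S n \<subseteq> S (Suc n)" "finite U" "\<And>n. S n \<subseteq> U"
  shows "\<exists>n0\<ge>m. \<forall>n\<ge>n0. S n = S n0"
proof -
  have "\<exists>n0. \<forall>n\<ge>n0. U - S (n + m) = U - S (n0 + m)"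
  proof (rule decseq_finite_stable)
    show "U - S (Suc n + m) \<subseteq> U - S (n + m)" for n
      using assms(1)[of "n + m"] by (simp add: Diff_mono)
  qed (use assms(2) in simp)
  then obtain n0 where n0: "\<forall>n\<ge>n0. U - S (n + m) = U - S (n0 + m)" ..
  have "S n = S (n0 + m)" if "n \<ge> n0 + m" for n
  proof -
    have "U - S n = U - S (n0 + m)" using n0[rule_format, of "n - m"] that by simp
    then show ?thesis using assms(3)[of n] assms(3)[of "n0 + m"] by blast
  qed
  then show ?thesis by (meson le_add2)
qed

section \<open>Quotients of a module and of an elementary module\<close>

context iwasawa_module begin

definition nab :: "nat \<Rightarrow> 'm set \<Rightarrow> 'm set" where
  "nab n A = msum M (mscale M (L [^] Suc n) A) (mscale M (w n) A)"

lemma nab_iff: "z \<in> nab n A \<longleftrightarrow> (\<exists>x\<in>A. \<exists>y\<in>A. z = (L [^] Suc n) \<odot>\<^bsub>M\<^esub> x \<oplus>\<^bsub>M\<^esub> w n \<odot>\<^bsub>M\<^esub> y)"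
  unfolding nab_def msum_def mscale_def by blast

lemma Lpow_carrier: "L [^] (n::nat) \<in> carrier R" by simp

lemma submodule_nab: "submodule A R M \<Longrightarrow> submodule (nab n A) R M"
  unfolding nab_def by (intro submodule_msum submodule_mscale Lpow_carrier w_carrier)

lemma nab_subset: "submodule A R M \<Longrightarrow> nab n A \<subseteq> A"
  unfolding nab_def by (intro msum_least mscale_subset Lpow_carrier w_carrier)

lemma nab_mono: "A \<subseteq> B \<Longrightarrow> nab n A \<subseteq> nab n B"
  by (auto simp: nab_iff subset_iff simp del: nat_pow_Suc) 

lemma nab_dec:
  assumes "submodule A R M" shows "nab (Suc n) A \<subseteq> nab n A"
proof
  note A = submoduleD[OF assms]
  fix z assume "z \<in> nab (Suc n) A"
  then obtain x y where xy: "x \<in> A" "y \<in> A" "z = (L [^] Suc (Suc n)) \<odot>\<^bsub>M\<^esub> x \<oplus>\<^bsub>M\<^esub> w (Suc n) \<odot>\<^bsub>M\<^esub> y"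
    unfolding nab_iff by blast
  have xyM: "x \<in> carrier M" "y \<in> carrier M" using xy A by auto
  obtain t where t: "t \<in> carrier R" "w (Suc n) = w n \<otimes> (L \<oplus> w n \<otimes> t)" using w_Suc by blast
  have "z = (L [^] Suc n) \<odot>\<^bsub>M\<^esub> (L \<odot>\<^bsub>M\<^esub> x) \<oplus>\<^bsub>M\<^esub> w n \<odot>\<^bsub>M\<^esub> ((L \<oplus> w n \<otimes> t) \<odot>\<^bsub>M\<^esub> y)"
    using xy(3) t xyM by (simp add: smult_assoc1)
  moreover have "L \<odot>\<^bsub>M\<^esub> x \<in> A" "(L \<oplus> w n \<otimes> t) \<odot>\<^bsub>M\<^esub> y \<in> A" using A(7) xy t by simp_all
  ultimately show "z \<in> nab n A" unfolding nab_iff by blast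
qed

end

lemma (in cring) lin_ConsE:
  assumes "x \<in> lin R (a # as)"
  obtains u v where "u \<in> carrier R" "v \<in> lin R as" "x = a \<otimes> u \<oplus> v"
  using assms by (auto simp: lin.simps(2))

context iwasawa_module begin

text \<open>The map g is a lift to F of a pseudo-isomorphism from X = M to F / N, Y is the preimage
  in F of its image and K its kernel. With P = K + nabla_n X, D = N + nabla_n Y and H = N + nabla_n
  F the indices satisfy (X : nabla_n X) = (X : P)(P : nabla_n X), (X : P) = (Y : D) and (F : Y)(Y :
  D) = (F : D) = (F : H)(H : D). Here (F : H) is the product in the conclusion, and c collects the
  eventually constant (H : D)(P : nabla_n X) / (F : Y).\<close>

lemma index_nab_asymptotics:
  fixes as :: "nat \<Rightarrow> 'a list" and g :: "'m \<Rightarrow> nat \<Rightarrow> 'a" and k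
  defines "F \<equiv> free_mod R k"
  defines "N \<equiv> boxmod k (\<lambda>i. lin R (as i))"
  defines "Y \<equiv> {v \<in> carrier F. \<exists>x\<in>carrier M. v \<ominus>\<^bsub>F\<^esub> g x \<in> N}"
  assumes as: "\<And>i. i < k \<Longrightarrow> set (as i) \<subseteq> carrier R"
    and asymptotically_stable: "\<And>i. i < k \<Longrightarrow> asymptotically_stable (as i)"
    and fin: "\<And>i n. i < k \<Longrightarrow> finite (cosets R (lin R (L [^] Suc n # w n # as i)) (carrier R))"
    and g: "\<And>x. x \<in> carrier M \<Longrightarrow> g x \<in> carrier F"
    and g_add: "\<And>x y. x \<in> carrier M \<Longrightarrow> y \<in> carrier M \<Longrightarrow> g (x \<oplus>\<^bsub>M\<^esub> y) \<ominus>\<^bsub>F\<^esub> (g x \<oplus>\<^bsub>F\<^esub> g y) \<in> N"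
    and g_smult: "\<And>a x. a \<in> carrier R \<Longrightarrow> x \<in> carrier M \<Longrightarrow> g (a \<odot>\<^bsub>M\<^esub> x) \<ominus>\<^bsub>F\<^esub> a \<odot>\<^bsub>F\<^esub> g x \<in> N"
    and ker: "finite {x \<in> carrier M. g x \<in> N}"
    and coker: "finite (cosets F Y (carrier F))"
  shows "\<exists>c>0. \<exists>n0. \<forall>n\<ge>n0. finite (cosets M (nab n (carrier M)) (carrier M)) \<and>
    real (index M (nab n (carrier M)) (carrier M)) =
      c * (\<Prod>i<k. real (index R (lin R (L [^] Suc n # w n # as i)) (carrier R)))"
proof -
  interpret F: module R F unfolding F_def by (rule R.free_mod_module)
  interpret FI: iwasawa_module R p q L T e F ..
  note [simp del] = nat_pow_Suc
  have N: "submodule N R F" unfolding N_def F_def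
    by (rule R.submodule_boxmod) (use as R.lin_ideal in blast)
  note ND = F.submoduleD[OF N]

  \<comment> \<open>Congruence modulo N, the submodule Y and the kernel K\<close>
  define sim where "sim u v \<longleftrightarrow> u \<in> carrier F \<and> v \<in> carrier F \<and> u \<ominus>\<^bsub>F\<^esub> v \<in> N" for u v
  have sim_refl: "sim u u" if "u \<in> carrier F" for u
    using that ND by (simp add: sim_def a_minus_def[of F] F.M.r_neg)
  have sim_sym: "sim v u" if "sim u v" for u v
    using that ND(5)[of "u \<ominus>\<^bsub>F\<^esub> v"] by (auto simp: sim_def F.M.minus_minus_cancel)
  have sim_trans: "sim u x" if "sim u v" "sim v x" for u v x
    using that ND(4)[of "u \<ominus>\<^bsub>F\<^esub> v" "v \<ominus>\<^bsub>F\<^esub> x"] by (auto simp: sim_def F.M.minus_minus_cancel)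
  have sim_add: "sim (u \<oplus>\<^bsub>F\<^esub> x) (v \<oplus>\<^bsub>F\<^esub> y)" if "sim u v" "sim x y" for u v x y
  proof -
    have c: "u \<in> carrier F" "v \<in> carrier F" "x \<in> carrier F" "y \<in> carrier F" using that by (auto simp: sim_def)
    have "(u \<oplus>\<^bsub>F\<^esub> x) \<ominus>\<^bsub>F\<^esub> (v \<oplus>\<^bsub>F\<^esub> y) = (u \<ominus>\<^bsub>F\<^esub> v) \<oplus>\<^bsub>F\<^esub> (x \<ominus>\<^bsub>F\<^esub> y)"
      using c by (simp add: a_minus_def[of F] F.M.minus_add F.M.a_ac)
    then show ?thesis using that c ND(4) by (auto simp: sim_def)
  qed
  have sim_smult: "sim (a \<odot>\<^bsub>F\<^esub> u) (a \<odot>\<^bsub>F\<^esub> v)" if "sim u v" "a \<in> carrier R" for a u v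
    using that ND(7)[of "u \<ominus>\<^bsub>F\<^esub> v" a] by (auto simp: sim_def F.smult_minus_r)
  have sim_mem: "u \<in> A \<longleftrightarrow> v \<in> A" if "sim u v" "submodule A R F" "N \<subseteq> A" for u v A
  proof -
    have c: "u \<in> carrier F" "v \<in> carrier F" "u \<ominus>\<^bsub>F\<^esub> v \<in> A" using that by (auto simp: sim_def)
    note A = F.submoduleD[OF that(2)]
    have "u = (u \<ominus>\<^bsub>F\<^esub> v) \<oplus>\<^bsub>F\<^esub> v" "v = u \<ominus>\<^bsub>F\<^esub> (u \<ominus>\<^bsub>F\<^esub> v)" using c by (simp_all add: F.M.minus_minus_cancel)
    then show ?thesis using A(4)[OF c(3)] A(6)[OF _ c(3)] by metis
  qed
  have sadd: "sim (g (x \<oplus>\<^bsub>M\<^esub> y)) (g x \<oplus>\<^bsub>F\<^esub> g y)" if "x \<in> carrier M" "y \<in> carrier M" for x y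
    using that g g_add by (simp add: sim_def)
  have ssm: "sim (g (a \<odot>\<^bsub>M\<^esub> x)) (a \<odot>\<^bsub>F\<^esub> g x)" if "a \<in> carrier R" "x \<in> carrier M" for a x
    using that g g_smult by (simp add: sim_def)
  have sneg: "sim (g (\<ominus>\<^bsub>M\<^esub> x)) (\<ominus>\<^bsub>F\<^esub> g x)" if "x \<in> carrier M" for x
    using ssm[of "\<ominus> \<one>" x] that g[OF that] by (simp add: smult_l_minus F.smult_l_minus)
  have sminus: "sim (g (x \<ominus>\<^bsub>M\<^esub> y)) (g x \<ominus>\<^bsub>F\<^esub> g y)" if "x \<in> carrier M" "y \<in> carrier M" for x y
    using sim_trans[OF sadd[of x "\<ominus>\<^bsub>M\<^esub> y"] sim_add[OF sim_refl sneg]] that g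
    by (simp add: a_minus_def[of M] a_minus_def[of F])
  have Yiff: "v \<in> Y \<longleftrightarrow> (\<exists>x\<in>carrier M. sim v (g x))" for v
    using g by (auto simp: Y_def sim_def)
  have gY: "g x \<in> Y" if "x \<in> carrier M" for x using that sim_refl g Yiff by blast
  have Ysub: "submodule Y R F"
  proof (rule F.submoduleI)
    show "Y \<subseteq> carrier F" by (auto simp: Y_def)
    have "g \<zero>\<^bsub>M\<^esub> \<in> N" using ssm[of "\<zero>" "\<zero>\<^bsub>M\<^esub>"] g[of "\<zero>\<^bsub>M\<^esub>"] ND(3) sim_mem[OF _ N] by auto
    then show "\<zero>\<^bsub>F\<^esub> \<in> Y" unfolding Yiff
      by (intro bexI[of _ "\<zero>\<^bsub>M\<^esub>"]) (use g ND in \<open>auto simp: sim_def a_minus_def[of F]\<close>)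
    fix u assume "u \<in> Y"
    then obtain x where x: "x \<in> carrier M" "sim u (g x)" using Yiff by blast
    have uF: "u \<in> carrier F" using x by (simp add: sim_def)
    have "sim (\<ominus>\<^bsub>F\<^esub> u) (\<ominus>\<^bsub>F\<^esub> g x)" using sim_smult[OF x(2), of "\<ominus> \<one>"] uF g x by (simp add: F.smult_l_minus)
    then show "\<ominus>\<^bsub>F\<^esub> u \<in> Y" using sim_trans[OF _ sim_sym[OF sneg[OF x(1)]]] x Yiff by blast
    show "a \<odot>\<^bsub>F\<^esub> u \<in> Y" if "a \<in> carrier R" for a
      using sim_trans[OF sim_smult[OF x(2) that] sim_sym[OF ssm[OF that x(1)]]] x that Yiff by blast
    fix v assume "v \<in> Y"
    then obtain y where y: "y \<in> carrier M" "sim v (g y)" using Yiff by blast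
    show "u \<oplus>\<^bsub>F\<^esub> v \<in> Y"
      using sim_trans[OF sim_add[OF x(2) y(2)] sim_sym[OF sadd[OF x(1) y(1)]]] x y Yiff M.add.m_closed by blast
  qed
  note YD = F.submoduleD[OF Ysub]
  have NY: "N \<subseteq> Y"
  proof
    fix v assume v: "v \<in> N"
    have "sim v \<zero>\<^bsub>F\<^esub>" using v ND by (auto simp: sim_def a_minus_def[of F])
    then show "v \<in> Y" using sim_mem[OF _ Ysub] YD(3) sim_trans Yiff by blast
  qed
  define K where "K = {x \<in> carrier M. g x \<in> N}"
  have K: "submodule K R M"
  proof (rule submoduleI)
    show "\<zero>\<^bsub>M\<^esub> \<in> K" using ssm[of "\<zero>" "\<zero>\<^bsub>M\<^esub>"] g[of "\<zero>\<^bsub>M\<^esub>"] ND(3) sim_mem[OF _ N] by (auto simp: K_def)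
    show "\<And>a. a \<in> K \<Longrightarrow> \<ominus>\<^bsub>M\<^esub> a \<in> K" using sim_mem[OF sneg N] ND(5) by (auto simp: K_def)
    show "\<And>a b. a \<in> K \<Longrightarrow> b \<in> K \<Longrightarrow> a \<oplus>\<^bsub>M\<^esub> b \<in> K" using sim_mem[OF sadd N] ND(4) by (auto simp: K_def)
    show "\<And>a x. a \<in> carrier R \<Longrightarrow> x \<in> K \<Longrightarrow> a \<odot>\<^bsub>M\<^esub> x \<in> K" using sim_mem[OF ssm N] ND(7) by (auto simp: K_def)
  qed (auto simp: K_def)

  \<comment> \<open>The submodules between which indices are taken, and the isomorphism of X / P
    with Y / D\<close>
  define XX where "XX n = nab n (carrier M)" for n
  have Xs: "submodule (XX n) R M" for n unfolding XX_def by (rule submodule_nab[OF submodule_carrier])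
  have Xdec: "XX (Suc n) \<subseteq> XX n" for n unfolding XX_def by (rule nab_dec[OF submodule_carrier])
  define P where "P n = msum M K (XX n)" for n
  have Ps: "submodule (P n) R M" for n unfolding P_def by (rule submodule_msum[OF K Xs])
  define D where "D n = msum F N (FI.nab n Y)" for n
  have Ds: "submodule (D n) R F" for n unfolding D_def by (rule F.submodule_msum[OF N FI.submodule_nab[OF Ysub]])
  note DD = F.submoduleD[OF Ds]
  have ND': "N \<subseteq> D n" for n unfolding D_def by (rule F.msum_upper(1)[OF N FI.submodule_nab[OF Ysub]])
  define H where "H n = msum F N (FI.nab n (carrier F))" for n
  have Hs: "submodule (H n) R F" for n unfolding H_def by (rule F.submodule_msum[OF N FI.submodule_nab[OF F.submodule_carrier]])
  have DH: "D n \<subseteq> H n" for n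
    using FI.nab_mono[OF YD(2), of n] by (auto simp: D_def H_def msum_def)
  have DY: "D n \<subseteq> Y" for n unfolding D_def by (rule F.msum_least[OF Ysub NY FI.nab_subset[OF Ysub]])

  \<comment> \<open>The preimage of D n under g is P n. The nabla-part of g z has coefficients in Y,
    which are lifted to M; the difference between z and the lifted element is sent into N, so it
    lies in K.\<close>
  have gD: "g z \<in> D n \<longleftrightarrow> z \<in> P n" if z: "z \<in> carrier M" for z n
  proof
    assume "g z \<in> D n"
    then obtain v u u' where v: "v \<in> N" "u \<in> Y" "u' \<in> Y"
      "g z = v \<oplus>\<^bsub>F\<^esub> ((L [^] Suc n) \<odot>\<^bsub>F\<^esub> u \<oplus>\<^bsub>F\<^esub> w n \<odot>\<^bsub>F\<^esub> u')"
      by (auto simp: D_def msum_def FI.nab_iff)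
    obtain x x' where x: "x \<in> carrier M" "x' \<in> carrier M" "sim u (g x)" "sim u' (g x')" using v Yiff by blast
    let ?s = "(L [^] Suc n) \<odot>\<^bsub>M\<^esub> x" and ?t = "w n \<odot>\<^bsub>M\<^esub> x'"
    have uF: "u \<in> carrier F" "u' \<in> carrier F" "v \<in> carrier F" using v YD ND by auto
    have "sim v \<zero>\<^bsub>F\<^esub>" using v ND by (auto simp: sim_def a_minus_def[of F])
    then have "sim (g z) (\<zero>\<^bsub>F\<^esub> \<oplus>\<^bsub>F\<^esub> ((L [^] Suc n) \<odot>\<^bsub>F\<^esub> g x \<oplus>\<^bsub>F\<^esub> w n \<odot>\<^bsub>F\<^esub> g x'))"
      unfolding v(4) by (intro sim_add sim_smult x) simp_all
    then have 1: "sim (g z) ((L [^] Suc n) \<odot>\<^bsub>F\<^esub> g x \<oplus>\<^bsub>F\<^esub> w n \<odot>\<^bsub>F\<^esub> g x')" using g x by simp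
    have "sim (g (?s \<oplus>\<^bsub>M\<^esub> ?t)) ((L [^] Suc n) \<odot>\<^bsub>F\<^esub> g x \<oplus>\<^bsub>F\<^esub> w n \<odot>\<^bsub>F\<^esub> g x')"
      by (rule sim_trans[OF sadd sim_add[OF ssm ssm]]) (use x in simp_all)
    from sim_trans[OF 1 sim_sym[OF this]] have 2: "sim (g z) (g (?s \<oplus>\<^bsub>M\<^esub> ?t))" .
    have "sim (g (z \<ominus>\<^bsub>M\<^esub> (?s \<oplus>\<^bsub>M\<^esub> ?t))) (g z \<ominus>\<^bsub>F\<^esub> g (?s \<oplus>\<^bsub>M\<^esub> ?t))"
      by (rule sminus) (use z x in simp_all)
    then have "g (z \<ominus>\<^bsub>M\<^esub> (?s \<oplus>\<^bsub>M\<^esub> ?t)) \<in> N" 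
      by (rule iffD2[OF sim_mem[OF _ N order_refl]]) (use 2 in \<open>simp only: sim_def\<close>)
    then have "z \<ominus>\<^bsub>M\<^esub> (?s \<oplus>\<^bsub>M\<^esub> ?t) \<in> K" using z x by (simp add: K_def)
    moreover have "?s \<oplus>\<^bsub>M\<^esub> ?t \<in> XX n" using x by (auto simp: XX_def nab_iff)
    moreover have "z = (z \<ominus>\<^bsub>M\<^esub> (?s \<oplus>\<^bsub>M\<^esub> ?t)) \<oplus>\<^bsub>M\<^esub> (?s \<oplus>\<^bsub>M\<^esub> ?t)" using z x by (simp add: M.minus_minus_cancel)
    ultimately show "z \<in> P n" unfolding P_def msum_def by blast
  next
    assume "z \<in> P n"
    then obtain v x x' where v: "v \<in> K" "x \<in> carrier M" "x' \<in> carrier M"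
      "z = v \<oplus>\<^bsub>M\<^esub> ((L [^] Suc n) \<odot>\<^bsub>M\<^esub> x \<oplus>\<^bsub>M\<^esub> w n \<odot>\<^bsub>M\<^esub> x')"
      by (auto simp: P_def msum_def XX_def nab_iff)
    have vc: "v \<in> carrier M" "g v \<in> N" using v by (auto simp: K_def)
    have "sim (g z) (g v \<oplus>\<^bsub>F\<^esub> ((L [^] Suc n) \<odot>\<^bsub>F\<^esub> g x \<oplus>\<^bsub>F\<^esub> w n \<odot>\<^bsub>F\<^esub> g x'))"
      unfolding v(4)
      by (rule sim_trans[OF sadd sim_add[OF sim_refl sim_trans[OF sadd sim_add[OF ssm ssm]]]])
        (use v vc g in simp_all)
    moreover have "g v \<oplus>\<^bsub>F\<^esub> ((L [^] Suc n) \<odot>\<^bsub>F\<^esub> g x \<oplus>\<^bsub>F\<^esub> w n \<odot>\<^bsub>F\<^esub> g x') \<in> D n"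
    proof -
      have "(L [^] Suc n) \<odot>\<^bsub>F\<^esub> g x \<oplus>\<^bsub>F\<^esub> w n \<odot>\<^bsub>F\<^esub> g x' \<in> FI.nab n Y"
        unfolding FI.nab_iff using gY v(2,3) by blast
      then show ?thesis unfolding D_def msum_def using vc(2) by blast
    qed
    ultimately show "g z \<in> D n" using sim_mem[OF _ Ds ND'] by blast
  qed

  \<comment> \<open>By \<open>gD\<close> the map g induces an injection of X / P n into Y / D n; it
    is onto because every element of Y is congruent modulo N to some g x, and N is contained in D
    n.\<close>
  have MY: "index M (P n) (carrier M) = index F (D n) Y \<and>
      (finite (cosets M (P n) (carrier M)) \<longleftrightarrow> finite (cosets F (D n) Y))" for n
  proof -
    have eq: "P n +>\<^bsub>M\<^esub> x = P n +>\<^bsub>M\<^esub> y \<longleftrightarrow> D n +>\<^bsub>F\<^esub> g x = D n +>\<^bsub>F\<^esub> g y"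
      if "x \<in> carrier M" "y \<in> carrier M" for x y
      using M.coset_eq_iff[OF submodule.axioms(1)[OF Ps]] F.M.coset_eq_iff[OF DD(1)] that g
        sim_mem[OF sminus Ds ND'] gD[of "x \<ominus>\<^bsub>M\<^esub> y"] by simp
    have "cosets F (D n) Y = (\<lambda>x. D n +>\<^bsub>F\<^esub> g x) ` carrier M"
    proof (intro equalityI subsetI)
      fix c assume "c \<in> cosets F (D n) Y"
      then obtain v where v: "v \<in> Y" "c = D n +>\<^bsub>F\<^esub> v" by (auto simp: cosets_def)
      then obtain x where x: "x \<in> carrier M" "sim v (g x)" using Yiff by blast
      then have "v \<ominus>\<^bsub>F\<^esub> g x \<in> D n" using ND' by (auto simp: sim_def)
      then have "c = D n +>\<^bsub>F\<^esub> g x" using v x F.M.coset_eq_iff[OF DD(1)] by (simp add: sim_def)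
      then show "c \<in> (\<lambda>x. D n +>\<^bsub>F\<^esub> g x) ` carrier M" using x by blast
    qed (use gY in \<open>auto simp: cosets_def\<close>)
    then show ?thesis
      using card_images_eq[of "carrier M" "\<lambda>x. P n +>\<^bsub>M\<^esub> x" "\<lambda>x. D n +>\<^bsub>F\<^esub> g x"]
       finite_images_iff[of "carrier M" "\<lambda>x. P n +>\<^bsub>M\<^esub> x" "\<lambda>x. D n +>\<^bsub>F\<^esub> g x"] eq
      by (simp add: index_def cosets_def[of M])
  qed

  \<comment> \<open>P n / nabla_n X is the image of K, so its order depends only on the intersection
    of K with nabla_n X.\<close>
  have XP: "cosets M (XX n) (P n) = (\<lambda>x. XX n +>\<^bsub>M\<^esub> x) ` K" for n
  proof (intro equalityI subsetI)
    note XD = submoduleD[OF Xs] and KD = submoduleD[OF K]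
    fix c assume "c \<in> cosets M (XX n) (P n)"
    then obtain a b where ab: "a \<in> K" "b \<in> XX n" "c = XX n +>\<^bsub>M\<^esub> (a \<oplus>\<^bsub>M\<^esub> b)"
      by (auto simp: cosets_def P_def msum_def)
    have abM: "a \<in> carrier M" "b \<in> carrier M" using ab XD KD by auto
    have "(a \<oplus>\<^bsub>M\<^esub> b) \<ominus>\<^bsub>M\<^esub> a = b" using abM by (simp add: M.minus_minus_cancel M.a_comm[of a])
    then have "c = XX n +>\<^bsub>M\<^esub> a" using ab abM M.coset_eq_iff[OF XD(1)] by simp
    then show "c \<in> (\<lambda>x. XX n +>\<^bsub>M\<^esub> x) ` K" using ab by blast
  qed (use msum_upper(1)[OF K Xs] in \<open>auto simp: cosets_def P_def\<close>)
  have "\<exists>n0. \<forall>n\<ge>n0. K \<inter> XX n = K \<inter> XX n0"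
    by (rule decseq_finite_stable) (use Xdec ker in \<open>auto simp: K_def\<close>)
  then obtain n1 where n1: "\<And>n. n \<ge> n1 \<Longrightarrow> K \<inter> XX n = K \<inter> XX n1" by blast
  have idx1: "index M (XX n) (P n) = index M (XX n1) (P n1)" if n: "n \<ge> n1" for n
  proof -
    note KD = submoduleD[OF K]
    have "XX n +>\<^bsub>M\<^esub> x = XX n +>\<^bsub>M\<^esub> y \<longleftrightarrow> XX n1 +>\<^bsub>M\<^esub> x = XX n1 +>\<^bsub>M\<^esub> y" if "x \<in> K" "y \<in> K" for x y
    proof -
      have "x \<in> carrier M" "y \<in> carrier M" "x \<ominus>\<^bsub>M\<^esub> y \<in> K" using that KD by auto
      then show ?thesis using n1[OF n] M.coset_eq_iff[OF submodule.axioms(1)[OF Xs]] by auto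
    qed
    then show ?thesis unfolding index_def XP by (rule card_images_eq)
  qed
  have fin1: "finite (cosets M (XX n) (P n))" for n using ker unfolding XP K_def[symmetric] by simp

  have towM: "index M (XX n) (carrier M) = index M (P n) (carrier M) * index M (XX n) (P n)"
    "finite (cosets M (XX n) (carrier M)) \<longleftrightarrow> finite (cosets M (P n) (carrier M)) \<and> finite (cosets M (XX n) (P n))" for n
    using M.index_tower[OF submodule.axioms(1)[OF Xs] submodule.axioms(1)[OF Ps] M.subgp_carrier
        msum_upper(2)[OF K Xs, folded P_def] submoduleD(2)[OF Ps]] by auto
  have towH: "index F (D n) (carrier F) = index F (H n) (carrier F) * index F (D n) (H n)"
    "finite (cosets F (D n) (carrier F)) \<longleftrightarrow> finite (cosets F (H n) (carrier F)) \<and> finite (cosets F (D n) (H n))" for n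
    using F.M.index_tower[OF DD(1) submodule.axioms(1)[OF Hs] F.M.subgp_carrier DH F.submoduleD(2)[OF Hs]] by auto
  have towY: "index F (D n) (carrier F) = index F Y (carrier F) * index F (D n) Y"
    "finite (cosets F (D n) (carrier F)) \<longleftrightarrow> finite (cosets F Y (carrier F)) \<and> finite (cosets F (D n) Y)" for n
    using F.M.index_tower[OF DD(1) YD(1) F.M.subgp_carrier DY YD(2)] by auto

  \<comment> \<open>Y need not be a product of ideals, but F is, so H n splits into coordinates;
    this reduces (F : H n) to cyclic summands.\<close>
  have H_box: "H n = boxmod k (\<lambda>i. lin R (L [^] Suc n # w n # as i))" for n
  proof (intro equalityI subsetI)
    fix v assume "v \<in> H n"
    then obtain r a b where v: "r \<in> N" "a \<in> carrier F" "b \<in> carrier F"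
      "v = r \<oplus>\<^bsub>F\<^esub> ((L [^] Suc n) \<odot>\<^bsub>F\<^esub> a \<oplus>\<^bsub>F\<^esub> w n \<odot>\<^bsub>F\<^esub> b)"
      by (auto simp: H_def msum_def FI.nab_iff)
    have rF: "r \<in> carrier F" using v ND by auto
    have "v i \<in> lin R (L [^] Suc n # w n # as i)" if i: "i < k" for i
    proof -
      have c: "r i \<in> carrier R" "a i \<in> carrier R" "b i \<in> carrier R"
        using v rF R.free_mod_simps(1)[OF _ i] unfolding F_def by blast+
      have "v i = r i \<oplus> ((L [^] Suc n) \<otimes> a i \<oplus> w n \<otimes> b i)"
        unfolding v(4) F_def by (simp add: R.free_mod_simps i)
      also have "\<dots> = (L [^] Suc n) \<otimes> a i \<oplus> (w n \<otimes> b i \<oplus> r i)" using c by (simp add: R.a_ac)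
      finally show ?thesis
        by (intro R.lin_ConsI[OF _ R.lin_ConsI[OF _ _ refl]]) (use c v i in \<open>simp_all add: N_def R.boxmod_def\<close>)
    qed
    moreover have "v \<in> carrier F" unfolding v(4) using v rF by simp
    ultimately show "v \<in> boxmod k (\<lambda>i. lin R (L [^] Suc n # w n # as i))" by (simp add: R.boxmod_def F_def)
  next
    fix v assume v: "v \<in> boxmod k (\<lambda>i. lin R (L [^] Suc n # w n # as i))"
    have vF: "v \<in> carrier F" using v by (simp add: R.boxmod_def F_def)
    have "\<forall>i\<in>{..<k}. \<exists>z. fst z \<in> carrier R \<and> fst (snd z) \<in> carrier R \<and> snd (snd z) \<in> lin R (as i) \<and>
       v i = (L [^] Suc n) \<otimes> fst z \<oplus> (w n \<otimes> fst (snd z) \<oplus> snd (snd z))"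
    proof
      fix i assume "i \<in> {..<k}"
      then have "v i \<in> lin R (L [^] Suc n # w n # as i)" using v by (simp add: R.boxmod_def)
      then obtain a y where 1: "a \<in> carrier R" "y \<in> lin R (w n # as i)" "v i = (L [^] Suc n) \<otimes> a \<oplus> y" by (rule R.lin_ConsE)
      from 1(2) obtain b r where 2: "b \<in> carrier R" "r \<in> lin R (as i)" "y = w n \<otimes> b \<oplus> r" by (rule R.lin_ConsE)
      show "\<exists>z. fst z \<in> carrier R \<and> fst (snd z) \<in> carrier R \<and> snd (snd z) \<in> lin R (as i) \<and>
       v i = (L [^] Suc n) \<otimes> fst z \<oplus> (w n \<otimes> fst (snd z) \<oplus> snd (snd z))"
        by (intro exI[of _ "(a, b, r)"]) (use 1 2 in simp)
    qed
    then obtain z where z: "\<forall>i\<in>{..<k}. fst (z i) \<in> carrier R \<and> fst (snd (z i)) \<in> carrier R \<and> snd (snd (z i)) \<in> lin R (as i) \<and>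
       v i = (L [^] Suc n) \<otimes> fst (z i) \<oplus> (w n \<otimes> fst (snd (z i)) \<oplus> snd (snd (z i)))"
      using bchoice by metis
    define a b r where abr: "a = (\<lambda>i\<in>{..<k}. fst (z i))" "b = (\<lambda>i\<in>{..<k}. fst (snd (z i)))" "r = (\<lambda>i\<in>{..<k}. snd (snd (z i)))"
    have r': "snd (snd (z i)) \<in> carrier R" if "i < k" for i using z that R.lin_carrier[OF as[OF that]] by auto
    have c: "a \<in> carrier F" "b \<in> carrier F" "r \<in> carrier F"
      unfolding abr F_def by (rule R.free_mod_I; use z r' in simp)+
    have "r \<in> N" using c z by (auto simp: N_def R.boxmod_def F_def abr)
    moreover have "v = r \<oplus>\<^bsub>F\<^esub> ((L [^] Suc n) \<odot>\<^bsub>F\<^esub> a \<oplus>\<^bsub>F\<^esub> w n \<odot>\<^bsub>F\<^esub> b)"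
    proof (rule R.free_mod_eqI)
      show "v \<in> carrier (free_mod R k)" using vF by (simp add: F_def)
      show "r \<oplus>\<^bsub>F\<^esub> ((L [^] Suc n) \<odot>\<^bsub>F\<^esub> a \<oplus>\<^bsub>F\<^esub> w n \<odot>\<^bsub>F\<^esub> b) \<in> carrier (free_mod R k)"
        unfolding F_def[symmetric] using c by simp
      fix i assume i: "i < k"
      then show "v i = (r \<oplus>\<^bsub>F\<^esub> ((L [^] Suc n) \<odot>\<^bsub>F\<^esub> a \<oplus>\<^bsub>F\<^esub> w n \<odot>\<^bsub>F\<^esub> b)) i"
        using z r'[OF i] unfolding F_def by (simp add: R.free_mod_simps abr R.a_ac)
    qed
    ultimately show "v \<in> H n" unfolding H_def msum_def using c by (auto simp: FI.nab_iff)
  qed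
  have Jid: "ideal (lin R (L [^] Suc n # w n # as i)) R" if "i < k" for i n
    by (rule R.lin_ideal) (use as[OF that] in simp)
  have idxH: "index F (H n) (carrier F) = (\<Prod>i<k. index R (lin R (L [^] Suc n # w n # as i)) (carrier R))" for n
    unfolding H_box F_def by (rule R.index_boxmod(1)) (rule Jid)
  have finH: "finite (cosets F (H n) (carrier F))" for n
    unfolding H_box F_def by (rule R.index_boxmod(2)) (fact Jid fin)+

  \<comment> \<open>Stabilisation of (H : D)\<close>
  obtain s1 :: nat where s1: "\<And>v. v \<in> carrier F \<Longrightarrow> (L [^] s1) \<odot>\<^bsub>F\<^esub> v \<in> Y"
    using FI.nilpotent_on_finite[OF Ysub F.submodule_carrier _ coker, of L] R.lin_gen[of "[L, T]" L] by auto
  obtain s2 :: nat where s2: "\<And>v. v \<in> carrier F \<Longrightarrow> (T [^] s2) \<odot>\<^bsub>F\<^esub> v \<in> Y"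
    using FI.nilpotent_on_finite[OF Ysub F.submodule_carrier _ coker, of T] R.lin_gen[of "[L, T]" T] by auto
  define s where "s = s1 + s2"
  have sL: "(L [^] s) \<odot>\<^bsub>F\<^esub> v \<in> Y" "(T [^] s) \<odot>\<^bsub>F\<^esub> v \<in> Y" if v: "v \<in> carrier F" for v
  proof -
    have "(L [^] s) \<odot>\<^bsub>F\<^esub> v = (L [^] s2) \<odot>\<^bsub>F\<^esub> ((L [^] s1) \<odot>\<^bsub>F\<^esub> v)"
      using v by (simp add: F.smult_assoc1[symmetric] R.nat_pow_mult s_def add.commute)
    then show "(L [^] s) \<odot>\<^bsub>F\<^esub> v \<in> Y" using YD(7)[OF s1[OF v]] by simp
    have "(T [^] s) \<odot>\<^bsub>F\<^esub> v = (T [^] s1) \<odot>\<^bsub>F\<^esub> ((T [^] s2) \<odot>\<^bsub>F\<^esub> v)"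
      using v by (simp add: F.smult_assoc1[symmetric] R.nat_pow_mult s_def)
    then show "(T [^] s) \<odot>\<^bsub>F\<^esub> v \<in> Y" using YD(7)[OF s2[OF v]] by simp
  qed
  \<comment> \<open>Both L^s and T^s send F into Y. So vectors of coefficients supplied by
    \<open>asymptotically_stable\<close>, which lie in (L^s, T^s), belong to Y.\<close>
  have VY: "v \<in> Y" if v: "v \<in> carrier F" "\<And>i. i < k \<Longrightarrow> v i \<in> lin R [L [^] s, T [^] s]" for v
  proof -
    have "\<forall>i\<in>{..<k}. \<exists>z. fst z \<in> carrier R \<and> snd z \<in> carrier R \<and> v i = (L [^] s) \<otimes> fst z \<oplus> (T [^] s) \<otimes> snd z"
    proof
      fix i assume "i \<in> {..<k}"
      then obtain a b where "a \<in> carrier R" "b \<in> carrier R" "v i = (L [^] s) \<otimes> a \<oplus> (T [^] s) \<otimes> b"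
        using v(2)[of i] R.lin2[of "L [^] s" "T [^] s"] by auto
      then show "\<exists>z. fst z \<in> carrier R \<and> snd z \<in> carrier R \<and> v i = (L [^] s) \<otimes> fst z \<oplus> (T [^] s) \<otimes> snd z"
        by (intro exI[of _ "(a, b)"]) simp
    qed
    then obtain z where z: "\<forall>i\<in>{..<k}. fst (z i) \<in> carrier R \<and> snd (z i) \<in> carrier R \<and> v i = (L [^] s) \<otimes> fst (z i) \<oplus> (T [^] s) \<otimes> snd (z i)"
      using bchoice by metis
    define a b where ab: "a = (\<lambda>i\<in>{..<k}. fst (z i))" "b = (\<lambda>i\<in>{..<k}. snd (z i))"
    have c: "a \<in> carrier F" "b \<in> carrier F"
      unfolding ab F_def by (rule R.free_mod_I; use z in simp)+
    have "v = (L [^] s) \<odot>\<^bsub>F\<^esub> a \<oplus>\<^bsub>F\<^esub> (T [^] s) \<odot>\<^bsub>F\<^esub> b"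
    proof (rule R.free_mod_eqI)
      show "v \<in> carrier (free_mod R k)" using v by (simp add: F_def)
      show "(L [^] s) \<odot>\<^bsub>F\<^esub> a \<oplus>\<^bsub>F\<^esub> (T [^] s) \<odot>\<^bsub>F\<^esub> b \<in> carrier (free_mod R k)"
        unfolding F_def[symmetric] using c by simp
      fix i assume i: "i < k"
      then show "v i = ((L [^] s) \<odot>\<^bsub>F\<^esub> a \<oplus>\<^bsub>F\<^esub> (T [^] s) \<odot>\<^bsub>F\<^esub> b) i"
        using z unfolding F_def by (simp add: R.free_mod_simps ab)
    qed
    then show ?thesis using YD(4)[OF sL(1)[OF c(1)] sL(2)[OF c(2)]] by simp
  qed

  define W where "W n = {(x, y). x \<in> carrier F \<and> y \<in> carrier F \<and>
     (L [^] Suc n) \<odot>\<^bsub>F\<^esub> x \<oplus>\<^bsub>F\<^esub> w n \<odot>\<^bsub>F\<^esub> y \<in> D n}" for n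
  have "\<forall>i\<in>{..<k}. \<exists>n0. \<forall>n\<ge>n0. \<forall>y\<in>carrier R. w n \<otimes> y \<in> lin R (L [^] Suc n # as i) \<longrightarrow>
     (\<exists>a\<in>lin R [L [^] s, T [^] s]. \<exists>b\<in>lin R [L [^] s, T [^] s].
       (w (Suc n) \<ominus> L \<otimes> w n) \<otimes> y \<ominus> (L [^] Suc (Suc n) \<otimes> a \<oplus> w (Suc n) \<otimes> b) \<in> lin R (as i))"
    using asymptotically_stable unfolding asymptotically_stable_def by blast
  then obtain h where h: "\<forall>i\<in>{..<k}. \<forall>n\<ge>h i. \<forall>y\<in>carrier R. w n \<otimes> y \<in> lin R (L [^] Suc n # as i) \<longrightarrow>
     (\<exists>a\<in>lin R [L [^] s, T [^] s]. \<exists>b\<in>lin R [L [^] s, T [^] s].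
       (w (Suc n) \<ominus> L \<otimes> w n) \<otimes> y \<ominus> (L [^] Suc (Suc n) \<otimes> a \<oplus> w (Suc n) \<otimes> b) \<in> lin R (as i))"
    using bchoice[of "{..<k}"] by metis
  \<comment> \<open>The sum bounds all the thresholds at once, and also makes sense for k =
    0.\<close>
  define n2 where "n2 = sum h {..<k}"
  have hn2: "h i \<le> n2" if "i < k" for i unfolding n2_def by (rule member_le_sum) (use that in auto)

  \<comment> \<open>With Q = L^(n+1), Z = w n and Z' = w (n+1), the hypothesis reads Q (x - a) + Z
    (y - b) = r in N with a, b in Y. Multiplied by L it gives L Q (x - a) + Z' (y - b) = L r + (Z' -
    L Z)(y - b). Asymptotic stability, applied to y - b in each coordinate, rewrites the last term
    as L Q a' + Z' b' modulo N with a', b' in Y.\<close>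
  have Winc: "W n \<subseteq> W (Suc n)" if n: "n \<ge> n2" for n
  proof (clarify)
    fix x y assume "(x, y) \<in> W n"
    then have xy: "x \<in> carrier F" "y \<in> carrier F" "(L [^] Suc n) \<odot>\<^bsub>F\<^esub> x \<oplus>\<^bsub>F\<^esub> w n \<odot>\<^bsub>F\<^esub> y \<in> D n"
      by (auto simp: W_def)
    from xy(3) obtain r a b where v: "r \<in> N" "a \<in> Y" "b \<in> Y"
      "(L [^] Suc n) \<odot>\<^bsub>F\<^esub> x \<oplus>\<^bsub>F\<^esub> w n \<odot>\<^bsub>F\<^esub> y = r \<oplus>\<^bsub>F\<^esub> ((L [^] Suc n) \<odot>\<^bsub>F\<^esub> a \<oplus>\<^bsub>F\<^esub> w n \<odot>\<^bsub>F\<^esub> b)"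
      by (auto simp: D_def msum_def FI.nab_iff)
    have cF: "r \<in> carrier F" "a \<in> carrier F" "b \<in> carrier F" using v ND YD by auto
    obtain Q Z Z' where d: "Q = L [^] Suc n" "Z = w n" "Z' = w (Suc n)" by blast
    have QR: "Q \<in> carrier R" "Z \<in> carrier R" "Z' \<in> carrier R" by (simp_all add: d)
    have QL: "L [^] Suc (Suc n) = Q \<otimes> L" by (simp add: d nat_pow_Suc)
    have ri: "r i \<in> lin R (as i)" if "i < k" for i using v that by (simp add: N_def R.boxmod_def)
    have comp: "x i \<in> carrier R" "y i \<in> carrier R" "r i \<in> carrier R" "a i \<in> carrier R" "b i \<in> carrier R"
      "Q \<otimes> x i \<oplus> Z \<otimes> y i = r i \<oplus> (Q \<otimes> a i \<oplus> Z \<otimes> b i)"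
      if i: "i < k" for i
    proof -
      show "x i \<in> carrier R" "y i \<in> carrier R" "r i \<in> carrier R" "a i \<in> carrier R" "b i \<in> carrier R"
        using xy cF R.free_mod_simps(1)[OF _ i] unfolding F_def by blast+
      show "Q \<otimes> x i \<oplus> Z \<otimes> y i = r i \<oplus> (Q \<otimes> a i \<oplus> Z \<otimes> b i)"
        using fun_cong[OF v(4), of i] i unfolding F_def d by (simp add: R.free_mod_simps)
    qed
    have "\<exists>z. fst z \<in> lin R [L [^] s, T [^] s] \<and> snd z \<in> lin R [L [^] s, T [^] s] \<and>
       (Z' \<ominus> L \<otimes> Z) \<otimes> (y i \<ominus> b i) \<ominus> (Q \<otimes> L \<otimes> fst z \<oplus> Z' \<otimes> snd z) \<in> lin R (as i)" if i: "i < k" for i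
    proof -
      obtain x1 y1 r1 a1 b1 where o: "x1 = x i" "y1 = y i" "r1 = r i" "a1 = a i" "b1 = b i" by blast
      have oc: "x1 \<in> carrier R" "y1 \<in> carrier R" "r1 \<in> carrier R" "a1 \<in> carrier R" "b1 \<in> carrier R"
        using comp[OF i] o by simp_all
      have "Z \<otimes> (y1 \<ominus> b1) = (Q \<otimes> x1 \<oplus> Z \<otimes> y1) \<ominus> Q \<otimes> x1 \<ominus> Z \<otimes> b1"
        using oc QR by algebra
      also have "\<dots> = Q \<otimes> (a1 \<ominus> x1) \<oplus> r1"
        unfolding o comp(6)[OF i] unfolding o[symmetric]
        using oc QR by algebra
      finally have "Z \<otimes> (y1 \<ominus> b1) \<in> lin R (Q # as i)"
        by (rule R.lin_ConsI[rotated 2]) (use oc ri[OF i] o in simp_all)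
      moreover have "n \<ge> h i" using hn2[OF i] n by simp
      ultimately obtain a3 b3 where "a3 \<in> lin R [L [^] s, T [^] s]" "b3 \<in> lin R [L [^] s, T [^] s]"
        "(Z' \<ominus> L \<otimes> Z) \<otimes> (y1 \<ominus> b1) \<ominus> (Q \<otimes> L \<otimes> a3 \<oplus> Z' \<otimes> b3) \<in> lin R (as i)"
        using h[rule_format, of i n "y1 \<ominus> b1"] i oc(2,5) unfolding QL d by auto
      then show ?thesis unfolding o by (intro exI[of _ "(a3, b3)"]) simp
    qed
    then have "\<forall>i\<in>{..<k}. \<exists>z. fst z \<in> lin R [L [^] s, T [^] s] \<and> snd z \<in> lin R [L [^] s, T [^] s] \<and>
       (Z' \<ominus> L \<otimes> Z) \<otimes> (y i \<ominus> b i) \<ominus> (Q \<otimes> L \<otimes> fst z \<oplus> Z' \<otimes> snd z) \<in> lin R (as i)" by blast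
    then obtain z where z: "\<forall>i\<in>{..<k}. fst (z i) \<in> lin R [L [^] s, T [^] s] \<and> snd (z i) \<in> lin R [L [^] s, T [^] s] \<and>
       (Z' \<ominus> L \<otimes> Z) \<otimes> (y i \<ominus> b i) \<ominus> (Q \<otimes> L \<otimes> fst (z i) \<oplus> Z' \<otimes> snd (z i)) \<in> lin R (as i)" 
      using bchoice by metis
    define a' b' where ab': "a' = (\<lambda>i\<in>{..<k}. fst (z i))" "b' = (\<lambda>i\<in>{..<k}. snd (z i))"
    have Vc: "lin R [L [^] s, T [^] s] \<subseteq> carrier R" by (rule R.lin_carrier) simp
    have c': "a' \<in> carrier F" "b' \<in> carrier F"
      unfolding ab' F_def by (rule R.free_mod_I; use z Vc in auto)+
    have Y': "a' \<in> Y" "b' \<in> Y" by (rule VY; use c' z in \<open>simp add: ab'\<close>)+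
    define u where "u = (L [^] Suc (Suc n)) \<odot>\<^bsub>F\<^esub> (a \<oplus>\<^bsub>F\<^esub> a') \<oplus>\<^bsub>F\<^esub> w (Suc n) \<odot>\<^bsub>F\<^esub> (b \<oplus>\<^bsub>F\<^esub> b')"
    have uF: "u \<in> carrier F" unfolding u_def using cF c' by simp
    define t where "t = (L [^] Suc (Suc n)) \<odot>\<^bsub>F\<^esub> x \<oplus>\<^bsub>F\<^esub> w (Suc n) \<odot>\<^bsub>F\<^esub> y"
    have tF: "t \<in> carrier F" unfolding t_def using xy by simp
    have "(t \<ominus>\<^bsub>F\<^esub> u) i \<in> lin R (as i)" if i: "i < k" for i
    proof -
      note I = R.idealD[OF R.lin_ideal[OF as[OF i]]]
      obtain x1 y1 r1 a1 b1 where o: "x1 = x i" "y1 = y i" "r1 = r i" "a1 = a i" "b1 = b i" by blast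
      have oc: "x1 \<in> carrier R" "y1 \<in> carrier R" "r1 \<in> carrier R" "a1 \<in> carrier R" "b1 \<in> carrier R"
        using comp[OF i] o by simp_all
      obtain a2 b2 where o2: "a2 = fst (z i)" "b2 = snd (z i)" by blast
      have oc2: "a2 \<in> carrier R" "b2 \<in> carrier R" using z Vc i o2 by auto
      have z1: "(Z' \<ominus> L \<otimes> Z) \<otimes> (y1 \<ominus> b1) \<ominus> (Q \<otimes> L \<otimes> a2 \<oplus> Z' \<otimes> b2) \<in> lin R (as i)" using z i o o2 by auto
      have "(t \<ominus>\<^bsub>F\<^esub> u) i = t i \<ominus> u i" using R.free_mod_minus(2)[OF uF[unfolded F_def] tF[unfolded F_def] i] by (simp add: F_def)
      also have "t i = Q \<otimes> L \<otimes> x1 \<oplus> Z' \<otimes> y1" unfolding t_def QL F_def by (simp add: R.free_mod_simps i o d)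
      also have "u i = Q \<otimes> L \<otimes> (a1 \<oplus> a2) \<oplus> Z' \<otimes> (b1 \<oplus> b2)"
        unfolding u_def QL F_def by (simp add: R.free_mod_simps i o o2 d ab')
      also have "(Q \<otimes> L \<otimes> x1 \<oplus> Z' \<otimes> y1) \<ominus> (Q \<otimes> L \<otimes> (a1 \<oplus> a2) \<oplus> Z' \<otimes> (b1 \<oplus> b2)) =
        L \<otimes> ((Q \<otimes> x1 \<oplus> Z \<otimes> y1) \<ominus> (Q \<otimes> a1 \<oplus> Z \<otimes> b1)) \<oplus> 
        ((Z' \<ominus> L \<otimes> Z) \<otimes> (y1 \<ominus> b1) \<ominus> (Q \<otimes> L \<otimes> a2 \<oplus> Z' \<otimes> b2))"
        using oc oc2 QR L_carrier by algebra
      also have "(Q \<otimes> x1 \<oplus> Z \<otimes> y1) \<ominus> (Q \<otimes> a1 \<oplus> Z \<otimes> b1) = r1"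
        unfolding o comp(6)[OF i] unfolding o[symmetric] using oc QR by algebra
      also have "L \<otimes> r1 \<oplus> ((Z' \<ominus> L \<otimes> Z) \<otimes> (y1 \<ominus> b1) \<ominus> (Q \<otimes> L \<otimes> a2 \<oplus> Z' \<otimes> b2)) \<in> lin R (as i)"
        by (rule I(4)[OF I(7)[OF _ L_carrier] z1]) (use ri[OF i] o in simp)
      finally show ?thesis .
    qed
    then have "t \<ominus>\<^bsub>F\<^esub> u \<in> N" using tF uF F.M.minus_closed by (simp add: N_def R.boxmod_def F_def)
    then have "sim t u" using tF uF by (simp add: sim_def)
    moreover have "u \<in> FI.nab (Suc n) Y" unfolding u_def FI.nab_iff using YD(4) v Y' by blast
    then have "u \<in> D (Suc n)" using F.msum_upper(2)[OF N FI.submodule_nab[OF Ysub]] unfolding D_def by blast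
    ultimately have "t \<in> D (Suc n)" using sim_mem[OF _ Ds ND'] by blast
    then show "(x, y) \<in> W (Suc n)" using xy by (simp add: W_def t_def)
  qed

  \<comment> \<open>W n need not be finite, so it is recorded by its image in the finite set (F / Y)
    x (F / Y). By \<open>Wsub\<close> this image determines it, since W n is closed under addition
    and contains Y x Y.\<close>
  let ?c = "\<lambda>(x, y). (Y +>\<^bsub>F\<^esub> x, Y +>\<^bsub>F\<^esub> y)"
  have "\<exists>n0\<ge>n2. \<forall>n\<ge>n0. ?c ` W n = ?c ` W n0"
  proof (rule incseq_finite_stable)
    show "finite (cosets F Y (carrier F) \<times> cosets F Y (carrier F))" using coker by simp
    show "?c ` W n \<subseteq> cosets F Y (carrier F) \<times> cosets F Y (carrier F)" for n by (auto simp: W_def cosets_def)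
    show "?c ` W n \<subseteq> ?c ` W (Suc n)" if "n \<ge> n2" for n using Winc[OF that] by blast
  qed
  then obtain n3 where n3: "n3 \<ge> n2" "\<And>n. n \<ge> n3 \<Longrightarrow> ?c ` W n = ?c ` W n3" by blast
  have Wlin: "(x \<oplus>\<^bsub>F\<^esub> x', y \<oplus>\<^bsub>F\<^esub> y') \<in> W n" if "(x, y) \<in> W n" "(x', y') \<in> W n" for x y x' y' n
  proof -
    have c: "x \<in> carrier F" "y \<in> carrier F" "x' \<in> carrier F" "y' \<in> carrier F" using that by (auto simp: W_def)
    have "(L [^] Suc n) \<odot>\<^bsub>F\<^esub> (x \<oplus>\<^bsub>F\<^esub> x') \<oplus>\<^bsub>F\<^esub> w n \<odot>\<^bsub>F\<^esub> (y \<oplus>\<^bsub>F\<^esub> y') =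
      ((L [^] Suc n) \<odot>\<^bsub>F\<^esub> x \<oplus>\<^bsub>F\<^esub> w n \<odot>\<^bsub>F\<^esub> y) \<oplus>\<^bsub>F\<^esub> ((L [^] Suc n) \<odot>\<^bsub>F\<^esub> x' \<oplus>\<^bsub>F\<^esub> w n \<odot>\<^bsub>F\<^esub> y')"
      using c by (simp add: F.smult_r_distr F.M.a_ac)
    then show ?thesis using that DD(4) c by (auto simp: W_def)
  qed
  have WY: "(x, y) \<in> W n" if "x \<in> Y" "y \<in> Y" for x y n
  proof -
    have "(L [^] Suc n) \<odot>\<^bsub>F\<^esub> x \<oplus>\<^bsub>F\<^esub> w n \<odot>\<^bsub>F\<^esub> y \<in> FI.nab n Y" using that unfolding FI.nab_iff by blast
    then have "(L [^] Suc n) \<odot>\<^bsub>F\<^esub> x \<oplus>\<^bsub>F\<^esub> w n \<odot>\<^bsub>F\<^esub> y \<in> D n"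
      using F.msum_upper(2)[OF N FI.submodule_nab[OF Ysub]] unfolding D_def by blast
    then show ?thesis using that YD by (auto simp: W_def)
  qed
  have Wsub: "W m \<subseteq> W n" if eq: "?c ` W m = ?c ` W n" for m n
  proof clarify
    fix x y assume xy: "(x, y) \<in> W m"
    then have "?c (x, y) \<in> ?c ` W n" using eq by blast
    then obtain x' y' where x': "(x', y') \<in> W n" "Y +>\<^bsub>F\<^esub> x = Y +>\<^bsub>F\<^esub> x'" "Y +>\<^bsub>F\<^esub> y = Y +>\<^bsub>F\<^esub> y'" by auto
    have c: "x \<in> carrier F" "y \<in> carrier F" "x' \<in> carrier F" "y' \<in> carrier F" using xy x' by (auto simp: W_def)
    have "x \<ominus>\<^bsub>F\<^esub> x' \<in> Y" "y \<ominus>\<^bsub>F\<^esub> y' \<in> Y"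
      using x'(2,3) c by (simp_all add: F.M.coset_eq_iff[OF YD(1)])
    then have "(x \<ominus>\<^bsub>F\<^esub> x', y \<ominus>\<^bsub>F\<^esub> y') \<in> W n" by (rule WY)
    from Wlin[OF this x'(1)] show "(x, y) \<in> W n" using c by (simp add: F.M.minus_minus_cancel)
  qed
  have Weq: "W n = W n3" if "n \<ge> n3" for n using Wsub n3(2)[OF that] by blast

  let ?f = "\<lambda>n (x, y). D n +>\<^bsub>F\<^esub> ((L [^] Suc n) \<odot>\<^bsub>F\<^esub> x \<oplus>\<^bsub>F\<^esub> w n \<odot>\<^bsub>F\<^esub> y)"
  \<comment> \<open>H n / D n is the image of F x F under (x, y) |-> L^(n+1) x + w n y, and by
    \<open>feq\<close> the kernel is W n. Stability of W n thus means stability of (H n : D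
    n).\<close>
  have DHimg: "cosets F (D n) (H n) = ?f n ` (carrier F \<times> carrier F)" for n
  proof (intro equalityI subsetI)
    fix c assume "c \<in> cosets F (D n) (H n)"
    then obtain r x y where r: "r \<in> N" "x \<in> carrier F" "y \<in> carrier F"
      "c = D n +>\<^bsub>F\<^esub> (r \<oplus>\<^bsub>F\<^esub> ((L [^] Suc n) \<odot>\<^bsub>F\<^esub> x \<oplus>\<^bsub>F\<^esub> w n \<odot>\<^bsub>F\<^esub> y))"
      by (auto simp: cosets_def H_def msum_def FI.nab_iff)
    let ?z = "(L [^] Suc n) \<odot>\<^bsub>F\<^esub> x \<oplus>\<^bsub>F\<^esub> w n \<odot>\<^bsub>F\<^esub> y"
    have zF: "?z \<in> carrier F" "r \<in> carrier F" using r ND by auto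
    have "(r \<oplus>\<^bsub>F\<^esub> ?z) \<ominus>\<^bsub>F\<^esub> ?z = r" using zF by (simp only: F.M.minus_minus_cancel)
    then have "c = D n +>\<^bsub>F\<^esub> ?z" unfolding r(4)
      by (subst F.M.coset_eq_iff[OF DD(1)]) (use zF r(1) ND' in auto)
    then show "c \<in> ?f n ` (carrier F \<times> carrier F)" using r by auto
  next
    fix c assume "c \<in> ?f n ` (carrier F \<times> carrier F)"
    then obtain x y where x: "x \<in> carrier F" "y \<in> carrier F"
      "c = D n +>\<^bsub>F\<^esub> ((L [^] Suc n) \<odot>\<^bsub>F\<^esub> x \<oplus>\<^bsub>F\<^esub> w n \<odot>\<^bsub>F\<^esub> y)" by auto
    then have "(L [^] Suc n) \<odot>\<^bsub>F\<^esub> x \<oplus>\<^bsub>F\<^esub> w n \<odot>\<^bsub>F\<^esub> y \<in> FI.nab n (carrier F)" unfolding FI.nab_iff by blast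
    then have "(L [^] Suc n) \<odot>\<^bsub>F\<^esub> x \<oplus>\<^bsub>F\<^esub> w n \<odot>\<^bsub>F\<^esub> y \<in> H n"
      using F.msum_upper(2)[OF N FI.submodule_nab[OF F.submodule_carrier]] unfolding H_def by blast
    then show "c \<in> cosets F (D n) (H n)" using x by (auto simp: cosets_def)
  qed
  have feq: "?f n (x, y) = ?f n (x', y') \<longleftrightarrow> (x \<ominus>\<^bsub>F\<^esub> x', y \<ominus>\<^bsub>F\<^esub> y') \<in> W n"
    if "x \<in> carrier F" "y \<in> carrier F" "x' \<in> carrier F" "y' \<in> carrier F" for x y x' y' n
  proof -
    have "((L [^] Suc n) \<odot>\<^bsub>F\<^esub> x \<oplus>\<^bsub>F\<^esub> w n \<odot>\<^bsub>F\<^esub> y) \<ominus>\<^bsub>F\<^esub> ((L [^] Suc n) \<odot>\<^bsub>F\<^esub> x' \<oplus>\<^bsub>F\<^esub> w n \<odot>\<^bsub>F\<^esub> y')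
     = (L [^] Suc n) \<odot>\<^bsub>F\<^esub> (x \<ominus>\<^bsub>F\<^esub> x') \<oplus>\<^bsub>F\<^esub> w n \<odot>\<^bsub>F\<^esub> (y \<ominus>\<^bsub>F\<^esub> y')"
      using that by (simp add: F.smult_minus_r) (simp add: a_minus_def[of F] F.M.minus_add F.M.a_ac)
    then show ?thesis using that by (simp add: F.M.coset_eq_iff[OF DD(1)] W_def)
  qed
  have idx2: "index F (D n) (H n) = index F (D n3) (H n3)" if n: "n \<ge> n3" for n
    unfolding index_def DHimg
  proof (rule card_images_eq)
    fix z z' assume z: "z \<in> carrier F \<times> carrier F" "z' \<in> carrier F \<times> carrier F"
    obtain x y x' y' where zz: "z = (x, y)" "z' = (x', y')" by (cases z, cases z') blast
    have c: "x \<in> carrier F" "y \<in> carrier F" "x' \<in> carrier F" "y' \<in> carrier F" using z zz by auto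
    show "?f n z = ?f n z' \<longleftrightarrow> ?f n3 z = ?f n3 z'"
      unfolding zz feq[OF c] Weq[OF n] ..
  qed
  have fin2: "finite (cosets F (D n) (H n))" for n
    unfolding DHimg
  proof (rule finite_image_coarser)
    show "finite (?c ` (carrier F \<times> carrier F))"
      by (rule finite_subset[of _ "cosets F Y (carrier F) \<times> cosets F Y (carrier F)"])
        (use coker in \<open>auto simp: cosets_def\<close>)
    fix z z' assume z: "z \<in> carrier F \<times> carrier F" "z' \<in> carrier F \<times> carrier F" "?c z = ?c z'"
    obtain x y x' y' where zz: "z = (x, y)" "z' = (x', y')" by (cases z, cases z') blast
    have c: "x \<in> carrier F" "y \<in> carrier F" "x' \<in> carrier F" "y' \<in> carrier F" using z zz by auto
    have "(x \<ominus>\<^bsub>F\<^esub> x', y \<ominus>\<^bsub>F\<^esub> y') \<in> W n"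
      by (rule WY) (use z(3) zz c F.M.coset_eq_iff[OF YD(1)] in auto)
    then show "?f n z = ?f n z'" using feq[OF c] zz by simp
  qed

  have finD: "finite (cosets F (D n) (carrier F))" for n using towH(2) finH fin2 by blast
  have finX: "finite (cosets M (XX n) (carrier M))" for n using towM(2) MY towY(2) finD fin1 by blast
  have pos: "index F Y (carrier F) > 0" "index M (XX n1) (P n1) > 0" "index F (D n3) (H n3) > 0"
    using F.M.index_pos[OF coker] M.index_pos[OF fin1] F.M.index_pos[OF fin2]
      submoduleD(3)[OF Ps] F.submoduleD(3)[OF Hs] F.M.zero_closed by blast+
  define c where "c = real (index F (D n3) (H n3)) * real (index M (XX n1) (P n1)) / real (index F Y (carrier F))"
  have cpos: "c > 0" using pos by (simp add: c_def)
  have main: "real (index M (XX n) (carrier M)) =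
      c * (\<Prod>i<k. real (index R (lin R (L [^] Suc n # w n # as i)) (carrier R)))" if n: "n \<ge> n1 + n3" for n
  proof -
    have "real (index F Y (carrier F)) * real (index F (D n) Y) =
      real (index F (H n) (carrier F)) * real (index F (D n3) (H n3))"
    proof -
      have "n \<ge> n3" using n by simp
      then have "index F Y (carrier F) * index F (D n) Y = index F (H n) (carrier F) * index F (D n3) (H n3)"
        using towH(1)[of n] towY(1)[of n] idx2[of n] by simp
      from arg_cong[OF this, of real] show ?thesis by simp
    qed
    then have "real (index F (D n) Y) = real (index F (H n) (carrier F)) * real (index F (D n3) (H n3)) / real (index F Y (carrier F))"
      using pos by (simp add: field_simps)
    moreover have "real (index M (XX n) (carrier M)) = real (index F (D n) Y) * real (index M (XX n1) (P n1))"
      using towM(1)[of n] MY[of n] idx1[of n] n by simp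
    ultimately show ?thesis using idxH[of n] by (simp add: c_def)
  qed
  show ?thesis
  proof (intro exI[of _ c] exI[of _ "n1 + n3"] conjI allI impI)
    fix n assume n: "n1 + n3 \<le> n"
    show "finite (cosets M (nab n (carrier M)) (carrier M))" using finX unfolding XX_def .
    show "real (index M (nab n (carrier M)) (carrier M)) =
      c * (\<Prod>i<k. real (index R (lin R (L [^] Suc n # w n # as i)) (carrier R)))"
      using main[OF n] unfolding XX_def .
  qed (rule cpos)
qed

end

section \<open>The completed group ring\<close>

text \<open>Coefficients at precision m = l^k are compared inside \<open>int fps\<close>. There the
  multiplication is exact and only equality is relaxed to congruence, so ring laws come for
  free.\<close>

definition fcong :: "int \<Rightarrow> int fps \<Rightarrow> int fps \<Rightarrow> bool" where
  "fcong m a b \<longleftrightarrow> fps_const m dvd a - b"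

lemma fcong_iff: "fcong m a b \<longleftrightarrow> (\<forall>i. fps_nth a i mod m = fps_nth b i mod m)"
proof
  assume "fcong m a b"
  then obtain c where c: "a - b = fps_const m * c" by (auto simp: fcong_def dvd_def)
  have "fps_nth a i - fps_nth b i = m * fps_nth c i" for i using arg_cong[OF c, of "\<lambda>f. fps_nth f i"] by simp
  then show "\<forall>i. fps_nth a i mod m = fps_nth b i mod m" by (metis mod_eq_dvd_iff dvd_triv_left)
next
  assume "\<forall>i. fps_nth a i mod m = fps_nth b i mod m"
  then have "a - b = fps_const m * Abs_fps (\<lambda>i. (fps_nth a i - fps_nth b i) div m)"
    by (intro fps_ext) (simp add: mod_eq_dvd_iff)
  then show "fcong m a b" unfolding fcong_def by (metis dvd_triv_left)
qed

lemma fcong_refl: "fcong m a a" by (simp add: fcong_iff)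
lemma fcong_sym: "fcong m a b \<Longrightarrow> fcong m b a" by (simp add: fcong_iff)
lemma fcong_trans: "fcong m a b \<Longrightarrow> fcong m b c \<Longrightarrow> fcong m a c" by (simp add: fcong_iff)

lemma fcong_mult: "fcong m a a' \<Longrightarrow> fcong m b b' \<Longrightarrow> fcong m (a * b) (a' * b')"
proof -
  assume "fcong m a a'" "fcong m b b'"
  then have "fps_const m dvd (a - a') * b + a' * (b - b')" by (auto simp: fcong_def intro: dvd_add dvd_mult dvd_mult2)
  also have "(a - a') * b + a' * (b - b') = a * b - a' * b'" by (simp add: algebra_simps)
  finally show ?thesis by (simp add: fcong_def)
qed

lemma fcong_sum: "(\<And>x. x \<in> A \<Longrightarrow> fcong m (f x) (g x)) \<Longrightarrow> fcong m (sum f A) (sum g A)"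
  unfolding fcong_def by (auto simp: sum_subtractf[symmetric] intro: dvd_sum)

lemma Zl_sel:
  "carrier (Zl l) = {a. \<forall>k. 0 \<le> a k \<and> a k < int l ^ k \<and> a (Suc k) mod int l ^ k = a k}"
  "(a \<oplus>\<^bsub>Zl l\<^esub> b) k = (a k + b k) mod int l ^ k"
  "(a \<otimes>\<^bsub>Zl l\<^esub> b) k = (a k * b k) mod int l ^ k"
  "\<one>\<^bsub>Zl l\<^esub> k = 1 mod int l ^ k" "\<zero>\<^bsub>Zl l\<^esub> k = 0"
  by (simp_all add: Zl_def)

locale ladic =
  fixes l :: nat
  assumes prime_l: "Factorial_Ring.prime l"
begin

lemma l_gt_1: "l > 1" using prime_l prime_gt_1_nat by blast

lemma lpow_pos [simp]: "int l ^ k > 0" using l_gt_1 by simp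

lemma Zl_mem_iff: "a \<in> carrier (Zl l) \<longleftrightarrow> (\<forall>k. a k mod int l ^ k = a k \<and> a (Suc k) mod int l ^ k = a k)"
proof -
  have "0 \<le> a k \<and> a k < int l ^ k \<longleftrightarrow> a k mod int l ^ k = a k" for k
    using lpow_pos[of k] by (metis mod_pos_pos_trivial pos_mod_bound pos_mod_sign)
  then show ?thesis by (auto simp: Zl_sel)
qed

lemma Zl_mod [simp]: "a \<in> carrier (Zl l) \<Longrightarrow> a k mod int l ^ k = a k"
  by (simp add: Zl_mem_iff)

lemma Zl_Suc: "a \<in> carrier (Zl l) \<Longrightarrow> a (Suc k) mod int l ^ k = a k"
  by (simp add: Zl_mem_iff)

lemma Zl_le:
  assumes "a \<in> carrier (Zl l)" "j \<le> k"
  shows "a k mod int l ^ j = a j"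
  using assms(2)
proof (induction k rule: dec_induct)
  case (step k)
  have "a (Suc k) mod int l ^ j = a (Suc k) mod int l ^ k mod int l ^ j"
    using step.hyps by (simp add: mod_mod_cancel le_imp_power_dvd)
  then show ?case using step.IH Zl_Suc[OF assms(1)] by simp
qed (simp add: assms)

text \<open>Operations on \<open>Zl\<close> reduce a sequence of integers level by level. The result
  is compatible as soon as the unreduced sequence is, so closure under the operations becomes a
  congruence between consecutive levels.\<close>

lemma Zl_memI:
  assumes "\<And>k. h (Suc k) mod int l ^ k = h k mod int l ^ k"
  shows "(\<lambda>k. h k mod int l ^ k) \<in> carrier (Zl l)"
proof -
  have "h (Suc k) mod int l ^ Suc k mod int l ^ k = h k mod int l ^ k" for k
    using assms by (subst mod_mod_cancel) auto
  then show ?thesis by (simp add: Zl_mem_iff)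
qed

lemma sum_first:
  fixes f :: "nat \<Rightarrow> int" shows "(\<Sum>j\<le>i. (if j = 0 then c else 0) * f j) = c * f 0"
proof -
  have "(\<Sum>j\<le>i. (if j = 0 then c else 0) * f j) = (\<Sum>j\<le>i. if j = 0 then c * f j else 0)"
    by (rule sum.cong) auto
  then show ?thesis by simp
qed

lemma Zl_cring: "cring (Zl l)"
proof (rule cringI)
  have add: "a \<oplus>\<^bsub>Zl l\<^esub> b \<in> carrier (Zl l)" if "a \<in> carrier (Zl l)" "b \<in> carrier (Zl l)" for a b
  proof -
    have "(\<lambda>k. (a k + b k) mod int l ^ k) \<in> carrier (Zl l)"
      by (rule Zl_memI) (metis that Zl_Suc mod_add_eq)
    then show ?thesis by (simp add: Zl_def)
  qed
  have mult: "a \<otimes>\<^bsub>Zl l\<^esub> b \<in> carrier (Zl l)" if "a \<in> carrier (Zl l)" "b \<in> carrier (Zl l)" for a b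
  proof -
    have "(\<lambda>k. (a k * b k) mod int l ^ k) \<in> carrier (Zl l)"
      by (rule Zl_memI) (metis that Zl_Suc mod_mult_eq)
    then show ?thesis by (simp add: Zl_def)
  qed
  have neg: "(\<lambda>k. (- a k) mod int l ^ k) \<in> carrier (Zl l)" if "a \<in> carrier (Zl l)" for a
    by (rule Zl_memI) (metis that Zl_Suc mod_minus_eq)
  have zero: "\<zero>\<^bsub>Zl l\<^esub> \<in> carrier (Zl l)" by (simp add: Zl_mem_iff Zl_sel(5))
  show "abelian_group (Zl l)"
  proof (rule abelian_groupI)
    fix a assume a: "a \<in> carrier (Zl l)"
    have "(\<lambda>k. (- a k) mod int l ^ k) \<oplus>\<^bsub>Zl l\<^esub> a = \<zero>\<^bsub>Zl l\<^esub>"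
      by (rule ext) (simp add: Zl_sel mod_add_left_eq)
    then show "\<exists>b\<in>carrier (Zl l). b \<oplus>\<^bsub>Zl l\<^esub> a = \<zero>\<^bsub>Zl l\<^esub>" using neg[OF a] by blast
  qed (use add zero in \<open>auto simp: fun_eq_iff Zl_sel(2-5) mod_simps ac_simps\<close>)
  have one: "\<one>\<^bsub>Zl l\<^esub> \<in> carrier (Zl l)" using Zl_memI[of "\<lambda>_. 1"] by (simp add: Zl_def)
  show "comm_monoid (Zl l)"
    by (rule comm_monoidI) (use mult one in \<open>auto simp: fun_eq_iff Zl_sel(2-5) mod_simps ac_simps\<close>)
  show "(a \<oplus>\<^bsub>Zl l\<^esub> b) \<otimes>\<^bsub>Zl l\<^esub> c = a \<otimes>\<^bsub>Zl l\<^esub> c \<oplus>\<^bsub>Zl l\<^esub> b \<otimes>\<^bsub>Zl l\<^esub> c" for a b c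
    by (simp add: fun_eq_iff Zl_sel(2-5) mod_simps algebra_simps)
qed

sublocale Zl: cring "Zl l" by (rule Zl_cring)

lemma finsum_Zl:
  assumes "finite A" "f \<in> A \<rightarrow> carrier (Zl l)"
  shows "finsum (Zl l) f A k = (\<Sum>a\<in>A. f a k) mod int l ^ k"
  using assms
proof (induction A rule: finite_induct)
  case (insert a A)
  then show ?case by (simp add: Zl_sel mod_simps Pi_iff)
qed (simp add: Zl_sel)

lemma PS_sel:
  "f \<in> carrier (PS l) \<longleftrightarrow> (\<forall>i. f i \<in> carrier (Zl l))"
  "(f \<oplus>\<^bsub>PS l\<^esub> g) i = f i \<oplus>\<^bsub>Zl l\<^esub> g i" "\<zero>\<^bsub>PS l\<^esub> i = \<zero>\<^bsub>Zl l\<^esub>"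
  "\<one>\<^bsub>PS l\<^esub> i = (if i = 0 then \<one>\<^bsub>Zl l\<^esub> else \<zero>\<^bsub>Zl l\<^esub>)"
  by (simp_all add: PS_def)

lemma PS_mult_closed: "f \<in> carrier (PS l) \<Longrightarrow> g \<in> carrier (PS l) \<Longrightarrow> f \<otimes>\<^bsub>PS l\<^esub> g \<in> carrier (PS l)"
  by (auto simp: PS_def intro!: Zl.finsum_closed)

lemma PS_mult:
  assumes "f \<in> carrier (PS l)" "g \<in> carrier (PS l)"
  shows "(f \<otimes>\<^bsub>PS l\<^esub> g) i k = (\<Sum>j\<le>i. f j k * g (i - j) k) mod int l ^ k"
proof -
  have "(f \<otimes>\<^bsub>PS l\<^esub> g) i k = (\<Sum>j\<le>i. (f j k * g (i - j) k) mod int l ^ k) mod int l ^ k"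
    using assms by (simp add: PS_def finsum_Zl Pi_iff Zl_sel(3))
  then show ?thesis by (simp add: mod_sum_eq)
qed

text \<open>Addition gives meaning to the finite sums in the product of \<open>GR\<close>; the
  multiplicative laws are proved for the whole group ring at once, through
  \<open>conv\<close>.\<close>

lemma PS_abelian_monoid: "abelian_monoid (PS l)"
  by (rule abelian_monoidI) (auto simp: PS_sel Zl.a_ac fun_eq_iff[where 'a = nat and 'b = "nat \<Rightarrow> int"])

sublocale PS: abelian_monoid "PS l" by (rule PS_abelian_monoid)

lemma finsum_PS:
  assumes "finite A" "f \<in> A \<rightarrow> carrier (PS l)"
  shows "finsum (PS l) f A i k = (\<Sum>a\<in>A. f a i k) mod int l ^ k"
  using assms
proof (induction A rule: finite_induct)
  case (insert a A)
  then show ?case by (simp add: PS_sel Zl_sel mod_simps Pi_iff)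
qed (simp add: PS_sel Zl_sel)

end

section \<open>The ring structure of the completed group ring\<close>

locale ladic_group_ring = ladic l + G: comm_group G
  for l and G :: "'g monoid" +
  assumes finite_G: "finite (carrier G)" and coprime_l: "coprime (card (carrier G)) l"
begin

abbreviation R :: "'g LD ring" where "R \<equiv> GR l G"

lemma GR_mem_iff: "x \<in> carrier R \<longleftrightarrow> x \<in> extensional (carrier G) \<and> (\<forall>g\<in>carrier G. \<forall>i. x g i \<in> carrier (Zl l))"
  by (auto simp: GR_def PiE_iff PS_sel)

lemma GR_coeff: "x \<in> carrier R \<Longrightarrow> g \<in> carrier G \<Longrightarrow> x g i \<in> carrier (Zl l)"
  by (simp add: GR_mem_iff)

lemma GR_coeff_mod [simp]: "x \<in> carrier R \<Longrightarrow> g \<in> carrier G \<Longrightarrow> x g i k mod int l ^ k = x g i k"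
  using GR_coeff Zl_mod by blast

lemma GR_eqI:
  assumes "x \<in> carrier R" "y \<in> carrier R" "\<And>g i k. g \<in> carrier G \<Longrightarrow> x g i k = y g i k"
  shows "x = y"
  by (rule extensionalityI[of _ "carrier G"]) (use assms in \<open>auto simp: GR_mem_iff fun_eq_iff\<close>)

lemma GR_add: "g \<in> carrier G \<Longrightarrow> (x \<oplus>\<^bsub>R\<^esub> y) g i k = (x g i k + y g i k) mod int l ^ k"
  by (simp add: GR_def PS_sel Zl_sel)

lemma GR_zero: "g \<in> carrier G \<Longrightarrow> \<zero>\<^bsub>R\<^esub> g i k = 0"
  by (simp add: GR_def PS_sel Zl_sel)

lemma GR_one: "g \<in> carrier G \<Longrightarrow> \<one>\<^bsub>R\<^esub> g i k = (if g = \<one>\<^bsub>G\<^esub> \<and> i = 0 then 1 mod int l ^ k else 0)"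
  by (simp add: GR_def PS_sel Zl_sel)

lemma GR_mult:
  assumes "x \<in> carrier R" "y \<in> carrier R" "g \<in> carrier G"
  shows "(x \<otimes>\<^bsub>R\<^esub> y) g i k =
    (\<Sum>h\<in>carrier G. \<Sum>j\<le>i. x h j k * y (inv\<^bsub>G\<^esub> h \<otimes>\<^bsub>G\<^esub> g) (i - j) k) mod int l ^ k"
proof -
  have xy: "x h \<in> carrier (PS l)" "y (inv\<^bsub>G\<^esub> h \<otimes>\<^bsub>G\<^esub> g) \<in> carrier (PS l)" if "h \<in> carrier G" for h
    using assms that by (auto simp: PS_sel GR_mem_iff)
  have "(x \<otimes>\<^bsub>R\<^esub> y) g i k = finsum (PS l) (\<lambda>h. x h \<otimes>\<^bsub>PS l\<^esub> y (inv\<^bsub>G\<^esub> h \<otimes>\<^bsub>G\<^esub> g)) (carrier G) i k"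
    using assms by (simp add: GR_def)
  also have "\<dots> = (\<Sum>h\<in>carrier G. (x h \<otimes>\<^bsub>PS l\<^esub> y (inv\<^bsub>G\<^esub> h \<otimes>\<^bsub>G\<^esub> g)) i k) mod int l ^ k"
    by (rule finsum_PS[OF finite_G]) (use xy PS_mult_closed in auto)
  also have "\<dots> = (\<Sum>h\<in>carrier G. (\<Sum>j\<le>i. x h j k * y (inv\<^bsub>G\<^esub> h \<otimes>\<^bsub>G\<^esub> g) (i - j) k) mod int l ^ k) mod int l ^ k"
    using xy by (simp add: PS_mult)
  finally show ?thesis by (simp add: mod_sum_eq)
qed

text \<open>At a fixed precision \<open>l ^ k\<close> the ring operations are those of the group ring of \<open>G\<close> over
  integral power series, up to congruence modulo \<open>l ^ k\<close>.\<close>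

definition lev :: "'g LD \<Rightarrow> nat \<Rightarrow> 'g \<Rightarrow> int fps" where "lev x k g = Abs_fps (\<lambda>i. x g i k)"

definition conv :: "('g \<Rightarrow> int fps) \<Rightarrow> ('g \<Rightarrow> int fps) \<Rightarrow> 'g \<Rightarrow> int fps" where
  "conv a b g = (\<Sum>h\<in>carrier G. a h * b (inv\<^bsub>G\<^esub> h \<otimes>\<^bsub>G\<^esub> g))"

lemma lev_mult:
  assumes "x \<in> carrier R" "y \<in> carrier R" "g \<in> carrier G"
  shows "fcong (int l ^ k) (lev (x \<otimes>\<^bsub>R\<^esub> y) k g) (conv (lev x k) (lev y k) g)"
  using assms by (simp add: fcong_iff lev_def conv_def GR_mult fps_sum_nth fps_mult_nth atLeast0AtMost)

lemma conv_cong: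
  assumes "\<And>g. g \<in> carrier G \<Longrightarrow> fcong m (a g) (a' g)" "\<And>g. g \<in> carrier G \<Longrightarrow> fcong m (b g) (b' g)"
    and "g \<in> carrier G"
  shows "fcong m (conv a b g) (conv a' b' g)"
  unfolding conv_def by (rule fcong_sum, rule fcong_mult) (use assms in auto)

lemma G_cancel:
  assumes "a \<in> carrier G" "b \<in> carrier G"
  shows "a \<otimes>\<^bsub>G\<^esub> (inv\<^bsub>G\<^esub> a \<otimes>\<^bsub>G\<^esub> b) = b" "inv\<^bsub>G\<^esub> a \<otimes>\<^bsub>G\<^esub> (a \<otimes>\<^bsub>G\<^esub> b) = b"
    "inv\<^bsub>G\<^esub> (inv\<^bsub>G\<^esub> a \<otimes>\<^bsub>G\<^esub> b) \<otimes>\<^bsub>G\<^esub> b = a"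
proof -
  show "a \<otimes>\<^bsub>G\<^esub> (inv\<^bsub>G\<^esub> a \<otimes>\<^bsub>G\<^esub> b) = b" "inv\<^bsub>G\<^esub> a \<otimes>\<^bsub>G\<^esub> (a \<otimes>\<^bsub>G\<^esub> b) = b"
    using assms by (simp_all add: G.m_assoc[symmetric])
  have "inv\<^bsub>G\<^esub> (inv\<^bsub>G\<^esub> a \<otimes>\<^bsub>G\<^esub> b) = inv\<^bsub>G\<^esub> b \<otimes>\<^bsub>G\<^esub> a"
    using assms by (simp add: G.inv_mult_group)
  then show "inv\<^bsub>G\<^esub> (inv\<^bsub>G\<^esub> a \<otimes>\<^bsub>G\<^esub> b) \<otimes>\<^bsub>G\<^esub> b = a"
    using assms by (simp add: G.m_comm[of _ b] G.m_assoc[symmetric])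
qed

text \<open>The two sums are exchanged and the inner variable is substituted by h = u t.\<close>

lemma conv_assoc:
  assumes "g \<in> carrier G" shows "conv (conv a b) c g = conv a (conv b c) g"
proof -
  let ?G = "carrier G"
  have "conv (conv a b) c g = (\<Sum>h\<in>?G. \<Sum>u\<in>?G. a u * b (inv\<^bsub>G\<^esub> u \<otimes>\<^bsub>G\<^esub> h) * c (inv\<^bsub>G\<^esub> h \<otimes>\<^bsub>G\<^esub> g))"
    by (simp add: conv_def sum_distrib_right)
  also have "\<dots> = (\<Sum>u\<in>?G. \<Sum>h\<in>?G. a u * b (inv\<^bsub>G\<^esub> u \<otimes>\<^bsub>G\<^esub> h) * c (inv\<^bsub>G\<^esub> h \<otimes>\<^bsub>G\<^esub> g))"
    by (rule sum.swap)
  also have "\<dots> = (\<Sum>u\<in>?G. \<Sum>t\<in>?G. a u * b t * c (inv\<^bsub>G\<^esub> t \<otimes>\<^bsub>G\<^esub> (inv\<^bsub>G\<^esub> u \<otimes>\<^bsub>G\<^esub> g)))"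
  proof (rule sum.cong[OF refl])
    fix u assume u: "u \<in> ?G"
    show "(\<Sum>h\<in>?G. a u * b (inv\<^bsub>G\<^esub> u \<otimes>\<^bsub>G\<^esub> h) * c (inv\<^bsub>G\<^esub> h \<otimes>\<^bsub>G\<^esub> g))
      = (\<Sum>t\<in>?G. a u * b t * c (inv\<^bsub>G\<^esub> t \<otimes>\<^bsub>G\<^esub> (inv\<^bsub>G\<^esub> u \<otimes>\<^bsub>G\<^esub> g)))"
      by (rule sum.reindex_bij_witness[of _ "\<lambda>t. u \<otimes>\<^bsub>G\<^esub> t" "\<lambda>h. inv\<^bsub>G\<^esub> u \<otimes>\<^bsub>G\<^esub> h"])
        (use u assms in \<open>simp_all add: G_cancel G.inv_mult_group G.m_assoc\<close>)
  qed
  also have "\<dots> = conv a (conv b c) g"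
    by (simp add: conv_def sum_distrib_left mult.assoc)
  finally show ?thesis .
qed

lemma conv_comm:
  assumes "g \<in> carrier G" shows "conv a b g = conv b a g"
  unfolding conv_def
  by (rule sum.reindex_bij_witness[of _ "\<lambda>h. inv\<^bsub>G\<^esub> h \<otimes>\<^bsub>G\<^esub> g" "\<lambda>h. inv\<^bsub>G\<^esub> h \<otimes>\<^bsub>G\<^esub> g"])
    (use assms in \<open>simp_all add: G_cancel mult.commute\<close>)

lemma GR_eq_levI:
  assumes "x \<in> carrier R" "y \<in> carrier R" "\<And>k g. g \<in> carrier G \<Longrightarrow> fcong (int l ^ k) (lev x k g) (lev y k g)"
  shows "x = y"
  by (rule GR_eqI[OF assms(1,2)]) (use assms in \<open>simp add: fcong_iff lev_def\<close>)

lemma GR_mult_closed: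
  assumes "x \<in> carrier R" "y \<in> carrier R" shows "x \<otimes>\<^bsub>R\<^esub> y \<in> carrier R"
proof -
  have "finsum (PS l) (\<lambda>h. x h \<otimes>\<^bsub>PS l\<^esub> y (inv\<^bsub>G\<^esub> h \<otimes>\<^bsub>G\<^esub> g)) (carrier G) \<in> carrier (PS l)" if "g \<in> carrier G" for g
    by (rule PS.finsum_closed) (use assms that PS_mult_closed in \<open>auto simp: GR_mem_iff PS_sel(1)\<close>)
  then show ?thesis by (simp add: GR_def)
qed

text \<open>Associativity, commutativity and distributivity hold at each precision l^k up to
  congruence, because by \<open>lev_mult\<close> they become laws of \<open>conv\<close> there.
  Since coefficients are reduced representatives, congruence at every precision is equality.\<close>

lemma GR_cring: "cring R"
proof (rule cringI)
  have add: "x \<oplus>\<^bsub>R\<^esub> y \<in> carrier R" if "x \<in> carrier R" "y \<in> carrier R" for x y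
    using that by (auto simp: GR_def PS_sel)
  have zero: "\<zero>\<^bsub>R\<^esub> \<in> carrier R" by (auto simp: GR_def PS_sel)
  show "abelian_group R"
  proof (rule abelian_groupI)
    fix x y z assume x: "x \<in> carrier R" and y: "y \<in> carrier R" and z: "z \<in> carrier R"
    show "x \<oplus>\<^bsub>R\<^esub> y \<oplus>\<^bsub>R\<^esub> z = x \<oplus>\<^bsub>R\<^esub> (y \<oplus>\<^bsub>R\<^esub> z)"
      by (rule GR_eqI) (use x y z add in \<open>simp_all add: GR_add mod_simps add.assoc\<close>)
    show "x \<oplus>\<^bsub>R\<^esub> y = y \<oplus>\<^bsub>R\<^esub> x"
      by (rule GR_eqI) (use x y add in \<open>simp_all add: GR_add add.commute\<close>)
    show "\<zero>\<^bsub>R\<^esub> \<oplus>\<^bsub>R\<^esub> x = x"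
      by (rule GR_eqI) (use x zero add in \<open>simp_all add: GR_add GR_zero\<close>)
    let ?y = "\<lambda>g\<in>carrier G. \<lambda>i. \<ominus>\<^bsub>Zl l\<^esub> x g i"
    have yR: "?y \<in> carrier R" using x by (auto simp: GR_mem_iff)
    have "(\<ominus>\<^bsub>Zl l\<^esub> a) k = (- a k) mod int l ^ k" if a: "a \<in> carrier (Zl l)" for a k
    proof -
      have "((\<ominus>\<^bsub>Zl l\<^esub> a) k + a k) mod int l ^ k = 0"
        using fun_cong[OF Zl.l_neg[OF a], of k] by (simp add: Zl_sel(2,5))
      then have "(\<ominus>\<^bsub>Zl l\<^esub> a) k mod int l ^ k = (- a k) mod int l ^ k"
        by (simp add: mod_eq_dvd_iff mod_0_imp_dvd)
      then show ?thesis using a by simp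
    qed
    then have "?y \<oplus>\<^bsub>R\<^esub> x = \<zero>\<^bsub>R\<^esub>"
      by (intro GR_eqI) (use x yR zero add in \<open>simp_all add: GR_add GR_zero GR_coeff mod_simps\<close>)
    then show "\<exists>y\<in>carrier R. y \<oplus>\<^bsub>R\<^esub> x = \<zero>\<^bsub>R\<^esub>" using yR by blast
  qed (use add zero in auto)
  then interpret A: abelian_group R .
  have one: "\<one>\<^bsub>R\<^esub> \<in> carrier R" by (auto simp: GR_def PS_sel)
  show "comm_monoid R"
  proof (rule comm_monoidI)
    fix x y z assume x: "x \<in> carrier R" and y: "y \<in> carrier R" and z: "z \<in> carrier R"
    show "x \<otimes>\<^bsub>R\<^esub> y \<otimes>\<^bsub>R\<^esub> z = x \<otimes>\<^bsub>R\<^esub> (y \<otimes>\<^bsub>R\<^esub> z)"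
    proof (rule GR_eq_levI)
      fix k g assume g: "g \<in> carrier G"
      have 1: "fcong (int l ^ k) (lev (x \<otimes>\<^bsub>R\<^esub> y \<otimes>\<^bsub>R\<^esub> z) k g) (conv (conv (lev x k) (lev y k)) (lev z k) g)"
        by (rule fcong_trans[OF lev_mult conv_cong[OF lev_mult]]) (use x y z g GR_mult_closed fcong_refl in auto)
      have 2: "fcong (int l ^ k) (lev (x \<otimes>\<^bsub>R\<^esub> (y \<otimes>\<^bsub>R\<^esub> z)) k g) (conv (lev x k) (conv (lev y k) (lev z k)) g)"
        by (rule fcong_trans[OF lev_mult conv_cong[OF _ lev_mult]]) (use x y z g GR_mult_closed fcong_refl in auto)
      show "fcong (int l ^ k) (lev (x \<otimes>\<^bsub>R\<^esub> y \<otimes>\<^bsub>R\<^esub> z) k g) (lev (x \<otimes>\<^bsub>R\<^esub> (y \<otimes>\<^bsub>R\<^esub> z)) k g)"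
        by (rule fcong_trans[OF 1[unfolded conv_assoc[OF g]] fcong_sym[OF 2]])
    qed (use x y z GR_mult_closed in auto)
    show "x \<otimes>\<^bsub>R\<^esub> y = y \<otimes>\<^bsub>R\<^esub> x"
    proof (rule GR_eq_levI)
      fix k g assume g: "g \<in> carrier G"
      show "fcong (int l ^ k) (lev (x \<otimes>\<^bsub>R\<^esub> y) k g) (lev (y \<otimes>\<^bsub>R\<^esub> x) k g)"
        using lev_mult[OF x y g, of k] lev_mult[OF y x g, of k] conv_comm[OF g, of "lev x k" "lev y k"]
        by (simp add: fcong_iff)
    qed (use x y GR_mult_closed in auto)
    show "\<one>\<^bsub>R\<^esub> \<otimes>\<^bsub>R\<^esub> x = x"
    proof (rule GR_eqI)
      fix g i k assume g: "g \<in> carrier G"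
      have "(\<Sum>h\<in>carrier G. \<Sum>j\<le>i. \<one>\<^bsub>R\<^esub> h j k * x (inv\<^bsub>G\<^esub> h \<otimes>\<^bsub>G\<^esub> g) (i - j) k)
        = (\<Sum>h\<in>carrier G. if h = \<one>\<^bsub>G\<^esub> then (1 mod int l ^ k) * x g i k else 0)"
        using g sum_first[of _ "\<lambda>j. x g (i - j) k" i] by (intro sum.cong refl) (auto simp: GR_one)
      also have "\<dots> = (1 mod int l ^ k) * x g i k" using finite_G by (simp add: sum.delta)
      finally show "(\<one>\<^bsub>R\<^esub> \<otimes>\<^bsub>R\<^esub> x) g i k = x g i k" using GR_mult[OF one x g] x g by (simp add: mod_simps)
    qed (use x one GR_mult_closed in auto)
  qed (use one GR_mult_closed in auto)
  show "(x \<oplus>\<^bsub>R\<^esub> y) \<otimes>\<^bsub>R\<^esub> z = x \<otimes>\<^bsub>R\<^esub> z \<oplus>\<^bsub>R\<^esub> y \<otimes>\<^bsub>R\<^esub> z"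
    if x: "x \<in> carrier R" and y: "y \<in> carrier R" and z: "z \<in> carrier R" for x y z
  proof (rule GR_eq_levI)
    fix k g assume g: "g \<in> carrier G"
    have a: "fcong (int l ^ k) (lev (x \<oplus>\<^bsub>R\<^esub> y) k g) (lev x k g + lev y k g)" if "g \<in> carrier G" for g x y
      using that by (simp add: fcong_iff lev_def GR_add)
    have "fcong (int l ^ k) (lev ((x \<oplus>\<^bsub>R\<^esub> y) \<otimes>\<^bsub>R\<^esub> z) k g) (conv (\<lambda>g. lev x k g + lev y k g) (lev z k) g)"
      by (rule fcong_trans[OF lev_mult conv_cong[OF a]]) (use x y z g fcong_refl in auto)
    also have "conv (\<lambda>g. lev x k g + lev y k g) (lev z k) g = conv (lev x k) (lev z k) g + conv (lev y k) (lev z k) g"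
      by (simp add: conv_def distrib_right sum.distrib)
    finally have 1: "fcong (int l ^ k) (lev ((x \<oplus>\<^bsub>R\<^esub> y) \<otimes>\<^bsub>R\<^esub> z) k g) (conv (lev x k) (lev z k) g + conv (lev y k) (lev z k) g)" .
    have 2: "fcong (int l ^ k) (lev (x \<otimes>\<^bsub>R\<^esub> z) k g + lev (y \<otimes>\<^bsub>R\<^esub> z) k g) (conv (lev x k) (lev z k) g + conv (lev y k) (lev z k) g)"
      using lev_mult[OF x z g, of k] lev_mult[OF y z g, of k] unfolding fcong_def by (simp add: add_diff_add dvd_add)
    show "fcong (int l ^ k) (lev ((x \<oplus>\<^bsub>R\<^esub> y) \<otimes>\<^bsub>R\<^esub> z) k g) (lev (x \<otimes>\<^bsub>R\<^esub> z \<oplus>\<^bsub>R\<^esub> y \<otimes>\<^bsub>R\<^esub> z) k g)"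
      by (rule fcong_trans[OF fcong_trans[OF 1 fcong_sym[OF 2]] fcong_sym[OF a[OF g]]])
  qed (use x y z GR_mult_closed in auto)
qed

sublocale R: cring R by (rule GR_cring)

lemma GR_minus: 
  assumes "x \<in> carrier R" "y \<in> carrier R" "g \<in> carrier G"
  shows "(x \<ominus>\<^bsub>R\<^esub> y) g i k = (x g i k - y g i k) mod int l ^ k"
proof -
  have "x g i k = ((x \<ominus>\<^bsub>R\<^esub> y) \<oplus>\<^bsub>R\<^esub> y) g i k" using assms by (simp add: R.minus_minus_cancel)
  also have "\<dots> = ((x \<ominus>\<^bsub>R\<^esub> y) g i k + y g i k) mod int l ^ k" using assms by (simp add: GR_add)
  finally have "(x g i k - y g i k) mod int l ^ k = (x \<ominus>\<^bsub>R\<^esub> y) g i k mod int l ^ k"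
    by (simp add: mod_diff_left_eq)
  then show ?thesis using assms by simp
qed

lemma GR_mult_base:
  assumes "y \<in> carrier R" "x \<in> carrier R" "g \<in> carrier G" "\<And>h j. h \<in> carrier G \<Longrightarrow> h \<noteq> \<one>\<^bsub>G\<^esub> \<Longrightarrow> y h j k = 0"
  shows "(y \<otimes>\<^bsub>R\<^esub> x) g i k = (\<Sum>j\<le>i. y \<one>\<^bsub>G\<^esub> j k * x g (i - j) k) mod int l ^ k"
proof -
  have "(\<Sum>h\<in>carrier G. \<Sum>j\<le>i. y h j k * x (inv\<^bsub>G\<^esub> h \<otimes>\<^bsub>G\<^esub> g) (i - j) k)
    = (\<Sum>h\<in>carrier G. if h = \<one>\<^bsub>G\<^esub> then (\<Sum>j\<le>i. y \<one>\<^bsub>G\<^esub> j k * x g (i - j) k) else 0)"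
    using assms by (intro sum.cong refl) auto
  also have "\<dots> = (\<Sum>j\<le>i. y \<one>\<^bsub>G\<^esub> j k * x g (i - j) k)" using finite_G by (simp add: sum.delta)
  finally show ?thesis using GR_mult[OF assms(1-3)] by simp
qed

lemma embZl_closed [simp]: "c \<in> carrier (Zl l) \<Longrightarrow> embZl l G c \<in> carrier R"
  by (auto simp: embZl_def GR_def PS_sel)

lemma embZl_coeff: "g \<in> carrier G \<Longrightarrow> embZl l G c g i k = (if g = \<one>\<^bsub>G\<^esub> \<and> i = 0 then c k else 0)"
  by (simp add: embZl_def PS_sel Zl_sel)

lemma embZl_mult:
  assumes "c \<in> carrier (Zl l)" "x \<in> carrier R" "g \<in> carrier G"
  shows "(embZl l G c \<otimes>\<^bsub>R\<^esub> x) g i k = (c k * x g i k) mod int l ^ k"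
proof -
  have "(embZl l G c \<otimes>\<^bsub>R\<^esub> x) g i k = (\<Sum>j\<le>i. embZl l G c \<one>\<^bsub>G\<^esub> j k * x g (i - j) k) mod int l ^ k"
    by (rule GR_mult_base) (use assms in \<open>simp_all add: embZl_coeff\<close>)
  also have "(\<Sum>j\<le>i. embZl l G c \<one>\<^bsub>G\<^esub> j k * x g (i - j) k) = (\<Sum>j\<le>i. if j = 0 then c k * x g (i - j) k else 0)"
    by (rule sum.cong) (auto simp: embZl_coeff)
  finally show ?thesis by simp
qed

lemma intZl_closed [simp]: "(\<lambda>k. c mod int l ^ k) \<in> carrier (Zl l)"
  using Zl_memI[of "\<lambda>_. c"] by simp

lemma intLD_closed [simp]: "intLD l G c \<in> carrier R"
  by (simp add: intLD_def)

lemma intLD_mult: "x \<in> carrier R \<Longrightarrow> g \<in> carrier G \<Longrightarrow> (intLD l G c \<otimes>\<^bsub>R\<^esub> x) g i k = (c * x g i k) mod int l ^ k"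
  by (simp add: intLD_def embZl_mult mod_simps)

lemma intLD_coeff: "g \<in> carrier G \<Longrightarrow> intLD l G c g i k = (if g = \<one>\<^bsub>G\<^esub> \<and> i = 0 then c mod int l ^ k else 0)"
  by (simp add: intLD_def embZl_coeff)

lemma intLD_1: "intLD l G 1 = \<one>\<^bsub>R\<^esub>"
  by (rule GR_eqI) (simp_all add: intLD_coeff GR_one)

lemma intLD_hom: "intLD l G (a + b) = intLD l G a \<oplus>\<^bsub>R\<^esub> intLD l G b" "intLD l G (a * b) = intLD l G a \<otimes>\<^bsub>R\<^esub> intLD l G b"
  by (rule GR_eqI; simp add: intLD_coeff GR_add intLD_mult mod_simps)+

lemma intLD_0: "intLD l G 0 = \<zero>\<^bsub>R\<^esub>"
  by (rule GR_eqI) (simp_all add: intLD_coeff GR_zero)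

lemma intLD_nat: "intLD l G (int n) = [n] \<cdot>\<^bsub>R\<^esub> \<one>\<^bsub>R\<^esub>"
proof (induction n)
  case (Suc n)
  have "intLD l G (int (Suc n)) = intLD l G (int n + 1)" by (simp add: add.commute)
  also have "\<dots> = [Suc n] \<cdot>\<^bsub>R\<^esub> \<one>\<^bsub>R\<^esub>" using Suc by (simp add: intLD_hom intLD_1)
  finally show ?case .
qed (simp add: intLD_0)

lemma intLD_pow: "intLD l G (c ^ n) = intLD l G c [^]\<^bsub>R\<^esub> n"
  by (induction n) (simp_all add: intLD_1 intLD_hom R.m_comm)

end

lemma (in cring) one_minus_mult:
  assumes "b \<in> carrier R" "c \<in> carrier R"
  shows "(\<one> \<oplus> \<ominus> b) \<otimes> c = c \<ominus> c \<otimes> b"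
  using assms by algebra

context ladic_group_ring begin

lemma GR_uminus:
  assumes "x \<in> carrier R" "g \<in> carrier G"
  shows "(\<ominus>\<^bsub>R\<^esub> x) g i k = (- x g i k) mod int l ^ k"
proof -
  have "\<zero>\<^bsub>R\<^esub> \<ominus>\<^bsub>R\<^esub> x = \<ominus>\<^bsub>R\<^esub> x" using assms by (simp add: a_minus_def[of R])
  then show ?thesis using GR_minus[OF R.zero_closed assms, of i k] assms by (simp add: GR_zero)
qed

section \<open>The elements L and T, and completeness\<close>

definition L :: "'g LD" where "L = intLD l G (int l)"
definition T :: "'g LD" where "T = gammaLD l G \<ominus>\<^bsub>R\<^esub> \<one>\<^bsub>R\<^esub>"

lemma L_carrier [simp]: "L \<in> carrier R" by (simp add: L_def)

lemma L_nat: "L = [l] \<cdot>\<^bsub>R\<^esub> \<one>\<^bsub>R\<^esub>" by (simp add: L_def intLD_nat)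

lemma L_pow: "L [^]\<^bsub>R\<^esub> k = intLD l G (int l ^ k)" by (simp add: L_def intLD_pow)

lemma gamma_closed [simp]: "gammaLD l G \<in> carrier R"
  by (auto simp: gammaLD_def GR_mem_iff PS_sel Zl.zero_closed)

lemma gamma_coeff: "g \<in> carrier G \<Longrightarrow> gammaLD l G g i k = (if g = \<one>\<^bsub>G\<^esub> \<and> i \<le> 1 then 1 mod int l ^ k else 0)"
  by (simp add: gammaLD_def PS_sel Zl_sel)

lemma T_carrier [simp]: "T \<in> carrier R" by (simp add: T_def)

lemma gamma_eq: "gammaLD l G = \<one>\<^bsub>R\<^esub> \<oplus>\<^bsub>R\<^esub> T"
  by (simp add: T_def R.minus_minus_cancel R.a_comm[of "\<one>\<^bsub>R\<^esub>"])

lemma gamma_mult: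
  assumes x: "x \<in> carrier R" "g \<in> carrier G"
  shows "(gammaLD l G \<otimes>\<^bsub>R\<^esub> x) g i k = (x g i k + (if i = 0 then 0 else x g (i - 1) k)) mod int l ^ k"
proof -
  have "(gammaLD l G \<otimes>\<^bsub>R\<^esub> x) g i k = (\<Sum>j\<le>i. gammaLD l G \<one>\<^bsub>G\<^esub> j k * x g (i - j) k) mod int l ^ k"
    by (rule GR_mult_base) (use assms in \<open>simp_all add: gamma_coeff\<close>)
  also have "(\<Sum>j\<le>i. gammaLD l G \<one>\<^bsub>G\<^esub> j k * x g (i - j) k)
     = (\<Sum>j\<in>{..i} \<inter> {..1}. (1 mod int l ^ k) * x g (i - j) k)"
    by (rule sum.mono_neutral_cong_right) (auto simp: gamma_coeff)
  also have "\<dots> = (1 mod int l ^ k) * (x g i k + (if i = 0 then 0 else x g (i - 1) k))"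
  proof (cases i)
    case 0
    then have "{..i} \<inter> {..1} = {0::nat}" by auto
    then show ?thesis using 0 by simp
  next
    case (Suc i')
    then have "{..i} \<inter> {..1} = {0, 1::nat}" by auto
    then show ?thesis using Suc by (simp add: distrib_left)
  qed
  finally show ?thesis by (simp only: mod_mult_left_eq mult_1)
qed

lemma T_mult:
  assumes x: "x \<in> carrier R" "g \<in> carrier G"
  shows "(T \<otimes>\<^bsub>R\<^esub> x) g i k = (if i = 0 then 0 else x g (i - 1) k)"
proof -
  have "T \<otimes>\<^bsub>R\<^esub> x = gammaLD l G \<otimes>\<^bsub>R\<^esub> x \<ominus>\<^bsub>R\<^esub> x"
    using x by (simp add: T_def a_minus_def[of R] R.l_distr R.l_minus)
  then show ?thesis using x by (simp add: GR_minus gamma_mult mod_simps)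
qed

lemma T_pow_mult:
  assumes "x \<in> carrier R" "g \<in> carrier G"
  shows "(T [^]\<^bsub>R\<^esub> a \<otimes>\<^bsub>R\<^esub> x) g i k = (if i < a then 0 else x g (i - a) k)"
proof (induction a arbitrary: i)
  case (Suc a)
  have "T [^]\<^bsub>R\<^esub> Suc a \<otimes>\<^bsub>R\<^esub> x = T \<otimes>\<^bsub>R\<^esub> (T [^]\<^bsub>R\<^esub> a \<otimes>\<^bsub>R\<^esub> x)" using assms by (simp add: R.m_ac)
  then show ?case using assms Suc[of "i - 1"] by (auto simp: T_mult)
qed (use assms in simp)

lemma L_mult: "x \<in> carrier R \<Longrightarrow> g \<in> carrier G \<Longrightarrow> (L \<otimes>\<^bsub>R\<^esub> x) g i k = (int l * x g i k) mod int l ^ k"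
  by (simp add: L_def intLD_mult)

text \<open>If x vanishes modulo l, all its higher residues are divisible by l. Division costs one
  digit: the residue of the quotient modulo l^k is read off from the residue of x modulo
  l^(k+1).\<close>

lemma mem_L_iff:
  assumes x: "x \<in> carrier R"
  shows "x \<in> lin R [L] \<longleftrightarrow> (\<forall>g\<in>carrier G. \<forall>i. x g i 1 = 0)"
proof
  assume "x \<in> lin R [L]"
  then obtain u where "u \<in> carrier R" "x = L \<otimes>\<^bsub>R\<^esub> u" using R.lin1 by auto
  then show "\<forall>g\<in>carrier G. \<forall>i. x g i 1 = 0" by (simp add: L_mult)
next
  assume 0: "\<forall>g\<in>carrier G. \<forall>i. x g i 1 = 0"
  define y where "y = (\<lambda>g\<in>carrier G. \<lambda>i k. x g i (Suc k) div int l)"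
  have l0: "int l > 0" using l_gt_1 by simp
  have xy: "x g i (Suc k) = int l * y g i k" if g: "g \<in> carrier G" for g i k
  proof -
    have "x g i (Suc k) mod int l ^ 1 = x g i 1" by (rule Zl_le[OF GR_coeff[OF x g]]) simp
    then have "int l dvd x g i (Suc k)" using 0 g by (simp add: mod_0_imp_dvd)
    then show ?thesis using g by (simp add: y_def)
  qed
  have yR: "y \<in> carrier R"
  proof -
    have "y g i \<in> carrier (Zl l)" if g: "g \<in> carrier G" for g i
      unfolding Zl_mem_iff
    proof (intro allI conjI)
      fix k
      have "int l * (y g i k mod int l ^ k) = int l * y g i k mod int l ^ Suc k" by (simp add: mod_mult_mult1)
      also have "\<dots> = int l * y g i k" using GR_coeff_mod[OF x g, of i "Suc k"] xy[OF g] by simp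
      finally show "y g i k mod int l ^ k = y g i k" using l0 by simp
      have "int l * (y g i (Suc k) mod int l ^ k) = x g i (Suc (Suc k)) mod int l ^ Suc k" by (simp add: xy[OF g] mod_mult_mult1)
      also have "\<dots> = int l * y g i k" by (rule trans[OF Zl_Suc[OF GR_coeff[OF x g]] xy[OF g]])
      finally show "y g i (Suc k) mod int l ^ k = y g i k" using l0 by simp
    qed
    then show ?thesis by (simp add: GR_mem_iff y_def)
  qed
  have "x = L \<otimes>\<^bsub>R\<^esub> y"
    by (rule GR_eqI) (use x yR Zl_Suc[OF GR_coeff[OF x]] in \<open>simp_all add: L_mult xy[symmetric]\<close>)
  then show "x \<in> lin R [L]" by (rule R.lin1I) (use yR in simp_all)
qed

text \<open>One digit is lost again: l x = 0 modulo l^(k+1) gives x = 0 modulo l^k, and every k is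
  reached.\<close>

lemma reg_L: 
  assumes x: "x \<in> carrier R" "L \<otimes>\<^bsub>R\<^esub> x = \<zero>\<^bsub>R\<^esub>" shows "x = \<zero>\<^bsub>R\<^esub>"
proof (rule GR_eqI)
  fix g i k assume g: "g \<in> carrier G"
  have "(int l * x g i (Suc k)) mod int l ^ Suc k = 0"
    using L_mult[OF x(1) g, of i "Suc k"] x(2) g by (simp add: GR_zero)
  then have "int l ^ k dvd x g i (Suc k)" using l_gt_1 by (simp add: mod_mult_mult1 mod_0_imp_dvd)
  then have "x g i (Suc k) mod int l ^ k = 0" by simp
  then show "x g i k = \<zero>\<^bsub>R\<^esub> g i k" using Zl_Suc[OF GR_coeff[OF x(1) g]] g by (simp add: GR_zero)
qed (use x in simp_all)

lemma reg_T:
  assumes x: "x \<in> carrier R" "T \<otimes>\<^bsub>R\<^esub> x \<in> lin R [L]" shows "x \<in> lin R [L]"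
  unfolding mem_L_iff[OF x(1)]
proof (intro ballI allI)
  fix g i assume g: "g \<in> carrier G"
  have "(T \<otimes>\<^bsub>R\<^esub> x) g (Suc i) 1 = 0" using x(2) mem_L_iff[of "T \<otimes>\<^bsub>R\<^esub> x"] x(1) g by simp
  then show "x g i 1 = 0" using T_mult[OF x(1) g, of "Suc i" 1] by simp
qed

text \<open>The ideals \<open>J a\<close> define the same topology as the powers of the ideal \<open>(L, T)\<close>.\<close>

definition J :: "nat \<Rightarrow> 'g LD set" where
  "J a = {x \<in> carrier R. \<forall>g\<in>carrier G. \<forall>i<a. x g i a = 0}"

lemma J_ideal: "ideal (J a) R"
proof (rule idealI)
  show "ring R" by (rule R.ring_axioms)
  show "subgp (J a) R"
  proof (rule R.subgpI)
    fix x assume x: "x \<in> J a"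
    then show "\<ominus>\<^bsub>R\<^esub> x \<in> J a" by (simp add: J_def GR_uminus)
  qed (auto simp: J_def GR_add GR_zero)
  show "x \<otimes>\<^bsub>R\<^esub> c \<in> J a" if "x \<in> J a" "c \<in> carrier R" for x c
    using that by (auto simp: J_def GR_mult intro!: sum.neutral)
  then show "c \<otimes>\<^bsub>R\<^esub> x \<in> J a" if "x \<in> J a" "c \<in> carrier R" for x c
    using that R.m_comm[of c x] by (simp add: J_def)
qed

lemma lin_pow_J: "lin R [L [^]\<^bsub>R\<^esub> a, T [^]\<^bsub>R\<^esub> a] \<subseteq> J a"
proof
  fix x assume "x \<in> lin R [L [^]\<^bsub>R\<^esub> a, T [^]\<^bsub>R\<^esub> a]"
  then obtain u v where u: "u \<in> carrier R" "v \<in> carrier R" "x = L [^]\<^bsub>R\<^esub> a \<otimes>\<^bsub>R\<^esub> u \<oplus>\<^bsub>R\<^esub> T [^]\<^bsub>R\<^esub> a \<otimes>\<^bsub>R\<^esub> v"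
    using R.lin2[of "L [^]\<^bsub>R\<^esub> a" "T [^]\<^bsub>R\<^esub> a"] by auto
  have "(L [^]\<^bsub>R\<^esub> a \<otimes>\<^bsub>R\<^esub> u) g i a = 0" if "g \<in> carrier G" for g i
    unfolding L_pow using u that by (simp add: intLD_mult)
  then show "x \<in> J a" unfolding u(3) using u(1,2) by (simp add: J_def GR_add T_pow_mult)
qed

lemma J_Inter_zero:
  assumes "x \<in> carrier R" "\<And>a. x \<in> J a" shows "x = \<zero>\<^bsub>R\<^esub>"
proof (rule GR_eqI)
  fix g i k assume g: "g \<in> carrier G"
  have "x g i (Suc i + k) = 0" using assms(2)[of "Suc i + k"] g by (simp add: J_def)
  moreover have "x g i (Suc i + k) mod int l ^ k = x g i k"
    by (rule Zl_le[OF GR_coeff[OF assms(1) g]]) simp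
  ultimately show "x g i k = \<zero>\<^bsub>R\<^esub> g i k" using g by (simp add: GR_zero)
qed (use assms in simp_all)

text \<open>Completeness. The step from s j to s (Suc j) does not alter the coefficient of T^i
  modulo l^k when j > i and j \<ge> k. So its value at j = i + k + 1 is final, which is the formula
  for t; it also shows that a limit of constants in T is constant.\<close>

lemma J_limit:
  assumes s: "\<And>j. s j \<in> carrier R" "\<And>j. s (Suc j) \<ominus>\<^bsub>R\<^esub> s j \<in> J j"
  shows "\<exists>t\<in>carrier R. (\<forall>j. t \<ominus>\<^bsub>R\<^esub> s j \<in> J j) \<and>
    (\<forall>g\<in>carrier G. \<forall>i k. t g i k = s (Suc (i + k)) g i k)"
proof -
  have st: "s j g i k = s (Suc (i + k)) g i k" if j: "j \<ge> Suc (i + k)" and g: "g \<in> carrier G" for j g i k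
    using j
  proof (induction j rule: dec_induct)
    case (step j)
    have "(s (Suc j) g i j - s j g i j) mod int l ^ j = 0"
      using s(2)[of j] step g by (simp add: J_def GR_minus s(1))
    then have "s (Suc j) g i j mod int l ^ k = s j g i j mod int l ^ k"
      using step by (metis mod_eq_dvd_iff mod_0_imp_dvd dvd_trans le_imp_power_dvd add_leD2 Suc_leD)
    moreover have "s (Suc j) g i (Suc j) mod int l ^ j = s (Suc j) g i j" using Zl_Suc[OF GR_coeff[OF s(1) g]] by blast
    ultimately have "s (Suc j) g i k = s j g i k"
      using Zl_le[OF GR_coeff[OF s(1) g], of k j] step by simp
    then show ?case using step by simp
  qed simp
  define t where "t = (\<lambda>g\<in>carrier G. \<lambda>i k. s (Suc (i + k)) g i k)"
  have t: "t \<in> carrier R"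
  proof -
    have "t g i \<in> carrier (Zl l)" if g: "g \<in> carrier G" for g i
      unfolding Zl_mem_iff
    proof (intro allI conjI)
      fix k
      show "t g i k mod int l ^ k = t g i k" using g s(1) by (simp add: t_def)
      have "s (Suc (i + Suc k)) g i (Suc k) mod int l ^ k = s (Suc (i + Suc k)) g i k"
        using Zl_Suc[OF GR_coeff[OF s(1) g]] by blast
      also have "\<dots> = s (Suc (i + k)) g i k" by (rule st) (use g in simp_all)
      finally show "t g i (Suc k) mod int l ^ k = t g i k" using g by (simp add: t_def)
    qed
    then show ?thesis by (simp add: GR_mem_iff t_def)
  qed
  have "t \<ominus>\<^bsub>R\<^esub> s j \<in> J j" for j
  proof -
    have "t g i j = s j g i j" if g: "g \<in> carrier G" and i: "i < j" for g i
    proof -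
      have "s (m + j) g i j = s j g i j" for m
      proof (induction m)
        case (Suc m)
        have "(s (Suc (m + j)) g i (m + j) - s (m + j) g i (m + j)) mod int l ^ (m + j) = 0"
          using s(2)[of "m + j"] g i by (simp add: J_def GR_minus s(1))
        then have "s (Suc (m + j)) g i (m + j) mod int l ^ j = s (m + j) g i (m + j) mod int l ^ j"
          by (metis mod_eq_dvd_iff mod_0_imp_dvd dvd_trans le_imp_power_dvd le_add2)
        then show ?case using Suc Zl_le[OF GR_coeff[OF s(1) g], of j "m + j"] by simp
      qed simp
      from this[of "Suc i"] show ?thesis using g by (simp add: t_def)
    qed
    then show ?thesis using t s(1) by (simp add: J_def GR_minus)
  qed
  then show ?thesis using t by (intro bexI[of _ t]) (auto simp: t_def)
qed

text \<open>The exponent 2 j comes from \<open>prod_in_lin_pow\<close> with a = b = j, applied to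
  the sequence of powers of c.\<close>

lemma pow_in_J:
  assumes "c \<in> lin R [L, T]" "m \<ge> 2 * j" shows "c [^]\<^bsub>R\<^esub> (m::nat) \<in> J j"
proof -
  have cR: "c \<in> carrier R" using assms(1) R.lin_carrier[of "[L, T]"] by auto
  show ?thesis
  proof (cases m)
    case 0
    then show ?thesis using assms(2) by (simp add: J_def)
  next
    case (Suc n)
    have "c [^]\<^bsub>R\<^esub> Suc n \<in> lin R [L [^]\<^bsub>R\<^esub> j, T [^]\<^bsub>R\<^esub> j]"
    proof (rule R.prod_in_lin_pow[where x = "\<lambda>n. c [^]\<^bsub>R\<^esub> Suc n"])
      show "c [^]\<^bsub>R\<^esub> Suc 0 \<in> lin R [L, T]" using assms cR by simp
      show "\<exists>ca\<in>lin R [L, T]. c [^]\<^bsub>R\<^esub> Suc (Suc n) = ca \<otimes>\<^bsub>R\<^esub> c [^]\<^bsub>R\<^esub> Suc n" for n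
        by (rule bexI[OF _ assms(1)]) (use cR in \<open>simp add: R.m_ac\<close>)
      show "j + j \<le> n + 2" using assms(2) Suc by simp
    qed (use cR in simp_all)
    then show ?thesis using lin_pow_J Suc by auto
  qed
qed

text \<open>The inverse is the geometric series in b = - c. The limit is taken along the partial
  sums of length 2 j, because b^(2 j) lies in J j.\<close>

lemma jacobson:
  assumes c: "c \<in> lin R [L, T]"
  shows "\<exists>d\<in>carrier R. (\<one>\<^bsub>R\<^esub> \<oplus>\<^bsub>R\<^esub> c) \<otimes>\<^bsub>R\<^esub> d = \<one>\<^bsub>R\<^esub>"
proof -
  have I: "ideal (lin R [L, T]) R" by (rule R.lin_ideal) simp
  define b where "b = \<ominus>\<^bsub>R\<^esub> c"
  have bI: "b \<in> lin R [L, T]" unfolding b_def by (rule R.idealD(5)[OF I c])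
  have bR: "b \<in> carrier R" and cR: "c \<in> carrier R" using bI c R.idealD(2)[OF I] by auto
  have cb: "c = \<ominus>\<^bsub>R\<^esub> b" using cR by (simp add: b_def)
  define S where "S = rec_nat \<zero>\<^bsub>R\<^esub> (\<lambda>n s. s \<oplus>\<^bsub>R\<^esub> b [^]\<^bsub>R\<^esub> n)"
  have S: "S 0 = \<zero>\<^bsub>R\<^esub>" "S (Suc n) = S n \<oplus>\<^bsub>R\<^esub> b [^]\<^bsub>R\<^esub> n" for n by (simp_all add: S_def)
  have SR: "S n \<in> carrier R" for n by (induction n) (use bR S in auto)
  have tele: "(\<one>\<^bsub>R\<^esub> \<oplus>\<^bsub>R\<^esub> c) \<otimes>\<^bsub>R\<^esub> S n = \<one>\<^bsub>R\<^esub> \<ominus>\<^bsub>R\<^esub> b [^]\<^bsub>R\<^esub> n" for n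
  proof (induction n)
    case 0
    then show ?case using cR S by (simp add: a_minus_def[of R] R.r_neg)
  next
    case (Suc n)
    have "(\<one>\<^bsub>R\<^esub> \<oplus>\<^bsub>R\<^esub> c) \<otimes>\<^bsub>R\<^esub> S (Suc n) = (\<one>\<^bsub>R\<^esub> \<ominus>\<^bsub>R\<^esub> b [^]\<^bsub>R\<^esub> n) \<oplus>\<^bsub>R\<^esub> (\<one>\<^bsub>R\<^esub> \<oplus>\<^bsub>R\<^esub> c) \<otimes>\<^bsub>R\<^esub> b [^]\<^bsub>R\<^esub> n"
      using Suc S SR cR bR by (simp add: R.r_distr)
    also have "(\<one>\<^bsub>R\<^esub> \<oplus>\<^bsub>R\<^esub> c) \<otimes>\<^bsub>R\<^esub> b [^]\<^bsub>R\<^esub> n = b [^]\<^bsub>R\<^esub> n \<ominus>\<^bsub>R\<^esub> b [^]\<^bsub>R\<^esub> Suc n"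
      unfolding cb using R.one_minus_mult[OF bR, of "b [^]\<^bsub>R\<^esub> n"] bR by simp
    also have "(\<one>\<^bsub>R\<^esub> \<ominus>\<^bsub>R\<^esub> b [^]\<^bsub>R\<^esub> n) \<oplus>\<^bsub>R\<^esub> (b [^]\<^bsub>R\<^esub> n \<ominus>\<^bsub>R\<^esub> b [^]\<^bsub>R\<^esub> Suc n) = \<one>\<^bsub>R\<^esub> \<ominus>\<^bsub>R\<^esub> b [^]\<^bsub>R\<^esub> Suc n"
      by (rule R.minus_minus_cancel(2)) (use bR in simp_all)
    finally show ?case .
  qed
  have "\<exists>t\<in>carrier R. (\<forall>j. t \<ominus>\<^bsub>R\<^esub> S (2 * j) \<in> J j) \<and>
    (\<forall>g\<in>carrier G. \<forall>i k. t g i k = S (2 * Suc (i + k)) g i k)"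
  proof (rule J_limit)
    fix j
    have "S (2 * Suc j) \<ominus>\<^bsub>R\<^esub> S (2 * j) = b [^]\<^bsub>R\<^esub> (2 * j) \<oplus>\<^bsub>R\<^esub> b [^]\<^bsub>R\<^esub> Suc (2 * j)"
    proof -
      have "S (2 * Suc j) = S (Suc (Suc (2 * j)))" by simp
      also have "\<dots> = (b [^]\<^bsub>R\<^esub> (2 * j) \<oplus>\<^bsub>R\<^esub> b [^]\<^bsub>R\<^esub> Suc (2 * j)) \<oplus>\<^bsub>R\<^esub> S (2 * j)"
        unfolding S(2) using SR bR by (simp add: R.a_ac)
      finally show ?thesis using SR bR by (simp only: R.minus_minus_cancel(5) R.add.m_closed R.nat_pow_closed)
    qed
    then show "S (2 * Suc j) \<ominus>\<^bsub>R\<^esub> S (2 * j) \<in> J j"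
      using R.idealD(4)[OF J_ideal pow_in_J[OF bI] pow_in_J[OF bI], of j "2 * j" "Suc (2 * j)"] by simp
  qed (rule SR)
  then obtain t where t: "t \<in> carrier R" "\<And>j. t \<ominus>\<^bsub>R\<^esub> S (2 * j) \<in> J j" by blast
  have "(\<one>\<^bsub>R\<^esub> \<oplus>\<^bsub>R\<^esub> c) \<otimes>\<^bsub>R\<^esub> t \<ominus>\<^bsub>R\<^esub> \<one>\<^bsub>R\<^esub> = \<zero>\<^bsub>R\<^esub>"
  proof (rule J_Inter_zero)
    fix j
    have 1: "(\<one>\<^bsub>R\<^esub> \<oplus>\<^bsub>R\<^esub> c) \<otimes>\<^bsub>R\<^esub> (t \<ominus>\<^bsub>R\<^esub> S (2 * j)) \<in> J j"
      by (rule R.idealD(7)[OF J_ideal t(2)]) (use cR in simp)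
    have "(\<one>\<^bsub>R\<^esub> \<oplus>\<^bsub>R\<^esub> c) \<otimes>\<^bsub>R\<^esub> (t \<ominus>\<^bsub>R\<^esub> S (2 * j)) = (\<one>\<^bsub>R\<^esub> \<oplus>\<^bsub>R\<^esub> c) \<otimes>\<^bsub>R\<^esub> t \<ominus>\<^bsub>R\<^esub> (\<one>\<^bsub>R\<^esub> \<ominus>\<^bsub>R\<^esub> b [^]\<^bsub>R\<^esub> (2 * j))"
      unfolding tele[symmetric] using cR t(1) SR by (simp add: a_minus_def[of R] R.r_distr R.r_minus)
    then have 2: "(\<one>\<^bsub>R\<^esub> \<oplus>\<^bsub>R\<^esub> c) \<otimes>\<^bsub>R\<^esub> t \<ominus>\<^bsub>R\<^esub> (\<one>\<^bsub>R\<^esub> \<ominus>\<^bsub>R\<^esub> b [^]\<^bsub>R\<^esub> (2 * j)) \<in> J j" using 1 by simp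
    have 3: "(\<one>\<^bsub>R\<^esub> \<ominus>\<^bsub>R\<^esub> b [^]\<^bsub>R\<^esub> (2 * j)) \<ominus>\<^bsub>R\<^esub> \<one>\<^bsub>R\<^esub> \<in> J j"
    proof -
      have "(\<one>\<^bsub>R\<^esub> \<ominus>\<^bsub>R\<^esub> b [^]\<^bsub>R\<^esub> (2 * j)) \<ominus>\<^bsub>R\<^esub> \<one>\<^bsub>R\<^esub> = \<ominus>\<^bsub>R\<^esub> (b [^]\<^bsub>R\<^esub> (2 * j))"
        using bR R.minus_minus_cancel(5)[of "\<ominus>\<^bsub>R\<^esub> (b [^]\<^bsub>R\<^esub> (2 * j))" "\<one>\<^bsub>R\<^esub>"] by (simp add: a_minus_def[of R] R.a_comm)
      then show ?thesis using R.idealD(5)[OF J_ideal pow_in_J[OF bI order_refl]] by simp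
    qed
    show "(\<one>\<^bsub>R\<^esub> \<oplus>\<^bsub>R\<^esub> c) \<otimes>\<^bsub>R\<^esub> t \<ominus>\<^bsub>R\<^esub> \<one>\<^bsub>R\<^esub> \<in> J j"
      using R.idealD(4)[OF J_ideal 2 3] cR t bR by (simp add: R.minus_minus_cancel)
  qed (use cR t in simp)
  then show ?thesis using cR t by (intro bexI[of _ t]) simp_all
qed

subsection \<open>Idempotents and the residue field\<close>

text \<open>This is the group element u regarded as an element of the group ring.\<close>

definition delta :: "'g \<Rightarrow> 'g LD" where
  "delta u = (\<lambda>g\<in>carrier G. \<lambda>i k. if g = u \<and> i = 0 then 1 mod int l ^ k else 0)"

lemma zero_Zl: "(\<lambda>k. 0) \<in> carrier (Zl l)" using Zl.zero_closed by (simp add: Zl_def)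

lemma delta_closed [simp]: "delta u \<in> carrier R"
proof -
  have "(\<lambda>k. if b then 1 mod int l ^ k else 0) \<in> carrier (Zl l)" for b
    using intZl_closed[of 1] zero_Zl by (cases b) simp_all
  then show ?thesis by (simp add: GR_mem_iff delta_def)
qed

lemma delta_coeff: "g \<in> carrier G \<Longrightarrow> delta u g i k = (if g = u \<and> i = 0 then 1 mod int l ^ k else 0)"
  by (simp add: delta_def)

lemma delta_ZlD [simp]: "delta u \<in> ZlD l G"
  by (auto simp: ZlD_def delta_coeff fun_eq_iff Zl_sel)

lemma delta_mult:
  assumes "u \<in> carrier G" "x \<in> carrier R" "g \<in> carrier G"
  shows "(delta u \<otimes>\<^bsub>R\<^esub> x) g i k = x (inv\<^bsub>G\<^esub> u \<otimes>\<^bsub>G\<^esub> g) i k"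
proof -
  have "(\<Sum>h\<in>carrier G. \<Sum>j\<le>i. delta u h j k * x (inv\<^bsub>G\<^esub> h \<otimes>\<^bsub>G\<^esub> g) (i - j) k)
    = (\<Sum>h\<in>carrier G. if h = u then (1 mod int l ^ k) * x (inv\<^bsub>G\<^esub> u \<otimes>\<^bsub>G\<^esub> g) i k else 0)"
    using assms sum_first[of _ "\<lambda>j. x (inv\<^bsub>G\<^esub> u \<otimes>\<^bsub>G\<^esub> g) (i - j) k" i]
    by (intro sum.cong refl) (auto simp: delta_coeff)
  also have "\<dots> = (1 mod int l ^ k) * x (inv\<^bsub>G\<^esub> u \<otimes>\<^bsub>G\<^esub> g) i k" using finite_G assms by (simp add: sum.delta)
  finally show ?thesis using GR_mult[OF delta_closed assms(2,3), of u i k] assms by (simp add: mod_mult_left_eq)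
qed

lemma delta_hom: "u \<in> carrier G \<Longrightarrow> v \<in> carrier G \<Longrightarrow> delta u \<otimes>\<^bsub>R\<^esub> delta v = delta (u \<otimes>\<^bsub>G\<^esub> v)"
proof (rule GR_eqI)
  fix g i k assume *: "u \<in> carrier G" "v \<in> carrier G" "g \<in> carrier G"
  then have "inv\<^bsub>G\<^esub> u \<otimes>\<^bsub>G\<^esub> g = v \<longleftrightarrow> g = u \<otimes>\<^bsub>G\<^esub> v" using G_cancel[of u] by metis
  then show "(delta u \<otimes>\<^bsub>R\<^esub> delta v) g i k = delta (u \<otimes>\<^bsub>G\<^esub> v) g i k" using * by (simp add: delta_mult delta_coeff)
qed simp_all

lemma delta_one: "delta \<one>\<^bsub>G\<^esub> = \<one>\<^bsub>R\<^esub>"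
  by (rule GR_eqI) (simp_all add: delta_coeff GR_one)

lemma delta_pow: "u \<in> carrier G \<Longrightarrow> delta u [^]\<^bsub>R\<^esub> (n::nat) = delta (u [^]\<^bsub>G\<^esub> n)"
  by (induction n) (simp_all add: delta_one delta_hom)

lemma ZlD_iff: "x \<in> ZlD l G \<longleftrightarrow> x \<in> carrier R \<and> (\<forall>g\<in>carrier G. \<forall>i>0. \<forall>k. x g i k = 0)"
  by (auto simp: ZlD_def fun_eq_iff Zl_sel)

lemma ZlD_carrier [simp]: "x \<in> ZlD l G \<Longrightarrow> x \<in> carrier R" by (simp add: ZlD_iff)

lemma ZlD_add [simp]: "x \<in> ZlD l G \<Longrightarrow> y \<in> ZlD l G \<Longrightarrow> x \<oplus>\<^bsub>R\<^esub> y \<in> ZlD l G"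
  by (simp add: ZlD_iff GR_add)

lemma ZlD_minus [simp]: "x \<in> ZlD l G \<Longrightarrow> y \<in> ZlD l G \<Longrightarrow> x \<ominus>\<^bsub>R\<^esub> y \<in> ZlD l G"
  by (simp add: ZlD_iff GR_minus)

lemma ZlD_mult [simp]: "x \<in> ZlD l G \<Longrightarrow> y \<in> ZlD l G \<Longrightarrow> x \<otimes>\<^bsub>R\<^esub> y \<in> ZlD l G"
proof -
  assume *: "x \<in> ZlD l G" "y \<in> ZlD l G"
  have "x h j k * y (inv\<^bsub>G\<^esub> h \<otimes>\<^bsub>G\<^esub> g) (i - j) k = 0" if "g \<in> carrier G" "h \<in> carrier G" "j \<le> i" "i > 0" for g h i j k
    using * that by (cases "j = 0") (simp_all add: ZlD_iff)
  then have "(\<Sum>h\<in>carrier G. \<Sum>j\<le>i. x h j k * y (inv\<^bsub>G\<^esub> h \<otimes>\<^bsub>G\<^esub> g) (i - j) k) = 0"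
    if "g \<in> carrier G" "i > 0" for g i k using that by (intro sum.neutral ballI) simp
  then show ?thesis using * by (simp add: ZlD_iff GR_mult GR_mult_closed)
qed

lemma ZlD_one [simp]: "\<one>\<^bsub>R\<^esub> \<in> ZlD l G" using delta_ZlD[of "\<one>\<^bsub>G\<^esub>"] by (simp add: delta_one)

lemma ZlD_pow [simp]: "x \<in> ZlD l G \<Longrightarrow> x [^]\<^bsub>R\<^esub> (n::nat) \<in> ZlD l G"
  by (induction n) simp_all

lemma ZlD_L_iff: "x \<in> ZlD l G \<Longrightarrow> x \<in> lin R [L] \<longleftrightarrow> (\<forall>g\<in>carrier G. x g 0 1 = 0)"
  by (auto simp: mem_L_iff ZlD_iff) (metis not_gr_zero)

lemma ZlD_J_imp_L: "x \<in> ZlD l G \<Longrightarrow> x \<in> J 1 \<Longrightarrow> x \<in> lin R [L]"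
  by (simp add: ZlD_L_iff J_def)

text \<open>By Euler's theorem the \<open>Q\<close>-th power map is the identity on \<open>G\<close>, hence on the group ring
  of \<open>G\<close> over the field with \<open>l\<close> elements.  This replaces Maschke's theorem.\<close>

definition Q :: nat where "Q = l ^ totient (card (carrier G))"

lemma delta_Q: assumes u: "u \<in> carrier G" shows "delta u [^]\<^bsub>R\<^esub> Q = delta u"
proof -
  have "[l ^ totient (card (carrier G)) = 1] (mod card (carrier G))"
    by (rule euler_theorem) (use coprime_l in \<open>simp add: coprime_commute\<close>)
  then have Q1: "Q mod order G = 1 mod order G" by (simp add: Q_def cong_def order_def)
  have pm: "u [^]\<^bsub>G\<^esub> n = u [^]\<^bsub>G\<^esub> (n mod order G)" for n :: nat
  proof -
    have "u [^]\<^bsub>G\<^esub> n = u [^]\<^bsub>G\<^esub> (order G * (n div order G) + n mod order G)" by simp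
    also have "\<dots> = u [^]\<^bsub>G\<^esub> (order G * (n div order G)) \<otimes>\<^bsub>G\<^esub> u [^]\<^bsub>G\<^esub> (n mod order G)"
      using u by (simp only: G.nat_pow_mult)
    also have "u [^]\<^bsub>G\<^esub> (order G * (n div order G)) = (u [^]\<^bsub>G\<^esub> order G) [^]\<^bsub>G\<^esub> (n div order G)"
      using u by (simp only: G.nat_pow_pow)
    finally show ?thesis using u by (simp add: G.pow_order_eq_1)
  qed
  have "u [^]\<^bsub>G\<^esub> Q = u [^]\<^bsub>G\<^esub> (1::nat)" using pm[of Q] pm[of 1] Q1 by simp
  then show ?thesis using u by (simp add: delta_pow)
qed

text \<open>Modulo l an element of Z_l[Delta] is a sum of group elements; the Q-th power map is
  additive modulo l and fixes each of them. The induction removes one group element at a time, the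
  measure being the sum of the coefficients modulo l.\<close>

lemma frobenius_ZlD:
  assumes "x \<in> ZlD l G" shows "x [^]\<^bsub>R\<^esub> Q \<ominus>\<^bsub>R\<^esub> x \<in> lin R [L]"
  using assms
proof (induction "nat (\<Sum>g\<in>carrier G. x g 0 1)" arbitrary: x rule: less_induct)
  case (less x)
  have I: "ideal (lin R [L]) R" by (rule R.lin_ideal) simp
  have xR: "x \<in> carrier R" using less by simp
  have nonneg: "x g 0 1 \<ge> 0" if "g \<in> carrier G" for g 
    using GR_coeff_mod[OF xR that, of 0 1] lpow_pos[of 1] by (metis pos_mod_sign)
  have Q0: "Q > 0" using l_gt_1 by (simp add: Q_def)
  show ?case
  proof (cases "\<forall>g\<in>carrier G. x g 0 1 = 0")
    case True
    then have xL: "x \<in> lin R [L]" using less.prems by (simp add: ZlD_L_iff)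
    obtain m where "Q = Suc m" using Q0 by (cases Q) auto
    then have "x [^]\<^bsub>R\<^esub> Q \<in> lin R [L]" using R.idealD(7)[OF I xL, of "x [^]\<^bsub>R\<^esub> m"] xR by simp
    then show ?thesis using R.idealD(6)[OF I _ xL] by blast
  next
    case False
    then obtain u where u: "u \<in> carrier G" "x u 0 1 \<noteq> 0" by blast
    define y where "y = x \<ominus>\<^bsub>R\<^esub> delta u"
    have y: "y \<in> ZlD l G" using less.prems by (simp add: y_def)
    have yR: "y \<in> carrier R" using y by simp
    have x_eq: "x = y \<oplus>\<^bsub>R\<^esub> delta u" using xR by (simp add: y_def R.minus_minus_cancel)
    have l1: "(1::int) mod int l = 1" using l_gt_1 by simp
    \<comment> \<open>The residue at u is positive, so subtracting 1 does not wrap around modulo l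
      and the measure drops by exactly one.\<close>
    have yu: "y u 0 1 = x u 0 1 - 1"
    proof -
      have "x u 0 1 mod int l = x u 0 1" using GR_coeff_mod[OF xR u(1), of 0 1] by simp
      moreover have "x u 0 1 > 0" using nonneg[OF u(1)] u(2) by simp
      moreover have "x u 0 1 < int l" using calculation(1) l_gt_1 by (metis of_nat_0_less_iff pos_mod_bound zero_less_one less_trans)
      ultimately show ?thesis using u xR by (simp add: y_def GR_minus delta_coeff l1)
    qed
    have yg: "y g 0 1 = x g 0 1" if "g \<in> carrier G" "g \<noteq> u" for g
      using that xR GR_coeff_mod[OF xR that(1), of 0 1] by (simp add: y_def GR_minus delta_coeff)
    have "(\<Sum>g\<in>carrier G. y g 0 1) = (x u 0 1 - 1) + (\<Sum>g\<in>carrier G - {u}. x g 0 1)"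
      using finite_G u yu yg by (subst sum.remove[of _ u]) auto
    also have "\<dots> = (\<Sum>g\<in>carrier G. x g 0 1) - 1"
      using finite_G u by (subst (2) sum.remove[of _ u]) auto
    finally have s: "(\<Sum>g\<in>carrier G. y g 0 1) = (\<Sum>g\<in>carrier G. x g 0 1) - 1" .
    have "(\<Sum>g\<in>carrier G. x g 0 1) > 0"
      by (rule sum_pos2[OF finite_G u(1)]) (use nonneg u in \<open>auto simp: order_less_le\<close>)
    then have "nat (\<Sum>g\<in>carrier G. y g 0 1) < nat (\<Sum>g\<in>carrier G. x g 0 1)" using s by simp
    then have IH: "y [^]\<^bsub>R\<^esub> Q \<ominus>\<^bsub>R\<^esub> y \<in> lin R [L]" using less.hyps y by blast
    have F: "x [^]\<^bsub>R\<^esub> Q \<ominus>\<^bsub>R\<^esub> (y [^]\<^bsub>R\<^esub> Q \<oplus>\<^bsub>R\<^esub> delta u [^]\<^bsub>R\<^esub> Q) \<in> lin R [L]"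
      using R.frobenius_add_pow[OF prime_l yR delta_closed, of u "totient (card (carrier G))"]
      by (simp add: L_nat Q_def x_eq)
    have "(y [^]\<^bsub>R\<^esub> Q \<oplus>\<^bsub>R\<^esub> delta u) \<ominus>\<^bsub>R\<^esub> (y \<oplus>\<^bsub>R\<^esub> delta u) \<in> lin R [L]"
      using IH yR by (simp add: R.minus_minus_cancel)
    then have "(y [^]\<^bsub>R\<^esub> Q \<oplus>\<^bsub>R\<^esub> delta u [^]\<^bsub>R\<^esub> Q) \<ominus>\<^bsub>R\<^esub> x \<in> lin R [L]" by (simp add: delta_Q[OF u(1)] x_eq)
    from R.idealD(4)[OF I F this] show ?thesis using xR yR by (simp add: R.minus_minus_cancel)
  qed
qed

end

lemma (in cring) idem_power_mod:
  assumes I: "ideal I R" and u: "u \<in> carrier R" "u \<otimes> u \<ominus> u \<in> I"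
  shows "u [^] Suc n \<ominus> u \<in> I"
proof (induction n)
  case 0
  then show ?case using u idealD(3)[OF I] by (simp add: a_minus_def r_neg)
next
  case (Suc n)
  obtain x where x: "x = u [^] Suc n" by blast
  have xR: "x \<in> carrier R" using u by (simp add: x)
  have "x \<otimes> u \<ominus> u \<otimes> u \<in> I"
  proof -
    have "(x \<ominus> u) \<otimes> u \<in> I" using idealD(8)[OF I _ u(1)] Suc x by blast
    moreover have "(x \<ominus> u) \<otimes> u = x \<otimes> u \<ominus> u \<otimes> u" using xR u(1) by algebra
    ultimately show ?thesis by simp
  qed
  from idealD(4)[OF I this u(2)] show ?case using xR u(1) by (simp add: minus_minus_cancel x)
qed

lemma (in cring) complementary_idempotent:
  assumes "e \<in> carrier R" "t \<in> carrier R" "e \<otimes> e = e" "t \<otimes> t = t" "t \<otimes> e = t"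
  shows "(e \<ominus> t) \<otimes> (e \<ominus> t) = e \<ominus> t" "t \<otimes> (e \<ominus> t) = \<zero>" "t \<oplus> (e \<ominus> t) = e"
proof -
  have "(e \<ominus> t) \<otimes> (e \<ominus> t) = (e \<otimes> e \<ominus> t \<otimes> e) \<ominus> (t \<otimes> e \<ominus> t \<otimes> t)"
    using assms(1,2) by algebra
  then show "(e \<ominus> t) \<otimes> (e \<ominus> t) = e \<ominus> t" using assms by (simp add: a_minus_def r_neg)
  have "t \<otimes> (e \<ominus> t) = t \<otimes> e \<ominus> t \<otimes> t"
    using assms(1,2) by algebra
  then show "t \<otimes> (e \<ominus> t) = \<zero>" using assms by (simp add: a_minus_def r_neg)
  show "t \<oplus> (e \<ominus> t) = e"
    using assms(1,2) by algebra
qed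

text \<open>If t - s and the defect s s - s lie in an ideal, the right side shows that t t - t does
  as well. Applied with the ideals J j, it makes a limit of approximate idempotents
  idempotent.\<close>

lemma (in cring) idempotent_defect:
  assumes "s \<in> carrier R" "t \<in> carrier R"
  shows "t \<otimes> t \<ominus> t = (t \<ominus> s) \<otimes> (t \<oplus> s) \<oplus> ((s \<otimes> s \<ominus> s) \<ominus> (t \<ominus> s))"
  using assms by algebra

lemma (in cring) residue_inverse_identity:
  assumes "x \<in> carrier R" "y \<in> carrier R" "e \<in> carrier R" "c \<in> carrier R" "z \<in> carrier R" "T \<in> carrier R" "x = c \<oplus> T \<otimes> z"
  shows "x \<otimes> y \<ominus> \<one> = (c \<otimes> e \<otimes> y \<ominus> e) \<oplus> (T \<otimes> (z \<otimes> y) \<oplus> (\<one> \<ominus> e) \<otimes> (c \<otimes> y \<ominus> \<one>))"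
  unfolding assms(7) using assms(1-6) by algebra

lemma (in cring) split_off_idempotent:
  assumes "e \<in> carrier R" "c \<in> carrier R" "z \<in> carrier R" "T \<in> carrier R"
  shows "c \<oplus> T \<otimes> z = c \<otimes> e \<oplus> (T \<otimes> z \<oplus> (\<one> \<ominus> e) \<otimes> c)"
  using assms by algebra

context ladic_group_ring begin

lemma const_split:
  assumes x: "x \<in> carrier R"
  obtains c z where "c \<in> ZlD l G" "z \<in> carrier R" "x = c \<oplus>\<^bsub>R\<^esub> T \<otimes>\<^bsub>R\<^esub> z" "\<And>g. g \<in> carrier G \<Longrightarrow> c g 0 = x g 0"
proof -
  define c where "c = (\<lambda>g\<in>carrier G. \<lambda>i::nat. if i = 0 then x g 0 else (\<lambda>k. 0))"
  define z where "z = (\<lambda>g\<in>carrier G. \<lambda>i. x g (Suc i))"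
  have c: "c \<in> carrier R" using GR_coeff[OF x] zero_Zl by (simp add: GR_mem_iff c_def)
  have z: "z \<in> carrier R" using GR_coeff[OF x] by (simp add: GR_mem_iff z_def)
  have cZ: "c \<in> ZlD l G" using c by (simp add: ZlD_iff c_def)
  have "x = c \<oplus>\<^bsub>R\<^esub> T \<otimes>\<^bsub>R\<^esub> z"
    by (rule GR_eqI) (use x c z in \<open>simp_all add: GR_add T_mult, simp_all add: c_def z_def\<close>)
  then show ?thesis using that cZ z by (simp add: c_def)
qed

context
  fixes e assumes prim: "prim_idem l G e"
begin

lemma e_ZlD [simp]: "e \<in> ZlD l G" and e_idem: "e \<otimes>\<^bsub>R\<^esub> e = e" and e_nonzero: "e \<noteq> \<zero>\<^bsub>R\<^esub>"
  using prim by (auto simp: prim_idem_def idem_def)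

lemma e_carrier [simp]: "e \<in> carrier R" by simp

abbreviation me where "me \<equiv> lin R [L, T, \<one>\<^bsub>R\<^esub> \<ominus>\<^bsub>R\<^esub> e]"

lemma me_set: "set [L, T, \<one>\<^bsub>R\<^esub> \<ominus>\<^bsub>R\<^esub> e] \<subseteq> carrier R" by simp

lemma me_ideal: "ideal me R" by (rule R.lin_ideal[OF me_set])

lemma L_sub_me: "lin R [L] \<subseteq> me"
  by (rule R.lin_mono_set[OF me_set]) simp

text \<open>The idempotent e is the sum of the orthogonal idempotents t and e - t, so primitivity
  kills one of them.\<close>

lemma primD: 
  assumes "t \<in> ZlD l G" "t \<otimes>\<^bsub>R\<^esub> t = t" "t \<otimes>\<^bsub>R\<^esub> e = t"
  shows "t = \<zero>\<^bsub>R\<^esub> \<or> t = e"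
proof -
  note id = R.complementary_idempotent[OF e_carrier ZlD_carrier[OF assms(1)] e_idem assms(2,3)]
  have "idem l G t" "idem l G (e \<ominus>\<^bsub>R\<^esub> t)" using assms id by (simp_all add: idem_def)
  then have "t = \<zero>\<^bsub>R\<^esub> \<or> e \<ominus>\<^bsub>R\<^esub> t = \<zero>\<^bsub>R\<^esub>" using prim id unfolding prim_idem_def by blast
  then show ?thesis using assms by auto
qed

text \<open>Idempotents lift along reduction modulo l. Since u^l is congruent to u modulo l,
  \<open>pow_prime_lift\<close> makes the powers u^(l^j) converge, to an idempotent t congruent to
  u. From u e = u follows t e = t, and primitivity leaves only t = 0 and t = e.\<close>

lemma lift_idempotent:
  assumes u: "u \<in> ZlD l G" "u \<otimes>\<^bsub>R\<^esub> u \<ominus>\<^bsub>R\<^esub> u \<in> lin R [L]" "u \<otimes>\<^bsub>R\<^esub> e = u"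
  shows "u \<in> lin R [L] \<or> u \<ominus>\<^bsub>R\<^esub> e \<in> lin R [L]"
proof -
  have I: "ideal (lin R [L]) R" by (rule R.lin_ideal) simp
  have uR: "u \<in> carrier R" using u by simp
  have l0: "l > 0" using l_gt_1 by simp
  define s where "s j = u [^]\<^bsub>R\<^esub> (l ^ j)" for j
  have sR: "s j \<in> carrier R" and sZ: "s j \<in> ZlD l G" for j using u by (simp_all add: s_def)
  have J_L: "lin R [[l] \<cdot>\<^bsub>R\<^esub> \<one>\<^bsub>R\<^esub> [^]\<^bsub>R\<^esub> Suc j] \<subseteq> J j" for j
  proof
    fix x assume "x \<in> lin R [[l] \<cdot>\<^bsub>R\<^esub> \<one>\<^bsub>R\<^esub> [^]\<^bsub>R\<^esub> Suc j]"
    then obtain v where v: "v \<in> carrier R" "x = (L [^]\<^bsub>R\<^esub> Suc j) \<otimes>\<^bsub>R\<^esub> v" using R.lin1[of "L [^]\<^bsub>R\<^esub> Suc j"] unfolding L_nat by auto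
    have "(L [^]\<^bsub>R\<^esub> j \<otimes>\<^bsub>R\<^esub> (L \<otimes>\<^bsub>R\<^esub> v)) g i j = 0" if "g \<in> carrier G" for g i
      unfolding L_pow using v that by (simp add: intLD_mult)
    moreover have "x = L [^]\<^bsub>R\<^esub> j \<otimes>\<^bsub>R\<^esub> (L \<otimes>\<^bsub>R\<^esub> v)" using v by (simp add: R.m_assoc)
    ultimately show "x \<in> J j" using v by (simp add: J_def)
  qed
  have lift: "x [^]\<^bsub>R\<^esub> (l ^ j) \<ominus>\<^bsub>R\<^esub> y [^]\<^bsub>R\<^esub> (l ^ j) \<in> lin R [[l] \<cdot>\<^bsub>R\<^esub> \<one>\<^bsub>R\<^esub> [^]\<^bsub>R\<^esub> Suc j]"
    if "x \<in> carrier R" "y \<in> carrier R" "x \<ominus>\<^bsub>R\<^esub> y \<in> lin R [L]" for x y j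
  proof (induction j)
    case 0
    then show ?case using that by (simp add: L_nat)
  next
    case (Suc j)
    have "(x [^]\<^bsub>R\<^esub> (l ^ j)) [^]\<^bsub>R\<^esub> l \<ominus>\<^bsub>R\<^esub> (y [^]\<^bsub>R\<^esub> (l ^ j)) [^]\<^bsub>R\<^esub> l \<in> lin R [[l] \<cdot>\<^bsub>R\<^esub> \<one>\<^bsub>R\<^esub> [^]\<^bsub>R\<^esub> Suc (Suc j)]"
      by (rule R.pow_prime_lift[OF _ _ Suc]) (use that l0 in simp_all)
    then show ?case using that by (simp add: R.nat_pow_pow mult.commute)
  qed
  obtain m where m: "Suc m = l" using l0 by (cases l) auto
  have ul: "u [^]\<^bsub>R\<^esub> l \<ominus>\<^bsub>R\<^esub> u \<in> lin R [L]" using R.idem_power_mod[OF I uR u(2), of m] unfolding m .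
  have "s (Suc j) \<ominus>\<^bsub>R\<^esub> s j \<in> J j" for j
    using lift[OF _ uR ul, of j] J_L[of j] uR unfolding s_def by (auto simp: R.nat_pow_pow)
  then obtain t where t: "t \<in> carrier R" "\<And>j. t \<ominus>\<^bsub>R\<^esub> s j \<in> J j"
    "\<And>g i k. g \<in> carrier G \<Longrightarrow> t g i k = s (Suc (i + k)) g i k"
    using J_limit[of s, OF sR] by blast
  have tZ: "t \<in> ZlD l G" using t(1,3) sZ by (simp add: ZlD_iff)
  \<comment> \<open>Here \<open>lift\<close> is applied to u u and u, which agree modulo l; their
    powers of exponent l^j are s j s j and s j.\<close>
  have ss: "s j \<otimes>\<^bsub>R\<^esub> s j \<ominus>\<^bsub>R\<^esub> s j \<in> J j" for j
    using lift[OF _ uR u(2), of j] J_L[of j] uR unfolding s_def by (auto simp: R.nat_pow_distrib)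
  have tt: "t \<otimes>\<^bsub>R\<^esub> t = t"
  proof (rule R.minus_eqI)
    show "t \<otimes>\<^bsub>R\<^esub> t \<ominus>\<^bsub>R\<^esub> t = \<zero>\<^bsub>R\<^esub>"
    proof (rule J_Inter_zero)
      fix j
      note JD = R.idealD[OF J_ideal[of j]]
      show "t \<otimes>\<^bsub>R\<^esub> t \<ominus>\<^bsub>R\<^esub> t \<in> J j"
        unfolding R.idempotent_defect[OF sR[of j] t(1)]
        by (rule JD(4)[OF JD(8)[OF t(2)] JD(6)[OF ss t(2)]]) (use t sR in simp)
    qed (use t in simp)
  qed (use t in simp_all)
  have se: "s j \<otimes>\<^bsub>R\<^esub> e = s j" for j
  proof -
    obtain m where m: "l ^ j = Suc m" using l0 by (cases "l ^ j") auto
    have "u [^]\<^bsub>R\<^esub> Suc m \<otimes>\<^bsub>R\<^esub> e = u [^]\<^bsub>R\<^esub> Suc m" using uR u(3) by (simp add: R.m_assoc)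
    then show ?thesis by (simp only: s_def m)
  qed
  have te: "t \<otimes>\<^bsub>R\<^esub> e = t"
  proof (rule R.minus_eqI)
    show "t \<otimes>\<^bsub>R\<^esub> e \<ominus>\<^bsub>R\<^esub> t = \<zero>\<^bsub>R\<^esub>"
    proof (rule J_Inter_zero)
      fix j
      note JD = R.idealD[OF J_ideal[of j]]
      have "(t \<ominus>\<^bsub>R\<^esub> s j) \<otimes>\<^bsub>R\<^esub> e \<in> J j" by (rule JD(8)[OF t(2)]) simp
      moreover have "(t \<ominus>\<^bsub>R\<^esub> s j) \<otimes>\<^bsub>R\<^esub> e = t \<otimes>\<^bsub>R\<^esub> e \<ominus>\<^bsub>R\<^esub> s j"
        using t sR[of j] se[of j] by (simp add: a_minus_def[of R] R.l_distr R.l_minus)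
      ultimately have 1: "t \<otimes>\<^bsub>R\<^esub> e \<ominus>\<^bsub>R\<^esub> s j \<in> J j" by simp
      have "(t \<otimes>\<^bsub>R\<^esub> e \<ominus>\<^bsub>R\<^esub> s j) \<ominus>\<^bsub>R\<^esub> (t \<ominus>\<^bsub>R\<^esub> s j) \<in> J j" by (rule JD(6)[OF 1 t(2)])
      then show "t \<otimes>\<^bsub>R\<^esub> e \<ominus>\<^bsub>R\<^esub> t \<in> J j" using t sR[of j] by (simp add: R.minus_minus_cancel)
    qed (use t in simp)
  qed (use t in simp_all)
  have "t \<ominus>\<^bsub>R\<^esub> s 1 \<in> lin R [L]" by (rule ZlD_J_imp_L) (use tZ sZ t(2) in auto)
  from R.idealD(4)[OF I this, of "s 1 \<ominus>\<^bsub>R\<^esub> u"] ul have tu: "t \<ominus>\<^bsub>R\<^esub> u \<in> lin R [L]"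
    using t sR[of 1] uR by (simp add: s_def R.minus_minus_cancel)
  have ut: "u \<ominus>\<^bsub>R\<^esub> t \<in> lin R [L]" using R.idealD(5)[OF I tu] t uR by (simp add: R.minus_minus_cancel)
  have "u \<ominus>\<^bsub>R\<^esub> \<zero>\<^bsub>R\<^esub> = u" using uR by (simp add: a_minus_def[of R])
  then show ?thesis using primD[OF tZ tt te] ut by auto
qed

lemma Q_ge_2: "\<exists>m. Q = Suc (Suc m)"
proof -
  have "totient (card (carrier G)) > 0" using finite_G G.one_closed by (simp add: totient_gt_0_iff card_gt_0_iff) blast
  then have "1 \<le> totient (card (carrier G))" unfolding One_nat_def by (rule Suc_leI)
  then have "l ^ 1 \<le> Q" unfolding Q_def by (rule power_increasing) (use l_gt_1 in simp)
  then have "Q \<ge> 2" using l_gt_1 by simp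
  then show ?thesis by (intro exI[of _ "Q - 2"]) simp
qed

text \<open>Modulo T and 1 - e the element x is represented by a = c e in Z_l[Delta] e. As a^Q is
  congruent to a modulo L, u = a^(Q-1) is idempotent modulo L, hence congruent to 0 or e. In the
  first case a would be congruent to u a, so to 0, and x would lie in the ideal. So u is congruent
  to e, and y = a^(Q-2) inverts x.\<close>

lemma residue_field:
  assumes x: "x \<in> carrier R" "x \<notin> me"
  shows "\<exists>y\<in>carrier R. x \<otimes>\<^bsub>R\<^esub> y \<ominus>\<^bsub>R\<^esub> \<one>\<^bsub>R\<^esub> \<in> me"
proof -
  have I: "ideal (lin R [L]) R" by (rule R.lin_ideal) simp
  note mD = R.idealD[OF me_ideal]
  obtain c z where cz: "c \<in> ZlD l G" "z \<in> carrier R" "x = c \<oplus>\<^bsub>R\<^esub> T \<otimes>\<^bsub>R\<^esub> z" using const_split[OF x(1)] by blast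
  have cR: "c \<in> carrier R" using cz by simp
  define a where "a = c \<otimes>\<^bsub>R\<^esub> e"
  have aZ: "a \<in> ZlD l G" using cz by (simp add: a_def)
  have aR: "a \<in> carrier R" using aZ by simp
  have ae: "a \<otimes>\<^bsub>R\<^esub> e = a" using cR e_idem by (simp add: a_def R.m_assoc)
  have Te: "T \<otimes>\<^bsub>R\<^esub> v \<in> me" "(\<one>\<^bsub>R\<^esub> \<ominus>\<^bsub>R\<^esub> e) \<otimes>\<^bsub>R\<^esub> v \<in> me" if "v \<in> carrier R" for v
    using R.lin_mem[OF me_set _ that] by simp_all
  have "a \<notin> me"
  proof
    assume "a \<in> me"
    then have "a \<oplus>\<^bsub>R\<^esub> (T \<otimes>\<^bsub>R\<^esub> z \<oplus>\<^bsub>R\<^esub> (\<one>\<^bsub>R\<^esub> \<ominus>\<^bsub>R\<^esub> e) \<otimes>\<^bsub>R\<^esub> c) \<in> me"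
      using mD(4) Te cz(2) cR by blast
    then show False using x(2) cz(3) R.split_off_idempotent[OF e_carrier cR cz(2) T_carrier] by (simp add: a_def)
  qed
  then have aL: "a \<notin> lin R [L]" using L_sub_me by blast
  obtain m where m: "Q = Suc (Suc m)" using Q_ge_2 by blast
  define y where "y = a [^]\<^bsub>R\<^esub> m"
  have yR: "y \<in> carrier R" using aR by (simp add: y_def)
  define u where "u = a \<otimes>\<^bsub>R\<^esub> y"
  have uZ: "u \<in> ZlD l G" using aZ by (simp add: u_def y_def)
  have uR: "u \<in> carrier R" using uZ by simp
  have aQ: "a [^]\<^bsub>R\<^esub> Q = u \<otimes>\<^bsub>R\<^esub> a" unfolding m u_def y_def using aR by (simp add: R.m_ac)
  have ua: "u \<otimes>\<^bsub>R\<^esub> a \<ominus>\<^bsub>R\<^esub> a \<in> lin R [L]" using frobenius_ZlD[OF aZ] by (simp add: aQ)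
  have "(u \<otimes>\<^bsub>R\<^esub> a \<ominus>\<^bsub>R\<^esub> a) \<otimes>\<^bsub>R\<^esub> y \<in> lin R [L]" by (rule R.idealD(8)[OF I ua yR])
  moreover have "(u \<otimes>\<^bsub>R\<^esub> a \<ominus>\<^bsub>R\<^esub> a) \<otimes>\<^bsub>R\<^esub> y = u \<otimes>\<^bsub>R\<^esub> u \<ominus>\<^bsub>R\<^esub> u"
    using uR aR yR by (simp add: u_def a_minus_def[of R] R.l_distr R.l_minus R.m_assoc)
  ultimately have uu: "u \<otimes>\<^bsub>R\<^esub> u \<ominus>\<^bsub>R\<^esub> u \<in> lin R [L]" by simp
  have "u \<otimes>\<^bsub>R\<^esub> e = (a \<otimes>\<^bsub>R\<^esub> e) \<otimes>\<^bsub>R\<^esub> y"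
    using aR yR by (simp add: u_def R.m_assoc R.m_comm[of y e])
  then have ue: "u \<otimes>\<^bsub>R\<^esub> e = u" by (simp add: ae u_def)
  have "u \<notin> lin R [L]"
  proof
    assume "u \<in> lin R [L]"
    then have "u \<otimes>\<^bsub>R\<^esub> a \<in> lin R [L]" using R.idealD(8)[OF I _ aR] by blast
    from R.idealD(6)[OF I this ua] have "a \<in> lin R [L]" using uR aR by (simp add: R.minus_minus_cancel)
    then show False using aL by simp
  qed
  then have "u \<ominus>\<^bsub>R\<^esub> e \<in> me" using lift_idempotent[OF uZ uu ue] L_sub_me by blast
  then have "(c \<otimes>\<^bsub>R\<^esub> e \<otimes>\<^bsub>R\<^esub> y \<ominus>\<^bsub>R\<^esub> e) \<oplus>\<^bsub>R\<^esub> (T \<otimes>\<^bsub>R\<^esub> (z \<otimes>\<^bsub>R\<^esub> y) \<oplus>\<^bsub>R\<^esub> (\<one>\<^bsub>R\<^esub> \<ominus>\<^bsub>R\<^esub> e) \<otimes>\<^bsub>R\<^esub> (c \<otimes>\<^bsub>R\<^esub> y \<ominus>\<^bsub>R\<^esub> \<one>\<^bsub>R\<^esub>)) \<in> me"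
    using Te[of "z \<otimes>\<^bsub>R\<^esub> y"] Te[of "c \<otimes>\<^bsub>R\<^esub> y \<ominus>\<^bsub>R\<^esub> \<one>\<^bsub>R\<^esub>"] cz(2) yR cR by (intro mD(4)) (simp_all add: u_def a_def)
  then have "x \<otimes>\<^bsub>R\<^esub> y \<ominus>\<^bsub>R\<^esub> \<one>\<^bsub>R\<^esub> \<in> me"
    using R.residue_inverse_identity[OF x(1) yR e_carrier cR cz(2) T_carrier cz(3)] by simp
  then show ?thesis using yR by blast
qed

text \<open>Two elements whose constant coefficients agree modulo l differ by an element of (L, T),
  so a coset is determined by finitely many residues.\<close>

lemma residue_finite: "finite (cosets R me (carrier R))"
  unfolding cosets_def
proof (rule finite_image_coarser)
  let ?f = "\<lambda>x. \<lambda>g\<in>carrier G. x g 0 1"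
  show "finite (?f ` carrier R)"
  proof (rule finite_subset)
    have "0 \<le> x g 0 1 \<and> x g 0 1 < int l" if "x \<in> carrier R" "g \<in> carrier G" for x g
      using GR_coeff_mod[OF that, of 0 1] l_gt_1 pos_mod_bound[of "int l" "x g 0 1"] pos_mod_sign[of "int l" "x g 0 1"] by simp
    then show "?f ` carrier R \<subseteq> Pi\<^sub>E (carrier G) (\<lambda>_. {0..<int l})" by auto
    show "finite (Pi\<^sub>E (carrier G) (\<lambda>_. {0..<int l}))" using finite_G by (intro finite_PiE) auto
  qed
  fix x y assume xy: "x \<in> carrier R" "y \<in> carrier R" "?f x = ?f y"
  have d: "(x \<ominus>\<^bsub>R\<^esub> y) g 0 1 = 0" if "g \<in> carrier G" for g
    using fun_cong[OF xy(3), of g] that xy by (simp add: GR_minus)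
  obtain c z where cz: "c \<in> ZlD l G" "z \<in> carrier R" "x \<ominus>\<^bsub>R\<^esub> y = c \<oplus>\<^bsub>R\<^esub> T \<otimes>\<^bsub>R\<^esub> z" "\<And>g. g \<in> carrier G \<Longrightarrow> c g 0 = (x \<ominus>\<^bsub>R\<^esub> y) g 0"
    using const_split[of "x \<ominus>\<^bsub>R\<^esub> y"] xy by auto
  have "c \<in> lin R [L]" using d cz by (simp add: ZlD_L_iff)
  then have "x \<ominus>\<^bsub>R\<^esub> y \<in> me"
    unfolding cz(3) using R.idealD(4)[OF me_ideal] L_sub_me R.lin_mem[OF me_set, of T z] cz(2) by auto
  then show "me +>\<^bsub>R\<^esub> x = me +>\<^bsub>R\<^esub> y"
    using R.coset_eq_iff[OF R.idealD(1)[OF me_ideal]] xy by simp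
qed

lemma iwasawa_GR: "iwasawa R l (index R me (carrier R)) L T e"
  by unfold_locales
    (use prime_l L_nat e_idem reg_L reg_T jacobson residue_field residue_finite in auto)

end

end

section \<open>The degree of a character\<close>

context ladic_group_ring begin

lemma ZlD_zero: "x \<in> ZlD l G \<Longrightarrow> g \<in> carrier G \<Longrightarrow> i \<noteq> 0 \<Longrightarrow> x g i k = 0"
  unfolding ZlD_iff by blast

lemma embZl_add: "a \<in> carrier (Zl l) \<Longrightarrow> b \<in> carrier (Zl l) \<Longrightarrow> embZl l G (a \<oplus>\<^bsub>Zl l\<^esub> b) = embZl l G a \<oplus>\<^bsub>R\<^esub> embZl l G b"
  by (rule GR_eqI) (simp_all add: embZl_coeff GR_add Zl_sel(2))

lemma embZl_times: "a \<in> carrier (Zl l) \<Longrightarrow> b \<in> carrier (Zl l) \<Longrightarrow> embZl l G (a \<otimes>\<^bsub>Zl l\<^esub> b) = embZl l G a \<otimes>\<^bsub>R\<^esub> embZl l G b"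
  by (rule GR_eqI) (simp_all add: embZl_coeff embZl_mult Zl_sel(3))

lemma embZl_zero: "embZl l G \<zero>\<^bsub>Zl l\<^esub> = \<zero>\<^bsub>R\<^esub>"
  by (rule GR_eqI) (simp_all add: embZl_coeff GR_zero Zl_sel(5))

lemma embZl_one: "embZl l G \<one>\<^bsub>Zl l\<^esub> = \<one>\<^bsub>R\<^esub>"
  by (rule GR_eqI) (simp_all add: embZl_coeff GR_one Zl_sel(4))

lemma embZl_ZlD [simp]: "c \<in> carrier (Zl l) \<Longrightarrow> embZl l G c \<in> ZlD l G"
  unfolding ZlD_iff by (simp add: embZl_coeff)

definition lZ :: "nat \<Rightarrow> int" where "lZ k = int l mod int l ^ k"

lemma lZ_carrier [simp]: "lZ \<in> carrier (Zl l)" unfolding lZ_def by (rule intZl_closed)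

lemma embZl_lZ: "embZl l G lZ = L"
proof -
  have "lZ = (\<lambda>k. int l mod int l ^ k)" by (rule ext) (rule lZ_def)
  then show ?thesis by (simp add: L_def intLD_def)
qed

text \<open>Transferred from \<open>mem_L_iff\<close> by reading the coefficient of
  \<open>embZl\<close> at the identity. The last clause, a gain of one digit, drives the induction
  for linear independence in \<open>has_Zl_rank_exists\<close>.\<close>

lemma Zl_divide:
  assumes a: "a \<in> carrier (Zl l)" "a 1 = 0"
  obtains b where "b \<in> carrier (Zl l)" "a = lZ \<otimes>\<^bsub>Zl l\<^esub> b" "\<And>k. b k = 0 \<Longrightarrow> a (Suc k) = 0"
proof -
  have "embZl l G a \<in> lin R [L]" using a by (simp add: mem_L_iff embZl_coeff)
  then obtain v where v: "v \<in> carrier R" "embZl l G a = L \<otimes>\<^bsub>R\<^esub> v" using R.lin1 by auto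
  define b where "b = v \<one>\<^bsub>G\<^esub> 0"
  have b: "b \<in> carrier (Zl l)" using v by (simp add: b_def GR_coeff)
  have ab: "a k = int l * b k mod int l ^ k" for k
    using L_mult[OF v(1) G.one_closed, of 0 k] v(2) embZl_coeff[OF G.one_closed, of a 0 k] by (simp add: b_def)
  show ?thesis
  proof (rule that[OF b])
    show "a = lZ \<otimes>\<^bsub>Zl l\<^esub> b" by (rule ext) (simp add: ab Zl_sel(3) lZ_def mod_mult_left_eq)
    show "a (Suc k) = 0" if "b k = 0" for k
    proof -
      have "b (Suc k) mod int l ^ k = 0" using Zl_Suc[OF b, of k] that by simp
      then have "int l ^ k dvd b (Suc k)" by (simp add: mod_0_imp_dvd)
      then show ?thesis by (simp add: ab)
    qed
  qed
qed

text \<open>For an integer m inverse to a modulo l, the product a m is congruent to 1 modulo L and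
  thus a unit by \<open>jacobson\<close>. The inverse of a is read off at the identity and the
  constant coefficient.\<close>

lemma Zl_unit:
  assumes a: "a \<in> carrier (Zl l)" "a 1 \<noteq> 0"
  obtains u where "u \<in> carrier (Zl l)" "u \<otimes>\<^bsub>Zl l\<^esub> a = \<one>\<^bsub>Zl l\<^esub>"
proof -
  have "a 1 mod int l = a 1" using Zl_mod[OF a(1), of 1] by simp
  then have "\<not> int l dvd a 1" using a(2) by (metis dvd_imp_mod_0)
  then have "coprime (a 1) (int l)" using prime_l by (metis coprime_commute prime_imp_coprime prime_nat_int_transfer)
  then obtain m where m: "[a 1 * m = 1] (mod int l)" using cong_solve_coprime_int by blast
  define x where "x = embZl l G a \<otimes>\<^bsub>R\<^esub> intLD l G m"
  have xR: "x \<in> carrier R" using a by (simp add: x_def)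
  have xc: "x g i 1 = (if g = \<one>\<^bsub>G\<^esub> \<and> i = 0 then 1 mod int l else 0)" if "g \<in> carrier G" for g i
    using that a m by (simp add: x_def embZl_mult intLD_coeff mod_mult_right_eq cong_def)
  have "x \<ominus>\<^bsub>R\<^esub> \<one>\<^bsub>R\<^esub> \<in> lin R [L]" using xR by (simp add: mem_L_iff GR_minus xc[unfolded One_nat_def] GR_one)
  then have xL: "x \<ominus>\<^bsub>R\<^esub> \<one>\<^bsub>R\<^esub> \<in> lin R [L, T]" using R.lin_mono_set[of "[L, T]" "[L]"] by auto
  obtain d where d: "d \<in> carrier R" "(\<one>\<^bsub>R\<^esub> \<oplus>\<^bsub>R\<^esub> (x \<ominus>\<^bsub>R\<^esub> \<one>\<^bsub>R\<^esub>)) \<otimes>\<^bsub>R\<^esub> d = \<one>\<^bsub>R\<^esub>" using jacobson[OF xL] by blast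
  have "\<one>\<^bsub>R\<^esub> \<oplus>\<^bsub>R\<^esub> (x \<ominus>\<^bsub>R\<^esub> \<one>\<^bsub>R\<^esub>) = x" using xR by (simp add: R.a_comm[of "\<one>\<^bsub>R\<^esub>"] R.minus_minus_cancel)
  then have d2: "embZl l G a \<otimes>\<^bsub>R\<^esub> (intLD l G m \<otimes>\<^bsub>R\<^esub> d) = \<one>\<^bsub>R\<^esub>" using d a by (simp add: x_def R.m_assoc)
  define u where "u = (intLD l G m \<otimes>\<^bsub>R\<^esub> d) \<one>\<^bsub>G\<^esub> 0"
  have u: "u \<in> carrier (Zl l)" unfolding u_def by (rule GR_coeff) (use d in simp_all)
  have "u \<otimes>\<^bsub>Zl l\<^esub> a = \<one>\<^bsub>Zl l\<^esub>"
  proof (rule ext)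
    fix k
    have "(a k * u k) mod int l ^ k = 1 mod int l ^ k"
      using embZl_mult[OF a(1) _ G.one_closed, of "intLD l G m \<otimes>\<^bsub>R\<^esub> d" 0 k] d d2 by (simp add: u_def GR_one)
    then show "(u \<otimes>\<^bsub>Zl l\<^esub> a) k = \<one>\<^bsub>Zl l\<^esub> k" by (simp add: Zl_sel(3,4) mult.commute)
  qed
  then show ?thesis using that u by blast
qed

definition comb :: "nat set \<Rightarrow> (nat \<Rightarrow> nat \<Rightarrow> int) \<Rightarrow> (nat \<Rightarrow> 'g LD) \<Rightarrow> 'g LD" where
  "comb I c b = finsum R (\<lambda>i. embZl l G (c i) \<otimes>\<^bsub>R\<^esub> b i) I"

lemma comb_closed: "\<lbrakk>\<And>i. i \<in> I \<Longrightarrow> b i \<in> carrier R; \<And>i. i \<in> I \<Longrightarrow> c i \<in> carrier (Zl l)\<rbrakk> \<Longrightarrow> comb I c b \<in> carrier R"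
  unfolding comb_def by (rule R.finsum_closed) auto

lemma comb_cong: "\<lbrakk>\<And>i. i \<in> I \<Longrightarrow> b i \<in> carrier R; \<And>i. i \<in> I \<Longrightarrow> c i \<in> carrier (Zl l); \<And>i. i \<in> I \<Longrightarrow> c i = c' i\<rbrakk> \<Longrightarrow> comb I c b = comb I c' b"
  unfolding comb_def by (rule R.finsum_cong') auto

lemma comb_insert:
  assumes "finite I" "j \<notin> I" "\<And>i. i \<in> insert j I \<Longrightarrow> b i \<in> carrier R" "\<And>i. i \<in> insert j I \<Longrightarrow> c i \<in> carrier (Zl l)"
  shows "comb (insert j I) c b = embZl l G (c j) \<otimes>\<^bsub>R\<^esub> b j \<oplus>\<^bsub>R\<^esub> comb I c b"
  unfolding comb_def by (rule R.finsum_insert) (use assms in auto)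

lemma (in cring) linear_combination_step:
  assumes "c \<in> carrier R" "s \<in> carrier R" "d \<in> carrier R" "b \<in> carrier R" "u \<in> carrier R" "v \<in> carrier R"
  shows "(c \<oplus> s \<otimes> d) \<otimes> b \<oplus> (u \<oplus> s \<otimes> v) = (c \<otimes> b \<oplus> u) \<oplus> s \<otimes> (d \<otimes> b \<oplus> v)"
  using assms by algebra

lemma comb_linear:
  assumes "finite I" "\<And>i. i \<in> I \<Longrightarrow> b i \<in> carrier R" "\<And>i. i \<in> I \<Longrightarrow> c i \<in> carrier (Zl l)"
    "\<And>i. i \<in> I \<Longrightarrow> d i \<in> carrier (Zl l)" "s \<in> carrier (Zl l)"
  shows "comb I (\<lambda>i. c i \<oplus>\<^bsub>Zl l\<^esub> s \<otimes>\<^bsub>Zl l\<^esub> d i) b = comb I c b \<oplus>\<^bsub>R\<^esub> embZl l G s \<otimes>\<^bsub>R\<^esub> comb I d b"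
  using assms(1-4)
proof (induction I rule: finite_induct)
  case empty
  then show ?case using assms(5) by (simp add: comb_def)
next
  case (insert j I)
  have "comb (insert j I) (\<lambda>i. c i \<oplus>\<^bsub>Zl l\<^esub> s \<otimes>\<^bsub>Zl l\<^esub> d i) b =
    (embZl l G (c j) \<oplus>\<^bsub>R\<^esub> embZl l G s \<otimes>\<^bsub>R\<^esub> embZl l G (d j)) \<otimes>\<^bsub>R\<^esub> b j \<oplus>\<^bsub>R\<^esub> (comb I c b \<oplus>\<^bsub>R\<^esub> embZl l G s \<otimes>\<^bsub>R\<^esub> comb I d b)"
    using insert assms(5) by (subst comb_insert) (simp_all add: embZl_add embZl_times)
  also have "\<dots> = (embZl l G (c j) \<otimes>\<^bsub>R\<^esub> b j \<oplus>\<^bsub>R\<^esub> comb I c b) \<oplus>\<^bsub>R\<^esub> embZl l G s \<otimes>\<^bsub>R\<^esub> (embZl l G (d j) \<otimes>\<^bsub>R\<^esub> b j \<oplus>\<^bsub>R\<^esub> comb I d b)"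
    by (rule R.linear_combination_step) (use insert assms(5) comb_closed in simp_all)
  also have "embZl l G (c j) \<otimes>\<^bsub>R\<^esub> b j \<oplus>\<^bsub>R\<^esub> comb I c b = comb (insert j I) c b"
    by (rule comb_insert[symmetric]) (use insert in auto)
  also have "embZl l G (d j) \<otimes>\<^bsub>R\<^esub> b j \<oplus>\<^bsub>R\<^esub> comb I d b = comb (insert j I) d b"
    by (rule comb_insert[symmetric]) (use insert in auto)
  finally show ?case .
qed

lemma comb_scale:
  assumes "finite I" "\<And>i. i \<in> I \<Longrightarrow> b i \<in> carrier R" "\<And>i. i \<in> I \<Longrightarrow> d i \<in> carrier (Zl l)" "s \<in> carrier (Zl l)"
  shows "comb I (\<lambda>i. s \<otimes>\<^bsub>Zl l\<^esub> d i) b = embZl l G s \<otimes>\<^bsub>R\<^esub> comb I d b"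
proof -
  have z: "comb I (\<lambda>i. \<zero>\<^bsub>Zl l\<^esub>) b = \<zero>\<^bsub>R\<^esub>"
    unfolding comb_def by (rule R.add.finprod_one_eqI) (use assms in \<open>simp add: embZl_zero\<close>)
  have "comb I (\<lambda>i. s \<otimes>\<^bsub>Zl l\<^esub> d i) b = comb I (\<lambda>i. \<zero>\<^bsub>Zl l\<^esub> \<oplus>\<^bsub>Zl l\<^esub> s \<otimes>\<^bsub>Zl l\<^esub> d i) b"
    by (rule comb_cong) (use assms in simp_all)
  also have "\<dots> = comb I (\<lambda>i. \<zero>\<^bsub>Zl l\<^esub>) b \<oplus>\<^bsub>R\<^esub> embZl l G s \<otimes>\<^bsub>R\<^esub> comb I d b"
    by (rule comb_linear) (use assms in simp_all)
  finally show ?thesis using assms comb_closed by (simp add: z)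
qed

context
  fixes e assumes prim: "prim_idem l G e"
begin

lemma Zphi_iff: "x \<in> Zphi l G e \<longleftrightarrow> x \<in> ZlD l G \<and> x \<otimes>\<^bsub>R\<^esub> e = x"
proof
  assume "x \<in> Zphi l G e"
  then obtain a where "a \<in> ZlD l G" "x = a \<otimes>\<^bsub>R\<^esub> e" by (auto simp: Zphi_def)
  then show "x \<in> ZlD l G \<and> x \<otimes>\<^bsub>R\<^esub> e = x" using e_ZlD[OF prim] e_idem[OF prim] by (simp add: R.m_assoc)
next
  assume "x \<in> ZlD l G \<and> x \<otimes>\<^bsub>R\<^esub> e = x"
  then have "x = x \<otimes>\<^bsub>R\<^esub> e \<and> x \<in> ZlD l G" by simp
  then show "x \<in> Zphi l G e" unfolding Zphi_def by blast
qed

lemma Zphi_ZlD: "x \<in> Zphi l G e \<Longrightarrow> x \<in> ZlD l G" unfolding Zphi_iff by blast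

lemma Zphi_carrier [simp]: "x \<in> Zphi l G e \<Longrightarrow> x \<in> carrier R" by (rule ZlD_carrier[OF Zphi_ZlD])

lemma Zphi_divide:
  assumes y: "y \<in> Zphi l G e" "y \<in> lin R [L]"
  obtains z where "z \<in> Zphi l G e" "y = L \<otimes>\<^bsub>R\<^esub> z"
proof -
  obtain v where v: "v \<in> carrier R" "y = L \<otimes>\<^bsub>R\<^esub> v" using y(2) R.lin1 by auto
  obtain c t where c: "c \<in> ZlD l G" "t \<in> carrier R" "v = c \<oplus>\<^bsub>R\<^esub> T \<otimes>\<^bsub>R\<^esub> t" "\<And>g. g \<in> carrier G \<Longrightarrow> c g 0 = v g 0"
    using const_split[OF v(1)] by blast
  have "y = L \<otimes>\<^bsub>R\<^esub> c"
  proof (rule GR_eqI)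
    fix g i k assume g: "g \<in> carrier G"
    show "y g i k = (L \<otimes>\<^bsub>R\<^esub> c) g i k"
    proof (cases "i = 0")
      case True
      then show ?thesis unfolding v(2) using c v(1) g by (simp add: L_mult)
    next
      case False
      then show ?thesis using ZlD_zero[OF Zphi_ZlD[OF y(1)] g] ZlD_zero[OF c(1) g] c(1) g by (simp add: L_mult)
    qed
  qed (use y c in simp_all)
  then have "y = L \<otimes>\<^bsub>R\<^esub> (c \<otimes>\<^bsub>R\<^esub> e)" using y(1) c(1) e_carrier[OF prim] by (simp add: Zphi_iff R.m_assoc[symmetric])
  moreover have "c \<otimes>\<^bsub>R\<^esub> e \<in> Zphi l G e" using c(1) by (auto simp: Zphi_def)
  ultimately show ?thesis using that by blast
qed

text \<open>Arbitrary finite index sets are allowed, so that \<open>spans_remove\<close> can drop a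
  generator without renumbering the others.\<close>

definition spans :: "nat set \<Rightarrow> (nat \<Rightarrow> 'g LD) \<Rightarrow> bool" where
  "spans I b \<longleftrightarrow> finite I \<and> (\<forall>i\<in>I. b i \<in> Zphi l G e) \<and>
     (\<forall>y\<in>Zphi l G e. \<exists>c. (\<forall>i\<in>I. c i \<in> carrier (Zl l)) \<and> y = comb I c b)"

text \<open>The group elements span Z_l[Delta] over Z_l, so their products with e span
  \<open>Zphi\<close>.\<close>

lemma spans_exists: "\<exists>I b. spans I b"
proof -
  obtain h where h: "bij_betw h {..<card (carrier G)} (carrier G)"
    using ex_bij_betw_nat_finite[OF finite_G] by (auto simp: atLeast0LessThan)
  let ?I = "{..<card (carrier G)}"
  have hG: "i \<in> ?I \<Longrightarrow> h i \<in> carrier G" for i using h bij_betwE by blast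
  define b where "b i = delta (h i) \<otimes>\<^bsub>R\<^esub> e" for i
  have eR: "e \<in> carrier R" by (rule e_carrier[OF prim])
  have bZ: "b i \<in> Zphi l G e" for i unfolding Zphi_def b_def by (rule CollectI, rule exI[of _ "delta (h i)"]) simp
  have "\<exists>c. (\<forall>i\<in>?I. c i \<in> carrier (Zl l)) \<and> y = comb ?I c b" if y: "y \<in> Zphi l G e" for y
  proof (intro exI conjI ballI)
    have yR: "y \<in> carrier R" using y by simp
    let ?c = "\<lambda>i. y (h i) 0"
    show "?c i \<in> carrier (Zl l)" if "i \<in> ?I" for i using GR_coeff[OF yR hG[OF that]] .
    have yc: "y g 0 \<in> carrier (Zl l)" if "g \<in> carrier G" for g using GR_coeff[OF yR that] .
    have coeff: "finsum R (\<lambda>g. embZl l G (y g 0) \<otimes>\<^bsub>R\<^esub> delta g) H u i k = (if u \<in> H \<and> i = 0 then y u 0 k else 0)"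
      if "finite H" "H \<subseteq> carrier G" "u \<in> carrier G" for H u i k
      using that
    proof (induction H rule: finite_induct)
      case (insert g H)
      have "finsum R (\<lambda>g. embZl l G (y g 0) \<otimes>\<^bsub>R\<^esub> delta g) (insert g H) =
         embZl l G (y g 0) \<otimes>\<^bsub>R\<^esub> delta g \<oplus>\<^bsub>R\<^esub> finsum R (\<lambda>g. embZl l G (y g 0) \<otimes>\<^bsub>R\<^esub> delta g) H"
        by (rule R.finsum_insert) (use insert yc in auto)
      moreover have "(embZl l G (y g 0) \<otimes>\<^bsub>R\<^esub> delta g) u i k = (if u = g \<and> i = 0 then y g 0 k else 0)"
        using insert yc[of g] yR by (simp add: embZl_mult delta_coeff mod_mult_right_eq)
      ultimately show ?case using insert yR by (auto simp: GR_add)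
    qed (simp add: GR_zero)
    have "y = finsum R (\<lambda>g. embZl l G (y g 0) \<otimes>\<^bsub>R\<^esub> delta g) (carrier G)"
    proof (rule GR_eqI)
      fix g i k assume "g \<in> carrier G"
      then show "y g i k = finsum R (\<lambda>g. embZl l G (y g 0) \<otimes>\<^bsub>R\<^esub> delta g) (carrier G) g i k"
        using coeff[OF finite_G order_refl] ZlD_zero[OF Zphi_ZlD[OF y]] by simp
    qed (use yR yc in \<open>auto intro!: R.finsum_closed\<close>)
    then have "y \<otimes>\<^bsub>R\<^esub> e = finsum R (\<lambda>g. embZl l G (y g 0) \<otimes>\<^bsub>R\<^esub> delta g) (carrier G) \<otimes>\<^bsub>R\<^esub> e" by simp
    also have "\<dots> = finsum R (\<lambda>g. embZl l G (y g 0) \<otimes>\<^bsub>R\<^esub> delta g \<otimes>\<^bsub>R\<^esub> e) (carrier G)"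
      by (rule R.finsum_ldistr[OF finite_G eR]) (use yc in auto)
    also have "\<dots> = finsum R (\<lambda>g. embZl l G (y g 0) \<otimes>\<^bsub>R\<^esub> delta g \<otimes>\<^bsub>R\<^esub> e) (h ` ?I)"
      using h by (simp add: bij_betw_def)
    also have "\<dots> = finsum R (\<lambda>i. embZl l G (y (h i) 0) \<otimes>\<^bsub>R\<^esub> delta (h i) \<otimes>\<^bsub>R\<^esub> e) ?I"
      by (rule R.finsum_reindex) (use h hG yc eR in \<open>auto simp: bij_betw_def\<close>)
    also have "\<dots> = comb ?I ?c b"
      unfolding comb_def by (rule R.finsum_cong') (use hG yc eR in \<open>auto simp: b_def R.m_assoc\<close>)
    finally show "y = comb ?I ?c b" using y by (simp add: Zphi_iff)
  qed
  then have "spans ?I b" using bZ by (simp add: spans_def)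
  then show ?thesis by blast
qed

text \<open>A relation with a unit coefficient makes a generator superfluous, so a spanning family of
  minimal length is a basis.\<close>

lemma spans_remove:
  assumes s: "spans I b" and d: "\<And>i. i \<in> I \<Longrightarrow> d i \<in> carrier (Zl l)" "comb I d b = \<zero>\<^bsub>R\<^esub>" and j: "j \<in> I" "d j 1 \<noteq> 0"
  shows "spans (I - {j}) b"
proof -
  have fI: "finite I" and bR: "i \<in> I \<Longrightarrow> b i \<in> carrier R" for i using s by (auto simp: spans_def)
  obtain u where u: "u \<in> carrier (Zl l)" "u \<otimes>\<^bsub>Zl l\<^esub> d j = \<one>\<^bsub>Zl l\<^esub>" using Zl_unit[OF d(1)[OF j(1)] j(2)] .
  have "\<exists>c. (\<forall>i\<in>I - {j}. c i \<in> carrier (Zl l)) \<and> y = comb (I - {j}) c b" if y: "y \<in> Zphi l G e" for y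
  proof -
    obtain c where c: "\<And>i. i \<in> I \<Longrightarrow> c i \<in> carrier (Zl l)" "y = comb I c b" using s y unfolding spans_def by metis
    \<comment> \<open>Adding t times the relation d cancels the coefficient of b j, since u is the
      inverse of d j, and does not change the combination.\<close>
    define t where "t = \<ominus>\<^bsub>Zl l\<^esub> (c j \<otimes>\<^bsub>Zl l\<^esub> u)"
    have t: "t \<in> carrier (Zl l)" using c j u by (simp add: t_def)
    define c' where "c' i = c i \<oplus>\<^bsub>Zl l\<^esub> t \<otimes>\<^bsub>Zl l\<^esub> d i" for i
    have c': "i \<in> I \<Longrightarrow> c' i \<in> carrier (Zl l)" for i using c d t by (simp add: c'_def)
    have "comb I c' b = comb I c b \<oplus>\<^bsub>R\<^esub> embZl l G t \<otimes>\<^bsub>R\<^esub> comb I d b"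
      unfolding c'_def by (rule comb_linear) (use fI bR c d t in auto)
    also have "\<dots> = y" using d(2) c(2) t y by simp
    finally have y2: "comb I c' b = y" .
    have "t \<otimes>\<^bsub>Zl l\<^esub> d j = \<ominus>\<^bsub>Zl l\<^esub> (c j \<otimes>\<^bsub>Zl l\<^esub> (u \<otimes>\<^bsub>Zl l\<^esub> d j))"
      using c(1)[OF j(1)] u(1) d(1)[OF j(1)] by (simp add: t_def Zl.l_minus Zl.m_assoc)
    then have "c' j = \<zero>\<^bsub>Zl l\<^esub>" using c(1)[OF j(1)] u(2) by (simp add: c'_def Zl.r_neg)
    moreover have "comb (insert j (I - {j})) c' b = embZl l G (c' j) \<otimes>\<^bsub>R\<^esub> b j \<oplus>\<^bsub>R\<^esub> comb (I - {j}) c' b"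
      by (rule comb_insert) (use fI bR c' j in auto)
    ultimately have "y = comb (I - {j}) c' b"
      using y2 j bR c' comb_closed[where I = "I - {j}" and b = b and c = c'] by (simp add: embZl_zero insert_absorb)
    then show ?thesis using c' by blast
  qed
  then show ?thesis using s by (auto simp: spans_def)
qed

text \<open>In a spanning family of least size every relation has all coefficients divisible by l,
  by \<open>spans_remove\<close>. Because L is regular the relation can be divided by l, and by
  repetition its coefficients vanish modulo every l^k. The rest renumbers the basis by an initial
  segment, as \<open>has_Zl_rank\<close> demands.\<close>

lemma has_Zl_rank_exists: "\<exists>n. has_Zl_rank l G e n"
proof -
  define n where "n = (LEAST n. \<exists>I b. spans I b \<and> card I = n)"
  have "\<exists>I b. spans I b \<and> card I = n" unfolding n_def by (rule LeastI_ex) (use spans_exists in blast)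
  then obtain I b where I: "spans I b" "card I = n" by blast
  have fI: "finite I" and bZ: "\<And>i. i \<in> I \<Longrightarrow> b i \<in> Zphi l G e" using I by (auto simp: spans_def)
  have bR: "i \<in> I \<Longrightarrow> b i \<in> carrier R" for i using bZ by auto
  have lead: "d j 1 = 0" if d: "\<And>i. i \<in> I \<Longrightarrow> d i \<in> carrier (Zl l)" "comb I d b = \<zero>\<^bsub>R\<^esub>" and j: "j \<in> I" for d j
  proof (rule ccontr)
    assume "d j 1 \<noteq> 0"
    then have "spans (I - {j}) b" using spans_remove[OF I(1) d j] by blast
    then have "n \<le> card (I - {j})" unfolding n_def by (intro Least_le) blast
    moreover have "card (I - {j}) < n" unfolding I(2)[symmetric] by (rule card_Diff1_less[OF fI j])
    ultimately show False by simp
  qed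
  have indep: "\<forall>j\<in>I. d j k = 0" if "\<And>i. i \<in> I \<Longrightarrow> d i \<in> carrier (Zl l)" "comb I d b = \<zero>\<^bsub>R\<^esub>" for d k
    using that
  proof (induction k arbitrary: d)
    case 0
    then show ?case using Zl_mod[of _ 0] by fastforce
  next
    case (Suc k)
    have "\<forall>j\<in>I. \<exists>a. a \<in> carrier (Zl l) \<and> d j = lZ \<otimes>\<^bsub>Zl l\<^esub> a \<and> (\<forall>k. a k = 0 \<longrightarrow> d j (Suc k) = 0)"
    proof
      fix j assume j: "j \<in> I"
      obtain a where "a \<in> carrier (Zl l)" "d j = lZ \<otimes>\<^bsub>Zl l\<^esub> a" "\<And>k. a k = 0 \<Longrightarrow> d j (Suc k) = 0"
        using Zl_divide[OF Suc.prems(1)[OF j] lead[OF Suc.prems j]] by blast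
      then show "\<exists>a. a \<in> carrier (Zl l) \<and> d j = lZ \<otimes>\<^bsub>Zl l\<^esub> a \<and> (\<forall>k. a k = 0 \<longrightarrow> d j (Suc k) = 0)" by blast
    qed
    then obtain d' where d': "\<forall>j\<in>I. d' j \<in> carrier (Zl l) \<and> d j = lZ \<otimes>\<^bsub>Zl l\<^esub> d' j \<and> (\<forall>k. d' j k = 0 \<longrightarrow> d j (Suc k) = 0)"
      using bchoice[of I] by metis
    have "comb I d b = comb I (\<lambda>i. lZ \<otimes>\<^bsub>Zl l\<^esub> d' i) b" by (rule comb_cong) (use bR Suc.prems d' in auto)
    also have "\<dots> = L \<otimes>\<^bsub>R\<^esub> comb I d' b" using comb_scale[OF fI bR _ lZ_carrier, where d = d'] d' by (simp add: embZl_lZ)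
    finally have "L \<otimes>\<^bsub>R\<^esub> comb I d' b = \<zero>\<^bsub>R\<^esub>" using Suc.prems by simp
    then have c0: "comb I d' b = \<zero>\<^bsub>R\<^esub>" using reg_L comb_closed[where I = I and b = b and c = d'] bR d' by simp
    have "\<forall>j\<in>I. d' j k = 0" by (rule Suc.IH) (use d' c0 in auto)
    then show ?case using d' by blast
  qed
  have inj: "c i = c' i" if c: "\<And>i. i \<in> I \<Longrightarrow> c i \<in> carrier (Zl l)" "\<And>i. i \<in> I \<Longrightarrow> c' i \<in> carrier (Zl l)"
    "comb I c b = comb I c' b" and i: "i \<in> I" for c c' i
  proof -
    let ?m = "\<ominus>\<^bsub>Zl l\<^esub> \<one>\<^bsub>Zl l\<^esub>"
    have m: "embZl l G ?m = \<ominus>\<^bsub>R\<^esub> \<one>\<^bsub>R\<^esub>"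
    proof (rule R.minus_equality[symmetric])
      show "embZl l G ?m \<oplus>\<^bsub>R\<^esub> \<one>\<^bsub>R\<^esub> = \<zero>\<^bsub>R\<^esub>"
        using embZl_add[of ?m "\<one>\<^bsub>Zl l\<^esub>"] by (simp add: embZl_one embZl_zero Zl.l_neg)
    qed simp_all
    have "comb I (\<lambda>i. c i \<oplus>\<^bsub>Zl l\<^esub> ?m \<otimes>\<^bsub>Zl l\<^esub> c' i) b = comb I c b \<oplus>\<^bsub>R\<^esub> embZl l G ?m \<otimes>\<^bsub>R\<^esub> comb I c' b"
      by (rule comb_linear) (use fI bR c in auto)
    also have "\<dots> = \<zero>\<^bsub>R\<^esub>" using c comb_closed[where I = I and b = b and c = c'] bR by (simp add: m R.l_minus R.r_neg)
    finally have "(c i \<oplus>\<^bsub>Zl l\<^esub> ?m \<otimes>\<^bsub>Zl l\<^esub> c' i) k = 0" for k using indep[of "\<lambda>i. c i \<oplus>\<^bsub>Zl l\<^esub> ?m \<otimes>\<^bsub>Zl l\<^esub> c' i" k] c i by simp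
    then have "c i \<oplus>\<^bsub>Zl l\<^esub> ?m \<otimes>\<^bsub>Zl l\<^esub> c' i = \<zero>\<^bsub>Zl l\<^esub>" by (simp add: fun_eq_iff Zl_sel(5))
    then have "c i \<ominus>\<^bsub>Zl l\<^esub> c' i = \<zero>\<^bsub>Zl l\<^esub>" using c i by (simp add: Zl.l_minus a_minus_def[of "Zl l"])
    then show ?thesis using c i by simp
  qed
  obtain h where h: "bij_betw h {..<n} I" using ex_bij_betw_nat_finite[OF fI] I(2) by (auto simp: atLeast0LessThan)
  have hI: "i < n \<Longrightarrow> h i \<in> I" for i using h bij_betwE by blast
  have re: "finsum R (\<lambda>i. embZl l G (c (h i)) \<otimes>\<^bsub>R\<^esub> b (h i)) {..<n} = comb I c b" if "\<And>i. i \<in> I \<Longrightarrow> c i \<in> carrier (Zl l)" for c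
  proof -
    have "comb I c b = finsum R (\<lambda>i. embZl l G (c i) \<otimes>\<^bsub>R\<^esub> b i) (h ` {..<n})" using h by (simp add: comb_def bij_betw_def)
    also have "\<dots> = finsum R (\<lambda>i. embZl l G (c (h i)) \<otimes>\<^bsub>R\<^esub> b (h i)) {..<n}"
      by (rule R.finsum_reindex) (use h hI that bR in \<open>auto simp: bij_betw_def\<close>)
    finally show ?thesis by simp
  qed
  let ?inv = "inv_into {..<n} h"
  have hinv: "?inv (h i) = i" if "i < n" for i using h that by (simp add: bij_betw_def inv_into_f_f)
  have invI: "?inv i < n" "h (?inv i) = i" if "i \<in> I" for i
    using h that inv_into_into[of i h "{..<n}"] by (auto simp: bij_betw_def f_inv_into_f)
  have "has_Zl_rank l G e n" unfolding has_Zl_rank_def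
  proof (intro exI[of _ "b \<circ> h"] conjI allI impI ballI)
    show "(b \<circ> h) i \<in> Zphi l G e" if "i < n" for i using bZ hI[OF that] by simp
    fix y assume y: "y \<in> Zphi l G e"
    obtain c where c: "\<And>i. i \<in> I \<Longrightarrow> c i \<in> carrier (Zl l)" "y = comb I c b" using I(1) y unfolding spans_def by metis
    show "\<exists>!c. c \<in> {..<n} \<rightarrow>\<^sub>E carrier (Zl l) \<and> y = finsum R (\<lambda>i. embZl l G (c i) \<otimes>\<^bsub>R\<^esub> (b \<circ> h) i) {..<n}"
    proof (rule ex1I[of _ "\<lambda>i\<in>{..<n}. c (h i)"])
      have "finsum R (\<lambda>i. embZl l G ((\<lambda>i\<in>{..<n}. c (h i)) i) \<otimes>\<^bsub>R\<^esub> (b \<circ> h) i) {..<n} =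
          finsum R (\<lambda>i. embZl l G (c (h i)) \<otimes>\<^bsub>R\<^esub> b (h i)) {..<n}"
        by (rule R.finsum_cong') (use hI c bR in auto)
      also have "\<dots> = comb I c b" by (rule re) (rule c(1))
      finally show "(\<lambda>i\<in>{..<n}. c (h i)) \<in> {..<n} \<rightarrow>\<^sub>E carrier (Zl l) \<and> y = finsum R (\<lambda>i. embZl l G ((\<lambda>i\<in>{..<n}. c (h i)) i) \<otimes>\<^bsub>R\<^esub> (b \<circ> h) i) {..<n}"
        using c hI by auto
      fix c' assume c': "c' \<in> {..<n} \<rightarrow>\<^sub>E carrier (Zl l) \<and> y = finsum R (\<lambda>i. embZl l G (c' i) \<otimes>\<^bsub>R\<^esub> (b \<circ> h) i) {..<n}"
      define c2 where "c2 i = c' (?inv i)" for i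
      have c'Z: "c' i \<in> carrier (Zl l)" if "i < n" for i using c' that by (auto simp: PiE_iff)
      have c2: "i \<in> I \<Longrightarrow> c2 i \<in> carrier (Zl l)" for i using c' invI by (auto simp: c2_def)
      have "comb I c2 b = finsum R (\<lambda>i. embZl l G (c2 (h i)) \<otimes>\<^bsub>R\<^esub> b (h i)) {..<n}"
        by (rule re[symmetric]) (rule c2)
      also have "\<dots> = finsum R (\<lambda>i. embZl l G (c' i) \<otimes>\<^bsub>R\<^esub> (b \<circ> h) i) {..<n}"
        by (rule R.finsum_cong') (use hI hinv c'Z bR in \<open>auto simp: c2_def\<close>)
      finally have cc: "comb I c2 b = comb I c b" using c' c(2) by simp
      have c2c: "c2 i = c i" if "i \<in> I" for i
        by (rule inj[of c2 c]) (use c2 c(1) cc that in auto)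
      have "c' i = c (h i)" if "i < n" for i
        using c2c[OF hI[OF that]] hinv[OF that] by (simp add: c2_def)
      then show "c' = (\<lambda>i\<in>{..<n}. c (h i))" using c' by (auto simp: fun_eq_iff PiE_iff extensional_def)
    qed
  qed
  then show ?thesis by blast
qed

text \<open>The quotient by (L, T, 1 - e) is \<open>Zphi\<close> modulo l, and coordinates with
  respect to the basis, reduced modulo l, identify it with the n-tuples of residues.\<close>

lemma index_of_Zl_rank:
  assumes "has_Zl_rank l G e n" shows "index R (me e) (carrier R) = l ^ n"
proof -
  from assms obtain b where b: "(\<forall>i<n. b i \<in> Zphi l G e) \<and>
      (\<forall>y\<in>Zphi l G e. \<exists>!c. c \<in> {..<n} \<rightarrow>\<^sub>E carrier (Zl l) \<and> y = comb {..<n} c b)"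
    unfolding has_Zl_rank_def comb_def by (elim exE)
  have bZ: "\<And>i. i < n \<Longrightarrow> b i \<in> Zphi l G e" using b by simp
  have ex: "\<exists>!c. c \<in> {..<n} \<rightarrow>\<^sub>E carrier (Zl l) \<and> y = comb {..<n} c b" if "y \<in> Zphi l G e" for y
    using conjunct2[OF b] that by (rule bspec)
  have bR: "i \<in> {..<n} \<Longrightarrow> b i \<in> carrier R" for i using bZ by auto
  have fin: "finite {..<n}" by simp
  let ?C = "{..<n} \<rightarrow>\<^sub>E carrier (Zl l)"
  have cR: "comb {..<n} c b \<in> carrier R" if "\<And>i. i < n \<Longrightarrow> c i \<in> carrier (Zl l)" for c
    by (rule comb_closed) (use that bR in auto)
  note mD = R.idealD[OF me_ideal[OF prim]]
  have eR: "e \<in> carrier R" by (rule e_carrier[OF prim])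
  \<comment> \<open>For the direction from left to right: an element of \<open>Zphi\<close> in the
    ideal is unchanged by e, so its constant coefficient vanishes modulo l and it is L z with z in
    \<open>Zphi\<close>. Uniqueness of coordinates passes the divisibility by l on to each d
    i.\<close>
  have in_me: "comb {..<n} d b \<in> me e \<longleftrightarrow> (\<forall>i<n. d i 1 = 0)"
    if d: "\<And>i. i < n \<Longrightarrow> d i \<in> carrier (Zl l)" and dZ: "comb {..<n} d b \<in> Zphi l G e" for d
  proof
    assume d1: "\<forall>i<n. d i 1 = 0"
    have "\<forall>i\<in>{..<n}. \<exists>a. a \<in> carrier (Zl l) \<and> d i = lZ \<otimes>\<^bsub>Zl l\<^esub> a"
    proof
      fix i assume "i \<in> {..<n}"
      then have i: "i < n" by simp
      show "\<exists>a. a \<in> carrier (Zl l) \<and> d i = lZ \<otimes>\<^bsub>Zl l\<^esub> a"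
        by (rule Zl_divide[OF d[OF i] d1[rule_format, OF i]]) blast
    qed
    then obtain d' where d': "\<forall>i\<in>{..<n}. d' i \<in> carrier (Zl l) \<and> d i = lZ \<otimes>\<^bsub>Zl l\<^esub> d' i" using bchoice by metis
    have "comb {..<n} d b = comb {..<n} (\<lambda>i. lZ \<otimes>\<^bsub>Zl l\<^esub> d' i) b" by (rule comb_cong) (use bR d d' in auto)
    also have "\<dots> = L \<otimes>\<^bsub>R\<^esub> comb {..<n} d' b" using comb_scale[OF fin bR _ lZ_carrier, where d = d'] d' by (simp add: embZl_lZ)
    finally show "comb {..<n} d b \<in> me e"
      using R.lin_mem[OF me_set[OF prim], of L "comb {..<n} d' b"] cR[of d'] d' by simp
  next
    assume m: "comb {..<n} d b \<in> me e"
    let ?y = "comb {..<n} d b"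
    obtain u v w where u: "u \<in> carrier R" "v \<in> carrier R" "w \<in> carrier R"
      "?y = L \<otimes>\<^bsub>R\<^esub> u \<oplus>\<^bsub>R\<^esub> (T \<otimes>\<^bsub>R\<^esub> v \<oplus>\<^bsub>R\<^esub> (\<one>\<^bsub>R\<^esub> \<ominus>\<^bsub>R\<^esub> e) \<otimes>\<^bsub>R\<^esub> w)"
      using m R.lin3[of L T "\<one>\<^bsub>R\<^esub> \<ominus>\<^bsub>R\<^esub> e"] eR by auto
    have "(\<one>\<^bsub>R\<^esub> \<ominus>\<^bsub>R\<^esub> e) \<otimes>\<^bsub>R\<^esub> e = \<zero>\<^bsub>R\<^esub>" using eR e_idem[OF prim] by (simp add: a_minus_def[of R] R.l_distr R.l_minus R.r_neg)
    moreover have "(\<one>\<^bsub>R\<^esub> \<ominus>\<^bsub>R\<^esub> e) \<otimes>\<^bsub>R\<^esub> w \<otimes>\<^bsub>R\<^esub> e = (\<one>\<^bsub>R\<^esub> \<ominus>\<^bsub>R\<^esub> e) \<otimes>\<^bsub>R\<^esub> e \<otimes>\<^bsub>R\<^esub> w"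
      using u eR by (simp add: R.m_assoc R.m_comm[of w e])
    ultimately have "(\<one>\<^bsub>R\<^esub> \<ominus>\<^bsub>R\<^esub> e) \<otimes>\<^bsub>R\<^esub> w \<otimes>\<^bsub>R\<^esub> e = \<zero>\<^bsub>R\<^esub>" using u by simp
    then have "?y \<otimes>\<^bsub>R\<^esub> e = L \<otimes>\<^bsub>R\<^esub> (u \<otimes>\<^bsub>R\<^esub> e) \<oplus>\<^bsub>R\<^esub> T \<otimes>\<^bsub>R\<^esub> (v \<otimes>\<^bsub>R\<^esub> e)"
      unfolding u(4) using u(1-3) eR by (simp add: R.l_distr R.m_assoc)
    then have y2: "?y = L \<otimes>\<^bsub>R\<^esub> (u \<otimes>\<^bsub>R\<^esub> e) \<oplus>\<^bsub>R\<^esub> T \<otimes>\<^bsub>R\<^esub> (v \<otimes>\<^bsub>R\<^esub> e)" using dZ by (simp add: Zphi_iff)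
    have "?y g 0 1 = 0" if "g \<in> carrier G" for g
      unfolding y2 using that u eR by (simp add: GR_add L_mult T_mult)
    then have yL: "?y \<in> lin R [L]" using dZ by (simp add: Zphi_iff ZlD_L_iff)
    obtain z where z: "z \<in> Zphi l G e" "?y = L \<otimes>\<^bsub>R\<^esub> z" using Zphi_divide[OF dZ yL] .
    from ex1_implies_ex[OF ex[OF z(1)]] obtain c where c': "c \<in> ?C \<and> z = comb {..<n} c b" by (elim exE)
    have c: "c \<in> ?C" "z = comb {..<n} c b" using c' by simp_all
    have "?y = comb {..<n} (\<lambda>i. lZ \<otimes>\<^bsub>Zl l\<^esub> c i) b"
      using comb_scale[OF fin bR _ lZ_carrier, where d = c] c z by (simp add: embZl_lZ PiE_iff)
    also have "\<dots> = comb {..<n} (\<lambda>i\<in>{..<n}. lZ \<otimes>\<^bsub>Zl l\<^esub> c i) b"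
      by (rule comb_cong) (use bR c in auto)
    finally have 1: "?y = comb {..<n} (\<lambda>i\<in>{..<n}. lZ \<otimes>\<^bsub>Zl l\<^esub> c i) b" .
    have 2: "?y = comb {..<n} (\<lambda>i\<in>{..<n}. d i) b" by (rule comb_cong) (use bR d in auto)
    have "(\<lambda>i\<in>{..<n}. lZ \<otimes>\<^bsub>Zl l\<^esub> c i) \<in> ?C" "(\<lambda>i\<in>{..<n}. d i) \<in> ?C" using c d by auto
    then have "(\<lambda>i\<in>{..<n}. lZ \<otimes>\<^bsub>Zl l\<^esub> c i) = (\<lambda>i\<in>{..<n}. d i)" using ex[OF dZ] 1 2 by blast
    then have "d i = lZ \<otimes>\<^bsub>Zl l\<^esub> c i" if "i < n" for i using that by (metis lessThan_iff restrict_apply')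
    then show "\<forall>i<n. d i 1 = 0" by (simp add: Zl_sel(3) lZ_def)
  qed
  have Zdiff: "x \<ominus>\<^bsub>R\<^esub> y \<in> Zphi l G e" if "x \<in> Zphi l G e" "y \<in> Zphi l G e" for x y
    using that eR by (simp add: Zphi_iff a_minus_def[of R] R.l_distr R.l_minus) (simp add: a_minus_def[of R, symmetric])
  have combZ: "comb {..<n} c b \<in> Zphi l G e" if "\<And>i. i < n \<Longrightarrow> c i \<in> carrier (Zl l)" for c
  proof -
    have "comb H c b \<in> Zphi l G e" if "finite H" "H \<subseteq> {..<n}" for H
      using that
    proof (induction H rule: finite_induct)
      case empty
      have "\<zero>\<^bsub>R\<^esub> \<in> ZlD l G" unfolding ZlD_iff by (simp add: GR_zero)
      then show ?case using eR by (simp add: comb_def Zphi_iff)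
    next
      case (insert j H)
      have "comb (insert j H) c b = embZl l G (c j) \<otimes>\<^bsub>R\<^esub> b j \<oplus>\<^bsub>R\<^esub> comb H c b"
        by (rule comb_insert) (use insert bR \<open>\<And>i. i < n \<Longrightarrow> c i \<in> carrier (Zl l)\<close> in auto)
      then show ?case using insert bZ[of j] \<open>\<And>i. i < n \<Longrightarrow> c i \<in> carrier (Zl l)\<close>[of j] eR
        by (simp add: Zphi_iff R.l_distr R.m_assoc)
    qed
    then show ?thesis by simp
  qed
  let ?f = "\<lambda>c. me e +>\<^bsub>R\<^esub> comb {..<n} c b" and ?h = "\<lambda>c. \<lambda>i\<in>{..<n}. c i 1"
  have "cosets R (me e) (carrier R) = ?f ` ?C"
  proof (intro equalityI subsetI)
    fix u assume "u \<in> cosets R (me e) (carrier R)"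
    then obtain x where x: "x \<in> carrier R" "u = me e +>\<^bsub>R\<^esub> x" by (auto simp: cosets_def)
    obtain c z where cz: "c \<in> ZlD l G" "z \<in> carrier R" "x = c \<oplus>\<^bsub>R\<^esub> T \<otimes>\<^bsub>R\<^esub> z" using const_split[OF x(1)] by blast
    have cC: "c \<in> carrier R" using cz by simp
    let ?r = "T \<otimes>\<^bsub>R\<^esub> z \<oplus>\<^bsub>R\<^esub> (\<one>\<^bsub>R\<^esub> \<ominus>\<^bsub>R\<^esub> e) \<otimes>\<^bsub>R\<^esub> c"
    have r: "?r \<in> me e" by (rule mD(4); rule R.lin_mem[OF me_set[OF prim]]) (use cz cC in simp_all)
    have "x = c \<otimes>\<^bsub>R\<^esub> e \<oplus>\<^bsub>R\<^esub> ?r" unfolding cz(3) by (rule R.split_off_idempotent[OF eR cC cz(2) T_carrier])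
    also have "\<dots> = ?r \<oplus>\<^bsub>R\<^esub> c \<otimes>\<^bsub>R\<^esub> e" using cC cz eR by (simp add: R.a_comm)
    finally have "x \<ominus>\<^bsub>R\<^esub> c \<otimes>\<^bsub>R\<^esub> e = ?r" using cC cz(2) eR by (simp add: R.minus_minus_cancel)
    then have u2: "u = me e +>\<^bsub>R\<^esub> (c \<otimes>\<^bsub>R\<^esub> e)" using R.coset_eq_iff[OF mD(1)] x cC eR r by simp
    have "c \<otimes>\<^bsub>R\<^esub> e \<in> Zphi l G e" using cz(1) by (auto simp: Zphi_def)
    from ex1_implies_ex[OF ex[OF this]] obtain a where a: "a \<in> ?C \<and> c \<otimes>\<^bsub>R\<^esub> e = comb {..<n} a b" by (elim exE)
    show "u \<in> ?f ` ?C" by (rule image_eqI[of _ _ a]) (use u2 a in simp_all)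
  next
    fix u assume "u \<in> ?f ` ?C"
    then obtain c where "c \<in> ?C" "u = ?f c" by blast
    then show "u \<in> cosets R (me e) (carrier R)" using cR[of c] by (auto simp: cosets_def)
  qed
  then have "index R (me e) (carrier R) = card (?f ` ?C)" by (simp add: index_def)
  also have "\<dots> = card (?h ` ?C)"
  proof (rule card_images_eq)
    fix c c' assume c: "c \<in> ?C" and c': "c' \<in> ?C"
    have cc: "c i \<in> carrier (Zl l)" "c' i \<in> carrier (Zl l)" if "i < n" for i using c c' that by auto
    let ?m = "\<ominus>\<^bsub>Zl l\<^esub> \<one>\<^bsub>Zl l\<^esub>"
    have m: "embZl l G ?m = \<ominus>\<^bsub>R\<^esub> \<one>\<^bsub>R\<^esub>"
    proof (rule R.minus_equality[symmetric])
      show "embZl l G ?m \<oplus>\<^bsub>R\<^esub> \<one>\<^bsub>R\<^esub> = \<zero>\<^bsub>R\<^esub>"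
        using embZl_add[of ?m "\<one>\<^bsub>Zl l\<^esub>"] by (simp add: embZl_one embZl_zero Zl.l_neg)
    qed simp_all
    define d where "d i = c i \<oplus>\<^bsub>Zl l\<^esub> ?m \<otimes>\<^bsub>Zl l\<^esub> c' i" for i
    have d: "d i \<in> carrier (Zl l)" if "i < n" for i using cc[OF that] by (simp add: d_def)
    have "comb {..<n} d b = comb {..<n} c b \<oplus>\<^bsub>R\<^esub> embZl l G ?m \<otimes>\<^bsub>R\<^esub> comb {..<n} c' b"
      unfolding d_def by (rule comb_linear) (use bR cc in auto)
    also have "\<dots> = comb {..<n} c b \<ominus>\<^bsub>R\<^esub> comb {..<n} c' b"
      using cR[of c'] cc by (simp add: m R.l_minus a_minus_def[of R])
    finally have dd: "comb {..<n} d b = comb {..<n} c b \<ominus>\<^bsub>R\<^esub> comb {..<n} c' b" .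
    have "d i 1 = 0 \<longleftrightarrow> c i 1 = c' i 1" if "i < n" for i
    proof -
      have "d i = c i \<ominus>\<^bsub>Zl l\<^esub> c' i" using cc[OF that] by (simp add: d_def Zl.l_minus a_minus_def[of "Zl l"])
      then have "c i = d i \<oplus>\<^bsub>Zl l\<^esub> c' i" using cc[OF that] by (simp add: Zl.minus_minus_cancel)
      then have "c i 1 = (d i 1 + c' i 1) mod int l" using Zl_sel(2)[of l "d i" "c' i" 1] by simp
      moreover have "c' i 1 mod int l = c' i 1" "d i 1 mod int l = d i 1"
        using Zl_mod[OF cc(2)[OF that], of 1] Zl_mod[OF d[OF that], of 1] by simp_all
      ultimately show ?thesis by (metis add_0 add_diff_cancel_right' diff_self mod_0 mod_diff_left_eq)
    qed
    then have "(\<forall>i<n. d i 1 = 0) \<longleftrightarrow> ?h c = ?h c'" by (auto simp: fun_eq_iff restrict_def)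
    moreover have "?f c = ?f c' \<longleftrightarrow> comb {..<n} d b \<in> me e"
      using R.coset_eq_iff[OF mD(1)] cR[of c] cR[of c'] cc by (simp add: dd)
    ultimately show "?f c = ?f c' \<longleftrightarrow> ?h c = ?h c'" using in_me[OF d combZ[OF d]] by simp
  qed
  also have "?h ` ?C = {..<n} \<rightarrow>\<^sub>E {0..<int l}"
  proof (intro equalityI subsetI)
    fix u assume "u \<in> ?h ` ?C"
    then obtain c where c: "c \<in> ?C" "u = ?h c" by blast
    have "0 \<le> c i 1 \<and> c i 1 < int l" if "i < n" for i
    proof -
      have "c i \<in> carrier (Zl l)" using c that by auto
      then have "0 \<le> c i 1 \<and> c i 1 < int l ^ 1" unfolding Zl_sel(1) by blast
      then show ?thesis by simp
    qed
    then show "u \<in> {..<n} \<rightarrow>\<^sub>E {0..<int l}" using c by auto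
  next
    fix u assume u: "u \<in> {..<n} \<rightarrow>\<^sub>E {0..<int l}"
    let ?c = "\<lambda>i\<in>{..<n}. \<lambda>k. u i mod int l ^ k"
    have cC: "?c \<in> ?C" by auto
    have hc: "?h ?c = u"
    proof
      fix i show "?h ?c i = u i" using u by (cases "i < n") (auto simp: PiE_iff extensional_def)
    qed
    show "u \<in> ?h ` ?C" using imageI[OF cC, of ?h] unfolding hc .
  qed
  finally show ?thesis by (simp add: card_PiE)
qed

text \<open>The index l^n determines n, so the rank is unique and the definite description in
  \<open>chardeg\<close> denotes it. It is positive because \<open>Zphi\<close> contains the nonzero
  element e.\<close>

lemma residue_index_chardeg: "index R (me e) (carrier R) = l ^ chardeg l G e"
  and chardeg_pos: "chardeg l G e > 0"
proof -
  obtain n where n: "has_Zl_rank l G e n" using has_Zl_rank_exists by blast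
  have "n' = n" if "has_Zl_rank l G e n'" for n'
    using index_of_Zl_rank[OF n] index_of_Zl_rank[OF that] l_gt_1 by simp
  then have c: "chardeg l G e = n" unfolding chardeg_def using n by blast
  then show "index R (me e) (carrier R) = l ^ chardeg l G e" using index_of_Zl_rank[OF n] by simp
  show "chardeg l G e > 0"
  proof (rule ccontr)
    assume "\<not> chardeg l G e > 0"
    then have "has_Zl_rank l G e 0" using n c by simp
    moreover have "e \<in> Zphi l G e" using e_ZlD[OF prim] e_idem[OF prim] by (simp add: Zphi_iff)
    ultimately have "e = \<zero>\<^bsub>R\<^esub>" unfolding has_Zl_rank_def by fastforce
    then show False using e_nonzero[OF prim] by simp
  qed
qed

end

end

section \<open>Elementary modules\<close>

text \<open>\<^const>\<open>gen_submod\<close> and \<^const>\<open>quot_module\<close> are only defined for unextended module records.\<close>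

locale plain_module = module R M
  for R :: "('a, 'b) ring_scheme" (structure) and M :: "('a, 'm) module" (structure)
begin

text \<open>In \<open>gen_submod\<close> coefficients are attached to the generators themselves. A
  further multiple of s must therefore be merged with the coefficient b that s already has, taken as
  0 if s does not occur.\<close>

lemma gen_submod_add:
  assumes S: "S \<subseteq> carrier M" and z: "z \<in> gen_submod R M S" and s: "s \<in> S" and a: "a \<in> carrier R"
  shows "z \<oplus>\<^bsub>M\<^esub> a \<odot>\<^bsub>M\<^esub> s \<in> gen_submod R M S"
proof -
  obtain U c where U: "finite U" "U \<subseteq> S" "c \<in> U \<rightarrow> carrier R" "z = finsum M (\<lambda>t. c t \<odot>\<^bsub>M\<^esub> t) U"
    using z unfolding gen_submod_def by blast
  have SM: "\<And>t. t \<in> S \<Longrightarrow> t \<in> carrier M" using S by blast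
  define b where "b = (if s \<in> U then c s else \<zero>)"
  define c' where "c' t = (if t = s then b \<oplus> a else c t)" for t
  have b: "b \<in> carrier R" using U by (auto simp: b_def)
  have c': "c' \<in> insert s U \<rightarrow> carrier R" using U b a by (auto simp: c'_def)
  let ?W = "finsum M (\<lambda>t. c t \<odot>\<^bsub>M\<^esub> t) (U - {s})"
  have W: "?W \<in> carrier M" by (rule M.finsum_closed) (use U SM in auto)
  have z2: "z = b \<odot>\<^bsub>M\<^esub> s \<oplus>\<^bsub>M\<^esub> ?W"
  proof (cases "s \<in> U")
    case True
    have "finsum M (\<lambda>t. c t \<odot>\<^bsub>M\<^esub> t) (insert s (U - {s})) = c s \<odot>\<^bsub>M\<^esub> s \<oplus>\<^bsub>M\<^esub> ?W"
      by (rule M.finsum_insert) (use U SM True in auto)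
    then show ?thesis using U True by (simp add: b_def insert_absorb)
  next
    case False
    then show ?thesis using U SM[OF s] W by (simp add: b_def)
  qed
  have "finsum M (\<lambda>t. c' t \<odot>\<^bsub>M\<^esub> t) (insert s (U - {s})) = c' s \<odot>\<^bsub>M\<^esub> s \<oplus>\<^bsub>M\<^esub> finsum M (\<lambda>t. c' t \<odot>\<^bsub>M\<^esub> t) (U - {s})"
    by (rule M.finsum_insert) (use U SM s Pi_mem[OF c'] in auto)
  also have "finsum M (\<lambda>t. c' t \<odot>\<^bsub>M\<^esub> t) (U - {s}) = ?W"
    by (rule M.finsum_cong') (use U SM in \<open>auto simp: c'_def\<close>)
  also have "c' s \<odot>\<^bsub>M\<^esub> s = b \<odot>\<^bsub>M\<^esub> s \<oplus>\<^bsub>M\<^esub> a \<odot>\<^bsub>M\<^esub> s" using a b SM[OF s] by (simp add: c'_def smult_l_distr)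
  finally have eq: "z \<oplus>\<^bsub>M\<^esub> a \<odot>\<^bsub>M\<^esub> s = finsum M (\<lambda>t. c' t \<odot>\<^bsub>M\<^esub> t) (insert s (U - {s}))"
    using z2 W a b SM[OF s] by (simp add: M.a_ac)
  show ?thesis unfolding gen_submod_def
    by (intro CollectI exI[of _ "insert s (U - {s})"] exI[of _ c'] conjI) (use eq U s c' in auto)
qed

lemma gen_submod_zero: "\<zero>\<^bsub>M\<^esub> \<in> gen_submod R M S"
  unfolding gen_submod_def by (rule CollectI, rule exI[of _ "{}"], rule exI[of _ "\<lambda>_. \<zero>"]) simp

lemma gen_submod_least:
  assumes "submodule N R M" "S \<subseteq> N" shows "gen_submod R M S \<subseteq> N"
proof
  note N = submoduleD[OF assms(1)]
  fix z assume "z \<in> gen_submod R M S"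
  then obtain U c where U: "finite U" "U \<subseteq> S" "c \<in> U \<rightarrow> carrier R" "z = finsum M (\<lambda>t. c t \<odot>\<^bsub>M\<^esub> t) U"
    unfolding gen_submod_def by blast
  have "finsum M (\<lambda>t. c t \<odot>\<^bsub>M\<^esub> t) U \<in> N" using U(1-3)
  proof (induction U rule: finite_induct)
    case (insert t U)
    have UM: "\<And>u. u \<in> insert t U \<Longrightarrow> u \<in> carrier M" using insert assms N(2) by blast
    have "finsum M (\<lambda>t. c t \<odot>\<^bsub>M\<^esub> t) (insert t U) = c t \<odot>\<^bsub>M\<^esub> t \<oplus>\<^bsub>M\<^esub> finsum M (\<lambda>t. c t \<odot>\<^bsub>M\<^esub> t) U"
      by (rule M.finsum_insert) (use insert UM in auto)
    moreover have "c t \<odot>\<^bsub>M\<^esub> t \<in> N" by (rule N(7)) (use insert assms in auto)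
    ultimately show ?case using insert N(4) by auto
  qed (use N in simp)
  then show "z \<in> N" using U by simp
qed

end

text \<open>A relation touches a single coordinate, so a vector with coordinates in the ideals is
  assembled coordinate by coordinate (\<open>?w j\<close>) and, inside one coordinate, generator by
  generator (\<open>add\<close>).\<close>

lemma (in cring) gen_submod_free_mod:
  assumes as: "\<And>i. i < k \<Longrightarrow> set (as i) \<subseteq> carrier R"
  shows "gen_submod R (free_mod R k) {a \<odot>\<^bsub>free_mod R k\<^esub> unitvec R k i | a i. i < k \<and> a \<in> set (as i)}
    = boxmod k (\<lambda>i. lin R (as i))"
proof -
  interpret F: plain_module R "free_mod R k" unfolding plain_module_def by (rule free_mod_module)
  let ?F = "free_mod R k" and ?S = "{a \<odot>\<^bsub>free_mod R k\<^esub> unitvec R k i | a i. i < k \<and> a \<in> set (as i)}"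
  have uF: "unitvec R k i \<in> carrier ?F" for i unfolding unitvec_def by (rule free_mod_I) simp
  have ui: "j < k \<Longrightarrow> unitvec R k i j = (if j = i then \<one> else \<zero>)" for i j by (simp add: unitvec_def)
  have SF: "?S \<subseteq> carrier ?F" using as uF by auto
  have B: "submodule (boxmod k (\<lambda>i. lin R (as i))) R ?F" by (rule submodule_boxmod) (rule lin_ideal[OF as])
  show ?thesis
  proof
    show "gen_submod R ?F ?S \<subseteq> boxmod k (\<lambda>i. lin R (as i))"
    proof (rule F.gen_submod_least[OF B], clarify)
      fix a i assume i: "i < k" "a \<in> set (as i)"
      have aR: "a \<in> carrier R" using as i by auto
      have "(a \<odot>\<^bsub>?F\<^esub> unitvec R k i) j \<in> lin R (as j)" if j: "j < k" for j
        using lin_gen[OF as[OF i(1)] i(2)] idealD(3)[OF lin_ideal[OF as[OF j]]] aR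
        by (simp add: free_mod_simps(3)[OF j] ui[OF j])
      then show "a \<odot>\<^bsub>?F\<^esub> unitvec R k i \<in> boxmod k (\<lambda>i. lin R (as i))" using aR uF by (simp add: boxmod_def)
    qed
    have add: "z \<oplus>\<^bsub>?F\<^esub> x \<odot>\<^bsub>?F\<^esub> unitvec R k i \<in> gen_submod R ?F ?S"
      if z: "z \<in> gen_submod R ?F ?S" "z \<in> carrier ?F" and i: "i < k" and x: "x \<in> lin R bs" and bs: "set bs \<subseteq> set (as i)" for z x i bs
      using x bs
    proof (induction bs arbitrary: x)
      case Nil
      then show ?case using z uF by (simp add: lin.simps)
    next
      case (Cons b bs)
      obtain y x' where y: "y \<in> carrier R" "x' \<in> lin R bs" "x = b \<otimes> y \<oplus> x'" using Cons.prems(1) by (rule lin_ConsE)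
      have bR: "b \<in> carrier R" using Cons.prems as[OF i] by auto
      have x'R: "x' \<in> carrier R" using y lin_carrier[of bs] Cons.prems as[OF i] by auto
      have 1: "z \<oplus>\<^bsub>?F\<^esub> x' \<odot>\<^bsub>?F\<^esub> unitvec R k i \<in> gen_submod R ?F ?S" by (rule Cons.IH) (use y Cons.prems in auto)
      have "b \<odot>\<^bsub>?F\<^esub> unitvec R k i \<in> ?S" using i Cons.prems by auto
      from F.gen_submod_add[OF SF 1 this y(1)]
      have "z \<oplus>\<^bsub>?F\<^esub> x' \<odot>\<^bsub>?F\<^esub> unitvec R k i \<oplus>\<^bsub>?F\<^esub> y \<odot>\<^bsub>?F\<^esub> (b \<odot>\<^bsub>?F\<^esub> unitvec R k i) \<in> gen_submod R ?F ?S" .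
      moreover have "z \<oplus>\<^bsub>?F\<^esub> x' \<odot>\<^bsub>?F\<^esub> unitvec R k i \<oplus>\<^bsub>?F\<^esub> y \<odot>\<^bsub>?F\<^esub> (b \<odot>\<^bsub>?F\<^esub> unitvec R k i)
         = z \<oplus>\<^bsub>?F\<^esub> x \<odot>\<^bsub>?F\<^esub> unitvec R k i"
        using z(2) x'R y(1) bR uF[of i] by (simp add: y(3) F.smult_l_distr F.smult_assoc1[symmetric] m_comm[of y b] F.M.a_ac)
      ultimately show ?case by simp
    qed
    show "boxmod k (\<lambda>i. lin R (as i)) \<subseteq> gen_submod R ?F ?S"
    proof
      fix v assume v: "v \<in> boxmod k (\<lambda>i. lin R (as i))"
      have vF: "v \<in> carrier ?F" and vi: "i < k \<Longrightarrow> v i \<in> lin R (as i)" for i using v by (auto simp: boxmod_def)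
      have "(\<lambda>i\<in>{..<k}. if i < j then v i else \<zero>) \<in> gen_submod R ?F ?S" if "j \<le> k" for j
        using that
      proof (induction j)
        case 0
        have "(\<lambda>i\<in>{..<k}. \<zero>) = \<zero>\<^bsub>?F\<^esub>" by (simp add: free_mod_def)
        then show ?case using F.gen_submod_zero[of ?S] by simp
      next
        case (Suc j)
        let ?w = "\<lambda>j. \<lambda>i\<in>{..<k}. if i < j then v i else \<zero>"
        have wF: "?w j \<in> carrier ?F" for j by (rule free_mod_I) (use free_mod_simps(1)[OF vF] in auto)
        have vR: "v j \<in> carrier R" using free_mod_simps(1)[OF vF] Suc.prems by simp
        have 1: "?w j \<oplus>\<^bsub>?F\<^esub> v j \<odot>\<^bsub>?F\<^esub> unitvec R k j \<in> gen_submod R ?F ?S"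
          by (rule add[OF Suc.IH[OF Suc_leD[OF Suc.prems]] wF _ vi order_refl]) (use Suc.prems in simp_all)
        have 2: "?w j \<oplus>\<^bsub>?F\<^esub> v j \<odot>\<^bsub>?F\<^esub> unitvec R k j = ?w (Suc j)"
        proof (rule free_mod_eqI)
          fix i assume i: "i < k"
          then show "(?w j \<oplus>\<^bsub>?F\<^esub> v j \<odot>\<^bsub>?F\<^esub> unitvec R k j) i = ?w (Suc j) i"
            using vR free_mod_simps(1)[OF vF i] by (auto simp: free_mod_simps ui less_Suc_eq)
        qed (use wF uF vR in auto)
        show ?case using 1 unfolding 2 .
      qed
      from this[of k] have "(\<lambda>i\<in>{..<k}. if i < k then v i else \<zero>) \<in> gen_submod R ?F ?S" by simp
      moreover have "(\<lambda>i\<in>{..<k}. if i < k then v i else \<zero>) = v"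
        using vF by (auto simp: free_mod_def fun_eq_iff PiE_iff extensional_def)
      ultimately show "v \<in> gen_submod R ?F ?S" by simp
    qed
  qed
qed

lemma prod_asymptotics:
  fixes u :: "nat \<Rightarrow> nat \<Rightarrow> real" and E :: "nat \<Rightarrow> nat \<Rightarrow> nat"
  assumes "\<And>i. i < k \<Longrightarrow> \<exists>c>0. \<exists>n0. \<forall>n\<ge>n0. u i n = c * q ^ E i n"
  shows "\<exists>c>0. \<exists>n0. \<forall>n\<ge>n0. (\<Prod>i<k. u i n) = c * (q::real) ^ (\<Sum>i<k. E i n)"
  using assms
proof (induction k)
  case 0
  then show ?case by (intro exI[of _ 1]) simp
next
  case (Suc k)
  then obtain c1 n1 where 1: "c1 > 0" "\<forall>n\<ge>n1. (\<Prod>i<k. u i n) = c1 * q ^ (\<Sum>i<k. E i n)" by force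
  from Suc obtain c2 n2 where 2: "c2 > 0" "\<forall>n\<ge>n2. u k n = c2 * q ^ E k n" by blast
  have "c1 * c2 > 0" "\<forall>n\<ge>max n1 n2. (\<Prod>i<Suc k. u i n) = (c1 * c2) * q ^ (\<Sum>i<Suc k. E i n)"
    using 1 2 by (simp_all add: power_add)
  then show ?case by blast
qed

text \<open>g picks a representative of each coset f x. It is linear only modulo N, and the
  finiteness of kernel and cokernel is restated inside M itself, which is the form that
  \<open>index_nab_asymptotics\<close> consumes.\<close>

lemma (in plain_module) quot_module_lift:
  assumes N: "submodule N R M" and X: "module R Y"
    and f: "f \<in> mod_hom R Y (quot_module M N)"
    and ker: "finite {x \<in> carrier Y. f x = \<zero>\<^bsub>quot_module M N\<^esub>}"
    and coker: "finite (A_RCOSETS (quot_module M N) (f ` carrier Y))"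
  shows "\<exists>g. (\<forall>x\<in>carrier Y. g x \<in> carrier M) \<and>
    (\<forall>x\<in>carrier Y. \<forall>y\<in>carrier Y. g (x \<oplus>\<^bsub>Y\<^esub> y) \<ominus>\<^bsub>M\<^esub> (g x \<oplus>\<^bsub>M\<^esub> g y) \<in> N) \<and>
    (\<forall>a\<in>carrier R. \<forall>x\<in>carrier Y. g (a \<odot>\<^bsub>Y\<^esub> x) \<ominus>\<^bsub>M\<^esub> a \<odot>\<^bsub>M\<^esub> g x \<in> N) \<and>
    finite {x \<in> carrier Y. g x \<in> N} \<and>
    finite (cosets M {v \<in> carrier M. \<exists>x\<in>carrier Y. v \<ominus>\<^bsub>M\<^esub> g x \<in> N} (carrier M))"
proof -
  interpret Y: module R Y by fact
  note ND = submoduleD[OF N]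
  have [simp]: "\<ominus>\<^bsub>M\<^esub> \<zero>\<^bsub>M\<^esub> = \<zero>\<^bsub>M\<^esub>" using M.l_neg[OF M.zero_closed] by simp
  let ?E = "quot_module M N"
  interpret S: abelian_subgroup N M
    by (rule abelian_subgroupI3[OF additive_subgroup.intro[OF ND(1)] M.abelian_group_axioms])
  have E: "carrier ?E = cosets M N (carrier M)" "\<zero>\<^bsub>?E\<^esub> = N" "A \<oplus>\<^bsub>?E\<^esub> B = A <+>\<^bsub>M\<^esub> B"
    "a \<odot>\<^bsub>?E\<^esub> A = \<Union>{N +>\<^bsub>M\<^esub> (a \<odot>\<^bsub>M\<^esub> x) | x. x \<in> A}" for A B a
    by (simp_all add: quot_module_def A_RCOSETS_eq_cosets)
  have fh: "f x \<in> cosets M N (carrier M)" if "x \<in> carrier Y" for x using f that E(1) by (auto simp: mod_hom_def)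
  have f_add: "f (x \<oplus>\<^bsub>Y\<^esub> y) = f x <+>\<^bsub>M\<^esub> f y" if "x \<in> carrier Y" "y \<in> carrier Y" for x y
    using f that by (simp add: mod_hom_def E)
  have f_sm: "f (a \<odot>\<^bsub>Y\<^esub> x) = \<Union>{N +>\<^bsub>M\<^esub> (a \<odot>\<^bsub>M\<^esub> v) | v. v \<in> f x}" if "a \<in> carrier R" "x \<in> carrier Y" for a x
    using f that by (simp add: mod_hom_def E)
  define g where "g x = (SOME v. v \<in> carrier M \<and> f x = N +>\<^bsub>M\<^esub> v)" for x
  have g: "g x \<in> carrier M \<and> f x = N +>\<^bsub>M\<^esub> g x" if "x \<in> carrier Y" for x
    unfolding g_def by (rule someI_ex) (use fh[OF that] in \<open>auto simp: cosets_def\<close>)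
  have g1: "\<And>x. x \<in> carrier Y \<Longrightarrow> g x \<in> carrier M" and g2: "\<And>x. x \<in> carrier Y \<Longrightarrow> f x = N +>\<^bsub>M\<^esub> g x"
    using g by auto
  note ceq = M.coset_eq_iff[OF ND(1)]
  have gadd: "g (x \<oplus>\<^bsub>Y\<^esub> y) \<ominus>\<^bsub>M\<^esub> (g x \<oplus>\<^bsub>M\<^esub> g y) \<in> N" if "x \<in> carrier Y" "y \<in> carrier Y" for x y
  proof -
    have "N +>\<^bsub>M\<^esub> g (x \<oplus>\<^bsub>Y\<^esub> y) = N +>\<^bsub>M\<^esub> (g x \<oplus>\<^bsub>M\<^esub> g y)"
      using f_add[OF that] S.a_rcos_sum[OF g1 g1] that by (simp add: g2)
    then show ?thesis using that g1 ceq by simp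
  qed
  have gsm: "g (a \<odot>\<^bsub>Y\<^esub> x) \<ominus>\<^bsub>M\<^esub> a \<odot>\<^bsub>M\<^esub> g x \<in> N" if a: "a \<in> carrier R" "x \<in> carrier Y" for a x
  proof -
    have same: "N +>\<^bsub>M\<^esub> (a \<odot>\<^bsub>M\<^esub> v) = N +>\<^bsub>M\<^esub> (a \<odot>\<^bsub>M\<^esub> g x)" if v: "v \<in> f x" for v
    proof -
      obtain m where m: "m \<in> N" "v = m \<oplus>\<^bsub>M\<^esub> g x" using v a g2 by (auto simp: a_r_coset_def')
      have mM: "m \<in> carrier M" using m ND by auto
      have "a \<odot>\<^bsub>M\<^esub> v \<ominus>\<^bsub>M\<^esub> a \<odot>\<^bsub>M\<^esub> g x = a \<odot>\<^bsub>M\<^esub> m"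
        using a mM g1 by (simp add: m(2) smult_r_distr M.minus_minus_cancel)
      then show ?thesis using ceq[of "a \<odot>\<^bsub>M\<^esub> v" "a \<odot>\<^bsub>M\<^esub> g x"] a m mM g1 ND(7) by simp
    qed
    have "\<zero>\<^bsub>M\<^esub> \<oplus>\<^bsub>M\<^esub> g x \<in> f x" using g2[OF a(2)] ND(3) by (auto simp: a_r_coset_def')
    then have gx: "g x \<in> f x" using g1 a by simp
    have "{N +>\<^bsub>M\<^esub> (a \<odot>\<^bsub>M\<^esub> v) | v. v \<in> f x} = {N +>\<^bsub>M\<^esub> (a \<odot>\<^bsub>M\<^esub> g x)}"
    proof (intro equalityI subsetI)
      fix C assume "C \<in> {N +>\<^bsub>M\<^esub> (a \<odot>\<^bsub>M\<^esub> v) | v. v \<in> f x}"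
      then show "C \<in> {N +>\<^bsub>M\<^esub> (a \<odot>\<^bsub>M\<^esub> g x)}" using same by blast
    qed (use gx in blast)
    then have "N +>\<^bsub>M\<^esub> g (a \<odot>\<^bsub>Y\<^esub> x) = N +>\<^bsub>M\<^esub> (a \<odot>\<^bsub>M\<^esub> g x)"
      using f_sm[OF a] a by (simp add: g2[symmetric])
    then show ?thesis using a g1 ceq by simp
  qed
  have gN: "g x \<in> N \<longleftrightarrow> f x = N" if "x \<in> carrier Y" for x
  proof -
    have N0: "N = N +>\<^bsub>M\<^esub> \<zero>\<^bsub>M\<^esub>" using ND by (auto simp: a_r_coset_def' subset_iff)
    have "f x = N \<longleftrightarrow> N +>\<^bsub>M\<^esub> g x = N +>\<^bsub>M\<^esub> \<zero>\<^bsub>M\<^esub>" using g2[OF that] N0 by simp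
    also have "\<dots> \<longleftrightarrow> g x \<in> N" using ceq[of "g x" "\<zero>\<^bsub>M\<^esub>"] g1[OF that] by (simp add: a_minus_def[of M])
    finally show ?thesis by simp
  qed
  have fin1: "finite {x \<in> carrier Y. g x \<in> N}"
    by (rule finite_subset[OF _ ker]) (use gN E(2) in auto)
  let ?Y = "{v \<in> carrier M. \<exists>x\<in>carrier Y. v \<ominus>\<^bsub>M\<^esub> g x \<in> N}"
  have g0: "g \<zero>\<^bsub>Y\<^esub> \<in> N"
  proof -
    have "g (\<zero> \<odot>\<^bsub>Y\<^esub> \<zero>\<^bsub>Y\<^esub>) \<ominus>\<^bsub>M\<^esub> \<zero> \<odot>\<^bsub>M\<^esub> g \<zero>\<^bsub>Y\<^esub> \<in> N" by (rule gsm) simp_all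
    then show ?thesis using g1[of "\<zero>\<^bsub>Y\<^esub>"] by (simp add: a_minus_def[of M])
  qed
  have gneg: "g (\<ominus>\<^bsub>Y\<^esub> x) \<oplus>\<^bsub>M\<^esub> g x \<in> N" if "x \<in> carrier Y" for x
  proof -
    have "g (\<ominus>\<^bsub>Y\<^esub> x \<oplus>\<^bsub>Y\<^esub> x) \<ominus>\<^bsub>M\<^esub> (g (\<ominus>\<^bsub>Y\<^esub> x) \<oplus>\<^bsub>M\<^esub> g x) \<in> N" by (rule gadd) (use that in simp_all)
    then have "g \<zero>\<^bsub>Y\<^esub> \<ominus>\<^bsub>M\<^esub> (g \<zero>\<^bsub>Y\<^esub> \<ominus>\<^bsub>M\<^esub> (g (\<ominus>\<^bsub>Y\<^esub> x) \<oplus>\<^bsub>M\<^esub> g x)) \<in> N"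
      using ND(6)[OF g0] that by (simp add: Y.M.l_neg)
    then show ?thesis using that g1 by (simp add: M.minus_minus_cancel)
  qed
  have Ysub: "subgp ?Y M"
  proof (rule M.subgpI)
    show "\<zero>\<^bsub>M\<^esub> \<in> ?Y" using ND(5)[OF g0] g1[of "\<zero>\<^bsub>Y\<^esub>"] by (auto intro!: bexI[of _ "\<zero>\<^bsub>Y\<^esub>"] simp: a_minus_def[of M])
    fix u v assume "u \<in> ?Y" "v \<in> ?Y"
    then obtain x y where x: "u \<in> carrier M" "v \<in> carrier M" "x \<in> carrier Y" "y \<in> carrier Y"
      "u \<ominus>\<^bsub>M\<^esub> g x \<in> N" "v \<ominus>\<^bsub>M\<^esub> g y \<in> N" by blast
    have "(u \<ominus>\<^bsub>M\<^esub> g x) \<oplus>\<^bsub>M\<^esub> (v \<ominus>\<^bsub>M\<^esub> g y) = (u \<oplus>\<^bsub>M\<^esub> v) \<ominus>\<^bsub>M\<^esub> (g x \<oplus>\<^bsub>M\<^esub> g y)"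
      using x g1 by (simp add: a_minus_def[of M] M.minus_add M.a_ac)
    then have "(u \<oplus>\<^bsub>M\<^esub> v) \<ominus>\<^bsub>M\<^esub> (g x \<oplus>\<^bsub>M\<^esub> g y) \<in> N" using ND(4)[OF x(5,6)] by simp
    from ND(6)[OF this gadd[OF x(3,4)]]
    have "((u \<oplus>\<^bsub>M\<^esub> v) \<ominus>\<^bsub>M\<^esub> (g x \<oplus>\<^bsub>M\<^esub> g y)) \<ominus>\<^bsub>M\<^esub> (g (x \<oplus>\<^bsub>Y\<^esub> y) \<ominus>\<^bsub>M\<^esub> (g x \<oplus>\<^bsub>M\<^esub> g y)) \<in> N" .
    then have "(u \<oplus>\<^bsub>M\<^esub> v) \<ominus>\<^bsub>M\<^esub> g (x \<oplus>\<^bsub>Y\<^esub> y) \<in> N" using x g1 by (simp add: M.minus_minus_cancel)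
    then show "u \<oplus>\<^bsub>M\<^esub> v \<in> ?Y" using x by blast
  next
    fix u assume "u \<in> ?Y"
    then obtain x where x: "u \<in> carrier M" "x \<in> carrier Y" "u \<ominus>\<^bsub>M\<^esub> g x \<in> N" by blast
    have "(u \<ominus>\<^bsub>M\<^esub> g x) \<oplus>\<^bsub>M\<^esub> (g (\<ominus>\<^bsub>Y\<^esub> x) \<oplus>\<^bsub>M\<^esub> g x) \<in> N" by (rule ND(4)[OF x(3) gneg[OF x(2)]])
    moreover have "(u \<ominus>\<^bsub>M\<^esub> g x) \<oplus>\<^bsub>M\<^esub> (g (\<ominus>\<^bsub>Y\<^esub> x) \<oplus>\<^bsub>M\<^esub> g x) = u \<oplus>\<^bsub>M\<^esub> g (\<ominus>\<^bsub>Y\<^esub> x)"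
    proof -
      have "(u \<ominus>\<^bsub>M\<^esub> g x) \<oplus>\<^bsub>M\<^esub> (g (\<ominus>\<^bsub>Y\<^esub> x) \<oplus>\<^bsub>M\<^esub> g x) = ((u \<ominus>\<^bsub>M\<^esub> g x) \<oplus>\<^bsub>M\<^esub> g x) \<oplus>\<^bsub>M\<^esub> g (\<ominus>\<^bsub>Y\<^esub> x)"
        using x g1 M.minus_closed by (simp add: M.a_ac)
      then show ?thesis using x g1 by (simp add: M.minus_minus_cancel)
    qed
    ultimately have "\<ominus>\<^bsub>M\<^esub> (u \<oplus>\<^bsub>M\<^esub> g (\<ominus>\<^bsub>Y\<^esub> x)) \<in> N" using ND(5) by simp
    then have "\<ominus>\<^bsub>M\<^esub> u \<ominus>\<^bsub>M\<^esub> g (\<ominus>\<^bsub>Y\<^esub> x) \<in> N" using x g1 by (simp add: a_minus_def[of M] M.minus_add)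
    then show "\<ominus>\<^bsub>M\<^esub> u \<in> ?Y" using x by (auto intro!: bexI[of _ "\<ominus>\<^bsub>Y\<^esub> x"])
  qed auto
  have "finite (cosets M ?Y (carrier M))"
    unfolding cosets_def
  proof (rule finite_image_coarser)
    \<comment> \<open>A coset of the image of f in the quotient is a class of classes. If v and v'
      give the same one, then v - v' is congruent modulo N to some g x, hence lies in
      \<open>?Y\<close>.\<close>
    let ?h = "\<lambda>v. (f ` carrier Y) +>\<^bsub>?E\<^esub> (N +>\<^bsub>M\<^esub> v)"
    show "finite (?h ` carrier M)"
      by (rule finite_subset[OF _ coker]) (auto simp: A_RCOSETS_eq_cosets cosets_def E(1))
    fix v v' assume v: "v \<in> carrier M" "v' \<in> carrier M" "?h v = ?h v'"
    have hv: "?h v = {f x <+>\<^bsub>M\<^esub> (N +>\<^bsub>M\<^esub> v) | x. x \<in> carrier Y}" for v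
      by (auto simp: a_r_coset_def' E(3))
    have mem: "f \<zero>\<^bsub>Y\<^esub> <+>\<^bsub>M\<^esub> (N +>\<^bsub>M\<^esub> v) \<in> {f x <+>\<^bsub>M\<^esub> (N +>\<^bsub>M\<^esub> v) | x. x \<in> carrier Y}"
      by (intro CollectI exI[of _ "\<zero>\<^bsub>Y\<^esub>"] conjI refl Y.M.zero_closed)
    have same: "{f x <+>\<^bsub>M\<^esub> (N +>\<^bsub>M\<^esub> v) | x. x \<in> carrier Y} = {f x <+>\<^bsub>M\<^esub> (N +>\<^bsub>M\<^esub> v') | x. x \<in> carrier Y}"
      by (rule trans[OF hv[symmetric] trans[OF v(3) hv]])
    from mem[unfolded same] obtain x where x: "x \<in> carrier Y"
      "f \<zero>\<^bsub>Y\<^esub> <+>\<^bsub>M\<^esub> (N +>\<^bsub>M\<^esub> v) = f x <+>\<^bsub>M\<^esub> (N +>\<^bsub>M\<^esub> v')"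
      by (elim CollectE exE conjE)
    then have "N +>\<^bsub>M\<^esub> (g \<zero>\<^bsub>Y\<^esub> \<oplus>\<^bsub>M\<^esub> v) = N +>\<^bsub>M\<^esub> (g x \<oplus>\<^bsub>M\<^esub> v')"
      using g2 S.a_rcos_sum g1 v by simp
    then have d: "(g \<zero>\<^bsub>Y\<^esub> \<oplus>\<^bsub>M\<^esub> v) \<ominus>\<^bsub>M\<^esub> (g x \<oplus>\<^bsub>M\<^esub> v') \<in> N" using ceq g1 x v by simp
    have "((g \<zero>\<^bsub>Y\<^esub> \<oplus>\<^bsub>M\<^esub> v) \<ominus>\<^bsub>M\<^esub> (g x \<oplus>\<^bsub>M\<^esub> v')) \<ominus>\<^bsub>M\<^esub> g \<zero>\<^bsub>Y\<^esub> \<in> N" by (rule ND(6)[OF d g0])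
    moreover have "((g \<zero>\<^bsub>Y\<^esub> \<oplus>\<^bsub>M\<^esub> v) \<ominus>\<^bsub>M\<^esub> (g x \<oplus>\<^bsub>M\<^esub> v')) \<ominus>\<^bsub>M\<^esub> g \<zero>\<^bsub>Y\<^esub> = (v \<ominus>\<^bsub>M\<^esub> v') \<ominus>\<^bsub>M\<^esub> g x"
    proof -
      define z where "z = g \<zero>\<^bsub>Y\<^esub>"
      have zM: "z \<in> carrier M" using g1 by (simp add: z_def)
      have "((z \<oplus>\<^bsub>M\<^esub> v) \<ominus>\<^bsub>M\<^esub> (g x \<oplus>\<^bsub>M\<^esub> v')) \<ominus>\<^bsub>M\<^esub> z = (((v \<ominus>\<^bsub>M\<^esub> v') \<ominus>\<^bsub>M\<^esub> g x) \<oplus>\<^bsub>M\<^esub> z) \<ominus>\<^bsub>M\<^esub> z"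
        using zM x g1 v by (simp add: a_minus_def[of M] M.minus_add M.a_ac)
      then show ?thesis using zM x g1 v unfolding z_def[symmetric] by (simp add: M.minus_minus_cancel)
    qed
    ultimately have "v \<ominus>\<^bsub>M\<^esub> v' \<in> ?Y" using v x by auto
    then show "?Y +>\<^bsub>M\<^esub> v = ?Y +>\<^bsub>M\<^esub> v'" using M.coset_eq_iff[OF Ysub] v by simp
  qed
  then show ?thesis by (intro exI[of _ g] conjI ballI g1 gadd gsm fin1)
qed

lemma (in cring) mult_idem_minus:
  assumes "t \<in> carrier R" "e \<in> carrier R"
  shows "t \<otimes> e \<ominus> t = (\<one> \<ominus> e) \<otimes> (\<ominus> t)"
  using assms by algebra

context ladic_group_ring begin

lemma coefT_coeff: "g \<in> carrier G \<Longrightarrow> coefT l G f k g 0 = f g k"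
  by (simp add: coefT_def)

context
  fixes e assumes prim: "prim_idem l G e"
begin

text \<open>All coefficients of f below dg are divisible by l and the one at dg is e, so f is
  congruent to T^dg e modulo L, and this is T^dg modulo 1 - e.\<close>

lemma distinguished_mod_L:
  assumes f: "distinguished l G e f dg"
  shows "f \<in> carrier R" "f \<ominus>\<^bsub>R\<^esub> T [^]\<^bsub>R\<^esub> dg \<in> lin R [L, \<one>\<^bsub>R\<^esub> \<ominus>\<^bsub>R\<^esub> e]"
proof -
  show fR: "f \<in> carrier R" using f by (simp add: distinguished_def)
  have eR: "e \<in> carrier R" by (rule e_carrier[OF prim])
  define h where "h = f \<ominus>\<^bsub>R\<^esub> T [^]\<^bsub>R\<^esub> dg \<otimes>\<^bsub>R\<^esub> e"
  have hR: "h \<in> carrier R" using fR eR by (simp add: h_def)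
  have "h g i 1 = 0" if g: "g \<in> carrier G" for g i
  proof -
    have e0: "e g j 1 = 0" if "j \<noteq> 0" for j using ZlD_zero[OF e_ZlD[OF prim] g that] .
    have "f g i 1 = (if i = dg then e g 0 1 else 0)"
    proof -
      consider "i = dg" | "i > dg" | "i < dg" by linarith
      then show ?thesis
      proof cases
        case 1
        then show ?thesis using f coefT_coeff[OF g, of f dg] by (simp add: distinguished_def)
      next
        case 2
        then have "coefT l G f i = \<zero>\<^bsub>R\<^esub>" using f by (simp add: distinguished_def)
        then show ?thesis using 2 coefT_coeff[OF g, of f i] GR_zero[OF g, of 0 1] by simp
      next
        case 3
        then obtain a where a: "a \<in> Zphi l G e" "coefT l G f i = intLD l G (int l) \<otimes>\<^bsub>R\<^esub> a"
          using f unfolding distinguished_def by blast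
        have "(intLD l G (int l) \<otimes>\<^bsub>R\<^esub> a) g 0 1 = 0"
          using intLD_mult[OF Zphi_carrier[OF prim a(1)] g, of "int l" 0 1] by simp
        then show ?thesis using 3 a(2) coefT_coeff[OF g, of f i] by simp
      qed
    qed
    moreover have "(T [^]\<^bsub>R\<^esub> dg \<otimes>\<^bsub>R\<^esub> e) g i 1 = (if i = dg then e g 0 1 else 0)"
      using T_pow_mult[OF eR g, of dg i 1] e0[of "i - dg"] by (cases i dg rule: linorder_cases) auto
    ultimately show ?thesis using fR eR g by (simp add: h_def GR_minus)
  qed
  then have "h \<in> lin R [L]" using mem_L_iff[OF hR] by simp
  then obtain u where u: "u \<in> carrier R" "h = L \<otimes>\<^bsub>R\<^esub> u" using R.lin1 by auto
  obtain t where t: "t = T [^]\<^bsub>R\<^esub> dg" by blast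
  have tR: "t \<in> carrier R" by (simp add: t)
  have "f \<ominus>\<^bsub>R\<^esub> t = h \<oplus>\<^bsub>R\<^esub> (t \<otimes>\<^bsub>R\<^esub> e \<ominus>\<^bsub>R\<^esub> t)"
    unfolding h_def t[symmetric] using fR tR eR by (simp add: R.minus_minus_cancel)
  also have "t \<otimes>\<^bsub>R\<^esub> e \<ominus>\<^bsub>R\<^esub> t = (\<one>\<^bsub>R\<^esub> \<ominus>\<^bsub>R\<^esub> e) \<otimes>\<^bsub>R\<^esub> (\<ominus>\<^bsub>R\<^esub> t)"
    by (rule R.mult_idem_minus[OF tR eR])
  finally have "f \<ominus>\<^bsub>R\<^esub> t = L \<otimes>\<^bsub>R\<^esub> u \<oplus>\<^bsub>R\<^esub> (\<one>\<^bsub>R\<^esub> \<ominus>\<^bsub>R\<^esub> e) \<otimes>\<^bsub>R\<^esub> (\<ominus>\<^bsub>R\<^esub> t)" by (simp add: u(2))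
  then show "f \<ominus>\<^bsub>R\<^esub> T [^]\<^bsub>R\<^esub> dg \<in> lin R [L, \<one>\<^bsub>R\<^esub> \<ominus>\<^bsub>R\<^esub> e]"
    unfolding t[symmetric] by (rule R.lin2I) (use u tR eR in simp_all)
qed

end

end

context iwasawa begin

text \<open>A specification \<open>(a, b, d, as)\<close> records the contributions of the cyclic summand
  \<open>R / lin R as\<close> to the parameters \<open>\<rho>\<close>, \<open>\<mu>\<close>, \<open>\<lambda>\<close>.\<close>

definition spec_ok :: "nat \<times> nat \<times> nat \<times> 'a list \<Rightarrow> bool" where
  "spec_ok sp \<longleftrightarrow> (case sp of (a, b, d, as) \<Rightarrow> set as \<subseteq> carrier R \<and> asymptotically_stable as \<and>
     (\<forall>n. finite (cosets R (lin R (L [^] Suc n # w n # as)) (carrier R))) \<and>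
     (\<exists>c>0. \<exists>n0. \<forall>n\<ge>n0. real (index R (lin R (L [^] Suc n # w n # as)) (carrier R)) =
        c * real q ^ (a * (n + 1) * p ^ n + b * p ^ n + d * n)))"

text \<open>The index is exactly q^((n+1) p^n), by \<open>index_free\<close> with k = n + 1.\<close>

lemma spec_ok_free: "spec_ok (1, 0, 0, [\<one> \<ominus> e])"
proof -
  have "real (index R (lin R [L [^] Suc n, w n, \<one> \<ominus> e]) (carrier R)) = 1 * real q ^ (1 * (n + 1) * p ^ n + 0 * p ^ n + 0 * n)" for n
    using index_free[of "Suc n" n] by (simp add: mult.commute del: nat_pow_Suc)
  then have "\<exists>c>0. \<exists>n0. \<forall>n\<ge>n0. real (index R (lin R [L [^] Suc n, w n, \<one> \<ominus> e]) (carrier R)) =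
        c * real q ^ (1 * (n + 1) * p ^ n + 0 * p ^ n + 0 * n)"
    by (intro exI[of _ "1::real"] exI[of _ "0::nat"]) simp
  moreover have "finite (cosets R (lin R [L [^] Suc n, w n, \<one> \<ominus> e]) (carrier R))" for n
    using index_free[of "Suc n" n] by blast
  ultimately show ?thesis unfolding spec_ok_def prod.case using asymptotically_stable_free by simp
qed

lemma q_pos: "q > 0"
  using index_pos[OF residue_finite] residue_card zero_closed by auto

lemma spec_ok_distinguished:
  assumes f: "f \<in> carrier R" "f \<ominus> T [^] (N::nat) \<in> lin R [L, \<one> \<ominus> e]"
  shows "spec_ok (0, 0, N, [f, \<one> \<ominus> e])"
proof -
  let ?i = "\<lambda>n. index R (lin R [L [^] Suc n, w n, f, \<one> \<ominus> e]) (carrier R)"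
  obtain n0 where n0: "?i n0 > 0"
    "\<forall>n. finite (cosets R (lin R [L [^] Suc n, w n, f, \<one> \<ominus> e]) (carrier R))"
    "\<forall>n\<ge>n0. ?i n = ?i n0 * q ^ (N * (n - n0))" using index_distinguished[OF f] by blast
  \<comment> \<open>Dividing by q^(N n0) turns the exponent N (n - n0) of
    \<open>index_distinguished\<close> into N n.\<close>
  define c where "c = real (?i n0) / real q ^ (N * n0)"
  have "c > 0" using n0(1) q_pos by (simp add: c_def)
  moreover have "real (?i n) = c * real q ^ (0 * (n + 1) * p ^ n + 0 * p ^ n + N * n)" if "n \<ge> n0" for n
  proof -
    have "N * n = N * (n - n0) + N * n0" using that by (simp add: distrib_left[symmetric])
    then have "real q ^ (N * n) = real q ^ (N * (n - n0)) * real q ^ (N * n0)" by (simp add: power_add[symmetric])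
    moreover have "real (?i n) = real (?i n0) * real q ^ (N * (n - n0))"
      using arg_cong[OF n0(3)[rule_format, OF that], of real] by simp
    ultimately show ?thesis using q_pos by (simp add: c_def)
  qed
  ultimately have "\<exists>c>0. \<exists>n0. \<forall>n\<ge>n0. real (?i n) = c * real q ^ (0 * (n + 1) * p ^ n + 0 * p ^ n + N * n)" by blast
  then show ?thesis unfolding spec_ok_def prod.case using asymptotically_stable_distinguished[OF f] n0(2) f(1) by simp
qed

lemma spec_ok_torsion: "spec_ok (0, m, 0, [L [^] (m::nat), \<one> \<ominus> e])"
proof -
  have s4: "set [L [^] Suc n, w n, L [^] m, \<one> \<ominus> e] \<subseteq> carrier R" for n by simp
  have s3: "set [L [^] m, w n, \<one> \<ominus> e] \<subseteq> carrier R" for n by simp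
  have eq: "lin R [L [^] Suc n, w n, L [^] m, \<one> \<ominus> e] = lin R [L [^] m, w n, \<one> \<ominus> e]" if "n \<ge> m" for n
  proof (rule lin_eqI[OF s4 s3])
    have "L [^] Suc n = L [^] m \<otimes> L [^] (Suc n - m)" using that by (simp add: nat_pow_mult del: nat_pow_Suc)
    then have "L [^] Suc n \<in> lin R [L [^] m, w n, \<one> \<ominus> e]" using lin_mem[OF s3, of "L [^] m" n "L [^] (Suc n - m)"] by simp
    then show "\<And>a. a \<in> set [L [^] Suc n, w n, L [^] m, \<one> \<ominus> e] \<Longrightarrow> a \<in> lin R [L [^] m, w n, \<one> \<ominus> e]"
      using lin_gen[OF s3, of _ n] by auto
    show "\<And>a. a \<in> set [L [^] m, w n, \<one> \<ominus> e] \<Longrightarrow> a \<in> lin R [L [^] Suc n, w n, L [^] m, \<one> \<ominus> e]"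
      using lin_gen[OF s4, of _ n] by auto
  qed
  have asy: "real (index R (lin R [L [^] Suc n, w n, L [^] m, \<one> \<ominus> e]) (carrier R)) = 1 * real q ^ (0 * (n + 1) * p ^ n + m * p ^ n + 0 * n)" if "n \<ge> m" for n
    unfolding eq[OF that] using index_free[of m n] by (simp add: mult.commute)
  have "\<exists>c>0. \<exists>n0. \<forall>n\<ge>n0. real (index R (lin R [L [^] Suc n, w n, L [^] m, \<one> \<ominus> e]) (carrier R)) =
        c * real q ^ (0 * (n + 1) * p ^ n + m * p ^ n + 0 * n)"
    by (rule exI[of _ "1::real"], rule conjI, simp, rule exI[of _ m], intro allI impI, erule asy)
  moreover have "finite (cosets R (lin R [L [^] Suc n, w n, L [^] m, \<one> \<ominus> e]) (carrier R))" for n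
  proof (rule finite_cosets_mono)
    have s: "set [L [^] Suc n, w n, \<one> \<ominus> e] \<subseteq> carrier R" by simp
    show "finite (cosets R (lin R [L [^] Suc n, w n, \<one> \<ominus> e]) (carrier R))" using index_free[of "Suc n" n] by blast
    show "lin R [L [^] Suc n, w n, \<one> \<ominus> e] \<subseteq> lin R [L [^] Suc n, w n, L [^] m, \<one> \<ominus> e]" by (rule lin_mono_set[OF s4]) auto
    show "subgp (lin R [L [^] Suc n, w n, \<one> \<ominus> e]) R" using idealD(1)[OF lin_ideal[OF s]] .
    show "subgp (lin R [L [^] Suc n, w n, L [^] m, \<one> \<ominus> e]) R" using idealD(1)[OF lin_ideal[OF s4]] .
  qed auto
  ultimately show ?thesis unfolding spec_ok_def prod.case using asymptotically_stable_torsion by simp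
qed

end

context iwasawa_module begin

text \<open>\<open>index_nab_asymptotics\<close> only yields a positive real constant. At a single
  large n the index is some q^j by \<open>index_submodule_power\<close>, which identifies the
  constant as q to the integer j - S n. This integer may be negative, whence the integer exponents
  and \<open>powr\<close>.\<close>

lemma index_nab_specs:
  fixes specs :: "(nat \<times> nat \<times> nat \<times> 'a list) list"
  defines "k \<equiv> length specs"
  defines "N \<equiv> boxmod k (\<lambda>i. lin R (snd (snd (snd (specs ! i)))))"
  assumes specs: "\<And>sp. sp \<in> set specs \<Longrightarrow> spec_ok sp"
    and e_id: "\<And>x. x \<in> carrier M \<Longrightarrow> e \<odot>\<^bsub>M\<^esub> x = x" and q1: "q > 1"
    and f: "f \<in> mod_hom R M (quot_module (free_mod R k) N)"
    and ker: "finite {x \<in> carrier M. f x = \<zero>\<^bsub>quot_module (free_mod R k) N\<^esub>}"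
    and coker: "finite (A_RCOSETS (quot_module (free_mod R k) N) (f ` carrier M))"
  shows "\<exists>c::int. \<exists>n0. \<forall>n\<ge>n0. real (index M (nab n (carrier M)) (carrier M)) =
    real q powr real_of_int (c + int (sum_list (map fst specs) * (n + 1) * p ^ n
      + sum_list (map (fst \<circ> snd) specs) * p ^ n + sum_list (map (fst \<circ> snd \<circ> snd) specs) * n))"
proof -
  let ?as = "\<lambda>i. snd (snd (snd (specs ! i)))"
  have ok: "spec_ok (specs ! i)" if "i < k" for i using that specs nth_mem unfolding k_def by blast
  have as: "set (?as i) \<subseteq> carrier R" "asymptotically_stable (?as i)"
     "finite (cosets R (lin R (L [^] Suc n # w n # ?as i)) (carrier R))" if "i < k" for i n
    using ok[OF that] by (cases "specs ! i"; simp add: spec_ok_def del: nat_pow_Suc)+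
  let ?E = "\<lambda>i n. fst (specs ! i) * (n + 1) * p ^ n + fst (snd (specs ! i)) * p ^ n + fst (snd (snd (specs ! i))) * n"
  have asy: "\<exists>c>0. \<exists>n0. \<forall>n\<ge>n0. real (index R (lin R (L [^] Suc n # w n # ?as i)) (carrier R)) = c * real q ^ ?E i n"
    if "i < k" for i
    using ok[OF that] by (cases "specs ! i") (simp add: spec_ok_def del: nat_pow_Suc)
  interpret F: plain_module R "free_mod R k" unfolding plain_module_def by (rule R.free_mod_module)
  have Ns: "submodule N R (free_mod R k)" unfolding N_def
    by (rule R.submodule_boxmod) (rule R.lin_ideal[OF as(1)])
  obtain g where g: "\<forall>x\<in>carrier M. g x \<in> carrier (free_mod R k)"
    "\<forall>x\<in>carrier M. \<forall>y\<in>carrier M. g (x \<oplus>\<^bsub>M\<^esub> y) \<ominus>\<^bsub>free_mod R k\<^esub> (g x \<oplus>\<^bsub>free_mod R k\<^esub> g y) \<in> N"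
    "\<forall>a\<in>carrier R. \<forall>x\<in>carrier M. g (a \<odot>\<^bsub>M\<^esub> x) \<ominus>\<^bsub>free_mod R k\<^esub> a \<odot>\<^bsub>free_mod R k\<^esub> g x \<in> N"
    "finite {x \<in> carrier M. g x \<in> N}"
    "finite (cosets (free_mod R k) {v \<in> carrier (free_mod R k). \<exists>x\<in>carrier M. v \<ominus>\<^bsub>free_mod R k\<^esub> g x \<in> N} (carrier (free_mod R k)))"
    using F.quot_module_lift[OF Ns module_axioms f ker coker] by (elim exE conjE)
  have "\<exists>c>0. \<exists>n0. \<forall>n\<ge>n0. finite (cosets M (nab n (carrier M)) (carrier M)) \<and>
    real (index M (nab n (carrier M)) (carrier M)) =
      c * (\<Prod>i<k. real (index R (lin R (L [^] Suc n # w n # ?as i)) (carrier R)))"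
    by (rule index_nab_asymptotics[where g = g]) (use as g in \<open>auto simp: N_def simp del: nat_pow_Suc\<close>)
  then obtain c1 n1 where c1: "c1 > 0" "\<And>n. n \<ge> n1 \<Longrightarrow> finite (cosets M (nab n (carrier M)) (carrier M))"
    "\<And>n. n \<ge> n1 \<Longrightarrow> real (index M (nab n (carrier M)) (carrier M)) =
      c1 * (\<Prod>i<k. real (index R (lin R (L [^] Suc n # w n # ?as i)) (carrier R)))" by blast
  have "\<exists>c>0. \<exists>n0. \<forall>n\<ge>n0. (\<Prod>i<k. real (index R (lin R (L [^] Suc n # w n # ?as i)) (carrier R))) =
      c * real q ^ (\<Sum>i<k. ?E i n)"
    by (rule prod_asymptotics) (rule asy)
  then obtain c2 n2 where c2: "c2 > 0" "\<And>n. n \<ge> n2 \<Longrightarrow> (\<Prod>i<k. real (index R (lin R (L [^] Suc n # w n # ?as i)) (carrier R))) =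
      c2 * real q ^ (\<Sum>i<k. ?E i n)"
    by blast
  define S where "S n = sum_list (map fst specs) * (n + 1) * p ^ n
      + sum_list (map (fst \<circ> snd) specs) * p ^ n + sum_list (map (fst \<circ> snd \<circ> snd) specs) * n" for n
  have sl: "sum_list (map h specs) = (\<Sum>i<k. h (specs ! i))" for h :: "_ \<Rightarrow> nat"
    by (simp add: sum_list_sum_nth k_def atLeast0LessThan)
  have ES: "(\<Sum>i<k. ?E i n) = S n" for n
    by (simp add: S_def sl sum.distrib sum_distrib_right mult.assoc del: One_nat_def)
  define n3 where "n3 = max n1 n2"
  have main: "real (index M (nab n (carrier M)) (carrier M)) = c1 * c2 * real q ^ S n" if "n \<ge> n3" for n
    using c1(3)[of n] c2(2)[of n] that ES[of n] by (simp add: n3_def)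
  have "\<exists>j. index M (nab n3 (carrier M)) (carrier M) = q ^ j"
    by (rule index_submodule_power[OF submodule_nab[OF submodule_carrier] submodule_carrier nab_subset[OF submodule_carrier]])
      (use c1(2)[of n3] e_id in \<open>simp_all add: n3_def\<close>)
  then obtain j where j: "index M (nab n3 (carrier M)) (carrier M) = q ^ j" by blast
  have qr: "real q > 0" using q1 by simp
  have "real q ^ j = c1 * c2 * real q ^ S n3" using main[of n3] j by simp
  then have cc: "c1 * c2 = real q powr (real j - real (S n3))"
    using qr by (simp add: powr_diff powr_realpow field_simps)
  show ?thesis
  proof (intro exI[of _ "int j - int (S n3)"] exI[of _ n3] allI impI)
    fix n assume n: "n \<ge> n3"
    have "real (index M (nab n (carrier M)) (carrier M)) = real q powr (real j - real (S n3)) * real q powr real (S n)"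
      using main[OF n] cc qr by (simp add: powr_realpow)
    also have "\<dots> = real q powr (real j - real (S n3) + real (S n))" by (rule powr_add[symmetric])
    finally show "real (index M (nab n (carrier M)) (carrier M)) =
      real q powr real_of_int (int j - int (S n3) + int (sum_list (map fst specs) * (n + 1) * p ^ n
      + sum_list (map (fst \<circ> snd) specs) * p ^ n + sum_list (map (fst \<circ> snd \<circ> snd) specs) * n))"
      unfolding S_def[symmetric] by simp
  qed
qed

end

section \<open>The component of the module at one character\<close>

context ladic_group_ring begin

context
  fixes e assumes prim: "prim_idem l G e"
begin

lemma comp_module_facts:
  fixes M :: "('g LD, 'm) module"
  assumes M: "module R M"
  shows "module R (comp_module M e)" "x \<in> carrier (comp_module M e) \<Longrightarrow> e \<odot>\<^bsub>comp_module M e\<^esub> x = x"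
proof -
  interpret M: module R M by fact
  have eR: "e \<in> carrier R" by (rule e_carrier[OF prim])
  have c: "comp_module M e = M\<lparr>carrier := mscale M e (carrier M)\<rparr>" by (simp add: comp_module_def mscale_def)
  show "module R (comp_module M e)" unfolding c
    by (rule submodule.submodule_is_module[OF M.submodule_mscale[OF M.submodule_carrier eR] M])
  show "e \<odot>\<^bsub>comp_module M e\<^esub> x = x" if "x \<in> carrier (comp_module M e)"
    using that eR e_idem[OF prim] unfolding c by (auto simp: mscale_def M.smult_assoc1[symmetric])
qed

text \<open>\<open>specs\<close> lists the cyclic summands in the order of the coordinates in
  \<open>elem_rels\<close>. The relations then have the coordinatewise form that
  \<open>gen_submod_free_mod\<close> evaluates.\<close>

lemma elem_rels_eq:
  fixes r fds ms
  defines "specs \<equiv> replicate r (1::nat, 0::nat, 0::nat, [\<one>\<^bsub>R\<^esub> \<ominus>\<^bsub>R\<^esub> e])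
     @ map (\<lambda>(f, d). (0, 0, d, [f, \<one>\<^bsub>R\<^esub> \<ominus>\<^bsub>R\<^esub> e])) fds
     @ map (\<lambda>m. (0, m, 0, [L [^]\<^bsub>R\<^esub> m, \<one>\<^bsub>R\<^esub> \<ominus>\<^bsub>R\<^esub> e])) ms"
  defines "k \<equiv> r + length (map fst fds) + length ms"
  shows "elem_rels l G e r (map fst fds) ms =
    {a \<odot>\<^bsub>free_mod R k\<^esub> unitvec R k i | a i. i < k \<and> a \<in> set (snd (snd (snd (specs ! i))))}"
proof -
  let ?u = "\<lambda>a i. a \<odot>\<^bsub>free_mod R k\<^esub> unitvec R k i"
  let ?as = "\<lambda>i. snd (snd (snd (specs ! i)))"
  have s1: "?as i = [\<one>\<^bsub>R\<^esub> \<ominus>\<^bsub>R\<^esub> e]" if "i < r" for i using that by (simp add: specs_def nth_append)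
  have s2: "?as (r + i) = [map fst fds ! i, \<one>\<^bsub>R\<^esub> \<ominus>\<^bsub>R\<^esub> e]" if "i < length fds" for i
    using that by (simp add: specs_def nth_append split_beta)
  have s3: "?as (r + length fds + i) = [L [^]\<^bsub>R\<^esub> (ms ! i), \<one>\<^bsub>R\<^esub> \<ominus>\<^bsub>R\<^esub> e]" if "i < length ms" for i
    using that by (simp add: specs_def nth_append)
  have cas: "i < r \<or> (\<exists>i'<length fds. i = r + i') \<or> (\<exists>i'<length ms. i = r + length fds + i')" if "i < k" for i
  proof -
    consider "i < r" | "r \<le> i" "i < r + length fds" | "r + length fds \<le> i" by linarith
    then show ?thesis
    proof cases
      case 2
      then have "i - r < length fds" "i = r + (i - r)" by auto
      then show ?thesis by blast
    next
      case 3
      then have "i - (r + length fds) < length ms" "i = r + length fds + (i - (r + length fds))" using that by (auto simp: k_def)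
      then show ?thesis by blast
    qed simp
  qed
  have E: "elem_rels l G e r (map fst fds) ms = {?u (\<one>\<^bsub>R\<^esub> \<ominus>\<^bsub>R\<^esub> e) i | i. i < k} \<union>
     {?u (map fst fds ! i) (r + i) | i. i < length fds} \<union> {?u (L [^]\<^bsub>R\<^esub> (ms ! j)) (r + length fds + j) | j. j < length ms}"
    unfolding elem_rels_def k_def[symmetric] by (simp add: L_pow)
  show ?thesis
  proof (intro equalityI subsetI)
    fix z assume "z \<in> elem_rels l G e r (map fst fds) ms"
    then consider i where "i < k" "z = ?u (\<one>\<^bsub>R\<^esub> \<ominus>\<^bsub>R\<^esub> e) i" | i where "i < length fds" "z = ?u (map fst fds ! i) (r + i)"
      | j where "j < length ms" "z = ?u (L [^]\<^bsub>R\<^esub> (ms ! j)) (r + length fds + j)" unfolding E by blast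
    then show "z \<in> {?u a i | a i. i < k \<and> a \<in> set (?as i)}"
    proof cases
      case 1
      then have "\<one>\<^bsub>R\<^esub> \<ominus>\<^bsub>R\<^esub> e \<in> set (?as i)" using cas[OF 1(1)] s1 s2 s3 by fastforce
      then show ?thesis using 1 by blast
    next
      case 2
      then have "r + i < k" "map fst fds ! i \<in> set (?as (r + i))" using s2 by (simp_all add: k_def)
      then show ?thesis using 2 by blast
    next
      case 3
      then have "r + length fds + j < k" "L [^]\<^bsub>R\<^esub> (ms ! j) \<in> set (?as (r + length fds + j))" using s3 by (simp_all add: k_def)
      then show ?thesis using 3 by blast
    qed
  next
    fix z assume "z \<in> {?u a i | a i. i < k \<and> a \<in> set (?as i)}"
    then obtain a i where ai: "z = ?u a i" "i < k" "a \<in> set (?as i)" by blast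
    consider "i < r" | i' where "i' < length fds" "i = r + i'" | i' where "i' < length ms" "i = r + length fds + i'"
      using cas[OF ai(2)] by blast
    then show "z \<in> elem_rels l G e r (map fst fds) ms"
    proof cases
      case 1
      then have "a = \<one>\<^bsub>R\<^esub> \<ominus>\<^bsub>R\<^esub> e" using ai s1 by simp
      then show ?thesis unfolding E using ai by blast
    next
      case 2
      then have "a = \<one>\<^bsub>R\<^esub> \<ominus>\<^bsub>R\<^esub> e \<or> a = map fst fds ! i'" using ai s2[OF 2(1)] by auto
      then show ?thesis unfolding E using ai 2 by blast
    next
      case 3
      then have "a = \<one>\<^bsub>R\<^esub> \<ominus>\<^bsub>R\<^esub> e \<or> a = L [^]\<^bsub>R\<^esub> (ms ! i')" using ai s3[OF 3(1)] by auto
      then show ?thesis unfolding E using ai 3 by blast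
    qed
  qed
qed

text \<open>Indices are counted in powers of q = l^deg, so every exponent is multiplied by the
  degree when expressed in powers of l. This is the factor <phi, phi> contained in the scalar
  products with phi.\<close>

lemma component_asymptotics:
  fixes M :: "('g LD, 'm) module"
  assumes M: "module R M"
    and fds: "\<forall>(f, dg)\<in>set fds. distinguished l G e f dg"
    and ps: "pseudo_iso R (comp_module M e) (elem_module l G e r (map fst fds) ms)"
  shows "\<exists>c::int. \<exists>n0. \<forall>n\<ge>n0.
     real (card (A_RCOSETS (comp_module M e) (nabla_sub l G n (comp_module M e)))) =
     real l powr real_of_int (int (chardeg l G e) *
       (c + int (r * (n + 1) * l ^ n + sum_list ms * l ^ n + sum_list (map snd fds) * n)))"
proof -
  let ?M = "comp_module M e"
  define q where "q = index R (me e) (carrier R)"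
  have q: "q = l ^ chardeg l G e" unfolding q_def by (rule residue_index_chardeg[OF prim])
  have q1: "q > 1" unfolding q using l_gt_1 chardeg_pos[OF prim] by (rule one_less_power)
  interpret I: iwasawa_module R l q L T e ?M
    unfolding iwasawa_module_def q_def using iwasawa_GR[OF prim] comp_module_facts(1)[OF M] by simp
  define specs where "specs = replicate r (1::nat, 0::nat, 0::nat, [\<one>\<^bsub>R\<^esub> \<ominus>\<^bsub>R\<^esub> e])
     @ map (\<lambda>(f, d). (0, 0, d, [f, \<one>\<^bsub>R\<^esub> \<ominus>\<^bsub>R\<^esub> e])) fds
     @ map (\<lambda>m. (0, m, 0, [L [^]\<^bsub>R\<^esub> m, \<one>\<^bsub>R\<^esub> \<ominus>\<^bsub>R\<^esub> e])) ms"
  define k where "k = length specs"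
  have k: "k = r + length (map fst fds) + length ms" by (simp add: k_def specs_def)
  let ?as = "\<lambda>i. snd (snd (snd (specs ! i)))"
  have ok: "I.spec_ok sp" if "sp \<in> set specs" for sp
  proof -
    have "I.spec_ok (0, 0, d, [f, \<one>\<^bsub>R\<^esub> \<ominus>\<^bsub>R\<^esub> e])" if "(f, d) \<in> set fds" for f d
    proof -
      have "distinguished l G e f d" using fds that by auto
      then show ?thesis using I.spec_ok_distinguished distinguished_mod_L[OF prim] by blast
    qed
    then show ?thesis using that I.spec_ok_free I.spec_ok_torsion by (auto simp: specs_def)
  qed
  have asR: "set (?as i) \<subseteq> carrier R" if "i < k" for i
    using ok[OF nth_mem[of i specs]] that unfolding k_def by (cases "specs ! i") (simp add: I.spec_ok_def)
  define N where "N = R.boxmod k (\<lambda>i. lin R (?as i))"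
  have "elem_module l G e r (map fst fds) ms = quot_module (free_mod R k) N"
    unfolding elem_module_def elem_rels_eq[where r = r and fds = fds and ms = ms, folded specs_def] k[symmetric] N_def
    by (subst R.gen_submod_free_mod[OF asR]) simp_all
  then obtain f where f: "f \<in> mod_hom R ?M (quot_module (free_mod R k) N)"
    "finite {x \<in> carrier ?M. f x = \<zero>\<^bsub>quot_module (free_mod R k) N\<^esub>}"
    "finite (A_RCOSETS (quot_module (free_mod R k) N) (f ` carrier ?M))"
    using ps unfolding pseudo_iso_def by auto
  have "\<exists>c::int. \<exists>n0. \<forall>n\<ge>n0. real (index ?M (I.nab n (carrier ?M)) (carrier ?M)) =
    real q powr real_of_int (c + int (sum_list (map fst specs) * (n + 1) * l ^ n
      + sum_list (map (fst \<circ> snd) specs) * l ^ n + sum_list (map (fst \<circ> snd \<circ> snd) specs) * n))"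
    by (rule I.index_nab_specs[OF ok comp_module_facts(2)[OF M] q1 f[unfolded N_def k_def]])
  then obtain c n0 where c: "\<And>n. n \<ge> n0 \<Longrightarrow> real (index ?M (I.nab n (carrier ?M)) (carrier ?M)) =
    real q powr real_of_int (c + int (sum_list (map fst specs) * (n + 1) * l ^ n
      + sum_list (map (fst \<circ> snd) specs) * l ^ n + sum_list (map (fst \<circ> snd \<circ> snd) specs) * n))" by blast
  have z: "sum_list (map (\<lambda>x. 0) xs) = (0::nat)" for xs :: "'x list" by (induction xs) auto
  have sums: "sum_list (map fst specs) = r" "sum_list (map (fst \<circ> snd) specs) = sum_list ms"
    "sum_list (map (fst \<circ> snd \<circ> snd) specs) = sum_list (map snd fds)"
    by (simp_all add: specs_def o_def split_beta sum_list_replicate z)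
  have om: "omegaLD l G n = I.w n" for n
    by (simp add: omegaLD_def I.w_def gamma_eq)
  have Lp: "intLD l G (int l ^ (n + 1)) = L [^]\<^bsub>R\<^esub> Suc n" for n by (simp only: L_pow Suc_eq_plus1)
  have nabla: "nabla_sub l G n ?M = I.nab n (carrier ?M)" for n
    unfolding nabla_sub_def om Lp set_eq_iff I.nab_iff by blast
  have qpow: "real q powr x = real l powr (real (chardeg l G e) * x)" for x
    using l_gt_1 by (simp add: q powr_powr[symmetric] powr_realpow)
  show ?thesis
  proof (intro exI[of _ c] exI[of _ n0] allI impI)
    fix n assume "n \<ge> n0"
    from c[OF this] show "real (card (A_RCOSETS ?M (nabla_sub l G n ?M))) =
     real l powr real_of_int (int (chardeg l G e) *
       (c + int (r * (n + 1) * l ^ n + sum_list ms * l ^ n + sum_list (map snd fds) * n)))"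
      unfolding nabla A_RCOSETS_eq_cosets index_def[symmetric] sums qpow by simp
  qed
qed

end

end

theorem theorem1p4:
  fixes l :: nat and G :: "'g monoid" and M :: "('g LD, 'm) module"
    and \<rho> \<mu> lam :: "'g LD \<Rightarrow> int"
  assumes "Factorial_Ring.prime l"
    and "comm_group G" and "finite (carrier G)" and "coprime (card (carrier G)) l"
    and "noetherian_module (GR l G) M"
    and "has_parameters l G M \<rho> \<mu> lam"
  shows "\<exists>!\<nu> :: 'g LD \<Rightarrow> int. (\<forall>e. \<not> prim_idem l G e \<longrightarrow> \<nu> e = 0) \<and>
    (\<forall>e. prim_idem l G e \<longrightarrow> (\<exists>N. \<forall>n\<ge>N.
       real (card (A_RCOSETS (comp_module M e) (nabla_sub l G n (comp_module M e))))
       = real l powr real_of_int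
           (charpair l G \<rho> e * (int n + 1) * int l ^ n + charpair l G \<mu> e * int l ^ n
            + charpair l G lam e * int n + charpair l G \<nu> e)))"
proof -
  interpret G: comm_group G by fact
  interpret ladic_group_ring l G by unfold_locales (use assms in auto)
  have M: "module R M" using assms(5) by (simp add: noetherian_module_def)
  \<comment> \<open>The coefficient of \<nu> at e enters only the formula at e, so existence and
    uniqueness are settled for one integer v per character.\<close>
  define order_formula where "order_formula e v n \<longleftrightarrow>
     real (card (A_RCOSETS (comp_module M e) (nabla_sub l G n (comp_module M e))))
       = real l powr real_of_int
           (charpair l G \<rho> e * (int n + 1) * int l ^ n + charpair l G \<mu> e * int l ^ n
            + charpair l G lam e * int n + v * int (chardeg l G e))" for e v n
  have ex: "\<exists>v N. \<forall>n\<ge>N. order_formula e v n" if e: "prim_idem l G e" for e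
  proof -
    obtain r fds ms where *: "\<forall>(f, dg)\<in>set fds. distinguished l G e f dg"
      "pseudo_iso R (comp_module M e) (elem_module l G e r (map fst fds) ms)"
      "\<rho> e = int r" "\<mu> e = int (sum_list ms)" "lam e = int (sum_list (map snd fds))"
      using assms(6) e unfolding has_parameters_def by blast
    obtain c :: int and n0 where c: "\<And>n. n \<ge> n0 \<Longrightarrow>
      real (card (A_RCOSETS (comp_module M e) (nabla_sub l G n (comp_module M e)))) =
      real l powr real_of_int (int (chardeg l G e) *
       (c + int (r * (n + 1) * l ^ n + sum_list ms * l ^ n + sum_list (map snd fds) * n)))"
      using component_asymptotics[OF e M *(1,2)] by blast
    have "order_formula e c n" if "n \<ge> n0" for n
    proof -
      have "int (chardeg l G e) * (c + int (r * (n + 1) * l ^ n + sum_list ms * l ^ n + sum_list (map snd fds) * n)) =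
        charpair l G \<rho> e * (int n + 1) * int l ^ n + charpair l G \<mu> e * int l ^ n
            + charpair l G lam e * int n + c * int (chardeg l G e)"
        by (simp add: charpair_def * algebra_simps)
      then show ?thesis using c[OF that] by (simp only: order_formula_def)
    qed
    then show ?thesis by blast
  qed
  \<comment> \<open>Both formulas are compared at one common n: the three main terms cancel, and the
    remaining multiple of the degree determines v because the degree is positive.\<close>
  have uniq: "v = v'" if e: "prim_idem l G e" and "\<forall>n\<ge>N. order_formula e v n" "\<forall>n\<ge>N'. order_formula e v' n" for e v v' N N'
  proof -
    let ?n = "max N N'"
    have 1: "order_formula e v ?n" "order_formula e v' ?n" using that by simp_all
    have "real l > 0" "real l \<noteq> 1" using l_gt_1 by simp_all
    from powr_inj[OF this] trans[OF 1(1)[unfolded order_formula_def, symmetric] 1(2)[unfolded order_formula_def]]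
    show ?thesis using chardeg_pos[OF e] by simp
  qed
  \<comment> \<open>Off the primitive idempotents the value is fixed as 0, so that \<nu> is unique
    as a function and not only on characters.\<close>
  define \<nu> where "\<nu> e = (if prim_idem l G e then SOME v. \<exists>N. \<forall>n\<ge>N. order_formula e v n else 0)" for e
  have \<nu>: "\<exists>N. \<forall>n\<ge>N. order_formula e (\<nu> e) n" if "prim_idem l G e" for e
    using someI_ex[OF ex[OF that]] that by (simp add: \<nu>_def)
  have eq: "charpair l G \<nu>' e = \<nu>' e * int (chardeg l G e)" for \<nu>' e by (simp add: charpair_def)
  show ?thesis
  proof (rule ex1I[of _ \<nu>])
    show "(\<forall>e. \<not> prim_idem l G e \<longrightarrow> \<nu> e = 0) \<and>
    (\<forall>e. prim_idem l G e \<longrightarrow> (\<exists>N. \<forall>n\<ge>N.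
       real (card (A_RCOSETS (comp_module M e) (nabla_sub l G n (comp_module M e))))
       = real l powr real_of_int
           (charpair l G \<rho> e * (int n + 1) * int l ^ n + charpair l G \<mu> e * int l ^ n
            + charpair l G lam e * int n + charpair l G \<nu> e)))"
      using \<nu> unfolding order_formula_def eq[of \<nu>] by (simp add: \<nu>_def)
    fix \<nu>' assume \<nu>': "(\<forall>e. \<not> prim_idem l G e \<longrightarrow> \<nu>' e = 0) \<and>
    (\<forall>e. prim_idem l G e \<longrightarrow> (\<exists>N. \<forall>n\<ge>N.
       real (card (A_RCOSETS (comp_module M e) (nabla_sub l G n (comp_module M e))))
       = real l powr real_of_int
           (charpair l G \<rho> e * (int n + 1) * int l ^ n + charpair l G \<mu> e * int l ^ n
            + charpair l G lam e * int n + charpair l G \<nu>' e)))"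
    show "\<nu>' = \<nu>"
    proof
      fix e
      show "\<nu>' e = \<nu> e"
      proof (cases "prim_idem l G e")
        case True
        then obtain N where N: "\<forall>n\<ge>N. order_formula e (\<nu>' e) n"
          using \<nu>' unfolding order_formula_def eq[of \<nu>'] by blast
        obtain N' where N': "\<forall>n\<ge>N'. order_formula e (\<nu> e) n" using \<nu>[OF True] by blast
        show ?thesis by (rule uniq[OF True N N'])
      qed (use \<nu>' in \<open>simp add: \<nu>_def\<close>)
    qed
  qed
qed

end
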